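(* Let $\mathcal{K}$ be a field of characteristic $p>0$, $q\in\mathcal{K}$, and $1\le k\ne k'\le n$. Fix the two distinguished elements $h:=D_{kk'}(x^{(\epsilon_k+\epsilon_{k'})})$ and $e:=2D_{kk'}(x^{(2\epsilon_k+\epsilon_{k'})})$ in $\mathbf{S}(n;\underline{1})$. Then there is a noncommutative and noncocommutative Hopf algebra $(\mathbf{u}_{t,q}(\mathbf{S}(n;\underline{1})),m,\iota,\Delta,S,\varepsilon)$ over $\mathcal{K}[t]_p^{(q)}$ with its algebra structure undeformed, whose coalgebra structure (and antipode) is given, for $0\le\alpha\le\tau$ and $1\le j<i\le n$, by $$\Delta(D_{ij}(x^{(\alpha)}))=D_{ij}(x^{(\alpha)})\otimes(1-et)^{\alpha_k-\delta_{ik}-\delta_{jk}-\alpha_{k'}+\delta_{ik'}+\delta_{jk'}}+\sum_{\ell=0}^{p-1}(-1)^\ell h^{\langle\ell\rangle}\otimes(1-et)^{-\ell}d^{(\ell)}(D_{ij}(x^{(\alpha)}))t^\ell,$$ $$S(D_{ij}(x^{(\alpha)}))=-(1-et)^{-\alpha_k+\delta_{ik}+\delta_{jk}+\alpha_{k'}-\delta_{ik'}-\delta_{jk'}}\cdot\Bigl(\sum_{\ell=0}^{p-1}d^{(\ell)}(D_{ij}(x^{(\alpha)}))\cdot h_1^{\langle\ell\rangle}t^\ell\Bigr),$$ $$\varepsilon(D_{ij}(x^{(\alpha)}))=0.$$ It is finite dimensional with $\dim_{\mathcal{K}}\mathbf{u}_{t,q}(\mathbf{S}(n;\underline{1}))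=p^{1+(n-1)(p^n-1)}$.
   Context: $\tau=(p-1,\dots,p-1)\in\mathbb{Z}^n$. $\mathcal{O}(n;\underline{1})$ is the restricted divided power algebra over $\mathcal{K}$ with basis $x^{(\alpha)}$, $0\le\alpha\le\tau$ (componentwise), $x^{(\alpha)}x^{(\beta)}=\binom{\alpha+\beta}{\alpha}x^{(\alpha+\beta)}$, where $x^{(\alpha)}=0$ if some $\alpha_j<0$ or $\alpha_j\ge p$; $D_i(x^{(\alpha)})=x^{(\alpha-\epsilon_i)}$ with $\epsilon_i$ the standard basis vectors. $\mathbf{W}(n;\underline{1})=\bigoplus_i\mathcal{O}(n;\underline{1})D_i$ is the Lie algebra of derivations. $D_{ij}(f)=D_j(f)D_i-D_i(f)D_j$. With $\mathbf{S}'(n;\underline1)=\{\sum a_iD_i\in\mathbf{W}(n;\underline1)\mid\sum D_i(a_i)=0\}$, the special algebra is the derived algebra $\mathbf{S}(n;\underline{1})=\mathbf{S}'(n;\underline1)^{(1)}$, which is spanned by the $D_{ij}(x^{(\alpha)})$ and has dimension $(n-1)(p^n-1)$. $\mathbf{u}(\mathbf{S}(n;\underline{1}))=U(\mathbf{S}(n;\underline{1}))/I$ is its restricted universal enveloping algebra, $I$ being the ideal generated by $(D_{ij}(x^{(\epsilon_i+\epsilon_j)}))^p-D_{ij}(x^{(\epsilon_i+\epsilon_j)})$ and $(D_{ij}(x^{(\alpha)}))^p$ for $\alpha\ne\epsilon_i+\epsilon_j$. $\mathcal{K}[t]_p^{(q)}=\mathcal{K}[t]/(t^p-qt)$ and $\mathbf{u}_{t,q}(\mathbf{S}(n;\underline{1}))=\mathbf{u}(\mathbf{S}(n;\underline{1}))\otimes_{\mathcal{K}}\mathcal{K}[t]_p^{(q)}$.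 In it $e^p=0$, so $1-et$ is invertible. $x_a^{\langle r\rangle}=(x+a)(x+a+1)\cdots(x+a+r-1)$, $x^{\langle r\rangle}=x_0^{\langle r\rangle}$; $d^{(\ell)}=\frac1{\ell!}(\mathrm{ad}\,e)^\ell$.
   Formalization: Noncocommutativity is claimed only for p ≠ 2: for p = 2 one has e = 2D_{kk'}(x^{(2ε_k+ε_{k'})}) = 0, so Δ is the standard cocommutative coproduct; all other claims are kept for every p > 0. *)

theory Defs
  imports
    "HOL-Algebra.Algebra"
    "HOL-Algebra.Algebraic_Closure_Type"
    "HOL-Library.Poly_Mapping"
    "HOL-Library.Function_Algebras"
begin

section \<open>Algebras over a commutative ring\<close>

text \<open>An algebra over a commutative ring is a ring together with a unit map from the base ring
  into its centre.\<close>

record ('a, 'r) ralg = "'a ring" + unit_map :: "'r \<Rightarrow> 'a"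

locale unital_algebra = cring R + A: ring A
  for R :: "('r, 'm) ring_scheme" and A :: "('a, 'r) ralg" +
  assumes unit_map_hom: "unit_map A \<in> ring_hom R A"
    and unit_map_central:
      "\<lbrakk>r \<in> carrier R; a \<in> carrier A\<rbrakk> \<Longrightarrow> unit_map A r \<otimes>\<^bsub>A\<^esub> a = a \<otimes>\<^bsub>A\<^esub> unit_map A r"

definition quot_alg :: "('a, 'r) ralg \<Rightarrow> 'a set \<Rightarrow> ('a set, 'r) ralg" where
  "quot_alg A I = ring.extend (A Quot I) (ralg.fields (\<lambda>r. I +>\<^bsub>A\<^esub> unit_map A r))"

text \<open>The monoid ring of \<open>M\<close>; its elements are the finitely supported functions on \<open>carrier M\<close>.\<close>

definition monoid_ring :: "('m, 'z) monoid_scheme \<Rightarrow> ('m \<Rightarrow>\<^sub>0 'c::comm_ring_1) ring" where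
  "monoid_ring M =
    \<lparr>carrier = {f. Poly_Mapping.keys f \<subseteq> carrier M},
     monoid.mult = (\<lambda>f g. \<Sum>u\<in>Poly_Mapping.keys f. \<Sum>v\<in>Poly_Mapping.keys g.
        Poly_Mapping.single (u \<otimes>\<^bsub>M\<^esub> v) (Poly_Mapping.lookup f u * Poly_Mapping.lookup g v)),
     one = Poly_Mapping.single \<one>\<^bsub>M\<^esub> 1,
     ring.zero = 0,
     add = (+)\<rparr>"

definition free_monoid :: "'x set \<Rightarrow> 'x list monoid" where
  "free_monoid B = \<lparr>carrier = lists B, monoid.mult = append, one = Nil\<rparr>"

definition free_alg :: "'x set \<Rightarrow> ('x list \<Rightarrow>\<^sub>0 'k::comm_ring_1, 'k) ralg" where
  "free_alg B = ring.extend (monoid_ring (free_monoid B))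
     (ralg.fields (\<lambda>c. Poly_Mapping.single [] c))"


section \<open>Tensor products\<close>

text \<open>\<open>A \<otimes>\<^sub>R B\<close> is the free abelian group on \<open>carrier A \<times> carrier B\<close> modulo the relations of
  biadditivity and \<open>R\<close>-balancedness. On this free abelian group we use the multiplication of the
  integral monoid ring of \<open>A \<times>\<times> B\<close>, that is \<open>(a, b) \<cdot> (a', b') = (a a', b b')\<close>. The set of relations is
  stable under multiplication by pairs on both sides, so the two-sided ideal it generates is the
  same as the subgroup it generates.\<close>

definition tensor_pre :: "('a, 'r) ralg \<Rightarrow> ('b, 'r) ralg \<Rightarrow> ('a \<times> 'b \<Rightarrow>\<^sub>0 int) ring" where
  "tensor_pre A B = monoid_ring (A \<times>\<times> B)"

definition tensor_rels ::
  "('r, 'm) ring_scheme \<Rightarrow> ('a, 'r) ralg \<Rightarrow> ('b, 'r) ralg \<Rightarrow> ('a \<times> 'b \<Rightarrow>\<^sub>0 int) set" where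
  "tensor_rels R A B =
     {frag_of (a \<oplus>\<^bsub>A\<^esub> a', b) - frag_of (a, b) - frag_of (a', b) | a a' b.
        a \<in> carrier A \<and> a' \<in> carrier A \<and> b \<in> carrier B} \<union>
     {frag_of (a, b \<oplus>\<^bsub>B\<^esub> b') - frag_of (a, b) - frag_of (a, b') | a b b'.
        a \<in> carrier A \<and> b \<in> carrier B \<and> b' \<in> carrier B} \<union>
     {frag_of (unit_map A r \<otimes>\<^bsub>A\<^esub> a, b) - frag_of (a, unit_map B r \<otimes>\<^bsub>B\<^esub> b) | r a b.
        r \<in> carrier R \<and> a \<in> carrier A \<and> b \<in> carrier B}"

definition tensor_ideal ::
  "('r, 'm) ring_scheme \<Rightarrow> ('a, 'r) ralg \<Rightarrow> ('b, 'r) ralg \<Rightarrow> ('a \<times> 'b \<Rightarrow>\<^sub>0 int) set" where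
  "tensor_ideal R A B = Idl\<^bsub>tensor_pre A B\<^esub> (tensor_rels R A B)"

definition tens ::
  "('r, 'm) ring_scheme \<Rightarrow> ('a, 'r) ralg \<Rightarrow> ('b, 'r) ralg \<Rightarrow> 'a \<Rightarrow> 'b \<Rightarrow> ('a \<times> 'b \<Rightarrow>\<^sub>0 int) set" where
  "tens R A B a b = tensor_ideal R A B +>\<^bsub>tensor_pre A B\<^esub> frag_of (a, b)"

definition tensor_alg ::
  "('r, 'm) ring_scheme \<Rightarrow> ('a, 'r) ralg \<Rightarrow> ('b, 'r) ralg \<Rightarrow> (('a \<times> 'b \<Rightarrow>\<^sub>0 int) set, 'r) ralg" where
  "tensor_alg R A B = ring.extend (tensor_pre A B Quot tensor_ideal R A B)
     (ralg.fields (\<lambda>r. tens R A B (unit_map A r) \<one>\<^bsub>B\<^esub>))"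

text \<open>The additive map on a tensor product induced by a balanced biadditive map \<open>\<phi>\<close> into \<open>C\<close>: the
  value on a coset is the common value of the formal sums it contains.\<close>

definition tensor_lift ::
  "('c, 'm) ring_scheme \<Rightarrow> ('a \<Rightarrow> 'b \<Rightarrow> 'c) \<Rightarrow> ('a \<times> 'b \<Rightarrow>\<^sub>0 int) set \<Rightarrow> 'c" where
  "tensor_lift C \<phi> z = the_elem ((\<lambda>f. \<Oplus>\<^bsub>C\<^esub>ab\<in>Poly_Mapping.keys f.
      add_pow C (Poly_Mapping.lookup f ab) (\<phi> (fst ab) (snd ab))) ` z)"

definition tensor_map ::
  "('r, 'm) ring_scheme \<Rightarrow> ('c, 'r) ralg \<Rightarrow> ('d, 'r) ralg \<Rightarrow> ('a \<Rightarrow> 'c) \<Rightarrow> ('b \<Rightarrow> 'd)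
    \<Rightarrow> ('a \<times> 'b \<Rightarrow>\<^sub>0 int) set \<Rightarrow> ('c \<times> 'd \<Rightarrow>\<^sub>0 int) set" where
  "tensor_map R C D f g = tensor_lift (tensor_alg R C D) (\<lambda>a b. tens R C D (f a) (g b))"

definition tensor_assoc ::
  "('r, 'm) ring_scheme \<Rightarrow> ('a, 'r) ralg \<Rightarrow> ('b, 'r) ralg \<Rightarrow> ('c, 'r) ralg
    \<Rightarrow> (('a \<times> 'b \<Rightarrow>\<^sub>0 int) set \<times> 'c \<Rightarrow>\<^sub>0 int) set
    \<Rightarrow> ('a \<times> ('b \<times> 'c \<Rightarrow>\<^sub>0 int) set \<Rightarrow>\<^sub>0 int) set" where
  "tensor_assoc R A B C =
    (let T = tensor_alg R A (tensor_alg R B C) in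
     tensor_lift T (\<lambda>x c. tensor_lift T
       (\<lambda>a b. tens R A (tensor_alg R B C) a (tens R B C b c)) x))"

definition tensor_flip ::
  "('r, 'm) ring_scheme \<Rightarrow> ('a, 'r) ralg \<Rightarrow> ('b, 'r) ralg
    \<Rightarrow> ('a \<times> 'b \<Rightarrow>\<^sub>0 int) set \<Rightarrow> ('b \<times> 'a \<Rightarrow>\<^sub>0 int) set" where
  "tensor_flip R A B = tensor_lift (tensor_alg R B A) (\<lambda>a b. tens R B A b a)"


section \<open>Hopf algebras\<close>

text \<open>Multiplication and unit are those of the algebra \<open>A\<close>. In the counit axioms,
  \<open>R \<otimes>\<^sub>R A\<close> and \<open>A \<otimes>\<^sub>R R\<close> are identified with \<open>A\<close> by means of the unit map.\<close>

locale hopf_algebra = unital_algebra R A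
  for R :: "('r, 'm) ring_scheme" and A :: "('a, 'r) ralg" +
  fixes \<Delta> :: "'a \<Rightarrow> ('a \<times> 'a \<Rightarrow>\<^sub>0 int) set" and S :: "'a \<Rightarrow> 'a" and \<epsilon> :: "'a \<Rightarrow> 'r"
  assumes comult_hom: "\<Delta> \<in> ring_hom A (tensor_alg R A A)"
    and comult_unit: "r \<in> carrier R \<Longrightarrow> \<Delta> (unit_map A r) = unit_map (tensor_alg R A A) r"
    and counit_hom: "\<epsilon> \<in> ring_hom A R"
    and counit_unit: "r \<in> carrier R \<Longrightarrow> \<epsilon> (unit_map A r) = r"
    and coassoc: "a \<in> carrier A \<Longrightarrow>
      tensor_assoc R A A A (tensor_map R (tensor_alg R A A) A \<Delta> id (\<Delta> a)) =
      tensor_map R A (tensor_alg R A A) id \<Delta> (\<Delta> a)"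
    and counit_left: "a \<in> carrier A \<Longrightarrow>
      tensor_lift A (\<lambda>x y. unit_map A (\<epsilon> x) \<otimes>\<^bsub>A\<^esub> y) (\<Delta> a) = a"
    and counit_right: "a \<in> carrier A \<Longrightarrow>
      tensor_lift A (\<lambda>x y. x \<otimes>\<^bsub>A\<^esub> unit_map A (\<epsilon> y)) (\<Delta> a) = a"
    and antipode_closed: "a \<in> carrier A \<Longrightarrow> S a \<in> carrier A"
    and antipode_add: "\<lbrakk>a \<in> carrier A; b \<in> carrier A\<rbrakk> \<Longrightarrow> S (a \<oplus>\<^bsub>A\<^esub> b) = S a \<oplus>\<^bsub>A\<^esub> S b"
    and antipode_smult: "\<lbrakk>r \<in> carrier R; a \<in> carrier A\<rbrakk> \<Longrightarrow>
      S (unit_map A r \<otimes>\<^bsub>A\<^esub> a) = unit_map A r \<otimes>\<^bsub>A\<^esub> S a"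
    and antipode_left: "a \<in> carrier A \<Longrightarrow>
      tensor_lift A (monoid.mult A) (tensor_map R A A S id (\<Delta> a)) = unit_map A (\<epsilon> a)"
    and antipode_right: "a \<in> carrier A \<Longrightarrow>
      tensor_lift A (monoid.mult A) (tensor_map R A A id S (\<Delta> a)) = unit_map A (\<epsilon> a)"

definition commutative_alg :: "('a, 'r) ralg \<Rightarrow> bool" where
  "commutative_alg A \<longleftrightarrow> (\<forall>a\<in>carrier A. \<forall>b\<in>carrier A. a \<otimes>\<^bsub>A\<^esub> b = b \<otimes>\<^bsub>A\<^esub> a)"

definition cocommutative ::
  "('r, 'm) ring_scheme \<Rightarrow> ('a, 'r) ralg \<Rightarrow> ('a \<Rightarrow> ('a \<times> 'a \<Rightarrow>\<^sub>0 int) set) \<Rightarrow> bool" where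
  "cocommutative R A \<Delta> \<longleftrightarrow> (\<forall>a\<in>carrier A. tensor_flip R A A (\<Delta> a) = \<Delta> a)"

text \<open>\<open>rising A a x r = (x + a) (x + a + 1) \<cdots> (x + a + r - 1)\<close>\<close>

primrec rising :: "('a, 'm) ring_scheme \<Rightarrow> int \<Rightarrow> 'a \<Rightarrow> nat \<Rightarrow> 'a" where
  "rising A a x 0 = \<one>\<^bsub>A\<^esub>"
| "rising A a x (Suc r) = rising A a x r \<otimes>\<^bsub>A\<^esub> (x \<oplus>\<^bsub>A\<^esub> add_pow A (a + int r) \<one>\<^bsub>A\<^esub>)"


section \<open>Divided powers and the special algebra\<close>

text \<open>Multi-indices are functions on \<open>nat\<close> that vanish outside \<open>{1..n}\<close>; \<open>midx p n\<close> consists of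
  those with \<open>0 \<le> \<alpha> \<le> \<tau>\<close>. An element of the divided power algebra is its coefficient function with
  respect to the basis of divided powers, and a vector field \<open>\<Sum>\<^sub>i a\<^sub>i D\<^sub>i\<close> is the tuple \<open>a\<close>.
  Addition is the pointwise one.\<close>

type_synonym 'k dpoly = "(nat \<Rightarrow> nat) \<Rightarrow> 'k"
type_synonym 'k vfield = "nat \<Rightarrow> 'k dpoly"

definition midx :: "nat \<Rightarrow> nat \<Rightarrow> (nat \<Rightarrow> nat) set" where
  "midx p n = {\<alpha>. (\<forall>i\<in>{1..n}. \<alpha> i \<le> p - 1) \<and> (\<forall>i. i \<notin> {1..n} \<longrightarrow> \<alpha> i = 0)}"

definition eps :: "nat \<Rightarrow> nat \<Rightarrow> nat" where
  "eps i = (\<lambda>j. of_bool (j = i))"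

definition dpow :: "nat \<Rightarrow> nat \<Rightarrow> (nat \<Rightarrow> nat) \<Rightarrow> 'k::field dpoly" where
  "dpow p n \<alpha> = (\<lambda>\<beta>. of_bool (\<alpha> \<in> midx p n \<and> \<beta> = \<alpha>))"

definition dpoly_carrier :: "nat \<Rightarrow> nat \<Rightarrow> 'k::field dpoly set" where
  "dpoly_carrier p n = {f. \<forall>\<alpha>. f \<alpha> \<noteq> 0 \<longrightarrow> \<alpha> \<in> midx p n}"

definition dpoly_mult :: "nat \<Rightarrow> nat \<Rightarrow> 'k::field dpoly \<Rightarrow> 'k dpoly \<Rightarrow> 'k dpoly" where
  "dpoly_mult p n f g = (\<lambda>\<gamma>. if \<gamma> \<in> midx p n
     then \<Sum>\<alpha>\<in>{\<alpha>. \<alpha> \<le> \<gamma>}. of_nat (\<Prod>i\<in>{1..n}. \<gamma> i choose \<alpha> i) * f \<alpha> * g (\<gamma> - \<alpha>)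
     else 0)"

text \<open>In coefficients, \<open>D\<^sub>i\<close> is the shift \<open>f \<mapsto> (\<alpha> \<mapsto> f (\<alpha> + \<epsilon>\<^sub>i))\<close>.\<close>

definition pder :: "nat \<Rightarrow> 'k::field dpoly \<Rightarrow> 'k dpoly" where
  "pder i f = (\<lambda>\<alpha>. f (\<alpha> + eps i))"

definition witt :: "nat \<Rightarrow> nat \<Rightarrow> 'k::field vfield set" where
  "witt p n = {a. (\<forall>i\<in>{1..n}. a i \<in> dpoly_carrier p n) \<and> (\<forall>i. i \<notin> {1..n} \<longrightarrow> a i = 0)}"

definition vf_apply :: "nat \<Rightarrow> nat \<Rightarrow> 'k::field vfield \<Rightarrow> 'k dpoly \<Rightarrow> 'k dpoly" where
  "vf_apply p n a f = (\<Sum>i\<in>{1..n}. dpoly_mult p n (a i) (pder i f))"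

definition vf_bracket :: "nat \<Rightarrow> nat \<Rightarrow> 'k::field vfield \<Rightarrow> 'k vfield \<Rightarrow> 'k vfield" where
  "vf_bracket p n a b = (\<lambda>j. vf_apply p n a (b j) - vf_apply p n b (a j))"

definition vf_scale :: "'k::field \<Rightarrow> 'k vfield \<Rightarrow> 'k vfield" where
  "vf_scale c a = (\<lambda>i \<alpha>. c * a i \<alpha>)"

text \<open>\<open>D\<^sub>i\<^sub>j(f) = D\<^sub>j(f) D\<^sub>i - D\<^sub>i(f) D\<^sub>j\<close>\<close>

definition dij :: "nat \<Rightarrow> nat \<Rightarrow> 'k::field dpoly \<Rightarrow> 'k vfield" where
  "dij i j f = (\<lambda>m. (if m = i then pder j f else 0) - (if m = j then pder i f else 0))"

definition special' :: "nat \<Rightarrow> nat \<Rightarrow> 'k::field vfield set" where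
  "special' p n = {a \<in> witt p n. (\<Sum>i\<in>{1..n}. pder i (a i)) = 0}"

definition special :: "nat \<Rightarrow> nat \<Rightarrow> 'k::field vfield set" where
  "special p n = Modules.module.span vf_scale
     {vf_bracket p n a b | a b. a \<in> special' p n \<and> b \<in> special' p n}"

definition div_ad :: "nat \<Rightarrow> nat \<Rightarrow> 'k::field vfield \<Rightarrow> nat \<Rightarrow> 'k vfield \<Rightarrow> 'k vfield" where
  "div_ad p n e l x = vf_scale (inverse (of_nat (fact l))) ((vf_bracket p n e ^^ l) x)"


section \<open>Enveloping algebras\<close>

text \<open>The universal enveloping algebra of the Lie algebra with underlying space \<open>L\<close>, presented on
  all elements of \<open>L\<close>: the first two families of relations turn the free algebra on the set \<open>L\<close> into
  the tensor algebra of the vector space \<open>L\<close>.\<close>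

definition env_rels ::
  "'v::ab_group_add set \<Rightarrow> ('k::field \<Rightarrow> 'v \<Rightarrow> 'v) \<Rightarrow> ('v \<Rightarrow> 'v \<Rightarrow> 'v) \<Rightarrow> ('v list \<Rightarrow>\<^sub>0 'k) set" where
  "env_rels L scale br =
     {Poly_Mapping.single [x + y] 1 - Poly_Mapping.single [x] 1 - Poly_Mapping.single [y] 1 | x y.
        x \<in> L \<and> y \<in> L} \<union>
     {Poly_Mapping.single [scale c x] 1 - Poly_Mapping.single [x] c | c x. x \<in> L} \<union>
     {Poly_Mapping.single [x, y] 1 - Poly_Mapping.single [y, x] 1
        - Poly_Mapping.single [br x y] 1 | x y. x \<in> L \<and> y \<in> L}"

definition env_ideal ::
  "'v::ab_group_add set \<Rightarrow> ('k::field \<Rightarrow> 'v \<Rightarrow> 'v) \<Rightarrow> ('v \<Rightarrow> 'v \<Rightarrow> 'v) \<Rightarrow> ('v list \<Rightarrow>\<^sub>0 'k) set" where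
  "env_ideal L scale br = Idl\<^bsub>(free_alg L :: ('v list \<Rightarrow>\<^sub>0 'k, 'k) ralg)\<^esub> (env_rels L scale br)"

definition env_alg ::
  "'v::ab_group_add set \<Rightarrow> ('k::field \<Rightarrow> 'v \<Rightarrow> 'v) \<Rightarrow> ('v \<Rightarrow> 'v \<Rightarrow> 'v)
    \<Rightarrow> (('v list \<Rightarrow>\<^sub>0 'k) set, 'k) ralg" where
  "env_alg L scale br = quot_alg (free_alg L) (env_ideal L scale br)"

definition env_gen ::
  "'v::ab_group_add set \<Rightarrow> ('k::field \<Rightarrow> 'v \<Rightarrow> 'v) \<Rightarrow> ('v \<Rightarrow> 'v \<Rightarrow> 'v) \<Rightarrow> 'v \<Rightarrow> ('v list \<Rightarrow>\<^sub>0 'k) set" where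
  "env_gen L scale br x =
     env_ideal L scale br +>\<^bsub>(free_alg L :: ('v list \<Rightarrow>\<^sub>0 'k, 'k) ralg)\<^esub> Poly_Mapping.single [x] 1"

type_synonym 'k env = "('k vfield list \<Rightarrow>\<^sub>0 'k) set"

definition US :: "nat \<Rightarrow> nat \<Rightarrow> ('k::field env, 'k) ralg" where
  "US p n = env_alg (special p n) vf_scale (vf_bracket p n)"

definition US_gen :: "nat \<Rightarrow> nat \<Rightarrow> 'k::field vfield \<Rightarrow> 'k env" where
  "US_gen p n = env_gen (special p n) vf_scale (vf_bracket p n)"

definition uS_ideal :: "nat \<Rightarrow> nat \<Rightarrow> 'k::field env set" where
  "uS_ideal p n = Idl\<^bsub>US p n\<^esub>
     ({US_gen p n (dij i j (dpow p n (eps i + eps j))) [^]\<^bsub>US p n\<^esub> p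
         \<ominus>\<^bsub>US p n\<^esub> US_gen p n (dij i j (dpow p n (eps i + eps j))) | i j.
         1 \<le> j \<and> j < i \<and> i \<le> n} \<union>
      {US_gen p n (dij i j (dpow p n \<alpha>)) [^]\<^bsub>US p n\<^esub> p | i j \<alpha>.
         1 \<le> j \<and> j < i \<and> i \<le> n \<and> \<alpha> \<in> midx p n \<and> \<alpha> \<noteq> eps i + eps j})"

definition uS :: "nat \<Rightarrow> nat \<Rightarrow> ('k::field env set, 'k) ralg" where
  "uS p n = quot_alg (US p n) (uS_ideal p n)"

definition uS_gen :: "nat \<Rightarrow> nat \<Rightarrow> 'k::field vfield \<Rightarrow> 'k env set" where
  "uS_gen p n x = uS_ideal p n +>\<^bsub>US p n\<^esub> US_gen p n x"

definition poly_alg :: "('k::field poly, 'k) ralg" where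
  "poly_alg = ring.extend ring_of_type_algebra (ralg.fields (\<lambda>c. [:c:]))"

text \<open>\<open>Ktpq p q = K[t] / (t\<^sup>p - q t)\<close>, with \<open>Ktpq_t\<close> the class of \<open>t\<close>\<close>

definition Ktpq_ideal :: "nat \<Rightarrow> 'k::field \<Rightarrow> 'k poly set" where
  "Ktpq_ideal p q = Idl\<^bsub>poly_alg\<^esub> {monom 1 p - monom q 1}"

definition Ktpq :: "nat \<Rightarrow> 'k::field \<Rightarrow> ('k poly set, 'k) ralg" where
  "Ktpq p q = quot_alg poly_alg (Ktpq_ideal p q)"

definition Ktpq_t :: "nat \<Rightarrow> 'k::field \<Rightarrow> 'k poly set" where
  "Ktpq_t p q = Ktpq_ideal p q +>\<^bsub>poly_alg\<^esub> monom 1 1"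

type_synonym 'k utq = "('k env set \<times> 'k poly set \<Rightarrow>\<^sub>0 int) set"

text \<open>The \<open>K\<close>-algebra \<open>u(S(n;1)) \<otimes>\<^sub>K K[t]\<^sub>p\<close>, regarded as an algebra over \<open>K[t]\<^sub>p\<close> via \<open>r \<mapsto> 1 \<otimes> r\<close>.\<close>

definition utqS :: "nat \<Rightarrow> nat \<Rightarrow> 'k::field \<Rightarrow> ('k utq, 'k poly set) ralg" where
  "utqS p n q = ring.extend
     (ring.truncate (tensor_alg (ring_of_type_algebra :: 'k ring) (uS p n) (Ktpq p q)))
     (ralg.fields (\<lambda>r. tens (ring_of_type_algebra :: 'k ring) (uS p n) (Ktpq p q) \<one>\<^bsub>uS p n\<^esub> r))"

definition utqS_gen :: "nat \<Rightarrow> nat \<Rightarrow> 'k::field \<Rightarrow> 'k vfield \<Rightarrow> 'k utq" where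
  "utqS_gen p n q x =
     tens (ring_of_type_algebra :: 'k ring) (uS p n) (Ktpq p q) (uS_gen p n x) \<one>\<^bsub>Ktpq p q\<^esub>"

end

(* Let Delta0 be the comultiplication for which the elements of S(n;1) are primitive, and S0 the
   corresponding antipode. Since h^p = h, the Lagrange interpolation polynomials pi_z (z in Z/p) of the
   prime field give orthogonal idempotents pi_z(h) with sum 1, and u = 1 - et satisfies u^p = 1. The
   element F = sum_z pi_z (x) u^z is therefore invertible with inverse sum_z pi_z (x) u^(-z), and
   he = eh + e makes it a twist: Delta = F Delta0 F^(-1) is again coassociative, Delta(u) = u (x) u, and
   S = y^(-1) S0 y with y = sum_z pi_z u^z is an antipode. Conjugating x by u^z yields the sum of the
   terms d^(l)(x) t^l with rising factorials of z as coefficients; summing against pi_z turns z into h,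
   which gives the closed formulas.
   The dimension is a Poincare-Birkhoff-Witt theorem for the restricted enveloping algebra. Monomials
   with exponents less than p span by straightening. They are independent because the coefficient
   functionals of the action on the divided power algebra vanish at 1 and are dual to a basis of S(n;1),
   so their convolution products are triangular with respect to the monomials, with products of
   factorials k!, k < p, on the diagonal. *)

theory Submission
  imports Defs "HOL-Number_Theory.Number_Theory"
begin

text \<open>The algebra is known only through generators and relations, and its tensor square only
  as a quotient of formal sums. So every structure map comes from a universal property, and
  identities between maps are reduced to pure tensors or generators. The delicate relations are the
  p-th powers: for x \<otimes> 1 + 1 \<otimes> x they hold because the two summands commute, so that
  Frobenius is additive on them. A Drinfeld twist is normally a power series in t. Here the
  eigenvalues of h and the exponents of u both live in Z/p, so the series becomes a finite sum that
  matches the two. A generator enters the twisting argument through its primitivity, its eigenvalue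
  under ad h, which is the exponent of u in the coproduct, and its divided powers under ad e. The
  element y is m(S0 \<otimes> id)(F^-1), as twisting theory prescribes. Inverting it and expressing
  S by rising factorials of h is the hard computation, because u and h do not commute. For p = 2 the
  factor 2 annihilates e, so u = 1 and nothing is twisted. This is why the failure of
  cocommutativity is claimed for p \<noteq> 2.\<close>

abbreviation pkeys where "pkeys \<equiv> Poly_Mapping.keys"
abbreviation plookup where "plookup \<equiv> Poly_Mapping.lookup"
abbreviation psingle where "psingle \<equiv> Poly_Mapping.single"

section \<open>Additive maps on finitely supported functions\<close>

text \<open>The supports of f, g and f + g differ, since terms may cancel. As h vanishes at
  coefficient 0, all three sums may be taken over the union of the supports of f and g.\<close>

lemma sum_keys_add:
 fixes h :: "'a \<Rightarrow> 'b::monoid_add \<Rightarrow> 'c::comm_monoid_add"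
 assumes h0: "\<And>u. h u 0 = 0" and ha: "\<And>u a b. h u (a + b) = h u a + h u b"
 shows "(\<Sum>u\<in>pkeys (f + g). h u (plookup (f + g) u)) =
  (\<Sum>u\<in>pkeys f. h u (plookup f u)) + (\<Sum>u\<in>pkeys g. h u (plookup g u))"
proof -
 have "(\<Sum>u\<in>pkeys x. h u (plookup x u)) = (\<Sum>u\<in>pkeys f \<union> pkeys g. h u (plookup x u))"
  if "pkeys x \<subseteq> pkeys f \<union> pkeys g" for x
  using that by (intro sum.mono_neutral_left) (auto simp: in_keys_iff h0)
 from this[of f] this[of g] this[of "f + g"] show ?thesis
  using Poly_Mapping.keys_add[of f g] by (simp add: lookup_add ha sum.distrib)
qed

lemma pm_sum_singles:
 fixes f :: "'a \<Rightarrow>\<^sub>0 'b::comm_monoid_add"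
 shows "f = (\<Sum>u\<in>pkeys f. psingle u (plookup f u))"
proof (rule poly_mapping_eqI)
 fix k
 have "plookup (\<Sum>u\<in>pkeys f. psingle u (plookup f u)) k
   = (\<Sum>u\<in>pkeys f. (plookup f u when u = k))"
  by (simp add: lookup_sum lookup_single)
 also have "\<dots> = (\<Sum>u\<in>pkeys f. if u = k then plookup f k else 0)"
  by (intro sum.cong) (auto simp: when_def)
 also have "\<dots> = plookup f k"
  by (simp add: in_keys_iff)
 finally show "plookup f k = plookup (\<Sum>u\<in>pkeys f. psingle u (plookup f u)) k" ..
qed

lemma pm_induct [consumes 1, case_names zero single add]:
 fixes f :: "'a \<Rightarrow>\<^sub>0 'b::comm_monoid_add"
 assumes "pkeys f \<subseteq> S" and "P 0" and s: "\<And>u c. u \<in> S \<Longrightarrow> P (psingle u c)"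
  and add: "\<And>f g. \<lbrakk>pkeys f \<subseteq> S; pkeys g \<subseteq> S; P f; P g\<rbrakk> \<Longrightarrow> P (f + g)"
 shows "P f"
proof -
 have "P (\<Sum>u\<in>U. psingle u (plookup f u)) \<and> pkeys (\<Sum>u\<in>U. psingle u (plookup f u)) \<subseteq> S"
  if "finite U" "U \<subseteq> S" for U
  using that
 proof (induction U rule: finite_induct)
  case empty
  then show ?case using \<open>P 0\<close> by simp
 next
  case (insert x F)
  have k: "pkeys (psingle x (plookup f x)) \<subseteq> S"
   using insert by auto
  have "pkeys (psingle x (plookup f x) + (\<Sum>u\<in>F. psingle u (plookup f u))) \<subseteq> S"
   using insert k Poly_Mapping.keys_add by (metis (no_types, lifting) Un_least dual_order.trans insert_subset)
  then show ?case
   using insert k by (auto intro!: add s)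
 qed
 from this[of "pkeys f"] show ?thesis
  using assms(1) pm_sum_singles[of f] by simp
qed

text \<open>The additive extension of a family of maps, one per basis element. With integer
  multiples it gives the maps out of tensor products, with scalar multiples the maps out of free
  algebras.\<close>

definition pm_hom :: "('c, 'm) ring_scheme \<Rightarrow> ('a \<Rightarrow> 'b::zero \<Rightarrow> 'c) \<Rightarrow> ('a \<Rightarrow>\<^sub>0 'b) \<Rightarrow> 'c" where
 "pm_hom C h f = (\<Oplus>\<^bsub>C\<^esub>u\<in>pkeys f. h u (plookup f u))"

locale additive_family = C: abelian_group C for C :: "('c, 'm) ring_scheme" +
 fixes S :: "'a set" and h :: "'a \<Rightarrow> 'b::ab_group_add \<Rightarrow> 'c"
 assumes h_closed: "u \<in> S \<Longrightarrow> h u a \<in> carrier C"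
  and h_add: "u \<in> S \<Longrightarrow> h u (a + b) = h u a \<oplus>\<^bsub>C\<^esub> h u b"
begin

lemma h_zero: "u \<in> S \<Longrightarrow> h u 0 = \<zero>\<^bsub>C\<^esub>"
 using h_add[of u 0 0] h_closed[of u 0] by (metis C.r_zero C.add.l_cancel C.zero_closed add.right_neutral)

lemma pm_closed: "pkeys f \<subseteq> S \<Longrightarrow> pm_hom C h f \<in> carrier C"
 unfolding pm_hom_def by (rule C.finsum_closed) (use h_closed in auto)

lemma pm_superset:
 assumes "pkeys f \<subseteq> U" "U \<subseteq> S" "finite U"
 shows "pm_hom C h f = (\<Oplus>\<^bsub>C\<^esub>u\<in>U. h u (plookup f u))"
 unfolding pm_hom_def
 by (rule C.add.finprod_mono_neutral_cong_left)
   (use assms h_zero h_closed in \<open>auto simp: in_keys_iff\<close>)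

lemma pm_add:
 assumes "pkeys f \<subseteq> S" "pkeys g \<subseteq> S"
 shows "pm_hom C h (f + g) = pm_hom C h f \<oplus>\<^bsub>C\<^esub> pm_hom C h g"
proof -
 let ?U = "pkeys f \<union> pkeys g"
 have "pm_hom C h x = (\<Oplus>\<^bsub>C\<^esub>u\<in>?U. h u (plookup x u))" if "pkeys x \<subseteq> ?U" for x
  using assms that by (intro pm_superset) auto
 from this[of f] this[of g] this[of "f + g"]
 have fg: "pm_hom C h (f + g) = (\<Oplus>\<^bsub>C\<^esub>u\<in>?U. h u (plookup (f + g) u))"
  and f: "pm_hom C h f = (\<Oplus>\<^bsub>C\<^esub>u\<in>?U. h u (plookup f u))"
  and g: "pm_hom C h g = (\<Oplus>\<^bsub>C\<^esub>u\<in>?U. h u (plookup g u))"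
  using Poly_Mapping.keys_add[of f g] by auto
 note fg
 also have "(\<Oplus>\<^bsub>C\<^esub>u\<in>?U. h u (plookup (f + g) u)) = (\<Oplus>\<^bsub>C\<^esub>u\<in>?U. h u (plookup f u) \<oplus>\<^bsub>C\<^esub> h u (plookup g u))"
  using assms h_closed by (intro C.finsum_cong') (auto simp: lookup_add h_add)
 also have "\<dots> = pm_hom C h f \<oplus>\<^bsub>C\<^esub> pm_hom C h g"
  unfolding f g using assms h_closed by (intro C.finsum_addf) auto
 finally show ?thesis .
qed

lemma pm_zero: "pm_hom C h 0 = \<zero>\<^bsub>C\<^esub>"
 by (simp add: pm_hom_def)

lemma pm_single: "u \<in> S \<Longrightarrow> pm_hom C h (psingle u c) = h u c"
 using pm_superset[of "psingle u c" "{u}"] h_closed by simp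

lemma pm_uminus:
 assumes "pkeys f \<subseteq> S" shows "pm_hom C h (- f) = \<ominus>\<^bsub>C\<^esub> pm_hom C h f"
proof -
 have "pm_hom C h (- f) \<oplus>\<^bsub>C\<^esub> pm_hom C h f = \<zero>\<^bsub>C\<^esub>"
  using pm_add[of "- f" f] assms pm_zero by simp
 then show ?thesis
  using pm_closed assms by (metis C.minus_equality keys_minus)
qed

lemma pm_diff:
 assumes "pkeys f \<subseteq> S" "pkeys g \<subseteq> S"
 shows "pm_hom C h (f - g) = pm_hom C h f \<ominus>\<^bsub>C\<^esub> pm_hom C h g"
 using pm_add[of f "- g"] pm_uminus[of g] assms by (simp add: a_minus_def)

end

section \<open>Monoid rings\<close>

definition mr_mult :: "('m, 'z) monoid_scheme \<Rightarrow> ('m \<Rightarrow>\<^sub>0 'c) \<Rightarrow> ('m \<Rightarrow>\<^sub>0 'c) \<Rightarrow> ('m \<Rightarrow>\<^sub>0 'c::comm_ring_1)" where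
 "mr_mult M f g = (\<Sum>u\<in>pkeys f. \<Sum>v\<in>pkeys g. psingle (u \<otimes>\<^bsub>M\<^esub> v) (plookup f u * plookup g v))"

lemma monoid_ring_simps [simp]:
 "carrier (monoid_ring M) = {f. pkeys f \<subseteq> carrier M}"
 "\<one>\<^bsub>monoid_ring M\<^esub> = psingle \<one>\<^bsub>M\<^esub> 1"
 "\<zero>\<^bsub>monoid_ring M\<^esub> = 0"
 "f \<oplus>\<^bsub>monoid_ring M\<^esub> g = f + g"
 "f \<otimes>\<^bsub>monoid_ring M\<^esub> g = mr_mult M f g"
 by (simp_all add: monoid_ring_def mr_mult_def)

lemma mr_mult_add_left: "mr_mult M (f + f') g = mr_mult M f g + mr_mult M f' g"
 unfolding mr_mult_def
 by (rule sum_keys_add[where h = "\<lambda>u a. \<Sum>v\<in>pkeys g. psingle (u \<otimes>\<^bsub>M\<^esub> v) (a * plookup g v)"])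
   (simp_all add: algebra_simps single_add sum.distrib)

lemma mr_mult_add_right: "mr_mult M f (g + g') = mr_mult M f g + mr_mult M f g'"
proof -
 have "(\<Sum>v\<in>pkeys (g + g'). psingle (u \<otimes>\<^bsub>M\<^esub> v) (a * plookup (g + g') v)) =
   (\<Sum>v\<in>pkeys g. psingle (u \<otimes>\<^bsub>M\<^esub> v) (a * plookup g v))
   + (\<Sum>v\<in>pkeys g'. psingle (u \<otimes>\<^bsub>M\<^esub> v) (a * plookup g' v))" for u a
  by (rule sum_keys_add[where h = "\<lambda>v b. psingle (u \<otimes>\<^bsub>M\<^esub> v) (a * b)"])
    (simp_all add: algebra_simps single_add)
 then show ?thesis
  unfolding mr_mult_def by (simp add: sum.distrib)
qed

lemma mr_mult_zero [simp]: "mr_mult M 0 g = 0" "mr_mult M f 0 = 0"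
 by (simp_all add: mr_mult_def)

lemma mr_mult_single [simp]:
 "mr_mult M (psingle u a) (psingle v b) = psingle (u \<otimes>\<^bsub>M\<^esub> v) (a * b)"
 by (cases "a = 0"; cases "b = 0") (simp_all add: mr_mult_def)

lemma mr_mult_uminus_left: "mr_mult M (- f) g = - mr_mult M f g"
 using mr_mult_add_left[of M "- f" f g] by (simp add: eq_neg_iff_add_eq_0)

lemma mr_mult_uminus_right: "mr_mult M f (- g) = - mr_mult M f g"
 using mr_mult_add_right[of M f "- g" g] by (simp add: eq_neg_iff_add_eq_0)

lemma mr_mult_diff_left: "mr_mult M (f - f') g = mr_mult M f g - mr_mult M f' g"
 using mr_mult_add_left[of M f "- f'" g] by (simp add: mr_mult_uminus_left)

lemma mr_mult_diff_right: "mr_mult M f (g - g') = mr_mult M f g - mr_mult M f g'"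
 using mr_mult_add_right[of M f g "- g'"] by (simp add: mr_mult_uminus_right)

lemma (in monoid) mr_mult_keys:
 assumes "pkeys f \<subseteq> carrier G" "pkeys g \<subseteq> carrier G"
 shows "pkeys (mr_mult G f g) \<subseteq> carrier G"
proof -
 have "pkeys (mr_mult G f g) \<subseteq> (\<Union>u\<in>pkeys f. \<Union>v\<in>pkeys g. {u \<otimes> v})"
  unfolding mr_mult_def
  by (rule order.trans[OF keys_sum] UN_mono order.refl)+ simp
 then show ?thesis using assms by auto
qed

lemma (in monoid) mr_mult_assoc:
 assumes "pkeys f \<subseteq> carrier G" "pkeys g \<subseteq> carrier G" "pkeys k \<subseteq> carrier G"
 shows "mr_mult G (mr_mult G f g) k = mr_mult G f (mr_mult G g k)"
 using assms(1)
proof (induction f rule: pm_induct)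
 case (single u c)
 show ?case using assms(2)
 proof (induction g rule: pm_induct)
  case (single v d)
  show ?case using assms(3)
   by (induction k rule: pm_induct)
     (use single \<open>u \<in> carrier G\<close> in \<open>simp_all add: m_assoc mr_mult_add_right mult.assoc\<close>)
 qed (simp_all add: mr_mult_add_left mr_mult_add_right)
qed (simp_all add: mr_mult_add_left mr_mult_add_right)

lemma (in monoid) mr_mult_one:
 assumes "pkeys f \<subseteq> carrier G"
 shows "mr_mult G (psingle \<one> 1) f = f" "mr_mult G f (psingle \<one> 1) = f"
 using assms
 by (induction f rule: pm_induct) (simp_all add: mr_mult_add_left mr_mult_add_right)

lemma (in monoid) ring_monoid_ring: "ring (monoid_ring G :: ('a \<Rightarrow>\<^sub>0 'c::comm_ring_1) ring)"
proof (rule ringI)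
 show "abelian_group (monoid_ring G :: ('a \<Rightarrow>\<^sub>0 'c::comm_ring_1) ring)"
 proof (rule abelian_groupI)
  fix x :: "'a \<Rightarrow>\<^sub>0 'c::comm_ring_1" assume "x \<in> carrier (monoid_ring G)"
  then show "\<exists>y\<in>carrier (monoid_ring G). y \<oplus>\<^bsub>monoid_ring G\<^esub> x = \<zero>\<^bsub>monoid_ring G\<^esub>"
   by (intro bexI[of _ "- x"]) auto
 next
  fix x y :: "'a \<Rightarrow>\<^sub>0 'c::comm_ring_1"
  assume "x \<in> carrier (monoid_ring G)" "y \<in> carrier (monoid_ring G)"
  then show "x \<oplus>\<^bsub>monoid_ring G\<^esub> y \<in> carrier (monoid_ring G)"
   using Poly_Mapping.keys_add[of x y] by auto
 qed (auto simp: algebra_simps)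
 show "Group.monoid (monoid_ring G :: ('a \<Rightarrow>\<^sub>0 'c::comm_ring_1) ring)"
  by (rule monoidI) (simp_all add: mr_mult_keys mr_mult_one mr_mult_assoc)
qed (auto simp: mr_mult_add_left mr_mult_add_right)

lemma (in monoid) minus_monoid_ring:
 assumes "f \<in> carrier (monoid_ring G)"
 shows "\<ominus>\<^bsub>monoid_ring G\<^esub> f = - (f :: 'a \<Rightarrow>\<^sub>0 'c::comm_ring_1)"
proof -
 interpret R: ring "monoid_ring G :: ('a \<Rightarrow>\<^sub>0 'c::comm_ring_1) ring" by (rule ring_monoid_ring)
 show ?thesis using R.minus_equality[of "- f" f] assms by simp
qed

text \<open>Both sides of the product rule are additive in each factor, so it suffices to compare
  them on single terms, where the rule is the hypothesis on h.\<close>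

lemma pm_hom_ring_hom:
 fixes h :: "'m \<Rightarrow> 'r::comm_ring_1 \<Rightarrow> 'c"
 assumes "monoid M" and "ring C" and "additive_family C (carrier M) h"
  and one: "h \<one>\<^bsub>M\<^esub> 1 = \<one>\<^bsub>C\<^esub>"
  and mult: "\<And>u v a b. \<lbrakk>u \<in> carrier M; v \<in> carrier M\<rbrakk> \<Longrightarrow>
   h (u \<otimes>\<^bsub>M\<^esub> v) (a * b) = h u a \<otimes>\<^bsub>C\<^esub> h v b"
 shows "pm_hom C h \<in> ring_hom (monoid_ring M) C"
proof -
 interpret M: monoid M by fact
 interpret C: ring C by fact
 interpret additive_family C "carrier M" h by fact
 have m: "pm_hom C h (mr_mult M f g) = pm_hom C h f \<otimes>\<^bsub>C\<^esub> pm_hom C h g"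
  if "pkeys f \<subseteq> carrier M" "pkeys g \<subseteq> carrier M" for f g
  using that(1)
 proof (induction f rule: pm_induct)
  case (single u c)
  show ?case using that(2)
  proof (induction g rule: pm_induct)
   case (add f g)
   have "pkeys (psingle u c) \<subseteq> carrier M" using single by auto
   then show ?case
    using add single by (simp add: mr_mult_add_right pm_add M.mr_mult_keys C.r_distr pm_closed)
  qed (use single in \<open>simp_all add: pm_zero pm_single mult pm_closed h_closed\<close>)
 next
  case (add f f')
  then show ?case
   using that(2) by (simp add: mr_mult_add_left pm_add M.mr_mult_keys C.l_distr pm_closed)
 qed (use that in \<open>simp_all add: pm_zero pm_closed\<close>)
 show ?thesis
  by (rule ring_hom_memI) (use m in \<open>auto simp: pm_closed pm_add pm_single one\<close>)
qed

section \<open>Quotient algebras\<close>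

lemma ring_extend_simps [simp]:
 "carrier (ring.extend r m) = carrier r" "monoid.mult (ring.extend r m) = monoid.mult r"
 "one (ring.extend r m) = one r" "ring.zero (ring.extend r m) = ring.zero r"
 "add (ring.extend r m) = add r"
 by (simp_all add: ring.extend_def)

lemma ring_truncate_simps [simp]:
 "carrier (ring.truncate r) = carrier r" "monoid.mult (ring.truncate r) = monoid.mult r"
 "one (ring.truncate r) = one r" "ring.zero (ring.truncate r) = ring.zero r"
 "add (ring.truncate r) = add r"
 by (simp_all add: ring.truncate_def)

lemma unit_map_extend [simp]: "unit_map (ring.extend r (ralg.fields u)) = u"
 by (simp add: ring.extend_def ralg.fields_def)

lemma ring_same_structure:
 assumes "ring r" and "carrier s = carrier r" "monoid.mult s = monoid.mult r" "one s = one r"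
  "ring.zero s = ring.zero r" "add s = add r"
 shows "ring s"
proof -
 interpret r: ring r by fact
 show ?thesis
 proof (rule ringI)
  show "abelian_group s"
   by (rule abelian_groupI) (use r.l_neg in \<open>auto simp: assms r.a_ac\<close>)
  show "Group.monoid s"
   by (rule monoidI) (auto simp: assms r.m_assoc)
 qed (auto simp: assms r.l_distr r.r_distr)
qed

lemma cring_same_structure:
 assumes "cring r" and "carrier s = carrier r" "monoid.mult s = monoid.mult r" "one s = one r"
  "ring.zero s = ring.zero r" "add s = add r"
 shows "cring s"
proof -
 interpret r: cring r by fact
 interpret s: ring s by (rule ring_same_structure[OF r.ring_axioms]) (use assms in auto)
 show ?thesis by unfold_locales (auto simp: assms r.m_comm)
qed

lemma ring_hom_same_structure:
 assumes "carrier s = carrier r" "monoid.mult s = monoid.mult r" "one s = one r" "add s = add r"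
  and "carrier s' = carrier r'" "monoid.mult s' = monoid.mult r'" "one s' = one r'" "add s' = add r'"
 shows "ring_hom s s' = ring_hom r r'"
 by (simp add: ring_hom_def assms)

lemma (in ideal) quot_lift:
 assumes "ring B" and "\<phi> \<in> ring_hom R B" and "\<And>x. x \<in> I \<Longrightarrow> \<phi> x = \<zero>\<^bsub>B\<^esub>"
 obtains \<psi> where "\<psi> \<in> ring_hom (R Quot I) B" "\<And>x. x \<in> carrier R \<Longrightarrow> \<psi> (I +> x) = \<phi> x"
proof
 interpret B: ring B by fact
 interpret \<phi>: ring_hom_ring R B \<phi> by unfold_locales (use assms in simp)
 define \<psi> where "\<psi> z = the_elem (\<phi> ` z)" for z
 show psi: "\<psi> (I +> x) = \<phi> x" if "x \<in> carrier R" for x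
 proof -
  have "\<phi> y = \<phi> x" if y: "y \<in> I +> x" for y
  proof -
   obtain i where i: "i \<in> I" "y = i \<oplus> x"
    using y by (auto simp: a_r_coset_def r_coset_def)
   then show ?thesis
    using assms(3) \<open>x \<in> carrier R\<close> a_Hcarr[of i] by simp
  qed
  moreover have "x \<in> I +> x" using a_rcos_self that by blast
  ultimately have "\<phi> ` (I +> x) = {\<phi> x}" by blast
  then show ?thesis by (simp add: \<psi>_def)
 qed
 show "\<psi> \<in> ring_hom (R Quot I) B"
  by (rule ring_hom_memI) (auto simp: FactRing_simps rcoset_mult_add a_rcos_sum psi)
qed

text \<open>The kernel of \<phi> is an ideal, so it contains the ideal generated by S as soon as it
  contains S. For an algebra given by relations only the relations themselves have to be
  checked.\<close>

lemma (in ring) genideal_quot_lift: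
 assumes S: "S \<subseteq> carrier R" and B: "ring B" and hom: "\<phi> \<in> ring_hom R B"
  and zero: "\<And>x. x \<in> S \<Longrightarrow> \<phi> x = \<zero>\<^bsub>B\<^esub>"
 obtains \<psi> where "\<psi> \<in> ring_hom (R Quot (Idl S)) B"
  "\<And>x. x \<in> carrier R \<Longrightarrow> \<psi> ((Idl S) +> x) = \<phi> x"
proof -
 have id: "ideal (Idl S) R" by (rule genideal_ideal[OF S])
 have h: "ring_hom_ring R B \<phi>" by (rule ring_hom_ringI2[OF ring_axioms B hom])
 have "S \<subseteq> a_kernel R B \<phi>"
  using S zero unfolding a_kernel_def' by blast
 then have "Idl S \<subseteq> a_kernel R B \<phi>"
  by (rule genideal_minimal[OF ring_hom_ring.kernel_is_ideal[OF h]])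
 then have z: "\<phi> x = \<zero>\<^bsub>B\<^esub>" if "x \<in> Idl S" for x
  using that unfolding a_kernel_def' by blast
 show thesis
  by (rule ideal.quot_lift[OF id B hom z]) (assumption, rule that)
qed

lemma (in ideal) quot_rep:
 assumes "z \<in> carrier (R Quot I)" obtains x where "x \<in> carrier R" "z = I +> x"
 using assms by (auto simp: FactRing_simps)

lemma quot_alg_simps [simp]:
 "carrier (quot_alg A I) = carrier (A Quot I)" "monoid.mult (quot_alg A I) = monoid.mult (A Quot I)"
 "one (quot_alg A I) = one (A Quot I)" "ring.zero (quot_alg A I) = ring.zero (A Quot I)"
 "add (quot_alg A I) = add (A Quot I)" "unit_map (quot_alg A I) = (\<lambda>r. I +>\<^bsub>A\<^esub> unit_map A r)"
 by (simp_all add: quot_alg_def)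

lemma ring_hom_quot_alg: "ring_hom (quot_alg A I) B = ring_hom (A Quot I) B"
 "ring_hom B (quot_alg A I) = ring_hom B (A Quot I)"
 by (rule ring_hom_same_structure; simp)+

lemma (in unital_algebra) unit_closed [simp, intro]: "r \<in> carrier R \<Longrightarrow> unit_map A r \<in> carrier A"
 using unit_map_hom by (rule ring_hom_closed)

lemma (in unital_algebra) unit_add:
 "\<lbrakk>r \<in> carrier R; s \<in> carrier R\<rbrakk> \<Longrightarrow> unit_map A (r \<oplus>\<^bsub>R\<^esub> s) = unit_map A r \<oplus>\<^bsub>A\<^esub> unit_map A s"
 using unit_map_hom by (rule ring_hom_add)

lemma (in unital_algebra) unit_mult:
 "\<lbrakk>r \<in> carrier R; s \<in> carrier R\<rbrakk> \<Longrightarrow> unit_map A (r \<otimes>\<^bsub>R\<^esub> s) = unit_map A r \<otimes>\<^bsub>A\<^esub> unit_map A s"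
 using unit_map_hom by (rule ring_hom_mult)

lemma (in unital_algebra) unit_one [simp]: "unit_map A \<one>\<^bsub>R\<^esub> = \<one>\<^bsub>A\<^esub>"
 using unit_map_hom by (rule ring_hom_one)

lemma (in unital_algebra) unit_ring_hom_ring: "ring_hom_ring R A (unit_map A)"
 by unfold_locales (rule unit_map_hom)

lemma (in unital_algebra) unit_zero [simp]: "unit_map A \<zero>\<^bsub>R\<^esub> = \<zero>\<^bsub>A\<^esub>"
 using unit_ring_hom_ring by (metis ring_hom_ring.axioms(1,2) ring_hom_zero unit_map_hom)

lemma (in unital_algebra) unit_left_commute:
 "\<lbrakk>r \<in> carrier R; a \<in> carrier A; b \<in> carrier A\<rbrakk> \<Longrightarrow>
  a \<otimes>\<^bsub>A\<^esub> (unit_map A r \<otimes>\<^bsub>A\<^esub> b) = unit_map A r \<otimes>\<^bsub>A\<^esub> (a \<otimes>\<^bsub>A\<^esub> b)"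
 using unit_map_central[of r a] by (metis A.m_assoc unit_closed)

lemma unital_algebra_quot_alg:
 assumes "unital_algebra R A" and "ideal I A"
 shows "unital_algebra R (quot_alg A I)"
proof -
 interpret A: unital_algebra R A by fact
 interpret I: ideal I A by fact
 interpret Q: ring "quot_alg A I"
  by (rule ring_same_structure[OF I.quotient_is_ring]) simp_all
 show ?thesis
 proof unfold_locales
  show "unit_map (quot_alg A I) \<in> ring_hom R (quot_alg A I)"
   unfolding ring_hom_quot_alg
   using ring_hom_trans[OF A.unit_map_hom I.rcos_ring_hom] by (simp add: comp_def)
 next
  fix r a assume "r \<in> carrier R" "a \<in> carrier (quot_alg A I)"
  then show "unit_map (quot_alg A I) r \<otimes>\<^bsub>quot_alg A I\<^esub> a = a \<otimes>\<^bsub>quot_alg A I\<^esub> unit_map (quot_alg A I) r"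
   by (auto elim!: I.quot_rep simp: FactRing_simps I.rcoset_mult_add A.unit_map_central)
 qed
qed

section \<open>Tensor products\<close>

locale two_algebras = A: unital_algebra R A + B: unital_algebra R B
 for R :: "('r, 'm) ring_scheme" and A :: "('a, 'r) ralg" and B :: "('b, 'r) ralg"
begin

abbreviation "AB \<equiv> tensor_alg R A B"
abbreviation "T \<equiv> tens R A B"
abbreviation "J \<equiv> tensor_ideal R A B"
abbreviation "pre \<equiv> tensor_pre A B"

sublocale M: Group.monoid "A \<times>\<times> B"
 by (rule DirProd_monoid) unfold_locales

sublocale P: ring pre
 unfolding tensor_pre_def by (rule M.ring_monoid_ring)

lemma pre_simps [simp]:
 "carrier pre = {f. pkeys f \<subseteq> carrier A \<times> carrier B}"
 "\<one>\<^bsub>pre\<^esub> = frag_of (\<one>\<^bsub>A\<^esub>, \<one>\<^bsub>B\<^esub>)"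
 "\<zero>\<^bsub>pre\<^esub> = 0"
 "f \<oplus>\<^bsub>pre\<^esub> g = f + g"
 "f \<otimes>\<^bsub>pre\<^esub> g = mr_mult (A \<times>\<times> B) f g"
 by (simp_all add: tensor_pre_def DirProd_def)

lemma frag_mult [simp]:
 "mr_mult (A \<times>\<times> B) (frag_of (a, b)) (frag_of (a', b')) = frag_of (a \<otimes>\<^bsub>A\<^esub> a', b \<otimes>\<^bsub>B\<^esub> b')"
 by (simp add: DirProd_def)

lemma pre_minus: "f \<in> carrier pre \<Longrightarrow> \<ominus>\<^bsub>pre\<^esub> f = - f"
 using M.minus_monoid_ring[of f] by (simp add: tensor_pre_def DirProd_def)

lemma keys_diff2: "pkeys f \<subseteq> S \<Longrightarrow> pkeys g \<subseteq> S \<Longrightarrow> pkeys (f - g) \<subseteq> S" for f g :: "'x \<Rightarrow>\<^sub>0 int"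
 using keys_diff[of f g] by blast

lemma pre_diff: "f \<in> carrier pre \<Longrightarrow> g \<in> carrier pre \<Longrightarrow> f - g \<in> carrier pre"
 unfolding pre_simps mem_Collect_eq by (rule keys_diff2)

lemma frag_pre': "\<lbrakk>a \<in> carrier A; b \<in> carrier B\<rbrakk> \<Longrightarrow> frag_of (a, b) \<in> carrier pre"
 by simp

lemma rels_closed: "tensor_rels R A B \<subseteq> carrier pre"
 unfolding tensor_rels_def
 by (intro Un_least subsetI; elim CollectE exE conjE; hypsubst; intro pre_diff frag_pre')
   (simp_all add: A.unit_closed B.unit_closed)

sublocale J: ideal J pre
 unfolding tensor_ideal_def by (rule P.genideal_ideal[OF rels_closed])

lemma rels_subset: "tensor_rels R A B \<subseteq> J"
 unfolding tensor_ideal_def by (rule P.genideal_self[OF rels_closed])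

lemma AB_simps:
 "carrier AB = carrier (pre Quot J)" "monoid.mult AB = monoid.mult (pre Quot J)"
 "one AB = one (pre Quot J)" "ring.zero AB = ring.zero (pre Quot J)"
 "add AB = add (pre Quot J)" "unit_map AB = (\<lambda>r. T (unit_map A r) \<one>\<^bsub>B\<^esub>)"
 by (simp_all add: tensor_alg_def)

lemma tens_def': "T a b = J +>\<^bsub>pre\<^esub> frag_of (a, b)"
 by (simp add: tens_def)

sublocale Q: ring AB
 by (rule ring_same_structure[OF J.quotient_is_ring]) (simp_all add: AB_simps)

lemma coset_closed: "f \<in> carrier pre \<Longrightarrow> J +>\<^bsub>pre\<^esub> f \<in> carrier AB"
 using P.a_rcosetsI[OF J.a_subset, of f] by (simp add: FactRing_def AB_simps)

lemma coset_add: "\<lbrakk>f \<in> carrier pre; g \<in> carrier pre\<rbrakk> \<Longrightarrow>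
  (J +>\<^bsub>pre\<^esub> f) \<oplus>\<^bsub>AB\<^esub> (J +>\<^bsub>pre\<^esub> g) = J +>\<^bsub>pre\<^esub> (f + g)"
 using J.a_rcos_sum[of f g] by (simp add: FactRing_simps AB_simps)

lemma coset_eqI: "\<lbrakk>f \<in> carrier pre; g \<in> carrier pre; f - g \<in> J\<rbrakk> \<Longrightarrow> J +>\<^bsub>pre\<^esub> f = J +>\<^bsub>pre\<^esub> g"
proof -
 assume fg: "f \<in> carrier pre" "g \<in> carrier pre" "f - g \<in> J"
 have "J +>\<^bsub>pre\<^esub> f = J +>\<^bsub>pre\<^esub> ((f - g) + g)" by simp
 also have "\<dots> = (J +>\<^bsub>pre\<^esub> (f - g)) \<oplus>\<^bsub>AB\<^esub> (J +>\<^bsub>pre\<^esub> g)"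
  using fg J.a_Hcarr[OF fg(3)] coset_add[of "f - g" g] by simp
 also have "J +>\<^bsub>pre\<^esub> (f - g) = J"
  by (rule J.a_rcos_const[OF fg(3)])
 also have "J \<oplus>\<^bsub>AB\<^esub> (J +>\<^bsub>pre\<^esub> g) = J +>\<^bsub>pre\<^esub> g"
  using Q.l_zero[OF coset_closed[OF fg(2)]] by (simp add: FactRing_def AB_simps)
 finally show ?thesis .
qed

lemma frag_closed [simp]: "a \<in> carrier A \<Longrightarrow> b \<in> carrier B \<Longrightarrow> pkeys (frag_of (a, b)) \<subseteq> carrier A \<times> carrier B"
 by simp

lemma tens_closed [simp, intro]: "\<lbrakk>a \<in> carrier A; b \<in> carrier B\<rbrakk> \<Longrightarrow> T a b \<in> carrier AB"
 unfolding tens_def' by (rule coset_closed) simp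

lemma tens_add_left:
 assumes "a \<in> carrier A" "a' \<in> carrier A" "b \<in> carrier B"
 shows "T (a \<oplus>\<^bsub>A\<^esub> a') b = T a b \<oplus>\<^bsub>AB\<^esub> T a' b"
proof -
 have k: "pkeys (frag_of (a, b) + frag_of (a', b)) \<subseteq> carrier A \<times> carrier B"
  using assms Poly_Mapping.keys_add[of "frag_of (a, b)" "frag_of (a', b)"] by auto
 have "frag_of (a \<oplus>\<^bsub>A\<^esub> a', b) - frag_of (a, b) - frag_of (a', b) \<in> tensor_rels R A B"
  unfolding tensor_rels_def using assms by blast
 then have d: "frag_of (a \<oplus>\<^bsub>A\<^esub> a', b) - (frag_of (a, b) + frag_of (a', b)) \<in> J"
  using rels_subset by (auto simp: diff_diff_eq)
 then show ?thesis
  using coset_eqI[OF _ _ d] k assms coset_add[of "frag_of (a, b)" "frag_of (a', b)"]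
  by (simp add: tens_def')
qed

lemma tens_add_right:
 assumes "a \<in> carrier A" "b \<in> carrier B" "b' \<in> carrier B"
 shows "T a (b \<oplus>\<^bsub>B\<^esub> b') = T a b \<oplus>\<^bsub>AB\<^esub> T a b'"
proof -
 have k: "pkeys (frag_of (a, b) + frag_of (a, b')) \<subseteq> carrier A \<times> carrier B"
  using assms Poly_Mapping.keys_add[of "frag_of (a, b)" "frag_of (a, b')"] by auto
 have "frag_of (a, b \<oplus>\<^bsub>B\<^esub> b') - frag_of (a, b) - frag_of (a, b') \<in> tensor_rels R A B"
  unfolding tensor_rels_def using assms by blast
 then have d: "frag_of (a, b \<oplus>\<^bsub>B\<^esub> b') - (frag_of (a, b) + frag_of (a, b')) \<in> J"
  using rels_subset by (auto simp: diff_diff_eq)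
 then show ?thesis
  using coset_eqI[OF _ _ d] k assms coset_add[of "frag_of (a, b)" "frag_of (a, b')"]
  by (simp add: tens_def')
qed

lemma tens_balanced:
 assumes "r \<in> carrier R" "a \<in> carrier A" "b \<in> carrier B"
 shows "T (unit_map A r \<otimes>\<^bsub>A\<^esub> a) b = T a (unit_map B r \<otimes>\<^bsub>B\<^esub> b)"
proof -
 have "frag_of (unit_map A r \<otimes>\<^bsub>A\<^esub> a, b) - frag_of (a, unit_map B r \<otimes>\<^bsub>B\<^esub> b) \<in> tensor_rels R A B"
  unfolding tensor_rels_def using assms by blast
 then show ?thesis
  using coset_eqI[of "frag_of (unit_map A r \<otimes>\<^bsub>A\<^esub> a, b)" "frag_of (a, unit_map B r \<otimes>\<^bsub>B\<^esub> b)"] rels_subset assms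
  by (simp add: tens_def' subset_eq)
qed

lemma tens_mult:
 assumes "a \<in> carrier A" "a' \<in> carrier A" "b \<in> carrier B" "b' \<in> carrier B"
 shows "T a b \<otimes>\<^bsub>AB\<^esub> T a' b' = T (a \<otimes>\<^bsub>A\<^esub> a') (b \<otimes>\<^bsub>B\<^esub> b')"
 using assms J.rcoset_mult_add[of "frag_of (a, b)" "frag_of (a', b')"]
 by (simp add: tens_def' FactRing_simps AB_simps)

lemma tens_one: "\<one>\<^bsub>AB\<^esub> = T \<one>\<^bsub>A\<^esub> \<one>\<^bsub>B\<^esub>"
 by (simp add: tens_def' FactRing_simps AB_simps)

lemma tens_zero_left [simp]:
 assumes "b \<in> carrier B" shows "T \<zero>\<^bsub>A\<^esub> b = \<zero>\<^bsub>AB\<^esub>"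
 using tens_add_left[of "\<zero>\<^bsub>A\<^esub>" "\<zero>\<^bsub>A\<^esub>" b] assms
 by (metis A.A.l_zero A.A.zero_closed Q.r_zero Q.add.l_cancel Q.zero_closed tens_closed)

lemma tens_zero_right [simp]:
 assumes "a \<in> carrier A" shows "T a \<zero>\<^bsub>B\<^esub> = \<zero>\<^bsub>AB\<^esub>"
 using tens_add_right[of a "\<zero>\<^bsub>B\<^esub>" "\<zero>\<^bsub>B\<^esub>"] assms
 by (metis B.A.l_zero B.A.zero_closed Q.r_zero Q.add.l_cancel Q.zero_closed tens_closed)

lemma tens_minus_left:
 assumes "a \<in> carrier A" "b \<in> carrier B" shows "T (\<ominus>\<^bsub>A\<^esub> a) b = \<ominus>\<^bsub>AB\<^esub> T a b"
 using tens_add_left[of "\<ominus>\<^bsub>A\<^esub> a" a b] assms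
 by (metis A.A.a_inv_closed A.A.l_neg Q.minus_equality tens_closed tens_zero_left)

lemma tens_minus_right:
 assumes "a \<in> carrier A" "b \<in> carrier B" shows "T a (\<ominus>\<^bsub>B\<^esub> b) = \<ominus>\<^bsub>AB\<^esub> T a b"
 using tens_add_right[of a "\<ominus>\<^bsub>B\<^esub> b" b] assms
 by (metis B.A.a_inv_closed B.A.l_neg Q.minus_equality tens_closed tens_zero_right)

text \<open>Formal sums have integer coefficients, yet no case for negatives occurs: the negative of
  a \<otimes> b is (-a) \<otimes> b.\<close>

lemma tens_induct [consumes 1, case_names tens add]:
 assumes "z \<in> carrier AB"
  and tens: "\<And>a b. \<lbrakk>a \<in> carrier A; b \<in> carrier B\<rbrakk> \<Longrightarrow> P (T a b)"
  and add: "\<And>x y. \<lbrakk>x \<in> carrier AB; y \<in> carrier AB; P x; P y\<rbrakk> \<Longrightarrow> P (x \<oplus>\<^bsub>AB\<^esub> y)"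
 shows "P z"
proof -
 obtain f where f: "f \<in> carrier pre" "z = J +>\<^bsub>pre\<^esub> f"
  using assms(1) J.quot_rep unfolding AB_simps by blast
 have "pkeys f \<subseteq> carrier A \<times> carrier B" using f by simp
 \<comment> \<open>The induction on formal sums proceeds by differences, hence P is carried for f
   and -f at once.\<close>
 then have "pkeys f \<subseteq> carrier A \<times> carrier B \<and> P (J +>\<^bsub>pre\<^esub> f) \<and> P (J +>\<^bsub>pre\<^esub> (- f))"
 proof (induction f rule: frag_induction)
  case zero
  have "\<zero>\<^bsub>AB\<^esub> = T \<zero>\<^bsub>A\<^esub> \<zero>\<^bsub>B\<^esub>" by simp
  moreover have "J +>\<^bsub>pre\<^esub> 0 = \<zero>\<^bsub>AB\<^esub>"
   using J.a_rcos_const[OF J.zero_closed] by (simp add: FactRing_def AB_simps)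
  ultimately show ?case using tens[of "\<zero>\<^bsub>A\<^esub>" "\<zero>\<^bsub>B\<^esub>"] by simp
 next
  case (one x)
  then obtain a b where x: "x = (a, b)" "a \<in> carrier A" "b \<in> carrier B" by blast
  have "J +>\<^bsub>pre\<^esub> (- frag_of (a, b)) = \<ominus>\<^bsub>AB\<^esub> T a b"
  proof -
   have "(J +>\<^bsub>pre\<^esub> (- frag_of (a, b))) \<oplus>\<^bsub>AB\<^esub> T a b = J +>\<^bsub>pre\<^esub> 0"
    using x coset_add[of "- frag_of (a, b)" "frag_of (a, b)"] by (simp add: tens_def')
   also have "\<dots> = \<zero>\<^bsub>AB\<^esub>"
    using J.a_rcos_const[OF J.zero_closed] by (simp add: FactRing_def AB_simps)
   finally show ?thesis
    using x coset_closed[of "- frag_of (a, b)"] Q.minus_equality tens_closed[of a b] by simp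
  qed
  then have "J +>\<^bsub>pre\<^esub> (- frag_of (a, b)) = T (\<ominus>\<^bsub>A\<^esub> a) b"
   using x tens_minus_left by simp
  then show ?case using tens[of a b] tens[of "\<ominus>\<^bsub>A\<^esub> a" b] x by (simp add: tens_def')
 next
  case (diff f g)
  then have "f \<in> carrier pre" "g \<in> carrier pre" "- f \<in> carrier pre" "- g \<in> carrier pre"
   by auto
  note c = this[THEN coset_closed]
  have "P ((J +>\<^bsub>pre\<^esub> f) \<oplus>\<^bsub>AB\<^esub> (J +>\<^bsub>pre\<^esub> (- g)))" "P ((J +>\<^bsub>pre\<^esub> (- f)) \<oplus>\<^bsub>AB\<^esub> (J +>\<^bsub>pre\<^esub> g))"
   using diff by (blast intro: add c)+
  then show ?case
   using diff coset_add[of f "- g"] coset_add[of "- f" g] keys_diff2[of f _ g] by simp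
 qed
 then show ?thesis using f by simp
qed

lemma unital_algebra_AB: "unital_algebra R AB"
proof unfold_locales
 show "unit_map AB \<in> ring_hom R AB"
 proof (rule ring_hom_memI)
  fix x y assume xy: "x \<in> carrier R" "y \<in> carrier R"
  show "unit_map AB (x \<otimes>\<^bsub>R\<^esub> y) = unit_map AB x \<otimes>\<^bsub>AB\<^esub> unit_map AB y"
   using xy tens_mult[of "unit_map A x" "unit_map A y" "\<one>\<^bsub>B\<^esub>" "\<one>\<^bsub>B\<^esub>"]
   by (simp add: A.unit_mult AB_simps(6))
  show "unit_map AB (x \<oplus>\<^bsub>R\<^esub> y) = unit_map AB x \<oplus>\<^bsub>AB\<^esub> unit_map AB y"
   using xy tens_add_left by (simp add: A.unit_add AB_simps(6))
 next
  show "unit_map AB \<one>\<^bsub>R\<^esub> = \<one>\<^bsub>AB\<^esub>" unfolding tens_one by (simp add: AB_simps(6))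
 next
  fix x assume "x \<in> carrier R"
  then show "unit_map AB x \<in> carrier AB" unfolding AB_simps(6) by (intro tens_closed) auto
 qed
next
 fix r z assume r: "r \<in> carrier R" and "z \<in> carrier AB"
 from this(2) show "unit_map AB r \<otimes>\<^bsub>AB\<^esub> z = z \<otimes>\<^bsub>AB\<^esub> unit_map AB r"
  unfolding AB_simps(6)
 proof (induction z rule: tens_induct)
  case (tens a b)
  then show ?case using r A.unit_map_central by (subst (1 2) tens_mult) auto
 next
  case (add x y)
  then show ?case using r by (simp only: Q.l_distr Q.r_distr tens_closed A.unit_closed B.A.one_closed)
 qed
qed

end

locale balanced_map = two_algebras R A B + C: abelian_group C
 for R :: "('r, 'm) ring_scheme" and A :: "('a, 'r) ralg" and B :: "('b, 'r) ralg"
  and C :: "('c, 'n) ring_scheme" +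
 fixes \<phi> :: "'a \<Rightarrow> 'b \<Rightarrow> 'c"
 assumes phi_closed: "\<lbrakk>a \<in> carrier A; b \<in> carrier B\<rbrakk> \<Longrightarrow> \<phi> a b \<in> carrier C"
  and phi_add_left: "\<lbrakk>a \<in> carrier A; a' \<in> carrier A; b \<in> carrier B\<rbrakk> \<Longrightarrow>
   \<phi> (a \<oplus>\<^bsub>A\<^esub> a') b = \<phi> a b \<oplus>\<^bsub>C\<^esub> \<phi> a' b"
  and phi_add_right: "\<lbrakk>a \<in> carrier A; b \<in> carrier B; b' \<in> carrier B\<rbrakk> \<Longrightarrow>
   \<phi> a (b \<oplus>\<^bsub>B\<^esub> b') = \<phi> a b \<oplus>\<^bsub>C\<^esub> \<phi> a b'"
  and phi_balanced: "\<lbrakk>r \<in> carrier R; a \<in> carrier A; b \<in> carrier B\<rbrakk> \<Longrightarrow>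
   \<phi> (unit_map A r \<otimes>\<^bsub>A\<^esub> a) b = \<phi> a (unit_map B r \<otimes>\<^bsub>B\<^esub> b)"
begin

definition hat :: "('a \<times> 'b \<Rightarrow>\<^sub>0 int) \<Rightarrow> 'c" where
 "hat = pm_hom C (\<lambda>ab n. add_pow C n (\<phi> (fst ab) (snd ab)))"

sublocale F: additive_family C "carrier A \<times> carrier B" "\<lambda>ab (n::int). add_pow C n (\<phi> (fst ab) (snd ab))"
 by unfold_locales (auto simp: phi_closed C.add.int_pow_mult)

lemma hat_add: "\<lbrakk>f \<in> carrier pre; g \<in> carrier pre\<rbrakk> \<Longrightarrow> hat (f + g) = hat f \<oplus>\<^bsub>C\<^esub> hat g"
 by (simp add: hat_def F.pm_add)

lemma hat_diff: "\<lbrakk>f \<in> carrier pre; g \<in> carrier pre\<rbrakk> \<Longrightarrow> hat (f - g) = hat f \<ominus>\<^bsub>C\<^esub> hat g"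
 by (simp add: hat_def F.pm_diff)

lemma hat_closed: "f \<in> carrier pre \<Longrightarrow> hat f \<in> carrier C"
 by (simp add: hat_def F.pm_closed)

lemma hat_frag: "\<lbrakk>a \<in> carrier A; b \<in> carrier B\<rbrakk> \<Longrightarrow> hat (frag_of (a, b)) = \<phi> a b"
 by (simp add: hat_def F.pm_single phi_closed)

text \<open>The subgroup of those formal sums all of whose two-sided multiples by pairs vanish under
 the additive extension is an ideal, so it is enough to check the relations themselves.\<close>

definition null :: "('a \<times> 'b \<Rightarrow>\<^sub>0 int) set" where
 "null = {f \<in> carrier pre. \<forall>u\<in>carrier A \<times> carrier B. \<forall>v\<in>carrier A \<times> carrier B.
   hat (frag_of u \<otimes>\<^bsub>pre\<^esub> f \<otimes>\<^bsub>pre\<^esub> frag_of v) = \<zero>\<^bsub>C\<^esub>}"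

lemma nullD: "\<lbrakk>f \<in> null; u \<in> carrier A \<times> carrier B; v \<in> carrier A \<times> carrier B\<rbrakk> \<Longrightarrow>
  hat (frag_of u \<otimes>\<^bsub>pre\<^esub> f \<otimes>\<^bsub>pre\<^esub> frag_of v) = \<zero>\<^bsub>C\<^esub>"
 unfolding null_def by blast

lemma frag_pre: "u \<in> carrier A \<times> carrier B \<Longrightarrow> frag_of u \<in> carrier pre"
 by simp

text \<open>Membership in \<open>null\<close> only speaks of pairs as outer factors. By additivity
  one of the two may become an arbitrary formal sum, which is what closure under multiplication asks
  for.\<close>

lemma hat_mult_null:
 assumes "f \<in> null" "g \<in> carrier pre" "u \<in> carrier A \<times> carrier B"
 shows "hat (g \<otimes>\<^bsub>pre\<^esub> f \<otimes>\<^bsub>pre\<^esub> frag_of u) = \<zero>\<^bsub>C\<^esub>" "hat (frag_of u \<otimes>\<^bsub>pre\<^esub> f \<otimes>\<^bsub>pre\<^esub> g) = \<zero>\<^bsub>C\<^esub>"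
proof -
 have f: "f \<in> carrier pre" using assms by (simp add: null_def)
 note c = P.m_closed frag_pre f assms(3)
 have "pkeys g \<subseteq> carrier A \<times> carrier B" using assms by simp
 then have "g \<in> carrier pre \<and> hat (g \<otimes>\<^bsub>pre\<^esub> f \<otimes>\<^bsub>pre\<^esub> frag_of u) = \<zero>\<^bsub>C\<^esub> \<and> hat (frag_of u \<otimes>\<^bsub>pre\<^esub> f \<otimes>\<^bsub>pre\<^esub> g) = \<zero>\<^bsub>C\<^esub>"
 proof (induction g rule: frag_induction)
  case zero
  then show ?case by (simp add: hat_def F.pm_zero)
 next
  case (one x)
  then show ?case using nullD[OF assms(1)] assms(3) frag_pre by blast
 next
  case (diff a b)
  then have ab: "a \<in> carrier pre" "b \<in> carrier pre" by auto
  have "hat ((a - b) \<otimes>\<^bsub>pre\<^esub> f \<otimes>\<^bsub>pre\<^esub> frag_of u) = hat (a \<otimes>\<^bsub>pre\<^esub> f \<otimes>\<^bsub>pre\<^esub> frag_of u) \<ominus>\<^bsub>C\<^esub> hat (b \<otimes>\<^bsub>pre\<^esub> f \<otimes>\<^bsub>pre\<^esub> frag_of u)"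
   using hat_diff[OF P.m_closed[OF P.m_closed[OF ab(1) f] frag_pre[OF assms(3)]] P.m_closed[OF P.m_closed[OF ab(2) f] frag_pre[OF assms(3)]]]
   by (simp add: mr_mult_diff_left)
  moreover have "hat (frag_of u \<otimes>\<^bsub>pre\<^esub> f \<otimes>\<^bsub>pre\<^esub> (a - b)) = hat (frag_of u \<otimes>\<^bsub>pre\<^esub> f \<otimes>\<^bsub>pre\<^esub> a) \<ominus>\<^bsub>C\<^esub> hat (frag_of u \<otimes>\<^bsub>pre\<^esub> f \<otimes>\<^bsub>pre\<^esub> b)"
   using hat_diff[OF P.m_closed[OF P.m_closed[OF frag_pre[OF assms(3)] f] ab(1)] P.m_closed[OF P.m_closed[OF frag_pre[OF assms(3)] f] ab(2)]]
   by (simp add: mr_mult_diff_right)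
  moreover have "a - b \<in> carrier pre" using ab by (rule pre_diff)
  ultimately show ?case using diff by (simp add: a_minus_def)
 qed
 then show "hat (g \<otimes>\<^bsub>pre\<^esub> f \<otimes>\<^bsub>pre\<^esub> frag_of u) = \<zero>\<^bsub>C\<^esub>" "hat (frag_of u \<otimes>\<^bsub>pre\<^esub> f \<otimes>\<^bsub>pre\<^esub> g) = \<zero>\<^bsub>C\<^esub>"
  by blast+
qed

lemma ideal_null: "ideal null pre"
proof (rule idealI)
 show "subgroup null (add_monoid pre)"
 proof (rule P.add.subgroupI)
  show "null \<subseteq> carrier pre" by (auto simp: null_def)
  have "0 \<in> null" by (simp add: null_def hat_def F.pm_zero)
  then show "null \<noteq> {}" by blast
 next
  fix f assume f: "f \<in> null"
  then have c: "f \<in> carrier pre" by (simp add: null_def)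
  have "hat (frag_of u \<otimes>\<^bsub>pre\<^esub> (\<ominus>\<^bsub>pre\<^esub> f) \<otimes>\<^bsub>pre\<^esub> frag_of v) = \<zero>\<^bsub>C\<^esub>"
   if "u \<in> carrier A \<times> carrier B" "v \<in> carrier A \<times> carrier B" for u v
   using F.pm_uminus[of "frag_of u \<otimes>\<^bsub>pre\<^esub> f \<otimes>\<^bsub>pre\<^esub> frag_of v"]
    P.m_closed[OF P.m_closed[OF frag_pre[OF that(1)] c] frag_pre[OF that(2)]]
    nullD[OF f that]
   by (simp add: pre_minus[OF c] mr_mult_uminus_left mr_mult_uminus_right hat_def)
  then show "\<ominus>\<^bsub>pre\<^esub> f \<in> null"
   using P.a_inv_closed[OF c] unfolding null_def by blast
 next
  fix f g assume fg: "f \<in> null" "g \<in> null"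
  then have c: "f \<in> carrier pre" "g \<in> carrier pre" by (auto simp: null_def)
  have "hat (frag_of u \<otimes>\<^bsub>pre\<^esub> (f \<oplus>\<^bsub>pre\<^esub> g) \<otimes>\<^bsub>pre\<^esub> frag_of v) = \<zero>\<^bsub>C\<^esub>"
   if "u \<in> carrier A \<times> carrier B" "v \<in> carrier A \<times> carrier B" for u v
   using hat_add[OF P.m_closed[OF P.m_closed[OF frag_pre[OF that(1)] c(1)] frag_pre[OF that(2)]]
     P.m_closed[OF P.m_closed[OF frag_pre[OF that(1)] c(2)] frag_pre[OF that(2)]]]
    nullD[OF fg(1) that] nullD[OF fg(2) that]
   by (simp add: mr_mult_add_left mr_mult_add_right)
  then show "f \<oplus>\<^bsub>pre\<^esub> g \<in> null"
   using P.a_closed[OF c] unfolding null_def by blast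
 qed
next
 fix f g assume fg: "f \<in> null" "g \<in> carrier pre"
 then have f: "f \<in> carrier pre" by (simp add: null_def)
 have "hat (frag_of u \<otimes>\<^bsub>pre\<^esub> (g \<otimes>\<^bsub>pre\<^esub> f) \<otimes>\<^bsub>pre\<^esub> frag_of v) = \<zero>\<^bsub>C\<^esub>"
  if "u \<in> carrier A \<times> carrier B" "v \<in> carrier A \<times> carrier B" for u v
 proof -
  have "frag_of u \<otimes>\<^bsub>pre\<^esub> (g \<otimes>\<^bsub>pre\<^esub> f) = (frag_of u \<otimes>\<^bsub>pre\<^esub> g) \<otimes>\<^bsub>pre\<^esub> f"
   using P.m_assoc[OF frag_pre[OF that(1)] fg(2) f] by simp
  then show ?thesis
   using hat_mult_null(1)[OF fg(1) P.m_closed[OF frag_pre[OF that(1)] fg(2)] that(2)] by simp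
 qed
 then show "g \<otimes>\<^bsub>pre\<^esub> f \<in> null"
  unfolding null_def using P.m_closed[OF fg(2) f] by blast
 have "hat (frag_of u \<otimes>\<^bsub>pre\<^esub> (f \<otimes>\<^bsub>pre\<^esub> g) \<otimes>\<^bsub>pre\<^esub> frag_of v) = \<zero>\<^bsub>C\<^esub>"
  if "u \<in> carrier A \<times> carrier B" "v \<in> carrier A \<times> carrier B" for u v
 proof -
  have "frag_of u \<otimes>\<^bsub>pre\<^esub> (f \<otimes>\<^bsub>pre\<^esub> g) \<otimes>\<^bsub>pre\<^esub> frag_of v = frag_of u \<otimes>\<^bsub>pre\<^esub> f \<otimes>\<^bsub>pre\<^esub> (g \<otimes>\<^bsub>pre\<^esub> frag_of v)"
   using that fg(2) f frag_pre by (metis P.m_assoc P.m_closed)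
  then show ?thesis
   using hat_mult_null(2)[OF fg(1) P.m_closed[OF fg(2) frag_pre[OF that(2)]] that(1)] by simp
 qed
 then show "f \<otimes>\<^bsub>pre\<^esub> g \<in> null"
  unfolding null_def using P.m_closed[OF f fg(2)] by blast
qed (rule P.ring_axioms)

text \<open>A relation multiplied by pairs on both sides is again a relation of the same family, and
  a balanced biadditive map respects it. For the third family the scalar has to be moved to the
  front, by centrality of the unit maps.\<close>

lemma rels_null: "tensor_rels R A B \<subseteq> null"
proof
 fix f assume f: "f \<in> tensor_rels R A B"
 have k: "\<lbrakk>x \<in> carrier A; y \<in> carrier B\<rbrakk> \<Longrightarrow> frag_of (x, y) \<in> carrier pre" for x y by simp
 have d: "\<lbrakk>x \<in> carrier pre; y \<in> carrier pre\<rbrakk> \<Longrightarrow> x - y \<in> carrier pre" for x y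
  by (rule pre_diff)
 have "hat (frag_of u \<otimes>\<^bsub>pre\<^esub> f \<otimes>\<^bsub>pre\<^esub> frag_of v) = \<zero>\<^bsub>C\<^esub>"
  if uv_in: "u \<in> carrier A \<times> carrier B" "v \<in> carrier A \<times> carrier B" for u v
 proof -
  obtain a0 b0 a1 b1 where uv: "u = (a0, b0)" "v = (a1, b1)"
   and c: "a0 \<in> carrier A" "a1 \<in> carrier A" "b0 \<in> carrier B" "b1 \<in> carrier B"
   using uv_in by blast
  from f consider
   (1) a a' b where "f = frag_of (a \<oplus>\<^bsub>A\<^esub> a', b) - frag_of (a, b) - frag_of (a', b)"
    "a \<in> carrier A" "a' \<in> carrier A" "b \<in> carrier B"
   | (2) a b b' where "f = frag_of (a, b \<oplus>\<^bsub>B\<^esub> b') - frag_of (a, b) - frag_of (a, b')"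
    "a \<in> carrier A" "b \<in> carrier B" "b' \<in> carrier B"
   | (3) r a b where "f = frag_of (unit_map A r \<otimes>\<^bsub>A\<^esub> a, b) - frag_of (a, unit_map B r \<otimes>\<^bsub>B\<^esub> b)"
    "r \<in> carrier R" "a \<in> carrier A" "b \<in> carrier B"
   unfolding tensor_rels_def by blast
  then show ?thesis
  proof cases
   case 1
   have "hat (frag_of u \<otimes>\<^bsub>pre\<^esub> f \<otimes>\<^bsub>pre\<^esub> frag_of v)
    = \<phi> (a0 \<otimes>\<^bsub>A\<^esub> (a \<oplus>\<^bsub>A\<^esub> a') \<otimes>\<^bsub>A\<^esub> a1) (b0 \<otimes>\<^bsub>B\<^esub> b \<otimes>\<^bsub>B\<^esub> b1) \<ominus>\<^bsub>C\<^esub> \<phi> (a0 \<otimes>\<^bsub>A\<^esub> a \<otimes>\<^bsub>A\<^esub> a1) (b0 \<otimes>\<^bsub>B\<^esub> b \<otimes>\<^bsub>B\<^esub> b1)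
     \<ominus>\<^bsub>C\<^esub> \<phi> (a0 \<otimes>\<^bsub>A\<^esub> a' \<otimes>\<^bsub>A\<^esub> a1) (b0 \<otimes>\<^bsub>B\<^esub> b \<otimes>\<^bsub>B\<^esub> b1)"
    unfolding uv 1(1) pre_simps mr_mult_diff_left mr_mult_diff_right frag_mult
    using 1 c by (subst hat_diff hat_frag; (intro d k)?; simp)+
   then show ?thesis
    using 1 c by (simp add: A.A.l_distr A.A.r_distr phi_add_left phi_closed C.minus_add a_minus_def C.add.m_ac C.r_neg C.r_neg1 C.r_neg2)
  next
   case 2
   have "hat (frag_of u \<otimes>\<^bsub>pre\<^esub> f \<otimes>\<^bsub>pre\<^esub> frag_of v)
    = \<phi> (a0 \<otimes>\<^bsub>A\<^esub> a \<otimes>\<^bsub>A\<^esub> a1) (b0 \<otimes>\<^bsub>B\<^esub> (b \<oplus>\<^bsub>B\<^esub> b') \<otimes>\<^bsub>B\<^esub> b1) \<ominus>\<^bsub>C\<^esub> \<phi> (a0 \<otimes>\<^bsub>A\<^esub> a \<otimes>\<^bsub>A\<^esub> a1) (b0 \<otimes>\<^bsub>B\<^esub> b \<otimes>\<^bsub>B\<^esub> b1)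
     \<ominus>\<^bsub>C\<^esub> \<phi> (a0 \<otimes>\<^bsub>A\<^esub> a \<otimes>\<^bsub>A\<^esub> a1) (b0 \<otimes>\<^bsub>B\<^esub> b' \<otimes>\<^bsub>B\<^esub> b1)"
    unfolding uv 2(1) pre_simps mr_mult_diff_left mr_mult_diff_right frag_mult
    using 2 c by (subst hat_diff hat_frag; (intro d k)?; simp)+
   then show ?thesis
    using 2 c by (simp add: B.A.l_distr B.A.r_distr phi_add_right phi_closed C.minus_add a_minus_def C.add.m_ac C.r_neg C.r_neg1 C.r_neg2)
  next
   case 3
   have "hat (frag_of u \<otimes>\<^bsub>pre\<^esub> f \<otimes>\<^bsub>pre\<^esub> frag_of v)
    = \<phi> (a0 \<otimes>\<^bsub>A\<^esub> (unit_map A r \<otimes>\<^bsub>A\<^esub> a) \<otimes>\<^bsub>A\<^esub> a1) (b0 \<otimes>\<^bsub>B\<^esub> b \<otimes>\<^bsub>B\<^esub> b1)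
     \<ominus>\<^bsub>C\<^esub> \<phi> (a0 \<otimes>\<^bsub>A\<^esub> a \<otimes>\<^bsub>A\<^esub> a1) (b0 \<otimes>\<^bsub>B\<^esub> (unit_map B r \<otimes>\<^bsub>B\<^esub> b) \<otimes>\<^bsub>B\<^esub> b1)"
    unfolding uv 3(1) pre_simps mr_mult_diff_left mr_mult_diff_right frag_mult
    using 3 c by (subst hat_diff hat_frag; (intro d k)?; simp)+
   then show ?thesis
    using 3 c by (simp add: A.unit_left_commute B.unit_left_commute A.A.m_assoc B.A.m_assoc phi_balanced phi_closed a_minus_def C.r_neg)
  qed
 qed
 then show "f \<in> null" using f rels_closed by (auto simp: null_def)
qed

lemma hat_J: assumes "f \<in> J" shows "hat f = \<zero>\<^bsub>C\<^esub>"
proof -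
 have f: "f \<in> null"
  using P.genideal_minimal[OF ideal_null rels_null] assms unfolding tensor_ideal_def by blast
 then have "f \<in> carrier pre" by (simp add: null_def)
 then have "frag_of (\<one>\<^bsub>A\<^esub>, \<one>\<^bsub>B\<^esub>) \<otimes>\<^bsub>pre\<^esub> f \<otimes>\<^bsub>pre\<^esub> frag_of (\<one>\<^bsub>A\<^esub>, \<one>\<^bsub>B\<^esub>) = f"
  using P.l_one P.r_one by simp
 then show ?thesis
  using nullD[OF f, of "(\<one>\<^bsub>A\<^esub>, \<one>\<^bsub>B\<^esub>)" "(\<one>\<^bsub>A\<^esub>, \<one>\<^bsub>B\<^esub>)"] by simp
qed

abbreviation "lft \<equiv> tensor_lift C \<phi>"

lemma lift_coset:
 assumes "f \<in> carrier pre" shows "lft (J +>\<^bsub>pre\<^esub> f) = hat f"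
proof -
 have "hat g = hat f" if g: "g \<in> J +>\<^bsub>pre\<^esub> f" for g
 proof -
  obtain i where i: "i \<in> J" "g = i + f"
   using g by (auto simp: a_r_coset_def r_coset_def)
  then show ?thesis
   using hat_add[of i f] hat_J[of i] J.a_Hcarr[of i] assms hat_closed by simp
 qed
 moreover have "f \<in> J +>\<^bsub>pre\<^esub> f" using J.a_rcos_self assms by blast
 ultimately have "hat ` (J +>\<^bsub>pre\<^esub> f) = {hat f}" by blast
 moreover have "hat = (\<lambda>f. \<Oplus>\<^bsub>C\<^esub>ab\<in>pkeys f. add_pow C (plookup f ab) (\<phi> (fst ab) (snd ab)))"
  by (rule ext) (simp add: hat_def pm_hom_def)
 ultimately show ?thesis
  unfolding tensor_lift_def by simp
qed

lemma lift_tens: "\<lbrakk>a \<in> carrier A; b \<in> carrier B\<rbrakk> \<Longrightarrow> lft (T a b) = \<phi> a b"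
 unfolding tens_def' by (simp add: lift_coset hat_frag)

lemma lift_add: "\<lbrakk>x \<in> carrier AB; y \<in> carrier AB\<rbrakk> \<Longrightarrow> lft (x \<oplus>\<^bsub>AB\<^esub> y) = lft x \<oplus>\<^bsub>C\<^esub> lft y"
 unfolding AB_simps(1)
 by (elim J.quot_rep) (simp only: coset_add lift_coset P.a_closed[simplified] hat_add pre_simps mem_Collect_eq)

lemma lift_closed: "x \<in> carrier AB \<Longrightarrow> lft x \<in> carrier C"
 unfolding AB_simps(1) by (elim J.quot_rep) (simp only: lift_coset hat_closed)

end

lemma (in balanced_map) lift_ring_hom:
 assumes "ring C" and "\<phi> \<one>\<^bsub>A\<^esub> \<one>\<^bsub>B\<^esub> = \<one>\<^bsub>C\<^esub>"
  and mult: "\<And>a b a' b'. \<lbrakk>a \<in> carrier A; b \<in> carrier B; a' \<in> carrier A; b' \<in> carrier B\<rbrakk> \<Longrightarrow>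
   \<phi> (a \<otimes>\<^bsub>A\<^esub> a') (b \<otimes>\<^bsub>B\<^esub> b') = \<phi> a b \<otimes>\<^bsub>C\<^esub> \<phi> a' b'"
 shows "lft \<in> ring_hom AB C"
proof (rule ring_hom_memI)
 interpret C: ring C by fact
 show "lft \<one>\<^bsub>AB\<^esub> = \<one>\<^bsub>C\<^esub>" unfolding tens_one by (simp only: lift_tens A.A.one_closed B.A.one_closed assms)
 fix x y assume x: "x \<in> carrier AB" and y: "y \<in> carrier AB"
 from x show "lft (x \<otimes>\<^bsub>AB\<^esub> y) = lft x \<otimes>\<^bsub>C\<^esub> lft y"
 proof (induction x rule: tens_induct)
  case (tens a b)
  from y show ?case
  proof (induction y rule: tens_induct)
   case (tens a' b')
   with \<open>a \<in> carrier A\<close> \<open>b \<in> carrier B\<close> show ?case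
    by (simp only: tens_mult lift_tens mult A.A.m_closed B.A.m_closed)
  next
   case (add z w)
   with \<open>a \<in> carrier A\<close> \<open>b \<in> carrier B\<close> show ?case
    by (simp only: Q.r_distr C.r_distr lift_add lift_closed Q.m_closed tens_closed)
  qed
 next
  case (add z w)
  with y show ?case by (simp only: Q.l_distr C.l_distr lift_add lift_closed Q.m_closed)
 qed
qed (simp_all only: lift_add lift_closed)

section \<open>Linear maps and maps between tensor products\<close>

definition alg_linear :: "('r, 'm) ring_scheme \<Rightarrow> ('a, 'r) ralg \<Rightarrow> ('c, 'r) ralg \<Rightarrow> ('a \<Rightarrow> 'c) \<Rightarrow> bool" where
 "alg_linear R A C f \<longleftrightarrow> (\<forall>a\<in>carrier A. f a \<in> carrier C) \<and>
  (\<forall>a\<in>carrier A. \<forall>b\<in>carrier A. f (a \<oplus>\<^bsub>A\<^esub> b) = f a \<oplus>\<^bsub>C\<^esub> f b) \<and>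
  (\<forall>r\<in>carrier R. \<forall>a\<in>carrier A. f (unit_map A r \<otimes>\<^bsub>A\<^esub> a) = unit_map C r \<otimes>\<^bsub>C\<^esub> f a)"

lemma alg_linearD:
 assumes "alg_linear R A C f"
 shows "a \<in> carrier A \<Longrightarrow> f a \<in> carrier C"
  "\<lbrakk>a \<in> carrier A; b \<in> carrier A\<rbrakk> \<Longrightarrow> f (a \<oplus>\<^bsub>A\<^esub> b) = f a \<oplus>\<^bsub>C\<^esub> f b"
  "\<lbrakk>r \<in> carrier R; a \<in> carrier A\<rbrakk> \<Longrightarrow> f (unit_map A r \<otimes>\<^bsub>A\<^esub> a) = unit_map C r \<otimes>\<^bsub>C\<^esub> f a"
 using assms unfolding alg_linear_def by blast+

lemma alg_linear_hom:
 assumes "unital_algebra R A" "f \<in> ring_hom A C" "\<And>r. r \<in> carrier R \<Longrightarrow> f (unit_map A r) = unit_map C r"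
 shows "alg_linear R A C f"
proof -
 interpret unital_algebra R A by fact
 show ?thesis
  unfolding alg_linear_def
  using assms(3) ring_hom_closed[OF assms(2)] ring_hom_add[OF assms(2)] ring_hom_mult[OF assms(2)] by auto
qed

lemma alg_linear_id: "alg_linear R A A id"
 by (simp add: alg_linear_def)

lemma two_algebrasI: "unital_algebra R A \<Longrightarrow> unital_algebra R B \<Longrightarrow> two_algebras R A B"
 by (simp add: two_algebras_def)

lemma balanced_map_tensor_map:
 assumes "two_algebras R A B" "two_algebras R C D" "alg_linear R A C f" "alg_linear R B D g"
 shows "balanced_map R A B (tensor_alg R C D) (\<lambda>a b. tens R C D (f a) (g b))"
proof -
 interpret X: two_algebras R A B by fact
 interpret Y: two_algebras R C D by fact
 show ?thesis
  by unfold_locales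
   (simp_all add: alg_linearD[OF assms(3)] alg_linearD[OF assms(4)]
    Y.tens_add_left Y.tens_add_right Y.tens_balanced)
qed

lemma tensor_map_tens:
 assumes "two_algebras R A B" "two_algebras R C D" "alg_linear R A C f" "alg_linear R B D g"
  and "a \<in> carrier A" "b \<in> carrier B"
 shows "tensor_map R C D f g (tens R A B a b) = tens R C D (f a) (g b)"
proof -
 interpret balanced_map R A B "tensor_alg R C D" "\<lambda>a b. tens R C D (f a) (g b)"
  by (rule balanced_map_tensor_map) fact+
 show ?thesis unfolding tensor_map_def using assms by (simp add: lift_tens)
qed

lemma tensor_map_add:
 assumes "two_algebras R A B" "two_algebras R C D" "alg_linear R A C f" "alg_linear R B D g"
  and "x \<in> carrier (tensor_alg R A B)" "y \<in> carrier (tensor_alg R A B)"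
 shows "tensor_map R C D f g (x \<oplus>\<^bsub>tensor_alg R A B\<^esub> y) =
  tensor_map R C D f g x \<oplus>\<^bsub>tensor_alg R C D\<^esub> tensor_map R C D f g y"
proof -
 interpret balanced_map R A B "tensor_alg R C D" "\<lambda>a b. tens R C D (f a) (g b)"
  by (rule balanced_map_tensor_map) fact+
 show ?thesis unfolding tensor_map_def using assms by (simp add: lift_add)
qed

lemma tensor_map_closed:
 assumes "two_algebras R A B" "two_algebras R C D" "alg_linear R A C f" "alg_linear R B D g"
  and "x \<in> carrier (tensor_alg R A B)"
 shows "tensor_map R C D f g x \<in> carrier (tensor_alg R C D)"
proof -
 interpret balanced_map R A B "tensor_alg R C D" "\<lambda>a b. tens R C D (f a) (g b)"
  by (rule balanced_map_tensor_map) fact+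
 show ?thesis unfolding tensor_map_def using assms by (simp add: lift_closed)
qed

lemma tensor_map_hom:
 assumes "two_algebras R A B" "two_algebras R C D" "alg_linear R A C f" "alg_linear R B D g"
  and "f \<in> ring_hom A C" "g \<in> ring_hom B D"
 shows "tensor_map R C D f g \<in> ring_hom (tensor_alg R A B) (tensor_alg R C D)"
proof -
 interpret Y: two_algebras R C D by fact
 interpret balanced_map R A B "tensor_alg R C D" "\<lambda>a b. tens R C D (f a) (g b)"
  by (rule balanced_map_tensor_map) fact+
 show ?thesis unfolding tensor_map_def
  by (rule lift_ring_hom)
   (simp_all add: Y.tens_one Y.tens_mult Y.Q.ring_axioms ring_hom_one[OF assms(5)] ring_hom_one[OF assms(6)]
    ring_hom_mult[OF assms(5)] ring_hom_mult[OF assms(6)] ring_hom_closed[OF assms(5)] ring_hom_closed[OF assms(6)])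
qed

lemma (in two_algebras) balanced_map_flip: "balanced_map R A B (tensor_alg R B A) (\<lambda>a b. tens R B A b a)"
proof -
 interpret Y: two_algebras R B A by unfold_locales
 show ?thesis
  by unfold_locales (simp_all add: Y.tens_add_left Y.tens_add_right Y.tens_balanced)
qed

lemma (in two_algebras) tensor_flip_tens:
 "\<lbrakk>a \<in> carrier A; b \<in> carrier B\<rbrakk> \<Longrightarrow> tensor_flip R A B (T a b) = tens R B A b a"
proof -
 interpret F: balanced_map R A B "tensor_alg R B A" "\<lambda>a b. tens R B A b a" by (rule balanced_map_flip)
 show "\<lbrakk>a \<in> carrier A; b \<in> carrier B\<rbrakk> \<Longrightarrow> tensor_flip R A B (T a b) = tens R B A b a"
  unfolding tensor_flip_def by (simp add: F.lift_tens)
qed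

lemma (in two_algebras) tensor_flip_add:
 "\<lbrakk>x \<in> carrier AB; y \<in> carrier AB\<rbrakk> \<Longrightarrow>
  tensor_flip R A B (x \<oplus>\<^bsub>AB\<^esub> y) = tensor_flip R A B x \<oplus>\<^bsub>tensor_alg R B A\<^esub> tensor_flip R A B y"
proof -
 interpret F: balanced_map R A B "tensor_alg R B A" "\<lambda>a b. tens R B A b a" by (rule balanced_map_flip)
 show "\<lbrakk>x \<in> carrier AB; y \<in> carrier AB\<rbrakk> \<Longrightarrow>
  tensor_flip R A B (x \<oplus>\<^bsub>AB\<^esub> y) = tensor_flip R A B x \<oplus>\<^bsub>tensor_alg R B A\<^esub> tensor_flip R A B y"
  unfolding tensor_flip_def by (simp add: F.lift_add)
qed

locale three_algebras = AB: two_algebras R A B + BC: two_algebras R B C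
 for R :: "('r, 'm) ring_scheme" and A :: "('a, 'r) ralg" and B :: "('b, 'r) ralg" and C :: "('c, 'r) ralg"
begin

abbreviation "BC \<equiv> tensor_alg R B C"
abbreviation "ABC \<equiv> tensor_alg R A BC"

sublocale X: two_algebras R A BC
 by (rule two_algebrasI[OF AB.A.unital_algebra_axioms BC.unital_algebra_AB])

sublocale Y: two_algebras R AB.AB C
 by (rule two_algebrasI[OF AB.unital_algebra_AB BC.B.unital_algebra_axioms])

lemma balanced_inner:
 assumes "c \<in> carrier C"
 shows "balanced_map R A B ABC (\<lambda>a b. X.T a (BC.T b c))"
proof unfold_locales
 fix r a b assume "r \<in> carrier R" "a \<in> carrier A" "b \<in> carrier B"
 then show "X.T (unit_map A r \<otimes>\<^bsub>A\<^esub> a) (BC.T b c) = X.T a (BC.T (unit_map B r \<otimes>\<^bsub>B\<^esub> b) c)"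
  using assms by (simp add: X.tens_balanced BC.AB_simps(6) BC.tens_mult)
qed (use assms in \<open>simp_all add: X.tens_add_left X.tens_add_right BC.tens_add_left\<close>)

text \<open>The associativity map is a lift inside a lift. Here the third factor is held fixed; that
  the result is balanced in that factor too is the content of \<open>balanced_outer\<close>.\<close>

definition inner :: "('a \<times> 'b \<Rightarrow>\<^sub>0 int) set \<Rightarrow> 'c \<Rightarrow> ('a \<times> ('b \<times> 'c \<Rightarrow>\<^sub>0 int) set \<Rightarrow>\<^sub>0 int) set" where
 "inner x c = tensor_lift ABC (\<lambda>a b. X.T a (BC.T b c)) x"

lemma inner_tens: "\<lbrakk>a \<in> carrier A; b \<in> carrier B; c \<in> carrier C\<rbrakk> \<Longrightarrow> inner (AB.T a b) c = X.T a (BC.T b c)"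
 unfolding inner_def by (rule balanced_map.lift_tens[OF balanced_inner])

lemma inner_add: "\<lbrakk>x \<in> carrier AB.AB; y \<in> carrier AB.AB; c \<in> carrier C\<rbrakk> \<Longrightarrow>
  inner (x \<oplus>\<^bsub>AB.AB\<^esub> y) c = inner x c \<oplus>\<^bsub>ABC\<^esub> inner y c"
 unfolding inner_def by (rule balanced_map.lift_add[OF balanced_inner])

lemma inner_closed: "\<lbrakk>x \<in> carrier AB.AB; c \<in> carrier C\<rbrakk> \<Longrightarrow> inner x c \<in> carrier ABC"
 unfolding inner_def by (rule balanced_map.lift_closed[OF balanced_inner])

lemma tensor_assoc_eq: "tensor_assoc R A B C = tensor_lift ABC inner"
 unfolding tensor_assoc_def inner_def Let_def ..

lemma balanced_outer: "balanced_map R AB.AB C ABC inner"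
proof unfold_locales
 fix x c assume "x \<in> carrier AB.AB" "c \<in> carrier C"
 then show "inner x c \<in> carrier ABC" by (rule inner_closed)
next
 fix x c c' assume x: "x \<in> carrier AB.AB" and c: "c \<in> carrier C" "c' \<in> carrier C"
 from x show "inner x (c \<oplus>\<^bsub>C\<^esub> c') = inner x c \<oplus>\<^bsub>ABC\<^esub> inner x c'"
 proof (induction x rule: AB.tens_induct)
  case (tens a b)
  then show ?case using c by (simp add: inner_tens BC.tens_add_right X.tens_add_right)
 next
  case (add x y)
  then show ?case using c by (simp add: inner_add inner_closed X.Q.a_ac)
 qed
next
 fix r x c assume r: "r \<in> carrier R" and x: "x \<in> carrier AB.AB" and c: "c \<in> carrier C"
 have u: "unit_map AB.AB r \<in> carrier AB.AB" using r by (simp add: AB.AB_simps(6))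
 from x show "inner (unit_map AB.AB r \<otimes>\<^bsub>AB.AB\<^esub> x) c = inner x (unit_map C r \<otimes>\<^bsub>C\<^esub> c)"
 proof (induction x rule: AB.tens_induct)
  case (tens a b)
  then have "unit_map AB.AB r \<otimes>\<^bsub>AB.AB\<^esub> AB.T a b = AB.T (unit_map A r \<otimes>\<^bsub>A\<^esub> a) b"
   using r by (simp add: AB.AB_simps(6) AB.tens_mult)
  then show ?case
   using tens r c
   by (simp add: inner_tens BC.tens_balanced[symmetric] AB.tens_balanced BC.AB_simps(6) BC.tens_mult X.tens_balanced)
 next
  case (add x y)
  then show ?case using r c u by (simp add: inner_add AB.Q.r_distr)
 qed
qed (simp add: inner_add)

sublocale O: balanced_map R AB.AB C ABC inner
 by (rule balanced_outer)

lemma tensor_assoc_tens: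
 "\<lbrakk>a \<in> carrier A; b \<in> carrier B; c \<in> carrier C\<rbrakk> \<Longrightarrow>
  tensor_assoc R A B C (Y.T (AB.T a b) c) = X.T a (BC.T b c)"
 unfolding tensor_assoc_eq by (simp add: O.lift_tens inner_tens)

lemma tensor_assoc_hom: "tensor_assoc R A B C \<in> ring_hom (tensor_alg R AB.AB C) ABC"
 unfolding tensor_assoc_eq
proof (rule O.lift_ring_hom)
 show "inner \<one>\<^bsub>AB.AB\<^esub> \<one>\<^bsub>C\<^esub> = \<one>\<^bsub>ABC\<^esub>"
  unfolding AB.tens_one X.tens_one BC.tens_one by (simp add: inner_tens)
next
 fix x c x' c'
 assume x: "x \<in> carrier AB.AB" and c: "c \<in> carrier C" and x': "x' \<in> carrier AB.AB" and c': "c' \<in> carrier C"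
 from x show "inner (x \<otimes>\<^bsub>AB.AB\<^esub> x') (c \<otimes>\<^bsub>C\<^esub> c') = inner x c \<otimes>\<^bsub>ABC\<^esub> inner x' c'"
 proof (induction x rule: AB.tens_induct)
  case (tens a b)
  from x' show ?case
  proof (induction x' rule: AB.tens_induct)
   case (tens a' b')
   with \<open>a \<in> carrier A\<close> \<open>b \<in> carrier B\<close> c c' show ?case
    by (simp add: AB.tens_mult inner_tens X.tens_mult BC.tens_mult)
  next
   case (add z w)
   with \<open>a \<in> carrier A\<close> \<open>b \<in> carrier B\<close> c c' show ?case
    by (simp add: AB.Q.r_distr X.Q.r_distr inner_add inner_closed)
  qed
 next
  case (add z w)
  with x' c c' show ?case by (simp add: AB.Q.l_distr X.Q.l_distr inner_add inner_closed)
 qed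
qed (rule X.Q.ring_axioms)

end

section \<open>Evaluation of polynomials and the Frobenius map\<close>

lemma rota_simps [simp]:
 "carrier (ring_of_type_algebra :: 'a::comm_ring_1 ring) = UNIV"
 "x \<otimes>\<^bsub>(ring_of_type_algebra :: 'a ring)\<^esub> y = x * y"
 "x \<oplus>\<^bsub>(ring_of_type_algebra :: 'a ring)\<^esub> y = x + y"
 "\<one>\<^bsub>(ring_of_type_algebra :: 'a ring)\<^esub> = 1"
 "\<zero>\<^bsub>(ring_of_type_algebra :: 'a ring)\<^esub> = 0"
 by (simp_all add: ring_of_type_algebra_def)

text \<open>Horner's scheme in a possibly noncommutative ring. It is multiplicative once c is a ring
  homomorphism whose values commute with b.\<close>

definition poly_ev :: "('c, 'm) ring_scheme \<Rightarrow> ('s::comm_ring_1 \<Rightarrow> 'c) \<Rightarrow> 'c \<Rightarrow> 's poly \<Rightarrow> 'c" where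
 "poly_ev C c b f = fold_coeffs (\<lambda>a r. c a \<oplus>\<^bsub>C\<^esub> b \<otimes>\<^bsub>C\<^esub> r) f \<zero>\<^bsub>C\<^esub>"

locale poly_evaluation = C: ring C for C :: "('c, 'm) ring_scheme" +
 fixes c :: "'s::comm_ring_1 \<Rightarrow> 'c" and b :: 'c
 assumes c_hom: "c \<in> ring_hom ring_of_type_algebra C"
  and b_closed [simp]: "b \<in> carrier C"
  and c_comm: "c s \<otimes>\<^bsub>C\<^esub> b = b \<otimes>\<^bsub>C\<^esub> c s"
begin

lemma c_closed [simp]: "c s \<in> carrier C"
 using ring_hom_closed[OF c_hom] by simp

lemma c_add: "c (s + t) = c s \<oplus>\<^bsub>C\<^esub> c t"
 using ring_hom_add[OF c_hom, of s t] by simp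

lemma c_mult: "c (s * t) = c s \<otimes>\<^bsub>C\<^esub> c t"
 using ring_hom_mult[OF c_hom, of s t] by simp

lemma c_one [simp]: "c 1 = \<one>\<^bsub>C\<^esub>"
 using ring_hom_one[OF c_hom] by simp

lemma c_zero [simp]: "c 0 = \<zero>\<^bsub>C\<^esub>"
 using c_add[of 0 0] by (metis C.add.l_cancel_one' add_0 c_closed)

abbreviation "ev \<equiv> poly_ev C c b"

lemma ev_0 [simp]: "ev 0 = \<zero>\<^bsub>C\<^esub>"
 by (simp add: poly_ev_def)

lemma ev_pCons [simp]: "ev (pCons a f) = c a \<oplus>\<^bsub>C\<^esub> b \<otimes>\<^bsub>C\<^esub> ev f"
 by (cases "a = 0 \<and> f = 0") (auto simp: poly_ev_def)

lemma ev_closed [simp]: "ev f \<in> carrier C"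
 by (induction f) simp_all

lemma ev_add: "ev (f + g) = ev f \<oplus>\<^bsub>C\<^esub> ev g"
proof (induction f g rule: poly_induct2)
 case (pCons a f a' g)
 then show ?case by (simp add: c_add C.r_distr C.a_ac)
qed simp

lemma ev_smult: "ev (smult a f) = c a \<otimes>\<^bsub>C\<^esub> ev f"
proof (induction f)
 case (pCons x f)
 have "c a \<otimes>\<^bsub>C\<^esub> (b \<otimes>\<^bsub>C\<^esub> ev f) = b \<otimes>\<^bsub>C\<^esub> (c a \<otimes>\<^bsub>C\<^esub> ev f)"
  by (metis C.m_assoc b_closed c_closed c_comm ev_closed)
 with pCons show ?case by (simp add: c_mult C.r_distr)
qed simp

lemma ev_mult: "ev (f * g) = ev f \<otimes>\<^bsub>C\<^esub> ev g"
 by (induction f) (simp_all add: ev_add ev_smult C.l_distr C.m_assoc)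

lemma ev_1 [simp]: "ev 1 = \<one>\<^bsub>C\<^esub>"
 by (simp add: one_pCons)

lemma ev_power: "ev (f ^ n) = ev f [^]\<^bsub>C\<^esub> n"
proof (induction n)
 case (Suc n)
 have "ev (f ^ Suc n) = ev (f ^ n * f)" by (simp add: mult.commute)
 then show ?case using Suc by (simp add: ev_mult)
qed simp

lemma ev_hom: "ev \<in> ring_hom ring_of_type_algebra C"
 by (rule ring_hom_memI) (simp_all add: ev_mult ev_add)

lemma ev_uminus: "ev (- f) = \<ominus>\<^bsub>C\<^esub> ev f"
 using ev_add[of "- f" f] by (metis C.minus_equality add.left_inverse ev_0 ev_closed)

lemma ev_diff: "ev (f - g) = ev f \<ominus>\<^bsub>C\<^esub> ev g"
 using ev_add[of f "- g"] by (simp add: ev_uminus a_minus_def)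

lemma ev_commute:
 assumes "x \<in> carrier C" "x \<otimes>\<^bsub>C\<^esub> b = b \<otimes>\<^bsub>C\<^esub> x" "\<And>s. x \<otimes>\<^bsub>C\<^esub> c s = c s \<otimes>\<^bsub>C\<^esub> x"
 shows "x \<otimes>\<^bsub>C\<^esub> ev f = ev f \<otimes>\<^bsub>C\<^esub> x"
proof (induction f)
 case (pCons a f)
 have "x \<otimes>\<^bsub>C\<^esub> (b \<otimes>\<^bsub>C\<^esub> ev f) = (b \<otimes>\<^bsub>C\<^esub> ev f) \<otimes>\<^bsub>C\<^esub> x"
  using pCons assms by (metis C.m_assoc b_closed ev_closed)
 then show ?case using assms by (simp add: C.l_distr C.r_distr)
qed (use assms in simp)

text \<open>On an eigenvector v of left multiplication by b the powers of b act by powers of the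
  eigenvalue. This evaluates the interpolation idempotents without expanding them.\<close>

lemma ev_eigenvector:
 assumes "v \<in> carrier C" "b \<otimes>\<^bsub>C\<^esub> v = c s \<otimes>\<^bsub>C\<^esub> v"
 shows "ev f \<otimes>\<^bsub>C\<^esub> v = c (poly f s) \<otimes>\<^bsub>C\<^esub> v"
proof (induction f)
 case (pCons a f)
 have "b \<otimes>\<^bsub>C\<^esub> ev f \<otimes>\<^bsub>C\<^esub> v = b \<otimes>\<^bsub>C\<^esub> (c (poly f s) \<otimes>\<^bsub>C\<^esub> v)"
  using pCons assms by (simp add: C.m_assoc)
 also have "\<dots> = c (poly f s) \<otimes>\<^bsub>C\<^esub> (c s \<otimes>\<^bsub>C\<^esub> v)"
  using assms by (metis C.m_assoc b_closed c_closed c_comm)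
 also have "\<dots> = c (s * poly f s) \<otimes>\<^bsub>C\<^esub> v"
  using assms by (simp add: c_mult C.m_assoc[symmetric] mult.commute[of s])
 finally show ?case using assms by (simp add: C.l_distr c_add)
qed (use assms in simp)

end

locale charp_algebra = C: ring C for C :: "('c, 'm) ring_scheme" +
 fixes \<kappa> :: "'k::field \<Rightarrow> 'c" and p :: nat
 assumes kappa_hom: "\<kappa> \<in> ring_hom ring_of_type_algebra C"
  and kappa_central: "x \<in> carrier C \<Longrightarrow> \<kappa> s \<otimes>\<^bsub>C\<^esub> x = x \<otimes>\<^bsub>C\<^esub> \<kappa> s"
  and char_p: "CHAR('k) = p" and p_pos: "p > 0"
begin

lemma prime_p: "Factorial_Ring.prime p"
 using char_p p_pos prime_CHAR_semidom[where ?'a = 'k] by simp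

lemma kappa_closed [simp, intro]: "\<kappa> s \<in> carrier C"
 using ring_hom_closed[OF kappa_hom] by simp

lemma kappa_add: "\<kappa> (s + t) = \<kappa> s \<oplus>\<^bsub>C\<^esub> \<kappa> t"
 using ring_hom_add[OF kappa_hom, of s t] by simp

lemma kappa_mult: "\<kappa> (s * t) = \<kappa> s \<otimes>\<^bsub>C\<^esub> \<kappa> t"
 using ring_hom_mult[OF kappa_hom, of s t] by simp

lemma kappa_one [simp]: "\<kappa> 1 = \<one>\<^bsub>C\<^esub>"
 using ring_hom_one[OF kappa_hom] by simp

lemma kappa_zero [simp]: "\<kappa> 0 = \<zero>\<^bsub>C\<^esub>"
 using kappa_add[of 0 0] by (metis C.add.l_cancel_one' add_0 kappa_closed)

lemma kappa_uminus: "\<kappa> (- s) = \<ominus>\<^bsub>C\<^esub> \<kappa> s"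
 using kappa_add[of "- s" s] by (metis C.minus_equality add.left_inverse kappa_zero kappa_closed)

lemma poly_evaluation: "b \<in> carrier C \<Longrightarrow> poly_evaluation C \<kappa> b"
 by unfold_locales (auto simp: kappa_hom kappa_central)

text \<open>The binomial theorem modulo p is a statement about commutative rings, so it is applied
  in K[X][Y] and carried over by evaluating X at a and Y at b. This is a homomorphism because a and
  b commute.\<close>

lemma frobenius_add:
 assumes a: "a \<in> carrier C" and b: "b \<in> carrier C" and ab: "a \<otimes>\<^bsub>C\<^esub> b = b \<otimes>\<^bsub>C\<^esub> a"
 shows "(a \<oplus>\<^bsub>C\<^esub> b) [^]\<^bsub>C\<^esub> p = a [^]\<^bsub>C\<^esub> p \<oplus>\<^bsub>C\<^esub> b [^]\<^bsub>C\<^esub> p"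
proof -
 interpret E: poly_evaluation C \<kappa> a by (rule poly_evaluation[OF a])
 interpret F: poly_evaluation C "poly_ev C \<kappa> a" b
  by unfold_locales (use a b ab E.ev_commute[of b] kappa_central in \<open>auto simp: E.ev_hom\<close>)
 have "([:[:0, 1:]:] + [:0, 1:] :: 'k poly poly) ^ p = [:[:0, 1:]:] ^ p + [:0, 1:] ^ p"
  by (rule freshmans_dream) (simp_all add: char_p prime_p)
 then have "F.ev (([:[:0, 1:]:] + [:0, 1:]) ^ p) = F.ev ([:[:0, 1:]:] ^ p + [:0, 1:] ^ p)"
  by simp
 then show ?thesis using a b by (simp add: F.ev_power F.ev_add)
qed

text \<open>Applying additivity to -a + a = 0 gives the sign for every p, with no distinction
  between p odd and p = 2.\<close>

lemma frobenius_uminus: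
 assumes a: "a \<in> carrier C"
 shows "(\<ominus>\<^bsub>C\<^esub> a) [^]\<^bsub>C\<^esub> p = \<ominus>\<^bsub>C\<^esub> (a [^]\<^bsub>C\<^esub> p)"
proof -
 have "\<zero>\<^bsub>C\<^esub> = ((\<ominus>\<^bsub>C\<^esub> a) \<oplus>\<^bsub>C\<^esub> a) [^]\<^bsub>C\<^esub> p"
  using a p_pos by (simp add: C.l_neg C.nat_pow_zero)
 also have "\<dots> = (\<ominus>\<^bsub>C\<^esub> a) [^]\<^bsub>C\<^esub> p \<oplus>\<^bsub>C\<^esub> a [^]\<^bsub>C\<^esub> p"
  using a by (intro frobenius_add) (simp_all add: C.l_minus C.r_minus)
 finally show ?thesis using a by (metis C.a_inv_closed C.minus_equality C.nat_pow_closed)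
qed

end

section \<open>The divided power algebra and its derivations\<close>

lemma sum_fun_apply: "sum F S x = (\<Sum>i\<in>S. F i x)" for F :: "'i \<Rightarrow> 'a \<Rightarrow> 'b::comm_monoid_add"
 by (induction S rule: infinite_finite_induct) auto

locale divided_powers =
 fixes p n :: nat and K :: "'k::field itself"
 assumes char_p: "CHAR('k) = p" and p_pos: "p > 0"
begin

lemma prime_p: "Factorial_Ring.prime p"
 using char_p p_pos prime_CHAR_semidom[where ?'a = 'k] by simp

lemma p_gt_1: "p > 1"
 using prime_p by (rule prime_gt_1_nat)

abbreviation "MI \<equiv> midx p n"
abbreviation "Od \<equiv> dpoly_carrier p n :: 'k dpoly set"
abbreviation conv :: "'k dpoly \<Rightarrow> 'k dpoly \<Rightarrow> 'k dpoly" (infixl "\<star>" 70) where "f \<star> g \<equiv> dpoly_mult p n f g"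
abbreviation mono :: "(nat \<Rightarrow> nat) \<Rightarrow> 'k dpoly" where "mono \<equiv> dpow p n"
abbreviation act :: "'k vfield \<Rightarrow> 'k dpoly \<Rightarrow> 'k dpoly" where "act \<equiv> vf_apply p n"
abbreviation br :: "'k vfield \<Rightarrow> 'k vfield \<Rightarrow> 'k vfield" where "br \<equiv> vf_bracket p n"

definition bc :: "(nat \<Rightarrow> nat) \<Rightarrow> (nat \<Rightarrow> nat) \<Rightarrow> nat" where
 "bc \<gamma> \<alpha> = (\<Prod>i\<in>{1..n}. \<gamma> i choose \<alpha> i)"

lemma conv_apply: "(f \<star> g) \<gamma> = (if \<gamma> \<in> MI then \<Sum>\<alpha>\<in>{\<alpha>. \<alpha> \<le> \<gamma>}. of_nat (bc \<gamma> \<alpha>) * f \<alpha> * g (\<gamma> - \<alpha>) else 0)"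
 by (simp add: dpoly_mult_def bc_def)

lemma midx_le: "\<gamma> \<in> MI \<Longrightarrow> \<alpha> \<le> \<gamma> \<Longrightarrow> \<alpha> \<in> MI"
 unfolding midx_def le_fun_def mem_Collect_eq by (metis le_trans le_zero_eq)

lemma midx_bound: "\<gamma> \<in> MI \<Longrightarrow> \<gamma> i < p"
proof -
 assume "\<gamma> \<in> MI"
 then have "\<gamma> i \<le> p - 1" unfolding midx_def by (cases "i \<in> {1..n}") auto
 then show ?thesis using p_pos by linarith
qed

lemma midx_bij: "bij_betw (\<lambda>\<alpha>. restrict \<alpha> {1..n}) MI ({1..n} \<rightarrow>\<^sub>E {0..p - 1})"
proof (rule bij_betwI[where g = "\<lambda>f i. if i \<in> {1..n} then f i else 0"])
 show "(\<lambda>\<alpha>. restrict \<alpha> {1..n}) \<in> MI \<rightarrow> {1..n} \<rightarrow>\<^sub>E {0..p - 1}" by (auto simp: midx_def)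
 show "(\<lambda>f i. if i \<in> {1..n} then f i else 0) \<in> ({1..n} \<rightarrow>\<^sub>E {0..p - 1}) \<rightarrow> MI"
  by (auto simp: midx_def PiE_iff)
qed (auto simp: midx_def fun_eq_iff PiE_iff extensional_def)

lemma finite_midx [simp]: "finite MI"
 using bij_betw_finite[OF midx_bij] by (simp add: finite_PiE)

lemma card_midx: "card MI = p ^ n"
 using bij_betw_same_card[OF midx_bij] p_pos by (simp add: card_PiE)

lemma finite_le [simp]: "\<gamma> \<in> MI \<Longrightarrow> finite {\<alpha>. \<alpha> \<le> \<gamma>}"
 by (rule finite_subset[OF _ finite_midx]) (auto intro: midx_le)

lemma O_outside: "f \<in> Od \<Longrightarrow> \<gamma> \<notin> MI \<Longrightarrow> f \<gamma> = 0"
 by (auto simp: dpoly_carrier_def)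

lemma conv_in_O [simp]: "f \<star> g \<in> Od"
 by (auto simp: dpoly_carrier_def conv_apply split: if_splits)

lemma O_zero [simp]: "0 \<in> Od"
 and O_add: "f \<in> Od \<Longrightarrow> g \<in> Od \<Longrightarrow> f + g \<in> Od"
 and O_diff: "f \<in> Od \<Longrightarrow> g \<in> Od \<Longrightarrow> f - g \<in> Od"
 by (auto simp: dpoly_carrier_def) (metis add_0, metis)

lemma O_sum: "(\<And>i. i \<in> S \<Longrightarrow> f i \<in> Od) \<Longrightarrow> sum f S \<in> Od"
 by (induction S rule: infinite_finite_induct) (auto simp: O_add)

lemma mono_in_O [simp]: "mono \<alpha> \<in> Od"
 by (auto simp: dpoly_carrier_def dpow_def)

lemma pder_in_O: assumes "f \<in> Od" shows "pder i f \<in> Od"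
 unfolding dpoly_carrier_def mem_Collect_eq
proof (intro allI impI)
 fix \<alpha> assume "pder i f \<alpha> \<noteq> 0"
 then have "\<alpha> + eps i \<in> MI" using O_outside[OF assms, of "\<alpha> + eps i"] by (auto simp: pder_def)
 then show "\<alpha> \<in> MI" by (rule midx_le) (simp add: le_fun_def)
qed

lemma bc_symmetric: "\<alpha> \<le> \<gamma> \<Longrightarrow> bc \<gamma> (\<gamma> - \<alpha>) = bc \<gamma> \<alpha>"
 unfolding bc_def by (intro prod.cong refl) (simp add: le_fun_def binomial_symmetric[symmetric])

lemma conv_commute: "f \<star> g = g \<star> f"
proof
 fix \<gamma>
 have "(\<Sum>\<alpha>\<in>{\<alpha>. \<alpha> \<le> \<gamma>}. of_nat (bc \<gamma> \<alpha>) * f \<alpha> * g (\<gamma> - \<alpha>)) =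
  (\<Sum>\<alpha>\<in>{\<alpha>. \<alpha> \<le> \<gamma>}. of_nat (bc \<gamma> \<alpha>) * g \<alpha> * f (\<gamma> - \<alpha>))"
 proof (rule sum.reindex_bij_witness[where i = "\<lambda>\<alpha>. \<gamma> - \<alpha>" and j = "\<lambda>\<alpha>. \<gamma> - \<alpha>"])
  fix \<alpha> assume "\<alpha> \<in> {\<alpha>. \<alpha> \<le> \<gamma>}"
  then show "\<gamma> - (\<gamma> - \<alpha>) = \<alpha>" by (auto simp: le_fun_def fun_eq_iff)
  with \<open>\<alpha> \<in> _\<close> show "of_nat (bc \<gamma> (\<gamma> - \<alpha>)) * g (\<gamma> - \<alpha>) * f (\<gamma> - (\<gamma> - \<alpha>)) = of_nat (bc \<gamma> \<alpha>) * f \<alpha> * g (\<gamma> - \<alpha>)"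
   by (simp add: bc_symmetric)
 qed (auto simp: le_fun_def fun_eq_iff)
 then show "(f \<star> g) \<gamma> = (g \<star> f) \<gamma>" by (simp add: conv_apply)
qed

text \<open>Both sides are the trinomial coefficient m! / (a! b! (m - a - b)!).\<close>

lemma choose_choose_swap:
 assumes "a + b \<le> (m::nat)"
 shows "(m choose a) * ((m - a) choose b) = (m choose b) * ((m - b) choose a)"
proof -
 have *: "fact a * fact b * fact (m - a - b) * ((m choose a) * ((m - a) choose b)) = (fact m :: nat)"
  if "a + b \<le> m" for a b
  using binomial_fact_lemma[of a m] binomial_fact_lemma[of b "m - a"] that
  by (simp add: mult_ac)
 have "fact a * fact b * fact (m - a - b) * ((m choose a) * ((m - a) choose b))
   = fact a * fact b * fact (m - a - b) * ((m choose b) * ((m - b) choose a))"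
  using *[of a b] *[of b a] assms by (simp add: mult_ac add.commute diff_right_commute)
 then show ?thesis by simp
qed

lemma bc_swap:
 assumes "\<alpha> + \<beta> \<le> \<gamma>"
 shows "bc \<gamma> \<alpha> * bc (\<gamma> - \<alpha>) \<beta> = bc \<gamma> \<beta> * bc (\<gamma> - \<beta>) \<alpha>"
 unfolding bc_def prod.distrib[symmetric]
 by (intro prod.cong refl) (use assms in \<open>auto simp: le_fun_def intro: choose_choose_swap\<close>)

text \<open>Exchanging the two inner indices is a symmetry of the double sum, with equal weights by
  \<open>bc_swap\<close>. Together with commutativity it implies associativity.\<close>

lemma conv_left_commute: "f \<star> (g \<star> h) = g \<star> (f \<star> h)"
proof
 fix \<gamma>
 have expand: "(f \<star> (g \<star> h)) \<gamma> = (\<Sum>(\<alpha>, \<beta>)\<in>(SIGMA \<alpha>:{\<alpha>. \<alpha> \<le> \<gamma>}. {\<beta>. \<beta> \<le> \<gamma> - \<alpha>}).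
   of_nat (bc \<gamma> \<alpha> * bc (\<gamma> - \<alpha>) \<beta>) * f \<alpha> * g \<beta> * h (\<gamma> - \<alpha> - \<beta>))" if g: "\<gamma> \<in> MI" for f g
 proof -
  have le: "\<gamma> - \<alpha> \<in> MI" for \<alpha> using g by (rule midx_le) (simp add: le_fun_def)
  show ?thesis
   using g le by (simp add: conv_apply sum.Sigma[symmetric] sum_distrib_left mult_ac)
 qed
 show "(f \<star> (g \<star> h)) \<gamma> = (g \<star> (f \<star> h)) \<gamma>"
 proof (cases "\<gamma> \<in> MI")
  case True
  show ?thesis unfolding expand[OF True]
  proof (rule sum.reindex_bij_witness[where i = prod.swap and j = prod.swap])
   fix x assume "x \<in> (SIGMA \<alpha>:{\<alpha>. \<alpha> \<le> \<gamma>}. {\<beta>. \<beta> \<le> \<gamma> - \<alpha>})"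
   then obtain \<alpha> \<beta> where x: "x = (\<alpha>, \<beta>)" "\<alpha> \<le> \<gamma>" "\<beta> \<le> \<gamma> - \<alpha>" by blast
   have ab: "\<alpha> + \<beta> \<le> \<gamma>"
    unfolding le_fun_def
   proof
    fix i show "(\<alpha> + \<beta>) i \<le> \<gamma> i"
     using x(2,3)[unfolded le_fun_def, THEN spec, of i] by simp
   qed
   have d: "\<gamma> - \<alpha> - \<beta> = \<gamma> - \<beta> - \<alpha>" by (simp add: fun_eq_iff add.commute)
   show "(case prod.swap x of (\<alpha>, \<beta>) \<Rightarrow> of_nat (bc \<gamma> \<alpha> * bc (\<gamma> - \<alpha>) \<beta>) * g \<alpha> * f \<beta> * h (\<gamma> - \<alpha> - \<beta>)) =
    (case x of (\<alpha>, \<beta>) \<Rightarrow> of_nat (bc \<gamma> \<alpha> * bc (\<gamma> - \<alpha>) \<beta>) * f \<alpha> * g \<beta> * h (\<gamma> - \<alpha> - \<beta>))"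
    using arg_cong[OF bc_swap[OF ab], of "of_nat :: nat \<Rightarrow> 'k"] d by (simp add: x mult_ac del: of_nat_mult)
  next
   have m: "b + a \<le> c \<Longrightarrow> a \<le> c - b" "a \<le> c - b \<Longrightarrow> b \<le> c \<Longrightarrow> b \<le> c - a" for a b c :: nat by auto
   fix x assume "x \<in> (SIGMA \<alpha>:{\<alpha>. \<alpha> \<le> \<gamma>}. {\<beta>. \<beta> \<le> \<gamma> - \<alpha>})"
   then obtain \<alpha> \<beta> where x: "x = (\<alpha>, \<beta>)" "\<alpha> \<le> \<gamma>" "\<beta> \<le> \<gamma> - \<alpha>" by blast
   have "\<beta> i \<le> \<gamma> i \<and> \<alpha> i \<le> \<gamma> i - \<beta> i" for i
    using x(2,3)[unfolded le_fun_def, THEN spec, of i] by auto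
   then show "prod.swap x \<in> (SIGMA \<alpha>:{\<alpha>. \<alpha> \<le> \<gamma>}. {\<beta>. \<beta> \<le> \<gamma> - \<alpha>})"
    by (simp add: x le_fun_def)
   then show "prod.swap x \<in> (SIGMA \<alpha>:{\<alpha>. \<alpha> \<le> \<gamma>}. {\<beta>. \<beta> \<le> \<gamma> - \<alpha>})" .
  qed auto
 qed (simp add: conv_apply)
qed

lemma conv_assoc: "(f \<star> g) \<star> h = f \<star> (g \<star> h)"
 by (metis conv_commute conv_left_commute)

lemma conv_add_left: "(f + g) \<star> h = f \<star> h + g \<star> h"
 by (rule ext) (simp add: conv_apply algebra_simps sum.distrib)

lemma conv_diff_left: "(f - g) \<star> h = f \<star> h - g \<star> h"
 by (rule ext) (simp add: conv_apply algebra_simps sum_subtractf)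

lemma conv_zero [simp]: "0 \<star> h = 0" "h \<star> 0 = 0"
 by (rule ext; simp add: conv_apply)+

lemma conv_add_right: "h \<star> (f + g) = h \<star> f + h \<star> g"
 by (metis conv_commute conv_add_left)

lemma conv_diff_right: "h \<star> (f - g) = h \<star> f - h \<star> g"
 by (metis conv_commute conv_diff_left)

lemma conv_sum_left: "sum f S \<star> h = (\<Sum>i\<in>S. f i \<star> h)"
 by (induction S rule: infinite_finite_induct) (simp_all only: sum.infinite sum.empty sum.insert not_False_eq_True conv_zero conv_add_left)

lemma conv_sum_right: "h \<star> sum f S = (\<Sum>i\<in>S. h \<star> f i)"
 by (induction S rule: infinite_finite_induct) (simp_all only: sum.infinite sum.empty sum.insert not_False_eq_True conv_zero conv_add_right)

lemma conv_nonzero: "(f \<star> g) \<gamma> \<noteq> 0 \<Longrightarrow> \<exists>\<alpha>\<le>\<gamma>. \<gamma> \<in> MI \<and> f \<alpha> \<noteq> 0 \<and> g (\<gamma> - \<alpha>) \<noteq> 0"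
 unfolding conv_apply by (auto split: if_splits elim!: sum.not_neutral_contains_not_neutral)

lemma conv_mono:
 assumes "\<alpha> \<in> MI" "\<beta> \<in> MI"
 shows "mono \<alpha> \<star> mono \<beta> = (\<lambda>\<gamma>. of_nat (bc (\<alpha> + \<beta>) \<alpha>) * mono (\<alpha> + \<beta>) \<gamma>)"
proof
 fix \<gamma>
 have eq: "\<alpha> \<le> \<gamma> \<and> \<gamma> - \<alpha> = \<beta> \<longleftrightarrow> \<gamma> = \<alpha> + \<beta>"
 proof
  assume *: "\<alpha> \<le> \<gamma> \<and> \<gamma> - \<alpha> = \<beta>"
  show "\<gamma> = \<alpha> + \<beta>"
  proof
   fix i have "\<alpha> i \<le> \<gamma> i" "\<gamma> i - \<alpha> i = \<beta> i" using * by (auto simp: le_fun_def)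
   then show "\<gamma> i = (\<alpha> + \<beta>) i" by simp
  qed
 qed (auto simp: le_fun_def fun_eq_iff)
 show "(mono \<alpha> \<star> mono \<beta>) \<gamma> = of_nat (bc (\<alpha> + \<beta>) \<alpha>) * mono (\<alpha> + \<beta>) \<gamma>"
 proof (cases "\<gamma> \<in> MI")
  case True
  have "(mono \<alpha> \<star> mono \<beta>) \<gamma> = (\<Sum>\<alpha>'\<in>{\<alpha>. \<alpha> \<le> \<gamma>}. if \<alpha>' = \<alpha> then of_nat (bc \<gamma> \<alpha>) * of_bool (\<gamma> - \<alpha> = \<beta>) else 0)"
   using True assms by (auto simp: conv_apply dpow_def intro!: sum.cong)
  also have "\<dots> = of_bool (\<alpha> \<le> \<gamma>) * (of_nat (bc \<gamma> \<alpha>) * of_bool (\<gamma> - \<alpha> = \<beta>))"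
   using True by simp
  also have "\<dots> = of_nat (bc \<gamma> \<alpha>) * of_bool (\<gamma> = \<alpha> + \<beta>)"
   using eq by auto
  also have "\<dots> = of_nat (bc (\<alpha> + \<beta>) \<alpha>) * mono (\<alpha> + \<beta>) \<gamma>"
   using True by (auto simp: dpow_def)
  finally show ?thesis .
 qed (auto simp: conv_apply dpow_def)
qed

lemma zero_midx [simp]: "0 \<in> MI" and eps_midx: "i \<in> {1..n} \<Longrightarrow> eps i \<in> MI"
 using p_gt_1 by (auto simp: midx_def eps_def)

lemma conv_one: assumes "f \<in> Od" shows "mono 0 \<star> f = f"
proof
 fix \<gamma>
 show "(mono 0 \<star> f) \<gamma> = f \<gamma>"
 proof (cases "\<gamma> \<in> MI")
  case True
  have "(mono 0 \<star> f) \<gamma> = (\<Sum>\<alpha>\<in>{\<alpha>. \<alpha> \<le> \<gamma>}. of_nat (bc \<gamma> \<alpha>) * mono 0 \<alpha> * f (\<gamma> - \<alpha>))"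
   using True by (simp add: conv_apply)
  also have "\<dots> = (\<Sum>\<alpha>\<in>{\<alpha>. \<alpha> \<le> \<gamma>}. if \<alpha> = 0 then f \<gamma> else 0)"
   by (intro sum.cong refl) (auto simp: dpow_def bc_def)
  also have "\<dots> = f \<gamma>"
  proof -
   have "0 \<le> \<gamma>" by (simp add: le_fun_def)
   then show ?thesis using True by simp
  qed
  finally show ?thesis .
 qed (use assms in \<open>auto simp: conv_apply O_outside\<close>)
qed

lemma pder_simps:
 "pder i 0 = 0" "pder i (f + g) = pder i f + pder i g" "pder i (f - g) = pder i f - pder i g"
 "pder i (- f) = - pder i f"
 by (auto simp: pder_def fun_eq_iff)

lemma pder_sum: "pder i (sum f S) = (\<Sum>j\<in>S. pder i (f j))"
 by (induction S rule: infinite_finite_induct) (simp_all only: sum.infinite sum.empty sum.insert not_False_eq_True pder_simps)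

lemma pder_commute: "pder i (pder j f) = pder j (pder i f)"
 by (auto simp: pder_def fun_eq_iff add_ac)

lemma bc_pascal:
 assumes "i \<in> {1..n}"
 shows "bc (\<gamma> + eps i) \<alpha> = (if \<alpha> i \<ge> 1 then bc \<gamma> (\<alpha> - eps i) else 0) + bc \<gamma> \<alpha>"
proof -
 have s: "bc \<gamma>' \<alpha>' = (\<gamma>' i choose \<alpha>' i) * (\<Prod>j\<in>{1..n} - {i}. \<gamma>' j choose \<alpha>' j)" for \<gamma>' \<alpha>'
  unfolding bc_def using assms by (simp add: prod.remove)
 have "(\<Prod>j\<in>{1..n} - {i}. (\<gamma> + eps i) j choose \<alpha> j) = (\<Prod>j\<in>{1..n} - {i}. \<gamma> j choose \<alpha> j)"
  "(\<Prod>j\<in>{1..n} - {i}. \<gamma> j choose (\<alpha> - eps i) j) = (\<Prod>j\<in>{1..n} - {i}. \<gamma> j choose \<alpha> j)"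
  by (auto simp: eps_def intro!: prod.cong)
 then show ?thesis
  unfolding s by (cases "\<alpha> i") (auto simp: eps_def algebra_simps)
qed

lemma le_add_eps: "\<alpha> \<le> \<gamma> \<Longrightarrow> \<alpha> \<le> \<gamma> + eps i"
 by (auto simp: le_fun_def intro: le_SucI trans_le_add1)

text \<open>Within range the rule is Pascal's identity in coordinate i. The critical case is
  \<gamma>_i = p - 1: there x^(\<gamma> + \<epsilon>_i) is 0 by truncation, and the right side
  vanishes too, because p divides the inner binomial coefficients while the end terms are out of
  range.\<close>

lemma pder_leibniz:
 assumes f: "f \<in> Od" and g: "g \<in> Od" and i: "i \<in> {1..n}"
 shows "pder i (f \<star> g) = pder i f \<star> g + f \<star> pder i g"
proof
 fix \<gamma>
 show "pder i (f \<star> g) \<gamma> = (pder i f \<star> g + f \<star> pder i g) \<gamma>"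
 proof (cases "\<gamma> \<in> MI")
  case False
  then have "\<gamma> + eps i \<notin> MI" using midx_le[of "\<gamma> + eps i" \<gamma>] by (auto simp: le_fun_def)
  with False show ?thesis by (simp add: pder_def conv_apply)
 next
  case True
  let ?G = "\<gamma> + eps i"
  let ?t = "\<lambda>\<alpha>. of_nat (bc ?G \<alpha>) * f \<alpha> * g (?G - \<alpha>)"
  \<comment> \<open>\<open>?G\<close> may lie outside the index box, so finiteness is derived from
    that of the set of indices below \<gamma>.\<close>
  have fin: "finite {\<alpha>. \<alpha> \<le> ?G}"
  proof (rule finite_subset)
   show "{\<alpha>. \<alpha> \<le> ?G} \<subseteq> {\<alpha>. \<alpha> \<le> \<gamma>} \<union> (\<lambda>\<alpha>. \<alpha> + eps i) ` {\<alpha>. \<alpha> \<le> \<gamma>}"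
   proof
    fix \<alpha> assume a: "\<alpha> \<in> {\<alpha>. \<alpha> \<le> ?G}"
    show "\<alpha> \<in> {\<alpha>. \<alpha> \<le> \<gamma>} \<union> (\<lambda>\<alpha>. \<alpha> + eps i) ` {\<alpha>. \<alpha> \<le> \<gamma>}"
    proof (cases "\<alpha> i \<ge> 1")
     case True
     have "\<alpha> - eps i \<le> \<gamma>" "\<alpha> = (\<alpha> - eps i) + eps i"
      using a True by (auto simp: le_fun_def eps_def fun_eq_iff le_diff_conv)
     then show ?thesis by blast
    next
     case False
     have "\<alpha> \<le> \<gamma>"
     proof (rule le_funI)
      fix j
      have "\<alpha> j \<le> \<gamma> j + eps i j" using a le_funD[of \<alpha> ?G j] by simp
      then show "\<alpha> j \<le> \<gamma> j" using False by (cases "j = i") (auto simp: eps_def)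
     qed
     then show ?thesis by blast
    qed
   qed
  qed (use True in auto)
  have A: "(\<Sum>\<alpha>\<in>{\<alpha>. \<alpha> \<le> ?G}. of_nat (if \<alpha> i \<ge> 1 then bc \<gamma> (\<alpha> - eps i) else 0) * f \<alpha> * g (?G - \<alpha>))
    = (pder i f \<star> g) \<gamma>"
  proof -
   have "(\<Sum>\<alpha>\<in>{\<alpha>. \<alpha> \<le> ?G}. of_nat (if \<alpha> i \<ge> 1 then bc \<gamma> (\<alpha> - eps i) else 0) * f \<alpha> * g (?G - \<alpha>))
    = (\<Sum>\<alpha>\<in>{\<alpha>. \<alpha> \<le> ?G \<and> \<alpha> i \<ge> 1}. of_nat (bc \<gamma> (\<alpha> - eps i)) * f \<alpha> * g (?G - \<alpha>))"
    by (rule sum.mono_neutral_cong_right[OF fin]) auto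
   also have "\<dots> = (\<Sum>\<alpha>\<in>{\<alpha>. \<alpha> \<le> \<gamma>}. of_nat (bc \<gamma> \<alpha>) * pder i f \<alpha> * g (\<gamma> - \<alpha>))"
   proof (rule sum.reindex_bij_witness[where i = "\<lambda>\<alpha>. \<alpha> + eps i" and j = "\<lambda>\<alpha>. \<alpha> - eps i"])
    fix \<alpha> assume a: "\<alpha> \<in> {\<alpha>. \<alpha> \<le> ?G \<and> \<alpha> i \<ge> 1}"
    show s: "\<alpha> - eps i + eps i = \<alpha>"
     using a by (auto simp: eps_def fun_eq_iff)
    show "\<alpha> - eps i \<in> {\<alpha>. \<alpha> \<le> \<gamma>}"
     using a by (auto simp: le_fun_def le_diff_conv)
    have "\<gamma> - (\<alpha> - eps i) = ?G - \<alpha>"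
     using a by (auto simp: fun_eq_iff eps_def)
    then show "of_nat (bc \<gamma> (\<alpha> - eps i)) * pder i f (\<alpha> - eps i) * g (\<gamma> - (\<alpha> - eps i)) =
     of_nat (bc \<gamma> (\<alpha> - eps i)) * f \<alpha> * g (?G - \<alpha>)"
     by (simp add: pder_def s)
   qed (auto simp: fun_eq_iff le_fun_def eps_def)
   finally show ?thesis using True by (simp add: conv_apply)
  qed
  have B: "(\<Sum>\<alpha>\<in>{\<alpha>. \<alpha> \<le> ?G}. of_nat (bc \<gamma> \<alpha>) * f \<alpha> * g (?G - \<alpha>)) = (f \<star> pder i g) \<gamma>"
  proof -
   have "(\<Sum>\<alpha>\<in>{\<alpha>. \<alpha> \<le> ?G}. of_nat (bc \<gamma> \<alpha>) * f \<alpha> * g (?G - \<alpha>)) =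
    (\<Sum>\<alpha>\<in>{\<alpha>. \<alpha> \<le> \<gamma>}. of_nat (bc \<gamma> \<alpha>) * f \<alpha> * pder i g (\<gamma> - \<alpha>))"
   proof (rule sum.mono_neutral_cong_right)
    show "\<forall>\<alpha>\<in>{\<alpha>. \<alpha> \<le> ?G} - {\<alpha>. \<alpha> \<le> \<gamma>}. of_nat (bc \<gamma> \<alpha>) * f \<alpha> * g (?G - \<alpha>) = 0"
    proof
     fix \<alpha> assume a: "\<alpha> \<in> {\<alpha>. \<alpha> \<le> ?G} - {\<alpha>. \<alpha> \<le> \<gamma>}"
     then obtain j where j: "\<not> \<alpha> j \<le> \<gamma> j" by (auto simp: le_fun_def)
     have "\<alpha> j \<le> \<gamma> j + eps i j" using a by (auto simp: le_fun_def)
     with j have "j = i" by (cases "j = i") (auto simp: eps_def)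
     then have "bc \<gamma> \<alpha> = 0" unfolding bc_def using i j by (auto intro!: bexI[of _ i])
     then show "of_nat (bc \<gamma> \<alpha>) * f \<alpha> * g (?G - \<alpha>) = 0" by simp
    qed
    fix \<alpha> assume "\<alpha> \<in> {\<alpha>. \<alpha> \<le> \<gamma>}"
    then have "?G - \<alpha> = \<gamma> - \<alpha> + eps i" by (auto simp: fun_eq_iff le_fun_def)
    then show "of_nat (bc \<gamma> \<alpha>) * f \<alpha> * g (?G - \<alpha>) = of_nat (bc \<gamma> \<alpha>) * f \<alpha> * pder i g (\<gamma> - \<alpha>)"
     by (simp add: pder_def)
   qed (use fin le_add_eps in auto)
   then show ?thesis using True by (simp add: conv_apply)
  qed
  have total: "(\<Sum>\<alpha>\<in>{\<alpha>. \<alpha> \<le> ?G}. ?t \<alpha>) = (pder i f \<star> g) \<gamma> + (f \<star> pder i g) \<gamma>"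
   unfolding A[symmetric] B[symmetric] bc_pascal[OF i] sum.distrib[symmetric]
   by (intro sum.cong) (auto simp: algebra_simps)
  show ?thesis
  proof (cases "?G \<in> MI")
   case True
   then show ?thesis using total by (simp add: pder_def conv_apply)
  next
   case False
   have gi: "\<gamma> i = p - 1"
   proof (rule ccontr)
    assume "\<gamma> i \<noteq> p - 1"
    moreover have g: "\<gamma> j \<le> p - 1" if "j \<in> {1..n}" for j
     using \<open>\<gamma> \<in> MI\<close> that unfolding midx_def by blast
    ultimately have "\<gamma> i + 1 \<le> p - 1" using i g[of i] by linarith
    then have "?G \<in> MI" using \<open>\<gamma> \<in> MI\<close> i g unfolding midx_def by (auto simp: eps_def)
    with False show False by blast
   qed
   have "?t \<alpha> = 0" if a: "\<alpha> \<le> ?G" for \<alpha>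
   proof -
    have ai: "\<alpha> i \<le> p" using le_funD[OF a, of i] gi p_pos by (simp add: eps_def)
    consider "\<alpha> i = 0" | "\<alpha> i = p" | "0 < \<alpha> i" "\<alpha> i < p" using ai by linarith
    then show ?thesis
    proof cases
     case 1
     then have "(?G - \<alpha>) i = p" using gi p_pos by (simp add: eps_def)
     then have "?G - \<alpha> \<notin> MI" using midx_bound[of "?G - \<alpha>" i] by auto
     then show ?thesis using g O_outside by auto
    next
     case 2
     then have "\<alpha> \<notin> MI" using midx_bound[of \<alpha> i] by auto
     then show ?thesis using f O_outside by auto
    next
     case 3
     have "?G i = p" using gi p_pos by (simp add: eps_def)
     then have "p dvd ?G i choose \<alpha> i" using 3 prime_p by (auto intro!: dvd_choose_prime)
     then have "p dvd bc ?G \<alpha>" unfolding bc_def using i by (meson dvd_prodI dvd_trans finite_atLeastAtMost)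
     then have "of_nat (bc ?G \<alpha>) = (0 :: 'k)" using of_nat_eq_0_iff_char_dvd char_p by blast
     then show ?thesis by simp
    qed
   qed
   then have "(\<Sum>\<alpha>\<in>{\<alpha>. \<alpha> \<le> ?G}. ?t \<alpha>) = 0" by (intro sum.neutral) auto
   then show ?thesis using total False by (simp add: pder_def conv_apply)
  qed
 qed
qed

end

section \<open>Derivations of the divided power algebra and the span of the D_ij\<close>

lemma vector_space_vf_scale: "vector_space vf_scale"
 by unfold_locales (auto simp: vf_scale_def fun_eq_iff algebra_simps)

context divided_powers
begin

sublocale V: vector_space "vf_scale :: 'k \<Rightarrow> 'k vfield \<Rightarrow> 'k vfield"
 by (rule vector_space_vf_scale)

abbreviation "W \<equiv> witt p n :: 'k vfield set"
abbreviation "S' \<equiv> special' p n :: 'k vfield set"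
abbreviation "L \<equiv> special p n :: 'k vfield set"
abbreviation D :: "nat \<Rightarrow> nat \<Rightarrow> (nat \<Rightarrow> nat) \<Rightarrow> 'k vfield" where "D i j \<alpha> \<equiv> dij i j (mono \<alpha>)"

lemma wittD: "a \<in> W \<Longrightarrow> a i \<in> Od"
 unfolding witt_def by (cases "i \<in> {1..n}") auto

lemma act_def: "act a f = (\<Sum>i\<in>{1..n}. a i \<star> pder i f)"
 by (simp add: vf_apply_def)

lemma act_in_O [simp]: "act a f \<in> Od"
 unfolding act_def by (rule O_sum) simp

lemma act_add_right: "act a (f + g) = act a f + act a g"
 by (simp only: act_def pder_simps conv_add_right sum.distrib)

lemma act_diff_right: "act a (f - g) = act a f - act a g"
 by (simp only: act_def pder_simps conv_diff_right sum_subtractf)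

lemma act_add_left: "act (a + b) f = act a f + act b f"
 by (simp only: act_def plus_fun_apply conv_add_left sum.distrib)

lemma act_diff_left: "act (a - b) f = act a f - act b f"
 by (simp only: act_def minus_apply conv_diff_left sum_subtractf)

lemma act_zero [simp]: "act a 0 = 0" "act 0 f = 0"
 by (simp_all only: act_def pder_simps conv_zero zero_fun_apply sum.neutral_const)

lemma act_sum_right: "act a (sum f S) = (\<Sum>i\<in>S. act a (f i))"
 by (induction S rule: infinite_finite_induct)
   (simp_all only: sum.infinite sum.empty sum.insert not_False_eq_True act_zero act_add_right)

lemma conv_scale_right: "f \<star> (\<lambda>\<gamma>. c * g \<gamma>) = (\<lambda>\<gamma>. c * (f \<star> g) \<gamma>)"
 by (rule ext) (simp add: conv_apply sum_distrib_left mult_ac)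

lemma conv_scale_left: "(\<lambda>\<gamma>. c * g \<gamma>) \<star> f = (\<lambda>\<gamma>. c * (g \<star> f) \<gamma>)"
 by (simp add: conv_commute[of _ f] conv_scale_right)

lemma act_apply: "act a f \<gamma> = (\<Sum>i\<in>{1..n}. (a i \<star> pder i f) \<gamma>)"
 by (simp add: act_def sum_fun_apply)

lemma pder_scale: "pder i (\<lambda>\<gamma>. c * g \<gamma>) = (\<lambda>\<gamma>. c * pder i g \<gamma>)"
 by (simp add: pder_def)

lemma act_scale_right: "act a (\<lambda>\<gamma>. c * f \<gamma>) = (\<lambda>\<gamma>. c * act a f \<gamma>)"
 by (rule ext) (simp add: act_apply pder_scale conv_scale_right sum_distrib_left)

lemma act_scale_left: "act (vf_scale c a) f = (\<lambda>\<gamma>. c * act a f \<gamma>)"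
 by (rule ext) (simp add: act_apply vf_scale_def conv_scale_left sum_distrib_left)

lemma mono_apply: "mono \<alpha> \<beta> = of_bool (\<alpha> \<in> MI \<and> \<beta> = \<alpha>)"
 by (simp add: dpow_def)

lemma O_expand: assumes "f \<in> Od" shows "f = (\<Sum>\<alpha>\<in>MI. (\<lambda>\<gamma>. f \<alpha> * mono \<alpha> \<gamma>))"
proof
 fix \<gamma>
 have "(\<Sum>\<alpha>\<in>MI. (\<lambda>\<gamma>. f \<alpha> * mono \<alpha> \<gamma>)) \<gamma> = (\<Sum>\<alpha>\<in>MI. f \<alpha> * mono \<alpha> \<gamma>)"
  by (simp add: sum_fun_apply)
 also have "\<dots> = (\<Sum>\<alpha>\<in>MI. if \<alpha> = \<gamma> then f \<gamma> else 0)"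
  by (intro sum.cong refl) (auto simp: mono_apply)
 also have "\<dots> = f \<gamma>" using O_outside[OF assms] by simp
 finally show "f \<gamma> = (\<Sum>\<alpha>\<in>MI. (\<lambda>\<gamma>. f \<alpha> * mono \<alpha> \<gamma>)) \<gamma>" ..
qed

lemma act_expand: assumes "f \<in> Od" shows "act a f \<gamma> = (\<Sum>\<beta>\<in>MI. f \<beta> * act a (mono \<beta>) \<gamma>)"
proof -
 have "act a f = (\<Sum>\<beta>\<in>MI. act a (\<lambda>\<gamma>. f \<beta> * mono \<beta> \<gamma>))"
  by (subst O_expand[OF assms]) (rule act_sum_right)
 then show ?thesis by (simp add: sum_fun_apply act_scale_right)
qed

text \<open>\<open>P\<close> collects the terms in which one field differentiates the coefficients
  of the other, \<open>Q\<close> those with second derivatives of f. As \<open>Q\<close> is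
  symmetric, it drops out of the commutator.\<close>

lemma act_br:
 assumes a: "a \<in> W" and b: "b \<in> W" and f: "f \<in> Od"
 shows "act (br a b) f = act a (act b f) - act b (act a f)"
proof -
 define P where "P a b = (\<Sum>j\<in>{1..n}. \<Sum>i\<in>{1..n}. a i \<star> (pder i (b j) \<star> pder j f))" for a b
 define Q where "Q a b = (\<Sum>j\<in>{1..n}. \<Sum>i\<in>{1..n}. a i \<star> (b j \<star> pder i (pder j f)))" for a b
 have Q: "Q a b = Q b a" for a b
  unfolding Q_def by (subst sum.swap) (simp only: conv_left_commute pder_commute)
 have PQ: "act a (act b f) = P a b + Q a b" if "b \<in> W" for a b
 proof -
  have "pder i (act b f) = (\<Sum>j\<in>{1..n}. pder i (b j) \<star> pder j f + b j \<star> pder i (pder j f))" if "i \<in> {1..n}" for i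
   unfolding act_def pder_sum
   by (intro sum.cong refl pder_leibniz wittD \<open>b \<in> W\<close> pder_in_O f that)
  then have "act a (act b f) = (\<Sum>i\<in>{1..n}. \<Sum>j\<in>{1..n}. a i \<star> (pder i (b j) \<star> pder j f) + a i \<star> (b j \<star> pder i (pder j f)))"
   unfolding act_def[of a] by (intro sum.cong refl) (simp only: conv_sum_right conv_add_right)
  also have "\<dots> = P a b + Q a b"
   unfolding P_def Q_def sum.distrib[symmetric] by (rule sum.swap)
  finally show ?thesis .
 qed
 have "act (br a b) f = P a b - P b a"
  unfolding act_def[of "br a b"] P_def sum_subtractf[symmetric]
  by (intro sum.cong refl) (simp only: vf_bracket_def act_def conv_diff_left conv_sum_left conv_assoc sum_subtractf)
 then show ?thesis using PQ[OF b, of a] PQ[OF a, of b] Q[of a b] by (simp only: add_diff_add diff_self add_0_right)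
qed

lemma specialD: "a \<in> S' \<Longrightarrow> a \<in> W" "a \<in> S' \<Longrightarrow> (\<Sum>i\<in>{1..n}. pder i (a i)) = 0"
 by (auto simp: special'_def)

text \<open>For divergence-free a the Leibniz rule turns a(f) into the sum of the D_i(a_i f). The
  bracket thus becomes a divergence of antisymmetric coefficients, the form in which combinations of
  the D_ij can be recognised.\<close>

lemma br_special':
 assumes a: "a \<in> S'" and b: "b \<in> S'"
 shows "br a b m = (\<Sum>i\<in>{1..n}. pder i (a i \<star> b m - b i \<star> a m))"
proof -
 have *: "act a f = (\<Sum>i\<in>{1..n}. pder i (a i \<star> f))" if a: "a \<in> S'" and f: "f \<in> Od" for a f
 proof -
  have "(\<Sum>i\<in>{1..n}. pder i (a i \<star> f)) = (\<Sum>i\<in>{1..n}. pder i (a i) \<star> f + a i \<star> pder i f)"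
   by (intro sum.cong refl pder_leibniz wittD specialD a f)
  also have "\<dots> = (\<Sum>i\<in>{1..n}. pder i (a i)) \<star> f + act a f"
   by (simp only: sum.distrib conv_sum_left act_def)
  finally show ?thesis by (simp only: specialD(2)[OF a] conv_zero add_0)
 qed
 show ?thesis
  unfolding vf_bracket_def
  by (simp only: *[OF a wittD[OF specialD(1)[OF b]]] *[OF b wittD[OF specialD(1)[OF a]]] pder_simps sum_subtractf)
qed

lemma dij_add: "dij i j (f + g) = dij i j f + dij i j g" for f g :: "'k dpoly"
 by (auto simp: dij_def pder_def fun_eq_iff)

lemma dij_zero: "dij i j 0 = (0 :: 'k vfield)"
 by (auto simp: dij_def pder_def fun_eq_iff)

lemma dij_sum: "dij i j (sum f S) = (\<Sum>s\<in>S. dij i j (f s))" for f :: "'s \<Rightarrow> 'k dpoly"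
 by (induction S rule: infinite_finite_induct)
   (simp_all only: sum.infinite sum.empty sum.insert not_False_eq_True dij_zero dij_add)

lemma dij_scale: "dij i j (\<lambda>\<gamma>. c * f \<gamma>) = vf_scale c (dij i j f)" for f :: "'k dpoly"
 by (auto simp: dij_def pder_def fun_eq_iff vf_scale_def)

lemma dij_swap: "dij j i f = - dij i j f" for f :: "'k dpoly"
 by (auto simp: dij_def fun_eq_iff)

lemma O_uminus: "f \<in> Od \<Longrightarrow> - f \<in> Od"
 by (simp add: dpoly_carrier_def)

lemma dij_in_W: "\<lbrakk>f \<in> Od; i \<in> {1..n}; j \<in> {1..n}\<rbrakk> \<Longrightarrow> dij i j f \<in> W"
 by (auto simp: dij_def witt_def fun_eq_iff intro!: O_diff O_uminus pder_in_O)

lemma dij_in_S':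
 assumes "f \<in> Od" "i \<in> {1..n}" "j \<in> {1..n}" "i \<noteq> j"
 shows "dij i j f \<in> S'"
proof -
 have "(\<Sum>m\<in>{1..n}. pder m (dij i j f m)) =
   (\<Sum>m\<in>{1..n}. (if m = i then pder i (pder j f) else 0) - (if m = j then pder i (pder j f) else 0))"
  using assms(4) by (intro sum.cong refl) (auto simp: dij_def pder_simps pder_commute[of j])
 also have "\<dots> = 0"
  using assms unfolding sum_subtractf by (simp add: sum.delta')
 finally show ?thesis using dij_in_W assms by (simp add: special'_def)
qed

definition gens :: "'k vfield set" where
 "gens = {D i j \<alpha> | i j \<alpha>. 1 \<le> j \<and> j < i \<and> i \<le> n \<and> \<alpha> \<in> MI}"

lemma dij_in_span:
 assumes f: "f \<in> Od" and ij: "1 \<le> j" "j < i" "i \<le> n"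
 shows "dij i j f \<in> V.span gens"
proof -
 have "dij i j f = (\<Sum>\<alpha>\<in>MI. vf_scale (f \<alpha>) (D i j \<alpha>))"
  by (subst O_expand[OF f]) (simp only: dij_sum dij_scale)
 also have "\<dots> \<in> V.span gens"
  using ij by (intro V.span_sum V.span_scale V.span_base) (auto simp: gens_def)
 finally show ?thesis .
qed

lemma br_in_span:
 assumes a: "a \<in> S'" and b: "b \<in> S'"
 shows "br a b \<in> V.span gens"
proof -
 define F where "F i j = a i \<star> b j - b i \<star> a j" for i j
 have F: "F i j \<in> Od" for i j
  by (simp add: F_def O_diff)
 have Fs: "F j i = - F i j" "F i i = 0" for i j
  by (simp_all add: F_def conv_commute[of "a i"] conv_commute[of "a j"])
 \<comment> \<open>Antisymmetry of \<open>F\<close> lets each unordered pair of indices be collected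
   into one D_ij.\<close>
 have "br a b = (\<Sum>i\<in>{1..n}. \<Sum>j\<in>{1..n}. if j < i then dij i j (F j i) else 0)"
 proof
  fix m
  have e: "br a b m = (\<Sum>i\<in>{1..n}. pder i (F i m))"
   unfolding F_def by (rule br_special'[OF a b])
  show "br a b m = (\<Sum>i\<in>{1..n}. \<Sum>j\<in>{1..n}. if j < i then dij i j (F j i) else 0) m"
  proof (cases "m \<in> {1..n}")
   case False
   then have "a m = 0" "b m = 0" using a b by (auto simp: special'_def witt_def)
   moreover have "(if j < i then dij i j (F j i) else 0) m = 0" if "i \<in> {1..n}" "j \<in> {1..n}" for i j
    using False that by (auto simp: dij_def)
   ultimately show ?thesis
    unfolding e sum_fun_apply[of _ _ m] by (simp add: F_def pder_simps sum.neutral)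
  next
   case True
   have "(\<Sum>i\<in>{1..n}. \<Sum>j\<in>{1..n}. if j < i then dij i j (F j i) else 0) m =
    (\<Sum>i\<in>{1..n}. \<Sum>j\<in>{1..n}. (if i = m then if j < m then pder j (F j m) else 0 else 0)
      - (if j = m then if m < i then pder i (F m i) else 0 else 0))"
    unfolding sum_fun_apply[of _ _ m] by (intro sum.cong refl) (auto simp: dij_def)
   also have "\<dots> = (\<Sum>i\<in>{1..n}. if i = m then \<Sum>j\<in>{1..n}. if j < m then pder j (F j m) else 0 else 0)
     - (\<Sum>i\<in>{1..n}. if m < i then pder i (F m i) else 0)"
    unfolding sum_subtractf using True by (intro arg_cong2[of _ _ _ _ minus] sum.cong refl) (auto simp: sum.neutral)
   also have "\<dots> = (\<Sum>j\<in>{1..n}. if j < m then pder j (F j m) else 0)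
     - (\<Sum>i\<in>{1..n}. if m < i then pder i (F m i) else 0)"
    using True by simp
   also have "\<dots> = (\<Sum>i\<in>{1..n}. pder i (F i m))"
    unfolding sum_subtractf[symmetric]
   proof (intro sum.cong refl)
    fix i
    show "(if i < m then pder i (F i m) else 0) - (if m < i then pder i (F m i) else 0) = pder i (F i m)"
     using Fs(1)[of m i] Fs(2)[of m] by (cases i m rule: linorder_cases) (simp_all add: pder_simps)
   qed
   finally show ?thesis unfolding e ..
  qed
 qed
 also have "\<dots> \<in> V.span gens"
  by (intro V.span_sum) (auto intro!: dij_in_span F V.span_zero simp: V.span_zero)
 finally show ?thesis .
qed

definition unitv :: "nat \<Rightarrow> 'k dpoly \<Rightarrow> 'k vfield" where
 "unitv l f = (\<lambda>m. if m = l then f else 0)"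

lemma unitv_in_S': "\<lbrakk>l \<in> {1..n}; f \<in> Od; pder l f = 0\<rbrakk> \<Longrightarrow> unitv l f \<in> S'"
 by (auto simp: special'_def witt_def unitv_def intro!: sum.neutral) (simp add: pder_simps)

lemma pder_mono:
 assumes "\<alpha> \<in> MI"
 shows "pder i (mono \<alpha>) = (if \<alpha> i = 0 then 0 else mono (\<alpha> - eps i))"
proof
 fix \<gamma>
 have "\<gamma> + eps i = \<alpha> \<longleftrightarrow> \<alpha> i \<noteq> 0 \<and> \<gamma> = \<alpha> - eps i"
 proof
  assume "\<gamma> + eps i = \<alpha>"
  then have "\<alpha> = \<gamma> + eps i" ..
  then show "\<alpha> i \<noteq> 0 \<and> \<gamma> = \<alpha> - eps i" by (auto simp: eps_def fun_eq_iff)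
 next
  assume a: "\<alpha> i \<noteq> 0 \<and> \<gamma> = \<alpha> - eps i"
  then show "\<gamma> + eps i = \<alpha>" by (auto simp: eps_def fun_eq_iff)
 qed
 moreover have "\<alpha> - eps i \<in> MI" by (rule midx_le[OF assms]) (simp add: le_fun_def)
 ultimately show "pder i (mono \<alpha>) \<gamma> = (if \<alpha> i = 0 then 0 else mono (\<alpha> - eps i)) \<gamma>"
  using assms by (auto simp: pder_def mono_apply)
qed

lemma act_unitv: "l \<in> {1..n} \<Longrightarrow> act (unitv l f) g = f \<star> pder l g"
proof -
 assume l: "l \<in> {1..n}"
 have "act (unitv l f) g = (\<Sum>i\<in>{1..n}. if i = l then f \<star> pder l g else 0)"
  unfolding act_def unitv_def by (intro sum.cong refl) auto
 then show ?thesis using l by (simp add: sum.delta')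
qed

text \<open>D_i maps x_m to 1 or 0 according to whether i = m. A derivation is therefore determined
  by its values on the x_m, which serves both to prove vanishing and to define functionals.\<close>

lemma act_mono_eps: "\<lbrakk>a \<in> W; m \<in> {1..n}\<rbrakk> \<Longrightarrow> act a (mono (eps m)) = a m"
proof -
 assume a: "a \<in> W" and m: "m \<in> {1..n}"
 have "a i \<star> pder i (mono (eps m)) = (if i = m then a m else 0)" for i
  using conv_one[OF wittD[OF a]] eps_midx[OF m]
  by (auto simp: pder_mono conv_commute[of _ "mono 0"] eps_def)
 then show ?thesis unfolding act_def using m by (simp add: sum.delta')
qed

lemma act_mono_0: "act a (mono 0) = 0"
 unfolding act_def by (rule sum.neutral) (simp add: pder_mono)

lemma dij_unitv: "i \<noteq> j \<Longrightarrow> dij i j f = unitv i (pder j f) - unitv j (pder i f)" for f :: "'k dpoly"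
 by (auto simp: dij_def unitv_def fun_eq_iff)

text \<open>Each D_ij(x^\<alpha>) must be exhibited as a bracket of divergence-free fields. If some
  \<alpha>_l < p - 1, it is the bracket of D_l with D_ij(x^(\<alpha> + \<epsilon>_l)). Only the top
  index \<tau> resists, and it is treated by splitting x^\<tau> into a product.\<close>

lemma D_in_L:
 assumes i: "i \<in> {1..n}" and j: "j \<in> {1..n}" and ij: "i \<noteq> j"
 shows "D i j \<alpha> \<in> L"
proof (cases "\<alpha> \<in> MI")
 case False
 then have "mono \<alpha> = 0" by (auto simp: mono_apply)
 then have "D i j \<alpha> = 0" by (simp only: dij_zero)
 then show ?thesis unfolding special_def by (metis V.span_zero)
next
 case True
 show ?thesis
 proof (cases "\<exists>l\<in>{1..n}. \<alpha> l \<noteq> p - 1")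
  case l: True
  then obtain l where l: "l \<in> {1..n}" "\<alpha> l \<noteq> p - 1" by blast
  have am: "\<alpha> m \<le> p - 1" if "m \<in> {1..n}" for m
   using True that unfolding midx_def by blast
  have "\<alpha> l + 1 \<le> p - 1" using l am[OF l(1)] by linarith
  then have al: "\<alpha> + eps l \<in> MI"
   using True l am unfolding midx_def eps_def by auto
  let ?x = "unitv l (mono 0)" and ?y = "D i j (\<alpha> + eps l)"
  have x: "?x \<in> S'" using l by (intro unitv_in_S') (auto simp: pder_mono)
  have y: "?y \<in> S'" using i j ij by (intro dij_in_S') auto
  have pm: "pder l (mono (\<alpha> + eps l)) = mono \<alpha>"
   using al by (auto simp: pder_mono eps_def fun_eq_iff intro!: arg_cong[of _ _ mono])
  have "br ?x ?y = D i j \<alpha>"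
  proof
   fix m
   have "act ?x (?y m) = pder l (?y m)"
    using l wittD[OF specialD(1)[OF y]] by (simp add: act_unitv conv_one pder_in_O)
   also have "\<dots> = D i j \<alpha> m"
    using ij by (auto simp: dij_def pder_simps pder_commute[of l] pm)
   finally have "act ?x (?y m) = D i j \<alpha> m" .
   moreover have "act ?y (?x m) = 0"
    by (auto simp: unitv_def act_mono_0)
   ultimately show "br ?x ?y m = D i j \<alpha> m"
    by (simp add: vf_bracket_def)
  qed
  then have "D i j \<alpha> \<in> {br a b | a b. a \<in> S' \<and> b \<in> S'}"
   using x y by (metis (mono_tags, lifting) mem_Collect_eq)
  then show ?thesis unfolding special_def by (rule V.span_base)
 next
  case False
  \<comment> \<open>Now \<alpha> = \<tau>. With b = (p - 1)\<epsilon>_j and a = \<tau> - b the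
    fields x^(a) D_j and x^(b) D_i are divergence-free, because a_j = 0 and b_i = 0, and their
    bracket is D_ij of the product x^(a) x^(b) = x^(\<tau>).\<close>
  define b where "b = (\<lambda>m. if m = j then p - 1 else 0)"
  define a where "a = \<alpha> - b"
  have bm: "b \<in> MI" using j by (auto simp: b_def midx_def)
  have am: "a \<in> MI" by (rule midx_le[OF True]) (simp add: a_def le_fun_def)
  have ab: "a + b = \<alpha>" using False j by (auto simp: a_def b_def fun_eq_iff)
  have aj: "a j = 0" and bi: "b i = 0"
   using False j ij by (auto simp: a_def b_def)
  let ?x = "unitv j (mono a)" and ?y = "unitv i (mono b)"
  have x: "?x \<in> S'" using j aj am by (intro unitv_in_S') (auto simp: pder_mono)
  have y: "?y \<in> S'" using i bi bm by (intro unitv_in_S') (auto simp: pder_mono)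
  have "bc \<alpha> a = 1"
   unfolding bc_def
  proof (rule prod.neutral, rule ballI)
   fix m show "\<alpha> m choose a m = 1" by (cases "m = j") (auto simp: aj, auto simp: a_def b_def)
  qed
  then have prod: "mono a \<star> mono b = mono \<alpha>"
   using conv_mono[OF am bm] by (simp add: ab)
  have "br ?x ?y = D i j \<alpha>"
  proof
   fix m
   have "br ?x ?y m = (\<Sum>s\<in>{1..n}. pder s (?x s \<star> ?y m - ?y s \<star> ?x m))"
    by (rule br_special'[OF x y])
   also have "\<dots> = (\<Sum>s\<in>{1..n}. (if s = j then if m = i then pder j (mono \<alpha>) else 0 else 0)
     - (if s = i then if m = j then pder i (mono \<alpha>) else 0 else 0))"
    using ij prod conv_commute[of "mono b" "mono a"] by (intro sum.cong refl) (auto simp: unitv_def pder_simps)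
   also have "\<dots> = D i j \<alpha> m"
    unfolding sum_subtractf dij_def using i j by (simp add: sum.delta')
   finally show "br ?x ?y m = D i j \<alpha> m" .
  qed
  then have "D i j \<alpha> \<in> {br a b | a b. a \<in> S' \<and> b \<in> S'}"
   using x y by (metis (mono_tags, lifting) mem_Collect_eq)
  then show ?thesis unfolding special_def by (rule V.span_base)
 qed
qed

lemma L_eq_span: "L = V.span gens"
proof
 show "L \<subseteq> V.span gens"
  unfolding special_def by (rule V.span_minimal) (auto intro: br_in_span)
 show "V.span gens \<subseteq> L"
 proof (rule V.span_minimal)
  show "gens \<subseteq> L" unfolding gens_def using D_in_L by auto
  show "V.subspace L" unfolding special_def by simp
 qed
qed

lemma subspace_L: "V.subspace L"
 unfolding L_eq_span by simp

lemma subspace_S': "V.subspace S'"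
proof (rule V.subspaceI)
 show "0 \<in> S'" by (auto simp: special'_def witt_def pder_simps intro!: sum.neutral)
next
 fix x y assume x: "x \<in> S'" and y: "y \<in> S'"
 have "(\<Sum>i\<in>{1..n}. pder i ((x + y) i)) = 0"
  using specialD(2)[OF x] specialD(2)[OF y] by (simp only: plus_fun_apply pder_simps sum.distrib add_0)
 then show "x + y \<in> S'" using x y by (auto simp: special'_def witt_def O_add)
next
 fix c x assume x: "x \<in> S'"
 have "(\<Sum>i\<in>{1..n}. pder i (vf_scale c x i)) \<gamma> = c * (\<Sum>i\<in>{1..n}. pder i (x i)) \<gamma>" for \<gamma>
  by (simp add: sum_fun_apply vf_scale_def pder_scale sum_distrib_left)
 then have "(\<Sum>i\<in>{1..n}. pder i (vf_scale c x i)) = 0"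
  using specialD(2)[OF x] by (simp add: fun_eq_iff)
 then show "vf_scale c x \<in> S'" using x by (auto simp: special'_def witt_def vf_scale_def dpoly_carrier_def fun_eq_iff)
qed

lemma L_subset_S': "L \<subseteq> S'"
 unfolding L_eq_span
proof (rule V.span_minimal[OF _ subspace_S'])
 show "gens \<subseteq> S'" unfolding gens_def using dij_in_S' by auto
qed

lemma L_subset_W: "x \<in> L \<Longrightarrow> x \<in> W"
 using L_subset_S' specialD(1) by blast

lemma br_in_L: "\<lbrakk>x \<in> L; y \<in> L\<rbrakk> \<Longrightarrow> br x y \<in> L"
 using L_subset_S' br_in_span L_eq_span by blast

text \<open>D_ij(x^\<alpha>) is homogeneous of multidegree \<alpha> - \<epsilon>_i - \<epsilon>_j.
  Degrees are integers here, since a coordinate of the difference can be negative.\<close>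

lemma act_D_mono_nonzero:
 assumes ij: "i \<noteq> j" and \<alpha>: "\<alpha> \<in> MI" and \<beta>: "\<beta> \<in> MI" and nz: "act (D i j \<alpha>) (mono \<beta>) \<gamma> \<noteq> 0"
 shows "\<gamma> \<in> MI" "int (\<gamma> l) = int (\<beta> l) + (int (\<alpha> l) - of_bool (l = i) - of_bool (l = j))"
proof -
 from nz obtain m where "(D i j \<alpha> m \<star> pder m (mono \<beta>)) \<gamma> \<noteq> 0"
  unfolding act_apply by (auto elim!: sum.not_neutral_contains_not_neutral)
 then obtain a where a: "a \<le> \<gamma>" "\<gamma> \<in> MI" "D i j \<alpha> m a \<noteq> 0" "pder m (mono \<beta>) (\<gamma> - a) \<noteq> 0"
  using conv_nonzero by blast
 show "\<gamma> \<in> MI" by fact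
 have 1: "\<beta> = \<gamma> - a + eps m" using a(4) by (auto simp: pder_def mono_apply split: if_splits)
 have 2: "(m = i \<and> a + eps j = \<alpha>) \<or> (m = j \<and> a + eps i = \<alpha>)"
  using a(3) ij by (auto simp: dij_def pder_def mono_apply split: if_splits)
 have "a l \<le> \<gamma> l" using a(1) by (simp add: le_fun_def)
 with 1 2 show "int (\<gamma> l) = int (\<beta> l) + (int (\<alpha> l) - of_bool (l = i) - of_bool (l = j))"
  using ij by (auto simp: eps_def)
qed

lemma act_pow_in_O: "f \<in> Od \<Longrightarrow> (act a ^^ m) f \<in> Od"
 by (cases m) simp_all

lemma act_D_pow_mono_nonzero:
 assumes ij: "i \<noteq> j" and \<alpha>: "\<alpha> \<in> MI" and \<beta>: "\<beta> \<in> MI"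
  and nz: "(act (D i j \<alpha>) ^^ m) (mono \<beta>) \<gamma> \<noteq> 0"
 shows "int (\<gamma> l) = int (\<beta> l) + int m * (int (\<alpha> l) - of_bool (l = i) - of_bool (l = j))"
 using nz
proof (induction m arbitrary: \<gamma>)
 case 0
 then show ?case by (simp add: mono_apply split: if_splits)
next
 case (Suc m)
 let ?f = "(act (D i j \<alpha>) ^^ m) (mono \<beta>)"
 have "act (D i j \<alpha>) ?f \<gamma> \<noteq> 0" using Suc.prems by simp
 then obtain \<beta>' where b: "\<beta>' \<in> MI" "?f \<beta>' \<noteq> 0" "act (D i j \<alpha>) (mono \<beta>') \<gamma> \<noteq> 0"
  unfolding act_expand[OF act_pow_in_O[OF mono_in_O]] by (auto elim!: sum.not_neutral_contains_not_neutral)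
 show ?case
  using Suc.IH[OF b(2)] act_D_mono_nonzero(2)[OF ij \<alpha> b(1) b(3), of l] by (simp add: algebra_simps)
qed

text \<open>Weights of \<open>D\<^sub>i\<^sub>j(x\<^sup>\<alpha>)\<close>: the derivation is homogeneous of degree \<open>\<alpha> - \<epsilon>\<^sub>i - \<epsilon>\<^sub>j\<close>, and a nonzero
 multidegree multiplied by \<open>p\<close> leaves the range of exponents.\<close>

lemma act_D_pow_p_zero:
 assumes ij: "i \<noteq> j" and \<alpha>: "\<alpha> \<in> MI" "\<alpha> \<noteq> eps i + eps j" and f: "f \<in> Od"
 shows "(act (D i j \<alpha>) ^^ p) f = 0"
proof -
 obtain l where l: "\<alpha> l \<noteq> eps i l + eps j l" using \<alpha>(2) by (auto simp: fun_eq_iff)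
 define d where "d = int (\<alpha> l) - of_bool (l = i) - of_bool (l = j)"
 have d: "d \<noteq> 0"
 proof
  assume "d = 0"
  then have "int (\<alpha> l) = int (eps i l + eps j l)" by (simp add: d_def eps_def)
  with l show False by linarith
 qed
 have z: "(act (D i j \<alpha>) ^^ p) (mono \<beta>) = 0" if \<beta>: "\<beta> \<in> MI" for \<beta>
 proof (rule ccontr)
  assume "(act (D i j \<alpha>) ^^ p) (mono \<beta>) \<noteq> 0"
  then obtain \<gamma> where nz: "(act (D i j \<alpha>) ^^ p) (mono \<beta>) \<gamma> \<noteq> 0" by (auto simp: fun_eq_iff)
  have "\<gamma> \<in> MI" using O_outside[OF act_pow_in_O[OF mono_in_O]] nz by blast
  then have "\<gamma> l < p" "\<beta> l < p" using \<beta> midx_bound by auto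
  moreover have "int (\<gamma> l) = int (\<beta> l) + int p * d"
   unfolding d_def by (rule act_D_pow_mono_nonzero[OF ij \<alpha>(1) \<beta> nz])
  moreover have "\<bar>int p * d\<bar> \<ge> int p" using d p_pos by (simp add: abs_mult)
  ultimately show False by linarith
 qed
 have pow_lin: "(act a ^^ m) (sum F S) = (\<Sum>s\<in>S. (act a ^^ m) (F s))" for a m and F :: "(nat \<Rightarrow> nat) \<Rightarrow> 'k dpoly" and S
  by (induction m) (simp_all add: act_sum_right)
 have pow_scale: "(act a ^^ m) (\<lambda>\<gamma>. c * g \<gamma>) = (\<lambda>\<gamma>. c * (act a ^^ m) g \<gamma>)" for a m c g
  by (induction m) (simp_all add: act_scale_right)
 show ?thesis
 proof
  fix \<gamma>
  have "(act (D i j \<alpha>) ^^ p) f = (\<Sum>\<beta>\<in>MI. (\<lambda>\<gamma>. f \<beta> * (act (D i j \<alpha>) ^^ p) (mono \<beta>) \<gamma>))"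
   by (subst O_expand[OF f]) (simp only: pow_lin pow_scale)
  then have "(act (D i j \<alpha>) ^^ p) f \<gamma> = (\<Sum>\<beta>\<in>MI. f \<beta> * (act (D i j \<alpha>) ^^ p) (mono \<beta>) \<gamma>)"
   by (simp add: sum_fun_apply)
  then show "(act (D i j \<alpha>) ^^ p) f \<gamma> = 0 \<gamma>" using z by simp
 qed
qed

lemma eps2_midx: "\<lbrakk>i \<in> {1..n}; j \<in> {1..n}; i \<noteq> j\<rbrakk> \<Longrightarrow> eps i + eps j \<in> MI"
 using p_gt_1 by (auto simp: midx_def eps_def)

text \<open>x_i D_i is the Euler operator of coordinate i: x^(\<epsilon>_i) x^(\<gamma> -
  \<epsilon>_i) = \<gamma>_i x^(\<gamma>).\<close>

lemma conv_eps_pder: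
 assumes f: "f \<in> Od" and i: "i \<in> {1..n}"
 shows "(mono (eps i) \<star> pder i f) \<gamma> = of_nat (\<gamma> i) * f \<gamma>"
proof (cases "\<gamma> \<in> MI")
 case True
 have "(mono (eps i) \<star> pder i f) \<gamma> = (\<Sum>\<alpha>\<in>{\<alpha>. \<alpha> \<le> \<gamma>}. of_nat (bc \<gamma> \<alpha>) * mono (eps i) \<alpha> * pder i f (\<gamma> - \<alpha>))"
  using True by (simp add: conv_apply)
 also have "\<dots> = (\<Sum>\<alpha>\<in>{\<alpha>. \<alpha> \<le> \<gamma>}. if \<alpha> = eps i then of_nat (bc \<gamma> (eps i)) * pder i f (\<gamma> - eps i) else 0)"
  using eps_midx[OF i] by (intro sum.cong refl) (auto simp: mono_apply)
 also have "\<dots> = (if eps i \<le> \<gamma> then of_nat (bc \<gamma> (eps i)) * pder i f (\<gamma> - eps i) else 0)"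
  using True by simp
 also have "\<dots> = of_nat (\<gamma> i) * f \<gamma>"
 proof (cases "\<gamma> i = 0")
  case True
  then have "\<not> eps i \<le> \<gamma>" by (auto simp: le_fun_def eps_def intro!: exI[of _ i])
  with True show ?thesis by simp
 next
  case False
  then have "eps i \<le> \<gamma>" "\<gamma> - eps i + eps i = \<gamma>" by (auto simp: le_fun_def eps_def fun_eq_iff)
  moreover have "bc \<gamma> (eps i) = \<gamma> i"
   unfolding bc_def using i by (subst prod.remove[of _ i]) (auto simp: eps_def intro!: prod.neutral)
  ultimately show ?thesis by (simp add: pder_def)
 qed
 finally show ?thesis .
qed (use f in \<open>simp add: conv_apply O_outside\<close>)

lemma D_cartan:
 assumes "i \<in> {1..n}" "j \<in> {1..n}" "i \<noteq> j"
 shows "D i j (eps i + eps j) = unitv i (mono (eps i)) - unitv j (mono (eps j))"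
proof -
 have "pder j (mono (eps i + eps j)) = mono (eps i)" "pder i (mono (eps i + eps j)) = mono (eps j)"
  using assms eps2_midx[OF assms] by (auto simp: pder_mono eps_def fun_eq_iff intro!: arg_cong[of _ _ mono])
 then show ?thesis using assms by (simp add: dij_unitv)
qed

lemma act_cartan:
 assumes "i \<in> {1..n}" "j \<in> {1..n}" "i \<noteq> j" "f \<in> Od"
 shows "act (D i j (eps i + eps j)) f = (\<lambda>\<gamma>. of_int (int (\<gamma> i) - int (\<gamma> j)) * f \<gamma>)"
 using assms by (auto simp: D_cartan act_diff_left act_unitv conv_eps_pder fun_eq_iff algebra_simps)

lemma of_int_pow_p: "of_int z ^ p = (of_int z :: 'k)"
proof -
 have fd: "(x + y) ^ p = x ^ p + y ^ p" for x y :: 'k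
  by (rule freshmans_dream) (simp_all add: char_p prime_p)
 have nat: "of_nat m ^ p = (of_nat m :: 'k)" for m
  using p_pos by (induction m) (simp_all add: fd)
 \<comment> \<open>A negative integer is a difference of two naturals, for which Fermat's identity
   is already known.\<close>
 have "z + int (nat (- z)) = int (nat z)" by simp
 then have "of_int (z + int (nat (- z))) = (of_int (int (nat z)) :: 'k)" by (rule arg_cong)
 then have "of_int z + of_nat (nat (- z)) = (of_nat (nat z) :: 'k)" by (simp only: of_int_add of_int_of_nat_eq)
 then have "(of_int z + of_nat (nat (- z))) ^ p = (of_nat (nat z) ^ p :: 'k)" by simp
 then have "of_int z ^ p + of_nat (nat (- z)) = (of_nat (nat z) :: 'k)"
  unfolding fd nat .
 then show ?thesis by (cases "z \<ge> 0") (auto simp: of_nat_nat add_eq_0_iff2 eq_neg_iff_add_eq_0)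
qed

lemma act_cartan_pow_p:
 assumes ij: "i \<in> {1..n}" "j \<in> {1..n}" "i \<noteq> j" and f: "f \<in> Od"
 shows "(act (D i j (eps i + eps j)) ^^ p) f = act (D i j (eps i + eps j)) f"
proof -
 have "(act (D i j (eps i + eps j)) ^^ m) f = (\<lambda>\<gamma>. of_int (int (\<gamma> i) - int (\<gamma> j)) ^ m * f \<gamma>)" for m
 proof (induction m)
  case (Suc m)
  show ?case
   unfolding funpow.simps comp_apply unfolding act_cartan[OF ij act_pow_in_O[OF f]] unfolding Suc
   by (simp add: mult_ac)
 qed simp
 then show ?thesis by (simp only: of_int_pow_p act_cartan[OF ij f])
qed

text \<open>h multiplies the coefficient at \<gamma> by \<gamma>_k - \<gamma>_k'; applying
  D_ij(x^\<alpha>) to the coefficients x_k and -x_k' of h corrects this by one in the components k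
  and k'. Both terms of D_ij(x^\<alpha>) then give the same number, the exponent of 1 - et in the
  coproduct.\<close>

lemma br_cartan:
 assumes kk: "k \<in> {1..n}" "k' \<in> {1..n}" "k \<noteq> k'" and ij: "i \<in> {1..n}" "j \<in> {1..n}" "i \<noteq> j"
 shows "br (D k k' (eps k + eps k')) (D i j \<alpha>) =
  vf_scale (of_int (int (\<alpha> k) - of_bool (i = k) - of_bool (j = k)
   - int (\<alpha> k') + of_bool (i = k') + of_bool (j = k'))) (D i j \<alpha>)"
proof (intro ext)
 fix m \<gamma>
 let ?h = "D k k' (eps k + eps k')" and ?x = "D i j \<alpha>"
 have x: "?x \<in> W" using ij by (intro dij_in_W) auto
 have 1: "act ?h (?x m) \<gamma> = of_int (int (\<gamma> k) - int (\<gamma> k')) * ?x m \<gamma>"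
  using act_cartan[OF kk wittD[OF x]] by simp
 have "?h m = (if m = k then mono (eps k) else 0) - (if m = k' then mono (eps k') else 0)"
  unfolding D_cartan[OF kk] by (simp add: unitv_def)
 then have "act ?x (?h m) = (if m = k then ?x k else 0) - (if m = k' then ?x k' else 0)"
  using kk act_mono_eps[OF x] by (simp add: act_diff_right)
 then have 2: "act ?x (?h m) \<gamma> = (of_bool (m = k) - of_bool (m = k')) * ?x m \<gamma>"
  by (auto simp: of_bool_def)
 show "br ?h ?x m \<gamma> = vf_scale (of_int (int (\<alpha> k) - of_bool (i = k) - of_bool (j = k)
   - int (\<alpha> k') + of_bool (i = k') + of_bool (j = k'))) ?x m \<gamma>"
 proof (cases "?x m \<gamma> = 0")
  case True
  then show ?thesis by (simp add: vf_bracket_def 1 2 vf_scale_def)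
 next
  case False
  then have "(m = i \<and> \<gamma> + eps j = \<alpha>) \<or> (m = j \<and> \<gamma> + eps i = \<alpha>)"
   using ij by (auto simp: dij_def pder_def mono_apply split: if_splits)
  then have "int (\<gamma> k) - int (\<gamma> k') - (of_bool (m = k) - of_bool (m = k')) = int (\<alpha> k) - of_bool (i = k) - of_bool (j = k)
   - int (\<alpha> k') + of_bool (i = k') + of_bool (j = k')" using ij kk by (auto simp: eps_def)
  from arg_cong[OF this, of "of_int :: int \<Rightarrow> 'k"] have
   "of_int (int (\<gamma> k) - int (\<gamma> k')) - (of_bool (m = k) - of_bool (m = k')) = (of_int (int (\<alpha> k) - of_bool (i = k) - of_bool (j = k)
   - int (\<alpha> k') + of_bool (i = k') + of_bool (j = k')) :: 'k)" by simp
  then show ?thesis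
   by (simp only: vf_bracket_def 1 2 vf_scale_def minus_apply left_diff_distrib[symmetric])
 qed
qed

subsection \<open>A basis of the special algebra\<close>

definition bpos :: "nat \<Rightarrow> (nat \<Rightarrow> nat) \<Rightarrow> nat" where
 "bpos m \<beta> = (LEAST l. 1 \<le> l \<and> l \<le> n \<and> l \<noteq> m \<and> \<beta> l + 1 < p)"

text \<open>A pair (m, \<beta>) stands for a leading term x^(\<beta>) D_m. For \<beta>_m \<ge> 1 put
  \<delta> = \<beta> - \<epsilon>_m. Among the terms E_m = x^(\<delta> + \<epsilon>_m) D_m of this
  degree the special algebra contains the differences, and the E_m - E_l with l the least index such
  that \<delta>_l < p - 1 form a basis of these; so m must exceed such an index. If \<beta>_m = 0,
  then x^(\<beta>) D_m is itself divergence-free, and it lies in the derived algebra unless all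
  other \<beta>_l equal p - 1.\<close>

definition bidx :: "(nat \<times> (nat \<Rightarrow> nat)) set" where
 "bidx = {(m, \<beta>). 1 \<le> m \<and> m \<le> n \<and> \<beta> \<in> MI \<and>
   ((\<beta> m \<ge> 1 \<and> (\<exists>l. 1 \<le> l \<and> l < m \<and> \<beta> l + 1 < p)) \<or>
   (\<beta> m = 0 \<and> (\<exists>l. 1 \<le> l \<and> l \<le> n \<and> l \<noteq> m \<and> \<beta> l + 1 < p)))}"

definition bvec :: "nat \<times> (nat \<Rightarrow> nat) \<Rightarrow> 'k vfield" where
 "bvec x = D (fst x) (bpos (fst x) (snd x)) (snd x + eps (bpos (fst x) (snd x)))"

lemma bpos_props:
 assumes "(m, \<beta>) \<in> bidx"
 shows "1 \<le> bpos m \<beta>" "bpos m \<beta> \<le> n" "bpos m \<beta> \<noteq> m" "\<beta> (bpos m \<beta>) + 1 < p"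
  "\<beta> m \<ge> 1 \<Longrightarrow> bpos m \<beta> < m"
  "\<And>l. \<lbrakk>1 \<le> l; l < bpos m \<beta>; l \<noteq> m\<rbrakk> \<Longrightarrow> \<not> \<beta> l + 1 < p"
proof -
 let ?P = "\<lambda>l. 1 \<le> l \<and> l \<le> n \<and> l \<noteq> m \<and> \<beta> l + 1 < p"
 have "\<exists>l. ?P l" using assms unfolding bidx_def by fastforce
 then have P: "?P (bpos m \<beta>)" unfolding bpos_def by (rule LeastI_ex)
 then show "1 \<le> bpos m \<beta>" "bpos m \<beta> \<le> n" "bpos m \<beta> \<noteq> m" "\<beta> (bpos m \<beta>) + 1 < p" by auto
 show "\<not> \<beta> l + 1 < p" if "1 \<le> l" "l < bpos m \<beta>" "l \<noteq> m" for l
  using not_less_Least[of l ?P] that P unfolding bpos_def[symmetric] by auto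
 assume "\<beta> m \<ge> 1"
 then obtain l where l: "1 \<le> l" "l < m" "\<beta> l + 1 < p" and "m \<le> n" using assms unfolding bidx_def by auto
 then have "bpos m \<beta> \<le> l" unfolding bpos_def by (intro Least_le) auto
 with l show "bpos m \<beta> < m" by simp
qed

lemma midx_add_eps: "\<lbrakk>\<beta> \<in> MI; l \<in> {1..n}; \<beta> l + 1 < p\<rbrakk> \<Longrightarrow> \<beta> + eps l \<in> MI"
 unfolding midx_def eps_def by auto

lemma add_eps_minus [simp]: "\<beta> + eps l - eps l = \<beta>"
 by (auto simp: fun_eq_iff)

lemma pder_mono_add: "\<beta> + eps l \<in> MI \<Longrightarrow> pder l (mono (\<beta> + eps l)) = mono \<beta>"
 by (simp add: pder_mono) (simp add: eps_def)

text \<open>Each basis vector is its leading term minus at most one other term, which sits at the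
  least admissible index. That term cannot be a leading term, since a pair in \<open>bidx\<close>
  with \<beta>_m \<ge> 1 has m above an admissible index. So reading off leading coefficients gives
  functionals dual to the basis.\<close>

lemma bvec_dual:
 assumes x: "(m, \<beta>) \<in> bidx" and y: "(m', \<beta>') \<in> bidx"
 shows "bvec (m', \<beta>') m \<beta> = of_bool ((m', \<beta>') = (m, \<beta>))"
proof -
 define l where "l = bpos m' \<beta>'"
 note lp = bpos_props[OF y, folded l_def]
 have y': "1 \<le> m'" "m' \<le> n" "\<beta>' \<in> MI" using y by (auto simp: bidx_def)
 have mi: "\<beta>' + eps l \<in> MI" using lp y' by (intro midx_add_eps) auto
 have "bvec (m', \<beta>') m = (if m = m' then mono \<beta>' else 0) - (if m = l then pder m' (mono (\<beta>' + eps l)) else 0)"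
  unfolding bvec_def fst_conv snd_conv l_def[symmetric] by (simp add: dij_def pder_mono_add[OF mi])
 moreover have "\<not> (m = l \<and> pder m' (mono (\<beta>' + eps l)) \<beta> \<noteq> 0)"
 proof
  assume ml: "m = l \<and> pder m' (mono (\<beta>' + eps l)) \<beta> \<noteq> 0"
  then have eq: "\<beta> + eps m' = \<beta>' + eps l" by (auto simp: pder_def mono_apply split: if_splits)
  then have e: "\<beta> i + eps m' i = \<beta>' i + eps l i" for i by (metis plus_fun_apply)
  have "\<beta>' m' \<ge> 1" using e[of m'] lp(3) by (auto simp: eps_def)
  from lp(5)[OF this] have lm: "l < m'" .
  have "\<beta> l \<ge> 1" using e[of l] lp(3) by (auto simp: eps_def)
  then obtain l2 where l2: "1 \<le> l2" "l2 < l" "\<beta> l2 + 1 < p"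
   using x ml by (auto simp: bidx_def)
  then have "\<beta>' l2 + 1 < p" using e[of l2] lm by (auto simp: eps_def)
  then show False using lp(6)[of l2] l2 lm by auto
 qed
 ultimately show ?thesis using y'(3) by (auto simp: mono_apply)
qed

lemma bvec_mem:
 assumes "x \<in> bidx"
 obtains i j \<alpha> where "bvec x = D i j \<alpha>" "i \<in> {1..n}" "j \<in> {1..n}" "i \<noteq> j" "\<alpha> \<in> MI"
proof -
 obtain m \<beta> where x: "x = (m, \<beta>)" "(m, \<beta>) \<in> bidx" using assms by (cases x) auto
 note lp = bpos_props[OF x(2)]
 have "\<beta> + eps (bpos m \<beta>) \<in> MI" using lp x by (intro midx_add_eps) (auto simp: bidx_def)
 then show thesis
  using that[of m "bpos m \<beta>" "\<beta> + eps (bpos m \<beta>)"] lp x by (auto simp: bvec_def bidx_def)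
qed

text \<open>If \<alpha>_i or \<alpha>_j is 0, at most one term is left, and up to sign it is a basis
  vector. Otherwise D_ij(x^\<alpha>) = E_i - E_j with both terms of degree \<delta> = \<alpha> -
  \<epsilon>_i - \<epsilon>_j, and each is compared with the term at the least admissible
  index.\<close>

lemma D_in_span_bvec:
 assumes i: "i \<in> {1..n}" and j: "j \<in> {1..n}" and ij: "i \<noteq> j" and \<alpha>: "\<alpha> \<in> MI"
 shows "D i j \<alpha> \<in> V.span (bvec ` bidx)"
proof -
 have one: "D i j \<alpha> \<in> V.span (bvec ` bidx)"
  if i: "i \<in> {1..n}" and j: "j \<in> {1..n}" and ij: "i \<noteq> j" and ai: "\<alpha> i = 0" and aj: "\<alpha> j \<noteq> 0" for i j
 proof -
  define \<beta> where "\<beta> = \<alpha> - eps j"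
  have bm: "\<beta> \<in> MI" unfolding \<beta>_def by (rule midx_le[OF \<alpha>]) (simp add: le_fun_def)
  have bj: "\<beta> j + 1 < p" using midx_bound[OF \<alpha>, of j] aj by (simp add: \<beta>_def eps_def)
  have bi: "\<beta> i = 0" using ai by (simp add: \<beta>_def)
  have mem: "(i, \<beta>) \<in> bidx" unfolding bidx_def using i j ij bm bi bj by auto
  note lp = bpos_props[OF mem]
  have mi: "\<beta> + eps (bpos i \<beta>) \<in> MI" using lp bm by (intro midx_add_eps) auto
  have "pder i (mono (\<beta> + eps (bpos i \<beta>))) = 0"
  proof -
   have "(\<beta> + eps (bpos i \<beta>)) i = 0" using lp(3) bi by (simp add: eps_def)
   then show ?thesis unfolding pder_mono[OF mi] by (rule if_P)
  qed
  then have "bvec (i, \<beta>) = unitv i (mono \<beta>)"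
   using lp(3) by (simp add: bvec_def dij_unitv pder_mono_add[OF mi]) (simp add: unitv_def fun_eq_iff)
  also have "\<dots> = D i j \<alpha>"
   using ai aj ij by (simp add: dij_unitv pder_mono[OF \<alpha>] \<beta>_def) (simp add: unitv_def fun_eq_iff)
  finally have "D i j \<alpha> = bvec (i, \<beta>)" ..
  with mem show ?thesis by (auto intro: V.span_base)
 qed
 consider "\<alpha> i = 0" "\<alpha> j = 0" | "\<alpha> i = 0" "\<alpha> j \<noteq> 0" | "\<alpha> i \<noteq> 0" "\<alpha> j = 0" | "\<alpha> i \<noteq> 0" "\<alpha> j \<noteq> 0" by blast
 then show ?thesis
 proof cases
  case 1
  then have "D i j \<alpha> = 0" using ij by (simp add: dij_unitv pder_mono[OF \<alpha>]) (simp add: unitv_def fun_eq_iff)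
  then show ?thesis by (metis V.span_zero)
 next
  case 2
  then show ?thesis by (intro one i j ij)
 next
  case 3
  have "D i j \<alpha> = - D j i \<alpha>" by (rule dij_swap)
  then show ?thesis using one[OF j i] ij 3 by (metis V.span_neg)
 next
  case 4
  define \<delta> where "\<delta> = \<alpha> - eps i - eps j"
  define E where "E m = unitv m (mono (\<delta> + eps m))" for m
  define M where "M = {l \<in> {1..n}. \<delta> l + 1 < p}"
  define l0 where "l0 = (LEAST l. l \<in> M)"
  have al: "\<alpha> m < p" for m using \<alpha> by (rule midx_bound)
  have iM: "i \<in> M" and jM: "j \<in> M"
   using 4 i j ij al[of i] al[of j] by (auto simp: M_def \<delta>_def eps_def)
  have l0: "l0 \<in> M" unfolding l0_def using iM by (rule LeastI)
  have l0min: "l \<in> M \<Longrightarrow> l0 \<le> l" for l unfolding l0_def by (rule Least_le)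
  have dm: "\<delta> \<in> MI" unfolding \<delta>_def by (rule midx_le[OF \<alpha>]) (simp add: le_fun_def)
  have E: "E m - E l0 \<in> V.span (bvec ` bidx)" if m: "m \<in> M" for m
  proof (cases "m = l0")
   case True
   then have "E m - E l0 = 0" by simp
   then show ?thesis by (metis V.span_zero)
  next
   case False
   then have lm: "l0 < m" using l0min[OF m] by simp
   define \<beta> where "\<beta> = \<delta> + eps m"
   have bm: "\<beta> \<in> MI" unfolding \<beta>_def using m dm by (intro midx_add_eps) (auto simp: M_def)
   have bl: "l \<noteq> m \<Longrightarrow> \<beta> l = \<delta> l" for l by (simp add: \<beta>_def eps_def)
   have bl0: "\<beta> l0 + 1 < p" using l0 bl[of l0] False by (auto simp: M_def)
   have mem: "(m, \<beta>) \<in> bidx"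
    unfolding bidx_def using m l0 lm bm bl0 by (auto simp: M_def \<beta>_def eps_def)
   have pos: "bpos m \<beta> = l0"
    unfolding bpos_def
   proof (rule Least_equality)
    show "1 \<le> l0 \<and> l0 \<le> n \<and> l0 \<noteq> m \<and> \<beta> l0 + 1 < p" using l0 False bl0 by (auto simp: M_def)
    fix l assume "1 \<le> l \<and> l \<le> n \<and> l \<noteq> m \<and> \<beta> l + 1 < p"
    then have "l \<in> M" using bl[of l] by (auto simp: M_def)
    then show "l0 \<le> l" by (rule l0min)
   qed
   have mi: "\<beta> + eps l0 \<in> MI" using l0 bm bl0 by (intro midx_add_eps) (auto simp: M_def)
   have mi': "\<delta> + eps l0 + eps m \<in> MI" using mi by (simp add: \<beta>_def add_ac)
   have "bvec (m, \<beta>) = unitv m (pder l0 (mono (\<beta> + eps l0))) - unitv l0 (pder m (mono (\<beta> + eps l0)))"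
    using False by (simp add: bvec_def pos dij_unitv)
   also have "pder m (mono (\<beta> + eps l0)) = mono (\<delta> + eps l0)"
    using pder_mono_add[OF mi'] by (simp add: \<beta>_def add_ac)
   also have "pder l0 (mono (\<beta> + eps l0)) = mono (\<delta> + eps m)"
    using pder_mono_add[OF mi] by (simp add: \<beta>_def)
   finally have "bvec (m, \<beta>) = E m - E l0" unfolding E_def .
   with mem show ?thesis by (metis V.span_base imageI)
  qed
  have "\<delta> + eps i = \<alpha> - eps j" "\<delta> + eps j = \<alpha> - eps i"
   using 4 ij by (auto simp: \<delta>_def eps_def fun_eq_iff)
  then have "D i j \<alpha> = E i - E j"
   using 4 ij by (simp add: dij_unitv pder_mono[OF \<alpha>] E_def)
  also have "\<dots> = (E i - E l0) - (E j - E l0)" by simp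
  finally show ?thesis using V.span_diff[OF E[OF iM] E[OF jM]] by simp
 qed
qed

lemma L_eq_span_bvec: "L = V.span (bvec ` bidx)"
proof
 show "L \<subseteq> V.span (bvec ` bidx)"
  unfolding L_eq_span by (rule V.span_minimal) (auto simp: gens_def intro!: D_in_span_bvec)
 show "V.span (bvec ` bidx) \<subseteq> L"
 proof (rule V.span_minimal[OF _ subspace_L])
  show "bvec ` bidx \<subseteq> L" using D_in_L by (auto elim!: bvec_mem)
 qed
qed

lemma finite_bidx [simp]: "finite bidx"
 by (rule finite_subset[of _ "{1..n} \<times> MI"]) (auto simp: bidx_def)

text \<open>The complement of \<open>bidx\<close> in all pairs is counted. \<open>XX\<close> has one
  pair for each degree \<delta> \<noteq> \<tau>, the term at the least admissible index, and
  \<open>Y\<close> one pair for each m, the divergence-free term with all other exponents p - 1.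
  This leaves n p^n - (p^n - 1) - n = (n - 1)(p^n - 1).\<close>

lemma card_bidx: "card bidx = (n - 1) * (p ^ n - 1)"
proof -
 define \<tau> where "\<tau> = (\<lambda>i. if i \<in> {1..n} then p - 1 else 0)"
 define Y where "Y = (\<lambda>m. (m, \<tau> - (\<lambda>i. if i = m then p - 1 else 0))) ` {1..n}"
 define lp where "lp \<delta> = (LEAST l. l \<in> {1..n} \<and> \<delta> l + 1 < p)" for \<delta> :: "nat \<Rightarrow> nat"
 define XX where "XX = (\<lambda>\<delta>. (lp \<delta>, \<delta> + eps (lp \<delta>))) ` (MI - {\<tau>})"
 have tau: "\<tau> \<in> MI" by (auto simp: \<tau>_def midx_def)
 have lp: "lp \<delta> \<in> {1..n}" "\<delta> (lp \<delta>) + 1 < p" "\<And>l. \<lbrakk>1 \<le> l; l < lp \<delta>\<rbrakk> \<Longrightarrow> \<not> \<delta> l + 1 < p"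
  if d: "\<delta> \<in> MI - {\<tau>}" for \<delta>
 proof -
  have "\<exists>l. l \<in> {1..n} \<and> \<delta> l + 1 < p"
  proof (rule ccontr)
   assume a: "\<not> ?thesis"
   have "\<delta> = \<tau>"
   proof
    fix l
    have "\<delta> l < p" using d midx_bound by blast
    then show "\<delta> l = \<tau> l"
     using a d by (cases "l \<in> {1..n}") (auto simp: \<tau>_def midx_def)
   qed
   with d show False by simp
  qed
  then have "lp \<delta> \<in> {1..n} \<and> \<delta> (lp \<delta>) + 1 < p" unfolding lp_def by (rule LeastI_ex)
  then show 1: "lp \<delta> \<in> {1..n}" "\<delta> (lp \<delta>) + 1 < p" by auto
  show "\<not> \<delta> l + 1 < p" if "1 \<le> l" "l < lp \<delta>" for l
   using not_less_Least[of l "\<lambda>l. l \<in> {1..n} \<and> \<delta> l + 1 < p"] that 1 unfolding lp_def[symmetric] by auto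
 qed
 have XX_mem: "(m, \<beta>) \<in> XX \<longleftrightarrow> m \<in> {1..n} \<and> \<beta> \<in> MI \<and> \<beta> m \<ge> 1 \<and> (\<forall>l. 1 \<le> l \<and> l < m \<longrightarrow> \<not> \<beta> l + 1 < p)" for m \<beta>
 proof
  assume "(m, \<beta>) \<in> XX"
  then obtain \<delta> where d: "\<delta> \<in> MI - {\<tau>}" "m = lp \<delta>" "\<beta> = \<delta> + eps m" by (auto simp: XX_def)
  show "m \<in> {1..n} \<and> \<beta> \<in> MI \<and> \<beta> m \<ge> 1 \<and> (\<forall>l. 1 \<le> l \<and> l < m \<longrightarrow> \<not> \<beta> l + 1 < p)"
   using lp[OF d(1)] d midx_add_eps[of \<delta> m] by (auto simp: eps_def)
 next
  assume a: "m \<in> {1..n} \<and> \<beta> \<in> MI \<and> \<beta> m \<ge> 1 \<and> (\<forall>l. 1 \<le> l \<and> l < m \<longrightarrow> \<not> \<beta> l + 1 < p)"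
  define \<delta> where "\<delta> = \<beta> - eps m"
  have b: "\<beta> = \<delta> + eps m" using a by (auto simp: \<delta>_def eps_def fun_eq_iff)
  have dm: "\<delta> \<in> MI" unfolding \<delta>_def by (rule midx_le[of \<beta>]) (use a in \<open>auto simp: le_fun_def\<close>)
  have bp: "\<delta> m + 1 < p" using midx_bound[of \<beta> m] a by (simp add: \<delta>_def eps_def)
  then have "\<delta> \<noteq> \<tau>" using a by (auto simp: \<tau>_def)
  moreover have "lp \<delta> = m"
   unfolding lp_def
  proof (rule Least_equality)
   show "m \<in> {1..n} \<and> \<delta> m + 1 < p" using a bp by simp
   fix l assume l: "l \<in> {1..n} \<and> \<delta> l + 1 < p"
   show "m \<le> l"
   proof (rule ccontr)
    assume "\<not> m \<le> l"
    then have "\<beta> l = \<delta> l" by (simp add: \<delta>_def eps_def)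
    then show False using a l \<open>\<not> m \<le> l\<close> by auto
   qed
  qed
  ultimately show "(m, \<beta>) \<in> XX" unfolding XX_def using dm b by force
 qed
 have Y_mem: "(m, \<beta>) \<in> Y \<longleftrightarrow> m \<in> {1..n} \<and> \<beta> \<in> MI \<and> \<beta> m = 0 \<and> (\<forall>l. 1 \<le> l \<and> l \<le> n \<and> l \<noteq> m \<longrightarrow> \<not> \<beta> l + 1 < p)" for m \<beta>
 proof
  assume "(m, \<beta>) \<in> Y"
  then show "m \<in> {1..n} \<and> \<beta> \<in> MI \<and> \<beta> m = 0 \<and> (\<forall>l. 1 \<le> l \<and> l \<le> n \<and> l \<noteq> m \<longrightarrow> \<not> \<beta> l + 1 < p)"
   by (auto simp: Y_def \<tau>_def midx_def)
 next
  assume a: "m \<in> {1..n} \<and> \<beta> \<in> MI \<and> \<beta> m = 0 \<and> (\<forall>l. 1 \<le> l \<and> l \<le> n \<and> l \<noteq> m \<longrightarrow> \<not> \<beta> l + 1 < p)"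
  have "\<beta> = \<tau> - (\<lambda>i. if i = m then p - 1 else 0)"
  proof
   fix l
   have "\<beta> l < p" using a midx_bound by blast
   then show "\<beta> l = (\<tau> - (\<lambda>i. if i = m then p - 1 else 0)) l"
    using a by (cases "l \<in> {1..n}"; cases "l = m") (auto simp: \<tau>_def midx_def)
  qed
  then show "(m, \<beta>) \<in> Y" unfolding Y_def using a by auto
 qed
 have split: "{1..n} \<times> MI = bidx \<union> (XX \<union> Y)" "bidx \<inter> (XX \<union> Y) = {}" "XX \<inter> Y = {}"
 proof -
  show "{1..n} \<times> MI = bidx \<union> (XX \<union> Y)"
  proof (intro equalityI subsetI)
   fix x assume "x \<in> {1..n} \<times> MI"
   then obtain m \<beta> where x: "x = (m, \<beta>)" "m \<in> {1..n}" "\<beta> \<in> MI" by blast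
   show "x \<in> bidx \<union> (XX \<union> Y)"
    unfolding x(1) Un_iff XX_mem Y_mem using x by (cases "\<beta> m") (auto simp: bidx_def)
  next
   fix x assume "x \<in> bidx \<union> (XX \<union> Y)"
   then show "x \<in> {1..n} \<times> MI"
    by (cases x) (use XX_mem Y_mem in \<open>auto simp: bidx_def\<close>)
  qed
  show "bidx \<inter> (XX \<union> Y) = {}"
  proof (rule ccontr)
   assume "bidx \<inter> (XX \<union> Y) \<noteq> {}"
   then obtain m \<beta> where "(m, \<beta>) \<in> bidx" "(m, \<beta>) \<in> XX \<or> (m, \<beta>) \<in> Y" by auto
   then show False unfolding XX_mem Y_mem bidx_def by (auto dest: not_less_eq_eq[THEN iffD1])
  qed
  show "XX \<inter> Y = {}"
   using XX_mem Y_mem by fastforce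
 qed
 have "inj_on (\<lambda>\<delta>. (lp \<delta>, \<delta> + eps (lp \<delta>))) (MI - {\<tau>})"
  by (rule inj_onI) auto
 then have cX: "card XX = p ^ n - 1"
  unfolding XX_def using tau by (simp add: card_image card_midx)
 have cY: "card Y = n"
  unfolding Y_def by (subst card_image) (auto intro: inj_onI)
 have fin: "finite XX" "finite Y" by (auto simp: XX_def Y_def)
 have "n * p ^ n = card bidx + (p ^ n - 1 + n)"
  using arg_cong[OF split(1), of card] split(2,3) fin cX cY
  by (simp add: card_Un_disjoint card_cartesian_product card_midx)
 moreover have "p ^ n \<ge> 1" using p_pos by simp
 moreover have "n * p ^ n = (n - 1) * (p ^ n - 1) + (p ^ n - 1 + n)"
 proof (cases n)
  case (Suc m)
  obtain N where "p ^ n = Suc N" using \<open>p ^ n \<ge> 1\<close> by (cases "p ^ n") auto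
  then show ?thesis using Suc by (simp add: algebra_simps)
 qed (simp)
 ultimately show ?thesis by linarith
qed

end

section \<open>Sums over residues\<close>

lemma additive_finsum:
 assumes "abelian_group G" "abelian_group H" and cl: "\<And>x. x \<in> carrier G \<Longrightarrow> \<phi> x \<in> carrier H"
  and add: "\<And>x y. \<lbrakk>x \<in> carrier G; y \<in> carrier G\<rbrakk> \<Longrightarrow> \<phi> (x \<oplus>\<^bsub>G\<^esub> y) = \<phi> x \<oplus>\<^bsub>H\<^esub> \<phi> y"
  and g: "g \<in> I \<rightarrow> carrier G"
 shows "\<phi> (\<Oplus>\<^bsub>G\<^esub>i\<in>I. g i) = (\<Oplus>\<^bsub>H\<^esub>i\<in>I. \<phi> (g i))"
proof -
 interpret G: abelian_group G by fact
 interpret H: abelian_group H by fact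
 have z: "\<phi> \<zero>\<^bsub>G\<^esub> = \<zero>\<^bsub>H\<^esub>"
  using add[of "\<zero>\<^bsub>G\<^esub>" "\<zero>\<^bsub>G\<^esub>"] cl[of "\<zero>\<^bsub>G\<^esub>"] by (metis G.r_zero G.zero_closed H.add.l_cancel_one')
 show ?thesis using g
  by (induction I rule: infinite_finite_induct) (auto simp: z add cl Pi_def)
qed

context abelian_group
begin

lemma add_cancels:
 "\<lbrakk>x \<in> carrier G; a \<in> carrier G; b \<in> carrier G\<rbrakk> \<Longrightarrow> x \<oplus> (a \<oplus> (\<ominus> x \<oplus> b)) = a \<oplus> b"
 "\<lbrakk>x \<in> carrier G; a \<in> carrier G; b \<in> carrier G\<rbrakk> \<Longrightarrow> \<ominus> x \<oplus> (a \<oplus> (x \<oplus> b)) = a \<oplus> b"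
 "\<lbrakk>x \<in> carrier G; a \<in> carrier G\<rbrakk> \<Longrightarrow> x \<oplus> (a \<oplus> \<ominus> x) = a"
 "\<lbrakk>x \<in> carrier G; a \<in> carrier G\<rbrakk> \<Longrightarrow> \<ominus> x \<oplus> (a \<oplus> x) = a"
 "x \<in> carrier G \<Longrightarrow> x \<oplus> \<ominus> x = \<zero>"
 "x \<in> carrier G \<Longrightarrow> \<ominus> x \<oplus> x = \<zero>"
 "\<lbrakk>x \<in> carrier G; a \<in> carrier G\<rbrakk> \<Longrightarrow> x \<oplus> (\<ominus> x \<oplus> a) = a"
 "\<lbrakk>x \<in> carrier G; a \<in> carrier G\<rbrakk> \<Longrightarrow> \<ominus> x \<oplus> (x \<oplus> a) = a"
 using a_lcomm[of x a] a_lcomm[of "\<ominus> x" a] by (simp_all add: r_neg l_neg r_neg1 r_neg2)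

lemma finsum_telescope:
 assumes "\<And>l. b l \<in> carrier G" "b 0 = \<zero>" "b m = \<zero>"
 shows "(\<Oplus>l\<in>{..<m}. b (Suc l)) = (\<Oplus>l\<in>{..<m}. b l)"
proof (cases m)
 case (Suc k)
 then have "(\<Oplus>l\<in>{..k}. b (Suc l)) \<oplus> b 0 = b (Suc k) \<oplus> (\<Oplus>l\<in>{..k}. b l)"
  using assms(1) finsum_Suc2[of b k] finsum_Suc[of b k] by (simp add: Pi_def)
 then show ?thesis using assms Suc by (simp add: lessThan_Suc_atMost)
qed simp

text \<open>Functions on Z/p are modelled by p-periodic functions on the integers, so that index
  arithmetic stays in the integers while sums over {0..<p} may be shifted and reflected.\<close>

definition per :: "nat \<Rightarrow> (int \<Rightarrow> 'a) \<Rightarrow> bool" where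
 "per p f \<longleftrightarrow> (\<forall>z. f (z + int p) = f z)"

lemma per_cong:
 assumes "per p f" "[z = w] (mod int p)" shows "f z = f w"
proof -
 have nat: "f (z + int p * int m) = f z" for z m
 proof (induction m)
  case (Suc m)
  have "f (z + int p * int (Suc m)) = f ((z + int p * int m) + int p)" by (simp add: algebra_simps)
  then show ?case using assms(1) Suc by (simp add: per_def)
 qed simp
 obtain k where k: "z = w + int p * k" using assms(2) by (metis cong_iff_lin cong_sym)
 show ?thesis
 proof (cases "k \<ge> 0")
  case True
  then show ?thesis using nat[of w "nat k"] k by simp
 next
  case False
  then have "w = z + int p * int (nat (- k))" using k by (simp add: algebra_simps)
  then show ?thesis using nat[of z "nat (- k)"] by simp
 qed
qed

lemma finsum_per_shift:
 assumes f: "per p f" "\<And>z. f z \<in> carrier G" and p: "p > 0"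
 shows "(\<Oplus>z\<in>{0..<int p}. f (z + a)) = (\<Oplus>z\<in>{0..<int p}. f z)"
proof -
 let ?h = "\<lambda>z. (z + a) mod int p"
 have inj: "inj_on ?h {0..<int p}"
 proof (rule inj_onI)
  fix x y assume xy: "x \<in> {0..<int p}" "y \<in> {0..<int p}" "?h x = ?h y"
  then have "[x = y] (mod int p)" by (simp add: cong_def[symmetric] cong_add_rcancel)
  then show "x = y" using xy by (simp add: cong_def)
 qed
 have "?h ` {0..<int p} \<subseteq> {0..<int p}" using p by auto
 then have im: "?h ` {0..<int p} = {0..<int p}"
  using inj by (intro endo_inj_surj) auto
 have "(\<Oplus>z\<in>{0..<int p}. f z) = (\<Oplus>z\<in>?h ` {0..<int p}. f z)" by (simp only: im)
 also have "\<dots> = (\<Oplus>z\<in>{0..<int p}. f (?h z))"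
  using f by (intro finsum_reindex inj) auto
 also have "\<dots> = (\<Oplus>z\<in>{0..<int p}. f (z + a))"
  using f by (intro finsum_cong') (auto intro: per_cong)
 finally show ?thesis ..
qed

lemma finsum_per_single:
 assumes f: "per p f" "\<And>z. f z \<in> carrier G" and p: "p > 0"
 shows "(\<Oplus>z\<in>{0..<int p}. if [z = a] (mod int p) then f z else \<zero>) = f a"
proof -
 have "(\<Oplus>z\<in>{0..<int p}. if [z = a] (mod int p) then f z else \<zero>) = (\<Oplus>z\<in>{0..<int p}. if z = a mod int p then f z else \<zero>)"
  using f by (intro finsum_cong') (auto simp: cong_def)
 also have "\<dots> = f (a mod int p)"
  using f p by (intro add.finprod_singleton_swap) auto
 also have "\<dots> = f a" using f by (intro per_cong[of p]) auto
 finally show ?thesis .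
qed

end

lemma prime_CHAR_field:
 assumes "CHAR('k::field) = p" "p > 0" shows "Factorial_Ring.prime p"
 unfolding assms(1)[symmetric] by (rule prime_CHAR_semidom) (use assms in simp)

lemma of_int_power_CHAR:
 fixes z :: int
 assumes "CHAR('k::field) = p" "p > 0"
 shows "of_int z ^ p = (of_int z :: 'k)"
proof -
 note pr = prime_CHAR_field[OF assms]
 have fd: "(x + y) ^ p = x ^ p + y ^ p" for x y :: 'k
  by (rule freshmans_dream) (simp_all add: assms pr)
 have nat: "of_nat m ^ p = (of_nat m :: 'k)" for m
  using assms(2) by (induction m) (simp_all add: fd)
 have "z + int (nat (- z)) = int (nat z)" by simp
 then have "of_int (z + int (nat (- z))) = (of_int (int (nat z)) :: 'k)" by (rule arg_cong)
 then have "of_int z + of_nat (nat (- z)) = (of_nat (nat z) :: 'k)" by (simp only: of_int_add of_int_of_nat_eq)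
 then have "(of_int z + of_nat (nat (- z))) ^ p = (of_nat (nat z) ^ p :: 'k)" by simp
 then have "of_int z ^ p + of_nat (nat (- z)) = (of_nat (nat z) :: 'k)"
  unfolding fd nat .
 then show ?thesis by (cases "z \<ge> 0") (auto simp: of_nat_nat add_eq_0_iff2 eq_neg_iff_add_eq_0)
qed

section \<open>The idempotents of a toral element\<close>

text \<open>Lagrange interpolation on the prime field: \<open>1 - (X - z)\<^sup>p\<^sup>-\<^sup>1\<close> is the indicator of \<open>z\<close>.\<close>

definition lagr :: "nat \<Rightarrow> int \<Rightarrow> 'k::field poly" where
 "lagr p z = 1 - [:- of_int z, 1:] ^ (p - 1)"

lemma poly_lagr:
 assumes "CHAR('k::field) = p" "p > 0"
 shows "poly (lagr p z) (of_int w) = (of_bool ([z = w] (mod int p)) :: 'k)"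
proof -
 have p: "p > 1" using prime_CHAR_field[OF assms] by (rule prime_gt_1_nat)
 let ?c = "of_int (w - z) :: 'k"
 have v: "poly (lagr p z) (of_int w) = 1 - ?c ^ (p - 1)"
  by (simp add: lagr_def)
 have iff: "?c = 0 \<longleftrightarrow> [z = w] (mod int p)"
 proof -
  have "?c = 0 \<longleftrightarrow> of_int z = (of_int w :: 'k)" by auto
  then show ?thesis using of_int_eq_iff_cong_CHAR[of z w, where ?'a = 'k] assms by simp
 qed
 have "?c * ?c ^ (p - 1) = ?c" using of_int_power_CHAR[OF assms, of "w - z"] p by (metis power_eq_if not_one_less_zero)
 then have "?c \<noteq> 0 \<Longrightarrow> ?c ^ (p - 1) = 1" by simp
 then show ?thesis using v iff p by (cases "?c = 0") (auto simp: power_0_left)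
qed

text \<open>The difference of both sides has degree below p and vanishes on the p elements of the
  prime field.\<close>

lemma sum_lagr:
 assumes "CHAR('k::field) = p" "p > 0"
 shows "(\<Sum>z\<in>{0..<int p}. lagr p z) = (1 :: 'k poly)"
proof (rule ccontr)
 let ?f = "(\<Sum>z\<in>{0..<int p}. lagr p z) - (1 :: 'k poly)"
 assume "(\<Sum>z\<in>{0..<int p}. lagr p z) \<noteq> (1 :: 'k poly)"
 then have nz: "?f \<noteq> 0" by simp
 have "degree (lagr p z :: 'k poly) \<le> p - 1" for z
  unfolding lagr_def by (intro degree_diff_le order.trans[OF degree_power_le]) auto
 then have deg: "degree ?f \<le> p - 1"
  by (intro degree_diff_le degree_sum_le) auto
 have root: "poly ?f (of_int w) = 0" for w
 proof -
  have "(\<Sum>z\<in>{0..<int p}. of_bool ([z = w] (mod int p)) :: 'k) = (\<Sum>z\<in>{0..<int p}. if z = w mod int p then 1 else 0)"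
   by (intro sum.cong) (auto simp: cong_def)
  also have "\<dots> = 1" using assms by simp
  finally show ?thesis by (simp add: poly_sum poly_lagr[OF assms])
 qed
 have "inj_on (of_int :: int \<Rightarrow> 'k) {0..<int p}"
  using of_int_eq_iff_cong_CHAR[where ?'a = 'k] assms by (auto intro!: inj_onI simp: cong_def)
 then have "int p = int (card ((of_int :: int \<Rightarrow> 'k) ` {0..<int p}))" by (simp add: card_image)
 also have "\<dots> \<le> int (card {x. poly ?f x = 0})"
  using root poly_roots_finite[OF nz] by (intro of_nat_mono card_mono) auto
 also have "\<dots> \<le> int (p - 1)"
  using card_poly_roots_bound[OF nz] deg by linarith
 finally show False using assms by simp
qed

lemma (in poly_evaluation) ev_sum: "ev (sum f S) = (\<Oplus>\<^bsub>C\<^esub>s\<in>S. ev (f s))"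
 by (induction S rule: infinite_finite_induct) (auto simp: ev_add)

lemma poly_ev_hom:
 assumes "poly_evaluation C c b" "poly_evaluation C' c' b'" "f \<in> ring_hom C C'" "\<And>s. f (c s) = c' s" "f b = b'"
 shows "f (poly_ev C c b g) = poly_ev C' c' b' g"
proof -
 interpret C: poly_evaluation C c b by fact
 interpret C': poly_evaluation C' c' b' by fact
 interpret f: ring_hom_ring C C' f by unfold_locales fact
 show ?thesis by (induction g) (simp_all add: assms)
qed

context charp_algebra
begin

lemma kappa_of_int_add_pow: "add_pow C (z::int) \<one>\<^bsub>C\<^esub> = \<kappa> (of_int z)"
proof -
 have nat: "add_pow C (m::nat) \<one>\<^bsub>C\<^esub> = \<kappa> (of_nat m)" for m
  by (induction m) (simp_all add: kappa_add C.add.nat_pow_Suc C.a_comm)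
 show ?thesis
 proof (cases "z \<ge> 0")
  case True
  then show ?thesis using nat[of "nat z"] by (simp add: add_pow_int_ge)
 next
  case False
  then show ?thesis using nat[of "nat (- z)"] kappa_uminus[of "of_int (- z)"] by (simp add: add_pow_int_lt)
 qed
qed

lemma of_int_per: "of_int (z + int p) = (of_int z :: 'k)"
 using char_p by (metis add.right_neutral of_int_add of_int_of_nat_eq of_nat_CHAR)

end

locale cartan_nilpotent = charp_algebra C \<kappa> p
 for C :: "('c, 'm) ring_scheme" (structure) and \<kappa> :: "'k::field \<Rightarrow> 'c" and p +
 fixes h e t :: 'c
 assumes h_closed [simp]: "h \<in> carrier C" and e_closed [simp]: "e \<in> carrier C" and t_closed [simp]: "t \<in> carrier C"
  and t_central: "x \<in> carrier C \<Longrightarrow> t \<otimes> x = x \<otimes> t"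
  and h_pow: "h [^] p = h" and e_pow: "e [^] p = \<zero>" and he: "h \<otimes> e = e \<otimes> h \<oplus> e"
begin

declare pow_nat [simp del]

sublocale E: poly_evaluation C \<kappa> h
 by (rule poly_evaluation) simp

abbreviation "Zp \<equiv> {0..<int p}"

definition pj :: "int \<Rightarrow> 'c" where "pj z = E.ev (lagr p z)"

lemma pj_closed [simp, intro]: "pj z \<in> carrier C"
 by (simp add: pj_def)

lemma kappa_lcomm: "\<lbrakk>x \<in> carrier C; y \<in> carrier C\<rbrakk> \<Longrightarrow> x \<otimes> (\<kappa> s \<otimes> y) = \<kappa> s \<otimes> (x \<otimes> y)"
 by (metis C.m_assoc kappa_central kappa_closed)

text \<open>By Frobenius and Fermat (X - z)(1 - (X - z)^(p-1)) = (X - z) - (X^p - z) = X - X^p, and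
  this is 0 at h.\<close>

lemma h_pj: "h \<otimes> pj z = \<kappa> (of_int z) \<otimes> pj z"
proof -
 let ?q = "[:- of_int z, 1:] :: 'k poly"
 have "?q ^ p = ([:0, 1:] + [:- of_int z:]) ^ p" by simp
 also have "\<dots> = [:0, 1:] ^ p + [:- of_int z:] ^ p"
  by (rule freshmans_dream) (simp_all add: char_p prime_p)
 also have "[:- of_int z:] ^ p = [:- of_int z :: 'k:]"
  using of_int_power_CHAR[OF char_p p_pos, of "- z"] by (simp add: poly_const_pow)
 finally have q: "?q ^ p = [:0, 1:] ^ p + [:- of_int z:]" .
 have "?q * lagr p z = ?q - ?q ^ p"
  using p_pos by (simp add: lagr_def algebra_simps power_eq_if)
 also have "\<dots> = [:0, 1:] - [:0, 1:] ^ p" unfolding q by simp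
 finally have "E.ev (?q * lagr p z) = E.ev [:0, 1:] \<ominus> E.ev [:0, 1:] [^] p"
  by (simp only: E.ev_diff E.ev_power)
 also have "\<dots> = \<zero>" by (simp add: h_pow a_minus_def C.r_neg)
 finally have "E.ev ?q \<otimes> pj z = \<zero>" unfolding E.ev_mult pj_def .
 moreover have "E.ev ?q = \<kappa> (- of_int z) \<oplus> h" by simp
 ultimately have "(\<kappa> (- of_int z) \<oplus> h) \<otimes> pj z = \<zero>" by (simp only:)
 then have "\<ominus> (\<kappa> (of_int z) \<otimes> pj z) \<oplus> h \<otimes> pj z = \<zero>"
  by (simp add: C.l_distr kappa_uminus C.l_minus)
 then show ?thesis
  using C.minus_equality[of "h \<otimes> pj z" "\<ominus> (\<kappa> (of_int z) \<otimes> pj z)"] C.a_comm by (metis C.a_inv_closed C.m_closed C.minus_equality C.minus_minus h_closed kappa_closed pj_closed)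
qed

lemma pj_eigen:
 assumes "v \<in> carrier C" "h \<otimes> v = \<kappa> (of_int w) \<otimes> v"
 shows "pj z \<otimes> v = (if [z = w] (mod int p) then v else \<zero>)"
 unfolding pj_def E.ev_eigenvector[OF assms] poly_lagr[OF char_p p_pos] using assms by simp

lemma pj_mult: "pj z \<otimes> pj w = (if [z = w] (mod int p) then pj w else \<zero>)"
 by (rule pj_eigen) (simp_all add: h_pj)

lemma pj_per: "C.per p pj"
 unfolding C.per_def pj_def lagr_def by (simp only: of_int_per) simp

lemma pj_cong: "[z = w] (mod int p) \<Longrightarrow> pj z = pj w"
 by (rule C.per_cong[OF pj_per])

lemma pj_sum: "(\<Oplus>z\<in>Zp. pj z) = \<one>"
 unfolding pj_def E.ev_sum[symmetric] by (simp add: sum_lagr[OF char_p p_pos])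

definition weight :: "int \<Rightarrow> 'c \<Rightarrow> bool" where
 "weight \<mu> x \<longleftrightarrow> x \<in> carrier C \<and> h \<otimes> x = x \<otimes> h \<oplus> \<kappa> (of_int \<mu>) \<otimes> x"

lemma weight_closed: "weight \<mu> x \<Longrightarrow> x \<in> carrier C"
 by (simp add: weight_def)

lemma insert_pj:
 assumes "x \<in> carrier C"
 shows "x = (\<Oplus>z\<in>Zp. x \<otimes> pj z)" "x = (\<Oplus>z\<in>Zp. pj z \<otimes> x)"
 using assms C.finsum_rdistr[of Zp x pj] C.finsum_ldistr[of Zp x pj] by (simp_all add: pj_sum)

text \<open>Multiplication by x raises h-eigenvalues by \<mu>. Inserting the resolution of 1 on the
  right of x leaves only the component that x carries to the eigenvalue z.\<close>

lemma weight_pj: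
 assumes "weight \<mu> x"
 shows "pj z \<otimes> x = x \<otimes> pj (z - \<mu>)"
proof -
 have x: "x \<in> carrier C" "h \<otimes> x = x \<otimes> h \<oplus> \<kappa> (of_int \<mu>) \<otimes> x" using assms by (auto simp: weight_def)
 have "h \<otimes> (x \<otimes> pj w) = \<kappa> (of_int (w + \<mu>)) \<otimes> (x \<otimes> pj w)" for w
 proof -
  have "h \<otimes> (x \<otimes> pj w) = x \<otimes> (h \<otimes> pj w) \<oplus> \<kappa> (of_int \<mu>) \<otimes> (x \<otimes> pj w)"
   using x by (simp add: C.m_assoc[symmetric] C.l_distr)
  then show ?thesis using x by (simp add: h_pj kappa_lcomm kappa_add C.l_distr)
 qed
 then have e: "pj z \<otimes> (x \<otimes> pj w) = (if [z = w + \<mu>] (mod int p) then x \<otimes> pj w else \<zero>)" for w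
  using x by (intro pj_eigen) auto
 have "pj z \<otimes> x = (\<Oplus>w\<in>Zp. (pj z \<otimes> x) \<otimes> pj w)" using x by (intro insert_pj) simp
 also have "\<dots> = (\<Oplus>w\<in>Zp. if [w = z - \<mu>] (mod int p) then x \<otimes> pj w else \<zero>)"
 proof (intro C.finsum_cong')
  fix w
  have "[z = w + \<mu>] (mod int p) \<longleftrightarrow> [w = z - \<mu>] (mod int p)"
   by (auto simp: cong_iff_dvd_diff algebra_simps dvd_diff_commute)
  then show "pj z \<otimes> x \<otimes> pj w = (if [w = z - \<mu>] (mod int p) then x \<otimes> pj w else \<zero>)"
   using x e[of w] by (simp add: C.m_assoc)
 qed (use x in auto)
 also have "\<dots> = x \<otimes> pj (z - \<mu>)"
  using x p_pos pj_per by (intro C.finsum_per_single) (auto simp: C.per_def)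
 finally show ?thesis .
qed

section \<open>The unipotent element\<close>

definition et where "et = e \<otimes> t"
definition u where "u = \<one> \<ominus> et"
text \<open>Since u^p = 1, the exponent may be taken in Z/p, the index set of the idempotents, and
  negative powers become positive ones.\<close>

definition U :: "int \<Rightarrow> 'c" where "U z = u [^] nat (z mod int p)"

lemma et_closed [simp]: "et \<in> carrier C" and u_closed [simp]: "u \<in> carrier C"
 by (simp_all add: et_def u_def)

lemma U_closed [simp, intro]: "U z \<in> carrier C"
 by (simp add: U_def)

lemma weight_e: "weight 1 e" and weight_et: "weight 1 et"
proof -
 show "weight 1 e" by (simp add: weight_def he)
 have "h \<otimes> (e \<otimes> t) = (e \<otimes> h \<oplus> e) \<otimes> t" by (simp add: he[symmetric] C.m_assoc)
 also have "\<dots> = e \<otimes> t \<otimes> h \<oplus> e \<otimes> t" by (simp add: C.l_distr C.m_assoc t_central)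
 finally show "weight 1 et" by (simp add: weight_def et_def)
qed

lemma u_et: "u \<otimes> et = et \<otimes> u"
 by (simp add: u_def a_minus_def C.l_distr C.r_distr C.l_minus C.r_minus)

lemma e_t_comm: "e \<otimes> et = et \<otimes> e"
 by (simp add: et_def C.m_assoc t_central)

lemma u_e: "u \<otimes> e = e \<otimes> u"
 by (simp add: u_def a_minus_def C.l_distr C.r_distr C.l_minus C.r_minus e_t_comm)

text \<open>t is central, so (et)^p = e^p t^p = 0, and Frobenius applies to the commuting pair 1 and
  -et.\<close>

lemma u_pow_p: "u [^] p = \<one>"
proof -
 have "et [^] p = \<zero>" unfolding et_def
  using C.pow_mult_distrib[of e t p] t_central[of e] e_pow by simp
 then have "(\<ominus> et) [^] p = \<zero>" using frobenius_uminus[of et] by simp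
 then show ?thesis
  unfolding u_def a_minus_def by (subst frobenius_add) auto
qed

lemma u_pow_cong: assumes "[int m = int m'] (mod int p)" shows "u [^] (m::nat) = u [^] (m'::nat)"
proof -
 have "u [^] (m::nat) = u [^] (m mod p)" for m
 proof -
  have "u [^] m = u [^] (p * (m div p) + m mod p)" by simp
  also have "\<dots> = (u [^] p) [^] (m div p) \<otimes> u [^] (m mod p)"
   by (simp only: C.nat_pow_mult[symmetric] C.nat_pow_pow u_closed)
  finally show ?thesis by (simp add: u_pow_p)
 qed
 then show ?thesis using assms by (metis cong_def cong_int_iff)
qed

lemma U_eqI: "[int m = z] (mod int p) \<Longrightarrow> U z = u [^] m"
 unfolding U_def using p_pos by (intro u_pow_cong) (simp add: cong_def)

lemma U_int [simp]: "U (int m) = u [^] m" by (rule U_eqI) simp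
lemma U_0 [simp]: "U 0 = \<one>" using U_int[of 0] by simp
lemma U_1 [simp]: "U 1 = u" using U_int[of 1] by simp

lemma U_per: "C.per p U"
 unfolding C.per_def U_def by simp

lemma U_cong: "[z = w] (mod int p) \<Longrightarrow> U z = U w"
 by (rule C.per_cong[OF U_per])

lemma U_add: "U a \<otimes> U b = U (a + b)"
proof -
 have "U (a + b) = u [^] (nat (a mod int p) + nat (b mod int p))"
  using p_pos by (intro U_eqI) (simp add: cong_def mod_add_eq)
 then show ?thesis by (simp add: U_def C.nat_pow_mult)
qed

lemma U_add': "x \<in> carrier C \<Longrightarrow> U a \<otimes> (U b \<otimes> x) = U (a + b) \<otimes> x"
 by (simp add: C.m_assoc[symmetric] U_add)

lemma U_inverse: "U z \<otimes> U (- z) = \<one>" "U (- z) \<otimes> U z = \<one>"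
 by (simp_all add: U_add)

lemma u_int_pow: "u [^] (z::int) = U z"
proof (cases "z < 0")
 case False
 then show ?thesis using U_int[of "nat z"] by (simp add: int_pow_def2)
next
 case True
 have "inv (U (- z)) = U z" by (rule C.inv_char) (simp_all add: U_inverse)
 then show ?thesis using True U_int[of "nat (- z)"] by (simp add: int_pow_def2)
qed

lemma U_e: "U z \<otimes> e = e \<otimes> U z" and U_et: "U z \<otimes> et = et \<otimes> U z"
 unfolding U_def by (simp_all add: C.group_commutes_pow u_e u_et)

lemma u_h: "u \<otimes> h = (h \<ominus> \<one>) \<otimes> u \<oplus> \<one>"
proof -
 have 1: "h \<otimes> et = et \<otimes> h \<oplus> et" using weight_et by (simp add: weight_def)
 have "(h \<ominus> \<one>) \<otimes> u \<oplus> \<one> = h \<ominus> h \<otimes> et \<oplus> et"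
  by (simp add: u_def a_minus_def C.l_distr C.r_distr C.l_minus C.r_minus C.minus_add C.a_ac C.add_cancels)
 also have "\<dots> = u \<otimes> h"
  unfolding 1 by (simp add: u_def a_minus_def C.l_distr C.l_minus C.minus_add C.a_ac C.add_cancels)
 finally show ?thesis ..
qed

text \<open>Each factor u moved across h lowers it by one and leaves a remainder, by
  \<open>u_h\<close>. Both sides depend on z only modulo p, so an induction over naturals covers all
  integers.\<close>

lemma U_h: "U z \<otimes> h = (h \<ominus> \<kappa> (of_int z)) \<otimes> U z \<oplus> \<kappa> (of_int z) \<otimes> U (z - 1)"
proof -
 have nat: "U (int m) \<otimes> h = (h \<ominus> \<kappa> (of_nat m)) \<otimes> U (int m) \<oplus> \<kappa> (of_nat m) \<otimes> U (int m - 1)" for m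
 proof (induction m)
  case 0
  then show ?case by (simp add: a_minus_def)
 next
  case (Suc m)
  have s: "U (int (Suc m)) = u \<otimes> U (int m)" using U_add[of 1 "int m"] by (simp add: add.commute)
  have i: "int (Suc m) - 1 = int m" by simp
  have s': "u \<otimes> U (int m - 1) = U (int m)" using U_add[of 1 "int m - 1"] by simp
  have "U (int (Suc m)) \<otimes> h = u \<otimes> ((h \<ominus> \<kappa> (of_nat m)) \<otimes> U (int m) \<oplus> \<kappa> (of_nat m) \<otimes> U (int m - 1))"
   unfolding s by (simp only: C.m_assoc u_closed U_closed h_closed Suc)
  also have "\<dots> = (u \<otimes> h \<ominus> \<kappa> (of_nat m) \<otimes> u) \<otimes> U (int m) \<oplus> \<kappa> (of_nat m) \<otimes> U (int m)"
   by (simp add: C.r_distr C.l_distr a_minus_def C.r_minus C.l_minus kappa_lcomm s' C.m_assoc kappa_central[symmetric, of u])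
  also have "\<dots> = (h \<ominus> \<kappa> (of_nat (Suc m))) \<otimes> (u \<otimes> U (int m)) \<oplus> \<kappa> (of_nat (Suc m)) \<otimes> U (int m)"
   unfolding u_h
   by (simp add: kappa_add C.r_distr C.l_distr a_minus_def C.r_minus C.l_minus C.m_assoc C.minus_add C.a_ac)
  finally show ?case by (simp only: s i)
 qed
 have z: "[z = int (nat (z mod int p))] (mod int p)" using p_pos by (simp add: cong_def)
 have "of_int z = (of_int (int (nat (z mod int p))) :: 'k)"
  using z of_int_eq_iff_cong_CHAR[where ?'a = 'k] char_p by blast
 moreover have "U (z - 1) = U (int (nat (z mod int p)) - 1)"
  using z by (intro U_cong cong_diff) auto
 ultimately show ?thesis
  using nat[of "nat (z mod int p)"] U_cong[OF z] by (simp del: U_int)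
qed

section \<open>Exchange rules for u, h and the idempotents; the element y and its inverse\<close>

lemma et_pj: "et \<otimes> pj z = pj (z + 1) \<otimes> et"
 using weight_pj[OF weight_et, of "z + 1"] by simp

text \<open>et raises eigenvalues by one, so the two et-terms coincide and cancel. The right side is
  a difference of neighbours, which later makes sums over Z/p telescope.\<close>

lemma pj_u_exchange: "u \<otimes> pj z \<ominus> pj (z + 1) \<otimes> u = pj z \<ominus> pj (z + 1)"
 by (simp add: u_def a_minus_def C.l_distr C.r_distr C.l_minus C.r_minus C.minus_add C.a_ac et_pj C.add_cancels)

lemma pj_U_h: "pj z \<otimes> (U z \<otimes> h) = \<kappa> (of_int z) \<otimes> (pj z \<otimes> U (z - 1))"
proof -
 have "pj z \<otimes> h = \<kappa> (of_int z) \<otimes> pj z"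
  using E.ev_commute[of h "lagr p z"] kappa_central by (simp add: pj_def[symmetric] h_pj[symmetric])
 then show ?thesis
  unfolding U_h
  by (simp add: C.r_distr C.l_distr a_minus_def C.l_minus C.r_minus C.m_assoc[symmetric] kappa_central[symmetric, of "pj z"] C.r_neg C.l_neg)
qed

text \<open>y is m(S0 \<otimes> id) applied to the inverse of the twist, after replacing z by -z.
  Its inverse y' is written with the powers of u on the left; the extra -1 in the exponent makes the
  blocks between different eigenvalues vanish.\<close>

definition y where "y = (\<Oplus>z\<in>Zp. pj z \<otimes> U z)"
definition y' where "y' = (\<Oplus>z\<in>Zp. U (- z - 1) \<otimes> pj z)"

lemma y_closed [simp]: "y \<in> carrier C" and y'_closed [simp]: "y' \<in> carrier C"
 unfolding y_def y'_def by (auto intro!: C.finsum_closed)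

lemma pj_shift [simp]: "pj (z + int p) = pj z" "U (z + int p) = U z"
 using pj_per U_per by (auto simp: C.per_def)

lemma pj_diag:
 assumes "\<And>z. b z \<in> carrier C" "C.per p b"
 shows "pj w \<otimes> (\<Oplus>z\<in>Zp. pj z \<otimes> b z) = pj w \<otimes> b w"
proof -
 have "pj w \<otimes> (\<Oplus>z\<in>Zp. pj z \<otimes> b z) = (\<Oplus>z\<in>Zp. pj w \<otimes> (pj z \<otimes> b z))"
  using assms by (intro C.finsum_rdistr) auto
 also have "\<dots> = (\<Oplus>z\<in>Zp. if [z = w] (mod int p) then pj z \<otimes> b z else \<zero>)"
  using assms by (intro C.finsum_cong') (auto simp: C.m_assoc[symmetric] pj_mult cong_sym_eq)
 also have "\<dots> = pj w \<otimes> b w"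
  using assms p_pos by (intro C.finsum_per_single) (auto simp: C.per_def)
 finally show ?thesis .
qed

lemma pj_y: "pj z \<otimes> y = pj z \<otimes> U z"
 unfolding y_def by (rule pj_diag) (auto simp: U_per)

text \<open>Equivalently (1 + et) y = y u^-1. The factor et raises the index of the idempotent and
  equals 1 - u, so reindexing the sum over Z/p turns u^z into u^(z-1).\<close>

lemma et_y: "et \<otimes> y = y \<otimes> U (- 1) \<ominus> y"
proof -
 have c1: "et \<otimes> (pj z \<otimes> U z) = pj (z + 1) \<otimes> U z \<ominus> pj (z + 1) \<otimes> U (z + 1)" for z
 proof -
  have "et = \<one> \<ominus> u"
   by (simp add: u_def a_minus_def C.minus_add C.r_neg1 C.r_neg2 C.a_assoc[symmetric] C.r_neg)
  then have "et \<otimes> U z = U z \<ominus> U (z + 1)"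
   using U_add[of 1 z] by (simp add: C.l_distr a_minus_def C.l_minus add.commute)
  then show ?thesis
   by (simp add: C.m_assoc[symmetric] et_pj) (simp add: C.m_assoc C.r_distr a_minus_def C.r_minus)
 qed
 have "et \<otimes> y = (\<Oplus>z\<in>Zp. et \<otimes> (pj z \<otimes> U z))"
  unfolding y_def by (intro C.finsum_rdistr) auto
 also have "\<dots> = (\<Oplus>z\<in>Zp. pj (z + 1) \<otimes> U ((z + 1) - 1) \<oplus> (\<ominus> (pj (z + 1) \<otimes> U (z + 1))))"
  by (simp add: c1 a_minus_def)
 also have "\<dots> = (\<Oplus>z\<in>Zp. pj (z + 1) \<otimes> U ((z + 1) - 1)) \<oplus> (\<Oplus>z\<in>Zp. \<ominus> (pj (z + 1) \<otimes> U (z + 1)))"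
  by (intro C.finsum_addf) auto
 also have "(\<Oplus>z\<in>Zp. pj (z + 1) \<otimes> U ((z + 1) - 1)) = (\<Oplus>z\<in>Zp. pj z \<otimes> U (z - 1))"
  by (rule C.finsum_per_shift[where f = "\<lambda>z. pj z \<otimes> U (z - 1)"])
    (use p_pos pj_shift(2)[of "_ - 1"] in \<open>auto simp: C.per_def diff_add_eq\<close>)
 also have "\<dots> = (\<Oplus>z\<in>Zp. (pj z \<otimes> U z) \<otimes> U (- 1))"
  by (simp add: C.m_assoc U_add)
 also have "\<dots> = y \<otimes> U (- 1)"
  unfolding y_def by (intro C.finsum_ldistr[symmetric]) auto
 also have "(\<Oplus>z\<in>Zp. \<ominus> (pj (z + 1) \<otimes> U (z + 1))) = (\<Oplus>z\<in>Zp. \<ominus> (pj z \<otimes> U z))"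
  by (rule C.finsum_per_shift[where f = "\<lambda>z. \<ominus> (pj z \<otimes> U z)"]) (use p_pos in \<open>auto simp: C.per_def\<close>)
 also have "\<dots> = \<ominus> y"
  unfolding y_def
  by (rule additive_finsum[symmetric]) (auto simp: C.minus_add C.is_abelian_group)
 finally show ?thesis by (simp add: a_minus_def)
qed

definition ub where "ub = \<one> \<oplus> et"

lemma ub_closed [simp]: "ub \<in> carrier C" by (simp add: ub_def)

lemma ub_y: "ub [^] (m::nat) \<otimes> y = y \<otimes> U (- int m)"
proof (induction m)
 case (Suc m)
 have 1: "ub \<otimes> y = y \<otimes> U (- 1)"
  by (simp add: ub_def C.l_distr et_y a_minus_def C.a_ac C.add_cancels)
 have "ub [^] Suc m \<otimes> y = ub [^] m \<otimes> (ub \<otimes> y)" by (simp add: C.m_assoc)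
 also have "\<dots> = (ub [^] m \<otimes> y) \<otimes> U (- 1)" by (simp add: 1 C.m_assoc)
 also have "\<dots> = y \<otimes> U (- int m + - 1)"
  unfolding Suc by (simp only: C.m_assoc y_closed U_closed U_add)
 also have "- int m + - 1 = - int (Suc m)" by simp
 finally show ?case .
qed simp

text \<open>1 + et is the image of u under S0, so the witness is m(id \<otimes> S0) of the twist. It
  serves to turn the right inverse y' into a two-sided one.\<close>

lemma y_left_inverse: "\<exists>v\<in>carrier C. v \<otimes> y = \<one>"
proof
 let ?v = "\<Oplus>z\<in>Zp. pj z \<otimes> ub [^] nat z"
 show "?v \<in> carrier C" by (intro C.finsum_closed) auto
 have "?v \<otimes> y = (\<Oplus>z\<in>Zp. pj z \<otimes> ub [^] nat z \<otimes> y)" by (intro C.finsum_ldistr) auto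
 also have "\<dots> = (\<Oplus>z\<in>Zp. pj z)"
 proof (intro C.finsum_cong' refl)
  fix z assume "z \<in> Zp"
  then have "pj z \<otimes> ub [^] nat z \<otimes> y = (pj z \<otimes> y) \<otimes> U (- z)"
   by (simp add: C.m_assoc ub_y)
  then show "pj z \<otimes> ub [^] nat z \<otimes> y = pj z"
   by (simp add: pj_y C.m_assoc U_add)
 qed auto
 finally show "?v \<otimes> y = \<one>" by (simp add: pj_sum)
qed

text \<open>In the expansion of (1 - et)^s no term raises an eigenvalue by more than s, while
  passing from j to i takes (i - j) mod p steps.\<close>

lemma pj_u_pow_pj_zero: "(i - j) mod int p > int s \<Longrightarrow> pj i \<otimes> (u [^] s \<otimes> pj j) = \<zero>"
proof (induction s arbitrary: j)
 case 0
 then have "\<not> [i = j] (mod int p)" by (auto simp: cong_iff_dvd_diff)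
 then show ?case by (simp add: pj_mult)
next
 case (Suc s)
 have "u \<otimes> pj j = pj j \<ominus> pj (j + 1) \<otimes> et"
  by (simp add: u_def a_minus_def C.l_distr C.l_minus et_pj)
 then have "pj i \<otimes> (u [^] Suc s \<otimes> pj j) = pj i \<otimes> (u [^] s \<otimes> pj j) \<ominus> (pj i \<otimes> (u [^] s \<otimes> pj (j + 1))) \<otimes> et"
  by (simp add: C.m_assoc C.r_distr a_minus_def C.r_minus)
 moreover have "(i - (j + 1)) mod int p > int s"
 proof -
  have "(i - (j + 1)) mod int p = ((i - j) mod int p - 1) mod int p"
   by (simp add: mod_diff_left_eq algebra_simps)
  also have "\<dots> = (i - j) mod int p - 1"
   using Suc.prems p_pos pos_mod_bound[of "int p" "i - j"] by (intro mod_pos_pos_trivial) linarith+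
  finally show ?thesis using Suc.prems by simp
 qed
 ultimately show ?case using Suc.IH[of j] Suc.IH[of "j + 1"] Suc.prems by (simp add: a_minus_def)
qed

lemma pj_u_pow_pj: "s < p \<Longrightarrow> pj j \<otimes> (u [^] s \<otimes> pj j) = pj j"
proof (induction s)
 case 0
 then show ?case by (simp add: pj_mult)
next
 case (Suc s)
 have "u \<otimes> pj j = pj j \<ominus> pj (j + 1) \<otimes> et"
  by (simp add: u_def a_minus_def C.l_distr C.l_minus et_pj)
 then have "pj j \<otimes> (u [^] Suc s \<otimes> pj j) = pj j \<otimes> (u [^] s \<otimes> pj j) \<ominus> (pj j \<otimes> (u [^] s \<otimes> pj (j + 1))) \<otimes> et"
  by (simp add: C.m_assoc C.r_distr a_minus_def C.r_minus)
 moreover have "(j - (j + 1)) mod int p > int s"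
  using Suc.prems by (simp add: zmod_minus1)
 ultimately show ?case using Suc pj_u_pow_pj_zero[of s j "j + 1"] by (simp add: a_minus_def)
qed

text \<open>The exponent i - j - 1 is one less than the number of steps from j to i, so the block
  vanishes for i \<noteq> j. For i = j it is p - 1, too small to wrap around Z/p, and only the
  constant term of the expansion remains.\<close>

lemma pj_U_pj: "pj i \<otimes> (U (i - j - 1) \<otimes> pj j) = (if [i = j] (mod int p) then pj j else \<zero>)"
proof (cases "[i = j] (mod int p)")
 case True
 have "i - j - 1 - int (p - 1) = (i - j) - int p" using p_pos by (simp add: of_nat_diff)
 then have "[i - j - 1 = int (p - 1)] (mod int p)"
  using True by (simp only: cong_iff_dvd_diff) (rule dvd_diff, simp_all)
 then have "U (i - j - 1) = u [^] (p - 1)" by (intro U_eqI) (simp add: cong_sym)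
 then show ?thesis using True pj_u_pow_pj[of "p - 1" j] pj_cong[OF True] p_pos by simp
next
 case False
 let ?r = "(i - j) mod int p"
 have r: "?r > 0" using False p_pos by (simp add: cong_iff_dvd_diff dvd_eq_mod_eq_0 order_le_neq_trans)
 have "U (i - j - 1) = u [^] nat (?r - 1)"
  using r by (intro U_eqI) (simp add: cong_def mod_diff_left_eq)
 moreover have "pj i \<otimes> (u [^] nat (?r - 1) \<otimes> pj j) = \<zero>"
  using r by (intro pj_u_pow_pj_zero) simp
 ultimately show ?thesis using False by simp
qed

lemma y_y': "y \<otimes> y' = \<one>"
proof -
 have "pj i \<otimes> (U i \<otimes> y') = pj i" for i
 proof -
  have "pj i \<otimes> (U i \<otimes> y') = (\<Oplus>j\<in>Zp. pj i \<otimes> U i \<otimes> (U (- j - 1) \<otimes> pj j))"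
   unfolding y'_def by (subst C.finsum_rdistr[symmetric]) (auto simp: C.m_assoc intro!: C.finsum_closed)
  also have "\<dots> = (\<Oplus>j\<in>Zp. if [j = i] (mod int p) then pj j else \<zero>)"
  proof (intro C.finsum_cong' refl)
   fix j
   have "pj i \<otimes> U i \<otimes> (U (- j - 1) \<otimes> pj j) = pj i \<otimes> (U (i - j - 1) \<otimes> pj j)"
    by (simp add: C.m_assoc U_add' add_diff_eq)
   then show "pj i \<otimes> U i \<otimes> (U (- j - 1) \<otimes> pj j) = (if [j = i] (mod int p) then pj j else \<zero>)"
    by (simp add: pj_U_pj cong_sym_eq)
  qed auto
  also have "\<dots> = pj i" by (rule C.finsum_per_single) (use pj_per p_pos in auto)
  finally show ?thesis .
 qed
 then have "(\<Oplus>z\<in>Zp. pj z \<otimes> U z \<otimes> y') = (\<Oplus>z\<in>Zp. pj z)" by (simp add: C.m_assoc)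
 then show ?thesis
  unfolding y_def pj_sum by (subst C.finsum_ldistr) auto
qed

lemma y'_y: "y' \<otimes> y = \<one>"
proof -
 obtain v where v: "v \<in> carrier C" "v \<otimes> y = \<one>" using y_left_inverse by blast
 have "v = v \<otimes> (y \<otimes> y')" using v y_y' by simp
 also have "\<dots> = (v \<otimes> y) \<otimes> y'" by (rule C.m_assoc[symmetric, OF v(1) y_closed y'_closed])
 also have "\<dots> = y'" using v by simp
 finally show ?thesis using v by simp
qed

end

section \<open>Rising factorials and conjugation by powers of u\<close>

definition rs :: "int \<Rightarrow> int \<Rightarrow> nat \<Rightarrow> 'k::field" where
 "rs a z l = (\<Prod>i<l. of_int (z + a + int i))"

lemma rs_0 [simp]: "rs a z 0 = 1"
 by (simp add: rs_def)

lemma rs_Suc: "rs a z (Suc l) = rs a z l * of_int (z + a + int l)"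
 by (simp add: rs_def)

lemma rs_Suc': "rs a z (Suc l) = of_int (z + a) * rs a (z + 1) l"
 unfolding rs_def prod.lessThan_Suc_shift by (simp add: add_ac)

lemma rs_shift: "rs (a + b) z l = rs a (z + b) l"
 by (simp add: rs_def algebra_simps)

context cartan_nilpotent
begin

lemma rs_per: "rs a (z + int p) l = (rs a z l :: 'k)"
proof -
 have "of_int (z + int p + a + int i) = (of_int (z + a + int i) :: 'k)" for i
  using of_int_per[of "z + a + int i"] by (simp add: algebra_simps)
 then show ?thesis unfolding rs_def by simp
qed

lemma rising_closed [simp]: "rising C a h l \<in> carrier C"
 by (induction l) (auto simp: kappa_of_int_add_pow)

text \<open>On the eigenspace of z the element h acts as z, so a rising factorial of h becomes the
  scalar \<open>rs a z l\<close>.\<close>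

lemma rising_pj: "rising C a h l \<otimes> pj z = \<kappa> (rs a z l) \<otimes> pj z"
proof (induction l)
 case (Suc l)
 have "(h \<oplus> \<kappa> (of_int (a + int l))) \<otimes> pj z = \<kappa> (of_int (z + a + int l)) \<otimes> pj z"
  using kappa_add[of "of_int z" "of_int (a + int l)"]
  by (simp add: C.l_distr h_pj add.assoc)
 then have "rising C a h (Suc l) \<otimes> pj z = \<kappa> (of_int (z + a + int l)) \<otimes> (rising C a h l \<otimes> pj z)"
  by (simp add: kappa_of_int_add_pow C.m_assoc kappa_lcomm[OF rising_closed] del: of_int_add)
 then show ?case
  by (simp add: Suc rs_Suc kappa_mult C.m_assoc[symmetric] del: of_int_add)
    (simp add: kappa_mult[symmetric] mult.commute)
qed (simp)

lemma U_shifts [simp]: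
 "U (z + int p + a) = U (z + a)" "U (z + int p - a) = U (z - a)"
 "U (a - (z + int p)) = U (a - z)" "U (- (z + int p) - a) = U (- z - a)"
 "pj (z + int p + a) = pj (z + a)" "pj (z + int p - a) = pj (z - a)"
 by (auto intro!: U_cong pj_cong simp: cong_iff_dvd_diff)

lemma U_shift_neg [simp]: "U (- z - int p - a) = U (- z - a)" "U (- z - int p) = U (- z)"
 by (auto intro!: U_cong simp: cong_iff_dvd_diff)

text \<open>This identity closes the antipode formula: a sum over idempotents with powers of u on
  both sides collapses to a polynomial in h. Case 0 is y' y = 1. In the step, multiplying by h and
  reindexing produces the new sum with one idempotent replaced by its neighbour; the exchange rule
  repairs this at the cost of a difference that contributes l + 1 times the old sum.\<close>

lemma rising_resolution:
 "(\<Oplus>j\<in>Zp. \<kappa> (rs 1 j l) \<otimes> (U (- j - 1 - int l) \<otimes> (pj j \<otimes> U j))) = rising C 1 h l"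
proof (induction l)
 case 0
 have "(\<Oplus>j\<in>Zp. U (- j - 1) \<otimes> (pj j \<otimes> U j)) = (\<Oplus>j\<in>Zp. (U (- j - 1) \<otimes> pj j) \<otimes> y)"
  by (simp add: C.m_assoc pj_y)
 also have "\<dots> = \<one>" unfolding y'_y[symmetric] y'_def by (intro C.finsum_ldistr[symmetric]) auto
 finally show ?case by simp
next
 case (Suc l)
 define c :: "int \<Rightarrow> 'k" where "c j = rs 1 j (Suc l)" for j
 define B where "B j = U (- j - 1 - int l) \<otimes> (pj j \<otimes> U j)" for j
 let ?T = "\<Oplus>j\<in>Zp. \<kappa> (rs 1 j l) \<otimes> B j"
 have Bc [simp]: "B j \<in> carrier C" for j by (simp add: B_def)
 have cper: "c (j + int p) = c j" for j unfolding c_def by (rule rs_per)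
 have Bper: "B (j + int p) = B j" for j
 proof -
  have "U (- (j + int p) - 1 - int l) = U (- j - 1 - int l)"
   by (rule U_cong) (simp add: cong_iff_dvd_diff)
  then show ?thesis by (simp add: B_def)
 qed
 have Th: "?T \<otimes> h = (\<Oplus>j\<in>Zp. \<kappa> (c j) \<otimes> (U (- j - 2 - int l) \<otimes> (pj (j + 1) \<otimes> U j)))"
 proof -
  define f where "f j = \<kappa> (rs 1 j l * of_int j) \<otimes> (U (- j - 1 - int l) \<otimes> (pj j \<otimes> U (j - 1)))" for j
  have fc: "f j \<in> carrier C" for j by (simp add: f_def)
  have "U (- (j + int p) - 1 - int l) = U (- j - 1 - int l)" for j
   by (rule U_cong) (simp add: cong_iff_dvd_diff)
  then have fper: "C.per p f" unfolding C.per_def f_def rs_per of_int_per by simp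
  have "?T \<otimes> h = (\<Oplus>j\<in>Zp. \<kappa> (rs 1 j l) \<otimes> B j \<otimes> h)" by (intro C.finsum_ldistr) auto
  also have "\<dots> = (\<Oplus>j\<in>Zp. f j)"
  proof (intro C.finsum_cong' refl)
   fix j
   have "\<kappa> (rs 1 j l) \<otimes> B j \<otimes> h = \<kappa> (rs 1 j l) \<otimes> (U (- j - 1 - int l) \<otimes> (pj j \<otimes> (U j \<otimes> h)))"
    by (simp add: B_def C.m_assoc)
   also have "\<dots> = f j"
    by (simp add: f_def pj_U_h kappa_lcomm[OF U_closed] kappa_mult C.m_assoc)
   finally show "\<kappa> (rs 1 j l) \<otimes> B j \<otimes> h = f j" .
  qed (use fc in auto)
  also have "\<dots> = (\<Oplus>j\<in>Zp. f (j + 1))"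
   by (rule C.finsum_per_shift[symmetric, OF fper fc p_pos])
  also have "\<dots> = (\<Oplus>j\<in>Zp. \<kappa> (c j) \<otimes> (U (- j - 2 - int l) \<otimes> (pj (j + 1) \<otimes> U j)))"
  proof (intro C.finsum_cong' refl)
   fix j
   have "rs 1 (j + 1) l * of_int (j + 1) = c j"
    unfolding c_def rs_Suc' by (simp add: mult.commute)
   moreover have "- (j + 1) - 1 - int l = - j - 2 - int l" "j + 1 - 1 = j" by simp_all
   ultimately show "f (j + 1) = \<kappa> (c j) \<otimes> (U (- j - 2 - int l) \<otimes> (pj (j + 1) \<otimes> U j))"
    unfolding f_def by (simp only:)
  qed auto
  finally show ?thesis .
 qed
 let ?S = "\<Oplus>j\<in>Zp. \<kappa> (c j) \<otimes> (U (- j - 1 - int (Suc l)) \<otimes> (pj j \<otimes> U j))"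
 have S: "?S = ?T \<otimes> h \<oplus> \<kappa> (of_nat (Suc l)) \<otimes> ?T"
 proof -
  define g where "g j = \<kappa> (c (j - 1)) \<otimes> B j" for j
  have gc: "g j \<in> carrier C" for j by (simp add: g_def)
  have gper: "C.per p g"
   unfolding C.per_def g_def Bper using cper[of "_ - 1"] by (simp add: diff_add_eq)
  \<comment> \<open>\<open>g\<close> is set up so that \<open>g (j + 1)\<close> carries the
    coefficient \<open>c j\<close>. After a shift of the summation index the correction pairs
    \<open>c j\<close> with \<open>c (j - 1)\<close>.\<close>
  have trm: "\<kappa> (c j) \<otimes> (U (- j - 1 - int (Suc l)) \<otimes> (pj j \<otimes> U j)) =
    \<kappa> (c j) \<otimes> (U (- j - 2 - int l) \<otimes> (pj (j + 1) \<otimes> U j)) \<oplus> (\<kappa> (c j) \<otimes> B j \<oplus> \<ominus> g (j + 1))" for j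
  proof -
   have i: "- j - 1 - int (Suc l) = - j - 2 - int l" "- j - 2 - int l + 1 = - j - 1 - int l"
     "- (j + 1) - 1 - int l = - j - 2 - int l" "j + 1 - 1 = j" by simp_all
   have u1: "U (- j - 1 - int l) = U (- j - 2 - int l) \<otimes> u" and u2: "U (j + 1) = u \<otimes> U j"
    using U_add[of "- j - 2 - int l" 1] U_add[of 1 j] unfolding U_1 i by (simp_all only: add.commute)
   have ex: "pj j = pj (j + 1) \<oplus> (u \<otimes> pj j \<ominus> pj (j + 1) \<otimes> u)"
    unfolding pj_u_exchange by (simp add: a_minus_def C.a_ac C.add_cancels)
   have "U (- j - 2 - int l) \<otimes> (pj j \<otimes> U j) = U (- j - 2 - int l) \<otimes> ((pj (j + 1) \<oplus> (u \<otimes> pj j \<ominus> pj (j + 1) \<otimes> u)) \<otimes> U j)"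
    using ex by simp
   also have "\<dots> = U (- j - 2 - int l) \<otimes> (pj (j + 1) \<otimes> U j) \<oplus> (B j \<oplus> \<ominus> B (j + 1))"
    unfolding B_def i u1 u2
    by (simp add: a_minus_def C.l_distr C.r_distr C.l_minus C.r_minus C.m_assoc)
   finally show ?thesis
    unfolding i g_def by (simp add: C.r_distr C.r_minus)
  qed
  have "?S = (\<Oplus>j\<in>Zp. \<kappa> (c j) \<otimes> (U (- j - 2 - int l) \<otimes> (pj (j + 1) \<otimes> U j)) \<oplus> (\<kappa> (c j) \<otimes> B j \<oplus> \<ominus> g (j + 1)))"
   by (simp only: trm)
  also have "\<dots> = ?T \<otimes> h \<oplus> (\<Oplus>j\<in>Zp. \<kappa> (c j) \<otimes> B j \<oplus> \<ominus> g (j + 1))"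
   unfolding Th by (intro C.finsum_addf) (use gc in auto)
  also have "(\<Oplus>j\<in>Zp. \<kappa> (c j) \<otimes> B j \<oplus> \<ominus> g (j + 1)) = (\<Oplus>j\<in>Zp. \<kappa> (c j) \<otimes> B j) \<oplus> (\<Oplus>j\<in>Zp. \<ominus> g (j + 1))"
   by (intro C.finsum_addf) (use gc in auto)
  also have "(\<Oplus>j\<in>Zp. \<ominus> g (j + 1)) = (\<Oplus>j\<in>Zp. \<ominus> g j)"
   by (rule C.finsum_per_shift[where f = "\<lambda>j. \<ominus> g j"]) (use gper gc p_pos in \<open>auto simp: C.per_def\<close>)
  also have "(\<Oplus>j\<in>Zp. \<kappa> (c j) \<otimes> B j) \<oplus> (\<Oplus>j\<in>Zp. \<ominus> g j) = (\<Oplus>j\<in>Zp. \<kappa> (c j) \<otimes> B j \<oplus> \<ominus> g j)"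
   by (intro C.finsum_addf[symmetric]) (use gc in auto)
  also have "\<dots> = (\<Oplus>j\<in>Zp. \<kappa> (of_nat (Suc l)) \<otimes> (\<kappa> (rs 1 j l) \<otimes> B j))"
  proof (intro C.finsum_cong' refl)
   fix j
   \<comment> \<open>The discrete derivative of a rising factorial with l + 1 factors is l + 1 times
     one with l factors.\<close>
   have "c (j - 1) = of_int j * rs 1 j l" unfolding c_def rs_Suc' by simp
   then have "c j + - c (j - 1) = of_nat (Suc l) * rs 1 j l"
    unfolding c_def rs_Suc by (simp add: algebra_simps)
   then have "\<kappa> (c j) \<oplus> \<ominus> \<kappa> (c (j - 1)) = \<kappa> (of_nat (Suc l)) \<otimes> \<kappa> (rs 1 j l)"
    by (simp only: kappa_add[symmetric] kappa_uminus[symmetric] kappa_mult[symmetric])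
   then have "(\<kappa> (c j) \<oplus> \<ominus> \<kappa> (c (j - 1))) \<otimes> B j = \<kappa> (of_nat (Suc l)) \<otimes> (\<kappa> (rs 1 j l) \<otimes> B j)"
    by (simp only: C.m_assoc kappa_closed Bc)
   then show "\<kappa> (c j) \<otimes> B j \<oplus> \<ominus> g j = \<kappa> (of_nat (Suc l)) \<otimes> (\<kappa> (rs 1 j l) \<otimes> B j)"
    by (simp only: g_def C.l_distr C.l_minus kappa_closed Bc C.a_inv_closed)
  qed auto
  also have "\<dots> = \<kappa> (of_nat (Suc l)) \<otimes> ?T" by (intro C.finsum_rdistr[symmetric]) auto
  finally show ?thesis .
 qed
 have T: "?T = rising C 1 h l" using Suc.IH unfolding B_def .
 have "rising C 1 h (Suc l) = ?T \<otimes> h \<oplus> ?T \<otimes> \<kappa> (of_int (1 + int l))"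
  unfolding T by (simp add: C.r_distr kappa_of_int_add_pow)
 also have "?T \<otimes> \<kappa> (of_int (1 + int l)) = \<kappa> (of_nat (Suc l)) \<otimes> ?T"
  by (subst kappa_central) (auto intro!: C.finsum_closed)
 finally show ?case using S unfolding c_def by simp
qed

text \<open>Divided powers of \<open>ad e\<close>: the sequences \<open>d\<^sup>(\<^sup>l\<^sup>)(x)\<close>.\<close>

definition ladder :: "(nat \<Rightarrow> 'c) \<Rightarrow> bool" where
 "ladder xs \<longleftrightarrow> (\<forall>l. xs l \<in> carrier C \<and>
   e \<otimes> xs l = xs l \<otimes> e \<oplus> \<kappa> (of_nat (Suc l)) \<otimes> xs (Suc l)) \<and> xs p = \<zero>"

lemma ladderD: "ladder xs \<Longrightarrow> xs l \<in> carrier C"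
 "ladder xs \<Longrightarrow> e \<otimes> xs l = xs l \<otimes> e \<oplus> \<kappa> (of_nat (Suc l)) \<otimes> xs (Suc l)" "ladder xs \<Longrightarrow> xs p = \<zero>"
 by (auto simp: ladder_def)

lemma t_pow_central: "x \<in> carrier C \<Longrightarrow> t [^] (m::nat) \<otimes> x = x \<otimes> t [^] m"
 by (rule C.group_commutes_pow) (simp_all add: t_central)

lemma ladder_u:
 assumes "ladder xs"
 shows "xs l \<otimes> u = u \<otimes> xs l \<oplus> \<kappa> (of_nat (Suc l)) \<otimes> (xs (Suc l) \<otimes> t)"
proof -
 note x = ladderD(1)[OF assms]
 have "u \<otimes> xs l = xs l \<ominus> (e \<otimes> xs l) \<otimes> t"
  using x by (simp add: u_def et_def a_minus_def C.l_distr C.l_minus C.m_assoc t_central)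
 also have "\<dots> = xs l \<otimes> u \<ominus> \<kappa> (of_nat (Suc l)) \<otimes> (xs (Suc l) \<otimes> t)"
  using x unfolding ladderD(2)[OF assms]
  by (simp add: u_def et_def a_minus_def C.l_distr C.r_distr C.l_minus C.r_minus C.m_assoc C.minus_add C.a_assoc del: of_nat_Suc)
 finally show ?thesis
  using x by (simp add: a_minus_def C.a_assoc C.l_neg del: of_nat_Suc)
qed

lemma combine_shifted:
 assumes a: "\<And>l. a l \<in> carrier C" and b: "\<And>l. b l \<in> carrier C" "b 0 = \<zero>" "b m = \<zero>"
 shows "(\<Oplus>l\<in>{..<m}. a l \<oplus> b (Suc l)) = (\<Oplus>l\<in>{..<m}. a l \<oplus> b l)"
proof -
 have "(\<Oplus>l\<in>{..<m}. a l \<oplus> b (Suc l)) = (\<Oplus>l\<in>{..<m}. a l) \<oplus> (\<Oplus>l\<in>{..<m}. b (Suc l))"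
  using a b by (intro C.finsum_addf) auto
 also have "(\<Oplus>l\<in>{..<m}. b (Suc l)) = (\<Oplus>l\<in>{..<m}. b l)"
  using b by (rule C.finsum_telescope)
 finally show ?thesis using a b by (subst C.finsum_addf) auto
qed

text \<open>Conjugation by u^z is a binomial series in ad e; collecting the powers of u on the left
  turns its coefficients into rising factorials. With r(w, l) for these, one more factor u amounts
  to r(w+1, l) - l r(w+1, l-1) = r(w, l). The series stops at p because the ladder ends
  there.\<close>

lemma conj_left:
 assumes "ladder xs"
 shows "U (int z) \<otimes> xs 0 = (\<Oplus>l\<in>{..<p}. \<kappa> ((- 1) ^ l * rs 0 (int z) l) \<otimes> (U (- int l) \<otimes> (xs l \<otimes> t [^] l))) \<otimes> U (int z)"
proof (induction z)
 case 0
 have z: "rs 0 0 l = of_bool (l = 0)" for l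
  by (cases l) (simp_all add: rs_Suc')
 have "(\<Oplus>l\<in>{..<p}. \<kappa> ((- 1) ^ l * rs 0 0 l) \<otimes> (U (- int l) \<otimes> (xs l \<otimes> t [^] l))) = (\<Oplus>l\<in>{..<p}. if l = 0 then xs l else \<zero>)"
  using ladderD(1)[OF assms] by (intro C.finsum_cong') (auto simp: z)
 also have "\<dots> = xs 0"
  using ladderD(1)[OF assms] p_pos by (intro C.add.finprod_singleton_swap) auto
 finally show ?case using ladderD(1)[OF assms] by simp
next
 case (Suc z)
 note x [simp] = ladderD(1)[OF assms]
 let ?z = "int z"
 define c :: "int \<Rightarrow> nat \<Rightarrow> 'k" where "c w l = (- 1) ^ l * rs 0 w l" for w l
 define E where "E w = (\<Oplus>l\<in>{..<p}. \<kappa> (c w l) \<otimes> (U (- int l) \<otimes> (xs l \<otimes> t [^] l)))" for w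
 have E [simp]: "E w \<in> carrier C" for w unfolding E_def by (auto intro!: C.finsum_closed)
 have step: "E (w + 1) \<otimes> u = u \<otimes> E w" for w
 proof -
  define a where "a l = \<kappa> (c (w + 1) l) \<otimes> (U (1 - int l) \<otimes> (xs l \<otimes> t [^] l))" for l
  define b where "b l = \<kappa> (c (w + 1) (l - 1) * of_nat l) \<otimes> (U (1 - int l) \<otimes> (xs l \<otimes> t [^] l))" for l
  have ab: "a l \<in> carrier C" "b l \<in> carrier C" for l by (simp_all add: a_def b_def)
  \<comment> \<open>Both ends of the shifted sum vanish, at 0 by the factor l and at p because the
    ladder ends, so shifting the index leaves no boundary term.\<close>
  have b0: "b 0 = \<zero>" "b p = \<zero>" by (simp_all add: b_def ladderD(3)[OF assms])
  have "E (w + 1) \<otimes> u = (\<Oplus>l\<in>{..<p}. \<kappa> (c (w + 1) l) \<otimes> (U (- int l) \<otimes> (xs l \<otimes> t [^] l)) \<otimes> u)"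
   unfolding E_def by (intro C.finsum_ldistr) auto
  also have "\<dots> = (\<Oplus>l\<in>{..<p}. a l \<oplus> b (Suc l))"
  proof (intro C.finsum_cong' refl)
   fix l
   have u1: "U (- int l) \<otimes> u = U (1 - int l)" using U_add[of "- int l" 1] by simp
   have i: "1 - int (Suc l) = - int l" by simp
   have "(xs l \<otimes> t [^] l) \<otimes> u = (xs l \<otimes> u) \<otimes> t [^] l"
    by (simp add: C.m_assoc t_pow_central)
   also have "\<dots> = u \<otimes> (xs l \<otimes> t [^] l) \<oplus> \<kappa> (of_nat (Suc l)) \<otimes> (xs (Suc l) \<otimes> t [^] Suc l)"
    unfolding ladder_u[OF assms] by (simp add: C.l_distr C.m_assoc t_central del: of_nat_Suc)
   finally have xu: "(xs l \<otimes> t [^] l) \<otimes> u = u \<otimes> (xs l \<otimes> t [^] l) \<oplus> \<kappa> (of_nat (Suc l)) \<otimes> (xs (Suc l) \<otimes> t [^] Suc l)" .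
   have "\<kappa> (c (w + 1) l) \<otimes> (U (- int l) \<otimes> (xs l \<otimes> t [^] l)) \<otimes> u = \<kappa> (c (w + 1) l) \<otimes> (U (- int l) \<otimes> ((xs l \<otimes> t [^] l) \<otimes> u))"
    by (simp add: C.m_assoc)
   also have "\<dots> = \<kappa> (c (w + 1) l) \<otimes> ((U (- int l) \<otimes> u) \<otimes> (xs l \<otimes> t [^] l)) \<oplus>
     \<kappa> (c (w + 1) l) \<otimes> (\<kappa> (of_nat (Suc l)) \<otimes> (U (- int l) \<otimes> (xs (Suc l) \<otimes> t [^] Suc l)))"
    unfolding xu by (simp add: C.r_distr C.m_assoc kappa_lcomm[OF U_closed] del: of_nat_Suc C.nat_pow_Suc)
   also have "\<dots> = a l \<oplus> b (Suc l)"
    unfolding u1 a_def b_def i by (simp add: kappa_mult C.m_assoc del: of_nat_Suc C.nat_pow_Suc)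
   finally show "\<kappa> (c (w + 1) l) \<otimes> (U (- int l) \<otimes> (xs l \<otimes> t [^] l)) \<otimes> u = a l \<oplus> b (Suc l)" .
  qed (use ab in auto)
  also have "\<dots> = (\<Oplus>l\<in>{..<p}. a l \<oplus> b l)"
   by (rule combine_shifted) (use ab b0 in auto)
  also have "\<dots> = (\<Oplus>l\<in>{..<p}. u \<otimes> (\<kappa> (c w l) \<otimes> (U (- int l) \<otimes> (xs l \<otimes> t [^] l))))"
  proof (intro C.finsum_cong' refl)
   fix l
   have u1: "u \<otimes> U (- int l) = U (1 - int l)" using U_add[of 1 "- int l"] by simp
   have "c (w + 1) l + c (w + 1) (l - 1) * of_nat l = c w l"
   proof (cases l)
    case (Suc m)
    show ?thesis
     unfolding c_def Suc diff_Suc_1 rs_Suc[of 0 "w + 1" m] rs_Suc'[of 0 w m] by (simp add: algebra_simps)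
   qed (simp add: c_def)
   then have "a l \<oplus> b l = \<kappa> (c w l) \<otimes> (U (1 - int l) \<otimes> (xs l \<otimes> t [^] l))"
    unfolding a_def b_def by (simp only: C.l_distr[symmetric] kappa_add[symmetric] kappa_closed C.m_closed U_closed x C.nat_pow_closed t_closed)
   moreover have "u \<otimes> (\<kappa> (c w l) \<otimes> (U (- int l) \<otimes> (xs l \<otimes> t [^] l))) = \<kappa> (c w l) \<otimes> ((u \<otimes> U (- int l)) \<otimes> (xs l \<otimes> t [^] l))"
    by (simp add: kappa_lcomm[OF u_closed] C.m_assoc)
   ultimately show "a l \<oplus> b l = u \<otimes> (\<kappa> (c w l) \<otimes> (U (- int l) \<otimes> (xs l \<otimes> t [^] l)))"
    by (simp only: u1)
  qed auto
  also have "\<dots> = u \<otimes> E w" unfolding E_def by (intro C.finsum_rdistr[symmetric]) auto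
  finally show ?thesis .
 qed
 have s: "U (int (Suc z)) = u \<otimes> U ?z" using U_add[of 1 ?z] by (simp add: add.commute)
 have "U (int (Suc z)) \<otimes> xs 0 = u \<otimes> (U ?z \<otimes> xs 0)" unfolding s by (simp only: C.m_assoc u_closed U_closed x)
 also have "\<dots> = u \<otimes> (E ?z \<otimes> U ?z)" using Suc.IH unfolding E_def c_def by simp
 also have "\<dots> = (u \<otimes> E ?z) \<otimes> U ?z" by (simp only: C.m_assoc u_closed U_closed E)
 also have "\<dots> = E (?z + 1) \<otimes> (u \<otimes> U ?z)" unfolding step[symmetric] by (simp only: C.m_assoc u_closed U_closed E)
 also have "\<dots> = E (int (Suc z)) \<otimes> U (int (Suc z))" unfolding s by (simp add: add.commute)
 finally show ?case unfolding E_def c_def .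
qed

text \<open>The mirror image of \<open>conj_left\<close>: inside the sum the powers of u stand to
  the right of the ladder, which is the order in which the antipode meets them.\<close>

lemma conj_right:
 assumes "ladder xs"
 shows "xs 0 \<otimes> U (int z) = U (int z) \<otimes> (\<Oplus>l\<in>{..<p}. \<kappa> (rs 0 (int z) l) \<otimes> (xs l \<otimes> (U (- int l) \<otimes> t [^] l)))"
proof (induction z)
 case 0
 have z: "rs 0 0 l = of_bool (l = 0)" for l
  by (cases l) (simp_all add: rs_Suc')
 have "(\<Oplus>l\<in>{..<p}. \<kappa> (rs 0 0 l) \<otimes> (xs l \<otimes> (U (- int l) \<otimes> t [^] l))) = (\<Oplus>l\<in>{..<p}. if l = 0 then xs l else \<zero>)"
  using ladderD(1)[OF assms] by (intro C.finsum_cong') (auto simp: z)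
 also have "\<dots> = xs 0"
  using ladderD(1)[OF assms] p_pos by (intro C.add.finprod_singleton_swap) auto
 finally show ?case using ladderD(1)[OF assms] by simp
next
 case (Suc z)
 note x [simp] = ladderD(1)[OF assms]
 let ?z = "int z"
 define c :: "int \<Rightarrow> nat \<Rightarrow> 'k" where "c w l = rs 0 w l" for w l
 define E where "E w = (\<Oplus>l\<in>{..<p}. \<kappa> (c w l) \<otimes> (xs l \<otimes> (U (- int l) \<otimes> t [^] l)))" for w
 have E [simp]: "E w \<in> carrier C" for w unfolding E_def by (auto intro!: C.finsum_closed)
 have step: "u \<otimes> E (w + 1) = E w \<otimes> u" for w
 proof -
  define a where "a l = \<kappa> (c (w + 1) l) \<otimes> (xs l \<otimes> (U (1 - int l) \<otimes> t [^] l))" for l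
  define b where "b l = \<kappa> (- (c (w + 1) (l - 1) * of_nat l)) \<otimes> (xs l \<otimes> (U (1 - int l) \<otimes> t [^] l))" for l
  have ab: "a l \<in> carrier C" "b l \<in> carrier C" for l by (simp_all add: a_def b_def)
  have b0: "b 0 = \<zero>" "b p = \<zero>" by (simp_all add: b_def ladderD(3)[OF assms])
  have "u \<otimes> E (w + 1) = (\<Oplus>l\<in>{..<p}. u \<otimes> (\<kappa> (c (w + 1) l) \<otimes> (xs l \<otimes> (U (- int l) \<otimes> t [^] l))))"
   unfolding E_def by (intro C.finsum_rdistr) auto
  also have "\<dots> = (\<Oplus>l\<in>{..<p}. a l \<oplus> b (Suc l))"
  proof (intro C.finsum_cong' refl)
   fix l
   have u1: "u \<otimes> U (- int l) = U (1 - int l)" using U_add[of 1 "- int l"] by simp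
   have i: "1 - int (Suc l) = - int l" by simp
   have ux: "u \<otimes> xs l = xs l \<otimes> u \<oplus> \<ominus> (\<kappa> (of_nat (Suc l)) \<otimes> (xs (Suc l) \<otimes> t))"
    unfolding ladder_u[OF assms] by (simp add: C.a_assoc C.r_neg del: of_nat_Suc)
   have "u \<otimes> (\<kappa> (c (w + 1) l) \<otimes> (xs l \<otimes> (U (- int l) \<otimes> t [^] l))) = \<kappa> (c (w + 1) l) \<otimes> ((u \<otimes> xs l) \<otimes> (U (- int l) \<otimes> t [^] l))"
    by (simp add: kappa_lcomm[OF u_closed] C.m_assoc)
   also have "\<dots> = \<kappa> (c (w + 1) l) \<otimes> (xs l \<otimes> ((u \<otimes> U (- int l)) \<otimes> t [^] l)) \<oplus>
     \<ominus> (\<kappa> (c (w + 1) l) \<otimes> (\<kappa> (of_nat (Suc l)) \<otimes> (xs (Suc l) \<otimes> (t \<otimes> (U (- int l) \<otimes> t [^] l)))))"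
    unfolding ux by (simp add: C.l_distr C.r_distr C.m_assoc C.l_minus C.r_minus del: of_nat_Suc)
   also have "t \<otimes> (U (- int l) \<otimes> t [^] l) = U (- int l) \<otimes> t [^] Suc l"
    by (simp add: t_central C.m_assoc)
   also have "\<kappa> (c (w + 1) l) \<otimes> (xs l \<otimes> ((u \<otimes> U (- int l)) \<otimes> t [^] l)) \<oplus>
     \<ominus> (\<kappa> (c (w + 1) l) \<otimes> (\<kappa> (of_nat (Suc l)) \<otimes> (xs (Suc l) \<otimes> (U (- int l) \<otimes> t [^] Suc l)))) = a l \<oplus> b (Suc l)"
    unfolding u1 a_def b_def i by (simp add: kappa_mult kappa_uminus C.m_assoc C.l_minus del: of_nat_Suc C.nat_pow_Suc)
   finally show "u \<otimes> (\<kappa> (c (w + 1) l) \<otimes> (xs l \<otimes> (U (- int l) \<otimes> t [^] l))) = a l \<oplus> b (Suc l)" .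
  qed (use ab in auto)
  also have "\<dots> = (\<Oplus>l\<in>{..<p}. a l \<oplus> b l)"
   by (rule combine_shifted) (use ab b0 in auto)
  also have "\<dots> = (\<Oplus>l\<in>{..<p}. (\<kappa> (c w l) \<otimes> (xs l \<otimes> (U (- int l) \<otimes> t [^] l))) \<otimes> u)"
  proof (intro C.finsum_cong' refl)
   fix l
   have u1: "U (- int l) \<otimes> u = U (1 - int l)" using U_add[of "- int l" 1] by simp
   have "c (w + 1) l + - (c (w + 1) (l - 1) * of_nat l) = c w l"
   proof (cases l)
    case (Suc m)
    show ?thesis
     unfolding c_def Suc diff_Suc_1 rs_Suc[of 0 "w + 1" m] rs_Suc'[of 0 w m] by (simp add: algebra_simps)
   qed (simp add: c_def)
   then have "a l \<oplus> b l = \<kappa> (c w l) \<otimes> (xs l \<otimes> (U (1 - int l) \<otimes> t [^] l))"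
    unfolding a_def b_def by (simp only: C.l_distr[symmetric] kappa_add[symmetric] kappa_closed C.m_closed U_closed x C.nat_pow_closed t_closed)
   moreover have "(xs l \<otimes> (U (- int l) \<otimes> t [^] l)) \<otimes> u = xs l \<otimes> ((U (- int l) \<otimes> u) \<otimes> t [^] l)"
    by (simp add: C.m_assoc t_pow_central)
   ultimately show "a l \<oplus> b l = (\<kappa> (c w l) \<otimes> (xs l \<otimes> (U (- int l) \<otimes> t [^] l))) \<otimes> u"
    by (simp add: C.m_assoc u1)
  qed auto
  also have "\<dots> = E w \<otimes> u" unfolding E_def by (intro C.finsum_ldistr[symmetric]) auto
  finally show ?thesis .
 qed
 have s: "U (int (Suc z)) = U ?z \<otimes> u" using U_add[of ?z 1] by (simp add: add.commute)
 have "xs 0 \<otimes> U (int (Suc z)) = (xs 0 \<otimes> U ?z) \<otimes> u" unfolding s by (simp only: C.m_assoc u_closed U_closed x)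
 also have "\<dots> = (U ?z \<otimes> E ?z) \<otimes> u" using Suc.IH unfolding E_def c_def by simp
 also have "\<dots> = U ?z \<otimes> (E ?z \<otimes> u)" by (simp only: C.m_assoc u_closed U_closed E)
 also have "\<dots> = (U ?z \<otimes> u) \<otimes> E (?z + 1)" unfolding step[symmetric] by (simp only: C.m_assoc u_closed U_closed E)
 also have "\<dots> = U (int (Suc z)) \<otimes> E (int (Suc z))" unfolding s by (simp add: add.commute)
 finally show ?case unfolding E_def c_def .
qed

end

context abelian_group
begin

lemma finsum_per_neg:
 assumes f: "per p f" "\<And>z. f z \<in> carrier G" and p: "p > 0"
 shows "(\<Oplus>z\<in>{0..<int p}. f (- z)) = (\<Oplus>z\<in>{0..<int p}. f z)"
proof -
 let ?h = "\<lambda>z. (- z) mod int p"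
 have inj: "inj_on ?h {0..<int p}"
 proof (rule inj_onI)
  fix x y assume xy: "x \<in> {0..<int p}" "y \<in> {0..<int p}" "?h x = ?h y"
  then have "[x = y] (mod int p)" using cong_minus_minus_iff[of x y "int p"] by (simp add: cong_def)
  then show "x = y" using xy by (simp add: cong_def)
 qed
 have "?h ` {0..<int p} \<subseteq> {0..<int p}" using p by auto
 then have im: "?h ` {0..<int p} = {0..<int p}"
  using inj by (intro endo_inj_surj) auto
 have "(\<Oplus>z\<in>{0..<int p}. f z) = (\<Oplus>z\<in>?h ` {0..<int p}. f z)" by (simp only: im)
 also have "\<dots> = (\<Oplus>z\<in>{0..<int p}. f (?h z))"
  using f by (intro finsum_reindex inj) auto
 also have "\<dots> = (\<Oplus>z\<in>{0..<int p}. f (- z))"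
  using f by (intro finsum_cong') (auto intro: per_cong)
 finally show ?thesis ..
qed

lemma finsum_swap:
 assumes "finite I" "finite J" "\<And>i j. \<lbrakk>i \<in> I; j \<in> J\<rbrakk> \<Longrightarrow> f i j \<in> carrier G"
 shows "(\<Oplus>i\<in>I. \<Oplus>j\<in>J. f i j) = (\<Oplus>j\<in>J. \<Oplus>i\<in>I. f i j)"
 using assms(1,3)
proof (induction I rule: finite_induct)
 case (insert x F)
 then have "(\<Oplus>i\<in>insert x F. \<Oplus>j\<in>J. f i j) = (\<Oplus>j\<in>J. f x j) \<oplus> (\<Oplus>i\<in>F. \<Oplus>j\<in>J. f i j)"
  by (intro finsum_insert) (auto intro!: finsum_closed)
 also have "\<dots> = (\<Oplus>j\<in>J. f x j) \<oplus> (\<Oplus>j\<in>J. \<Oplus>i\<in>F. f i j)"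
  using insert by simp
 also have "\<dots> = (\<Oplus>j\<in>J. f x j \<oplus> (\<Oplus>i\<in>F. f i j))"
  using insert by (intro finsum_addf[symmetric]) (auto intro!: finsum_closed)
 also have "\<dots> = (\<Oplus>j\<in>J. \<Oplus>i\<in>insert x F. f i j)"
  using insert by (intro finsum_cong') (auto intro!: finsum_closed)
 finally show ?case .
qed simp

end

text \<open>What the twist takes from the special algebra: maps \<Delta>0, S0 and \<epsilon> for
  which h, e and a set G of generators of definite weight are primitive. \<open>gen_induct\<close>
  expresses that A is generated over R by G as an induction rule, because identities are propagated
  from G through sums and products.\<close>

locale hopf_twist = A: unital_algebra R A + C: cartan_nilpotent A \<kappa> p h e "unit_map A t0"
 for R :: "('r, 'm) ring_scheme" and A :: "('a, 'r) ralg" (structure) and \<kappa> :: "'k::field \<Rightarrow> 'a" and p h e and t0 :: 'r +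
 fixes \<kappa>0 :: "'k \<Rightarrow> 'r" and G :: "'a set"
  and \<Delta>0 :: "'a \<Rightarrow> ('a \<times> 'a \<Rightarrow>\<^sub>0 int) set" and S0 :: "'a \<Rightarrow> 'a" and \<epsilon> :: "'a \<Rightarrow> 'r"
 assumes t0_closed [simp]: "t0 \<in> carrier R"
  and kappa0_closed [simp]: "\<kappa>0 s \<in> carrier R" and kappa_unit: "\<kappa> s = unit_map A (\<kappa>0 s)"
  and gen_induct: "\<And>P a. \<lbrakk>a \<in> carrier A; \<And>r. r \<in> carrier R \<Longrightarrow> P (unit_map A r); \<And>g. g \<in> G \<Longrightarrow> P g;
   \<And>a b. \<lbrakk>a \<in> carrier A; b \<in> carrier A; P a; P b\<rbrakk> \<Longrightarrow> P (a \<oplus> b);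
   \<And>a b. \<lbrakk>a \<in> carrier A; b \<in> carrier A; P a; P b\<rbrakk> \<Longrightarrow> P (a \<otimes> b)\<rbrakk> \<Longrightarrow> P a"
  and G_weight: "g \<in> G \<Longrightarrow> \<exists>w. C.weight w g"
  and D0_hom: "\<Delta>0 \<in> ring_hom A (tensor_alg R A A)"
  and D0_unit: "r \<in> carrier R \<Longrightarrow> \<Delta>0 (unit_map A r) = unit_map (tensor_alg R A A) r"
  and S0_closed [simp]: "a \<in> carrier A \<Longrightarrow> S0 a \<in> carrier A"
  and S0_add: "\<lbrakk>a \<in> carrier A; b \<in> carrier A\<rbrakk> \<Longrightarrow> S0 (a \<oplus> b) = S0 a \<oplus> S0 b"
  and S0_mult: "\<lbrakk>a \<in> carrier A; b \<in> carrier A\<rbrakk> \<Longrightarrow> S0 (a \<otimes> b) = S0 b \<otimes> S0 a"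
  and S0_unit: "r \<in> carrier R \<Longrightarrow> S0 (unit_map A r) = unit_map A r"
  and eps_hom: "\<epsilon> \<in> ring_hom A R"
  and eps_unit: "r \<in> carrier R \<Longrightarrow> \<epsilon> (unit_map A r) = r"
  and primitive: "x \<in> G \<union> {h, e} \<Longrightarrow> \<Delta>0 x = tens R A A x \<one> \<oplus>\<^bsub>tensor_alg R A A\<^esub> tens R A A \<one> x"
   "x \<in> G \<union> {h, e} \<Longrightarrow> S0 x = \<ominus> x" "x \<in> G \<union> {h, e} \<Longrightarrow> \<epsilon> x = \<zero>\<^bsub>R\<^esub>"
begin

sublocale T3: three_algebras R A A A
 by (simp add: three_algebras_def two_algebras_def A.unital_algebra_axioms)

abbreviation "AA \<equiv> tensor_alg R A A"
abbreviation mult_AA (infixl "\<bullet>" 70) where "x \<bullet> y \<equiv> x \<otimes>\<^bsub>AA\<^esub> y"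
abbreviation "T \<equiv> tens R A A"

lemma G_closed [simp]: "g \<in> G \<Longrightarrow> g \<in> carrier A"
 using G_weight C.weight_closed by blast

lemma T_sum_right: "\<lbrakk>a \<in> carrier A; g \<in> I \<rightarrow> carrier A\<rbrakk> \<Longrightarrow>
  T a (\<Oplus>i\<in>I. g i) = (\<Oplus>\<^bsub>AA\<^esub>i\<in>I. T a (g i))"
 by (rule additive_finsum) (auto intro: A.A.is_abelian_group T3.AB.Q.is_abelian_group simp: T3.AB.tens_add_right)

lemma T_sum_left: "\<lbrakk>a \<in> carrier A; g \<in> I \<rightarrow> carrier A\<rbrakk> \<Longrightarrow>
  T (\<Oplus>i\<in>I. g i) a = (\<Oplus>\<^bsub>AA\<^esub>i\<in>I. T (g i) a)"
 by (rule additive_finsum[where \<phi> = "\<lambda>x. T x a"])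
   (auto intro: A.A.is_abelian_group T3.AB.Q.is_abelian_group simp: T3.AB.tens_add_left)

text \<open>Elements of this shape multiply componentwise, by orthogonality of the idempotents. The
  twist and its inverse are of this shape, so twisting a diagonal element means conjugating its
  component at z by u^z.\<close>

definition diag :: "(int \<Rightarrow> 'a) \<Rightarrow> ('a \<times> 'a \<Rightarrow>\<^sub>0 int) set" where
 "diag b = (\<Oplus>\<^bsub>AA\<^esub>z\<in>C.Zp. T (C.pj z) (b z))"

lemma diag_closed [simp]: "(\<And>z. b z \<in> carrier A) \<Longrightarrow> diag b \<in> carrier AA"
 unfolding diag_def by (intro T3.AB.Q.finsum_closed) auto

abbreviation "per \<equiv> A.A.per p"

lemma AA_perI: "(\<And>z. f (z + int p) = f z) \<Longrightarrow> T3.AB.Q.per p f"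
 by (simp add: T3.AB.Q.per_def)

lemma diag_mult:
 assumes b: "\<And>z. b z \<in> carrier A" and c: "\<And>z. c z \<in> carrier A" "per c"
 shows "diag b \<bullet> diag c = diag (\<lambda>z. b z \<otimes> c z)"
proof -
 have "diag b \<bullet> diag c = (\<Oplus>\<^bsub>AA\<^esub>z\<in>C.Zp. T (C.pj z) (b z) \<bullet> diag c)"
  unfolding diag_def[of b] by (intro T3.AB.Q.finsum_ldistr) (use b c in auto)
 also have "\<dots> = (\<Oplus>\<^bsub>AA\<^esub>z\<in>C.Zp. T (C.pj z) (b z \<otimes> c z))"
 proof (intro T3.AB.Q.finsum_cong' refl)
  fix z
  have "T (C.pj z) (b z) \<bullet> diag c = (\<Oplus>\<^bsub>AA\<^esub>w\<in>C.Zp. T (C.pj z) (b z) \<bullet> T (C.pj w) (c w))"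
   unfolding diag_def by (intro T3.AB.Q.finsum_rdistr) (use b c in auto)
  also have "\<dots> = (\<Oplus>\<^bsub>AA\<^esub>w\<in>C.Zp. if [w = z] (mod int p) then T (C.pj w) (b z \<otimes> c w) else \<zero>\<^bsub>AA\<^esub>)"
   by (intro T3.AB.Q.finsum_cong') (use b c in \<open>auto simp: T3.AB.tens_mult C.pj_mult cong_sym_eq\<close>)
  also have "\<dots> = T (C.pj z) (b z \<otimes> c z)"
   by (rule T3.AB.Q.finsum_per_single) (use b c C.p_pos in \<open>auto simp: T3.AB.Q.per_def A.A.per_def\<close>)
  finally show "T (C.pj z) (b z) \<bullet> diag c = T (C.pj z) (b z \<otimes> c z)" .
 qed (use b c in auto)
 finally show ?thesis unfolding diag_def .
qed

lemma diag_const: "x \<in> carrier A \<Longrightarrow> diag (\<lambda>_. x) = T \<one> x"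
 unfolding diag_def C.pj_sum[symmetric] by (rule T_sum_left[symmetric]) auto

lemma diag_cong: "(\<And>z. z \<in> C.Zp \<Longrightarrow> b z = c z) \<Longrightarrow> (\<And>z. c z \<in> carrier A) \<Longrightarrow> diag b = diag c"
 unfolding diag_def by (intro T3.AB.Q.finsum_cong') auto

definition F where "F = diag C.U"
definition F' where "F' = diag (\<lambda>z. C.U (- z))"

lemma per_U_neg: "per (\<lambda>z. C.U (- z))"
proof -
 have "C.U (- (z + int p)) = C.U (- z)" for z by (rule C.U_cong) (simp add: cong_iff_dvd_diff)
 then show ?thesis unfolding A.A.per_def by blast
qed

lemma F_closed [simp]: "F \<in> carrier AA" "F' \<in> carrier AA"
 by (simp_all add: F_def F'_def)

lemma F_inverse: "F \<bullet> F' = \<one>\<^bsub>AA\<^esub>" "F' \<bullet> F = \<one>\<^bsub>AA\<^esub>"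
 unfolding F_def F'_def
 by (simp_all add: diag_mult C.U_per per_U_neg C.U_inverse diag_const T3.AB.tens_one)

definition \<Delta> where "\<Delta> a = F \<bullet> \<Delta>0 a \<bullet> F'"

lemma D0_closed [simp]: "a \<in> carrier A \<Longrightarrow> \<Delta>0 a \<in> carrier AA"
 using D0_hom by (rule ring_hom_closed)

lemma conj_F_mult:
 assumes "a \<in> carrier AA" "b \<in> carrier AA"
 shows "(F \<bullet> a \<bullet> F') \<bullet> (F \<bullet> b \<bullet> F') = F \<bullet> (a \<bullet> b) \<bullet> F'"
proof -
 have "F' \<bullet> (F \<bullet> (b \<bullet> F')) = b \<bullet> F'"
  using assms by (simp add: T3.AB.Q.m_assoc[symmetric] F_inverse)
 then show ?thesis using assms by (simp add: T3.AB.Q.m_assoc)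
qed

lemma D_hom: "\<Delta> \<in> ring_hom A AA"
proof (rule ring_hom_memI)
 show "\<Delta> \<one> = \<one>\<^bsub>AA\<^esub>"
  by (simp add: \<Delta>_def ring_hom_one[OF D0_hom] F_inverse)
qed (simp_all add: \<Delta>_def conj_F_mult ring_hom_mult[OF D0_hom] ring_hom_add[OF D0_hom] T3.AB.Q.l_distr T3.AB.Q.r_distr)

lemma D_closed [simp]: "a \<in> carrier A \<Longrightarrow> \<Delta> a \<in> carrier AA"
 using D_hom by (rule ring_hom_closed)

lemma unit_AA: "unit_map AA r = T (unit_map A r) \<one>"
 by (simp add: T3.AB.AB_simps(6))

lemma unit_AA_closed [simp]: "r \<in> carrier R \<Longrightarrow> unit_map AA r \<in> carrier AA"
 by (simp add: unit_AA)

lemma D_unit: assumes "r \<in> carrier R" shows "\<Delta> (unit_map A r) = unit_map AA r"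
proof -
 have "F \<bullet> unit_map AA r = unit_map AA r \<bullet> F"
  using unital_algebra.unit_map_central[OF T3.AB.unital_algebra_AB assms] by simp
 then show ?thesis
  using assms by (simp add: \<Delta>_def D0_unit T3.AB.Q.m_assoc F_inverse)
qed

text \<open>Passing x \<otimes> 1 through the twist shifts the index z by the weight of x, which
  leaves a factor u^w on the right. The element 1 \<otimes> x is diagonal and is conjugated in each
  component.\<close>

lemma D_primitive:
 assumes x: "C.weight w x" and prim: "\<Delta>0 x = T x \<one> \<oplus>\<^bsub>AA\<^esub> T \<one> x"
 shows "\<Delta> x = T x (C.U w) \<oplus>\<^bsub>AA\<^esub> diag (\<lambda>z. C.U z \<otimes> (x \<otimes> C.U (- z)))"
proof -
 have xc [simp]: "x \<in> carrier A" using x by (rule C.weight_closed)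
 have "F \<bullet> T x \<one> = (\<Oplus>\<^bsub>AA\<^esub>z\<in>C.Zp. T (C.pj z) (C.U z) \<bullet> T x \<one>)"
  unfolding F_def diag_def by (intro T3.AB.Q.finsum_ldistr) auto
 also have "\<dots> = (\<Oplus>\<^bsub>AA\<^esub>z\<in>C.Zp. (\<lambda>v. T (x \<otimes> C.pj v) (C.U (v + w))) (z + - w))"
  by (simp add: T3.AB.tens_mult C.weight_pj[OF x])
 also have "\<dots> = (\<Oplus>\<^bsub>AA\<^esub>z\<in>C.Zp. T (x \<otimes> C.pj z) (C.U (z + w)))"
  by (rule T3.AB.Q.finsum_per_shift) (use C.p_pos in \<open>auto intro!: AA_perI\<close>)
 also have "\<dots> = (\<Oplus>\<^bsub>AA\<^esub>z\<in>C.Zp. T x (C.U w) \<bullet> T (C.pj z) (C.U z))"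
  by (simp add: T3.AB.tens_mult C.U_add add.commute)
 also have "\<dots> = T x (C.U w) \<bullet> F"
  unfolding F_def diag_def by (intro T3.AB.Q.finsum_rdistr[symmetric]) auto
 finally have 1: "F \<bullet> T x \<one> \<bullet> F' = T x (C.U w)"
  by (simp add: T3.AB.Q.m_assoc F_inverse)
 have 2: "F \<bullet> T \<one> x \<bullet> F' = diag (\<lambda>z. C.U z \<otimes> x \<otimes> C.U (- z))"
  unfolding F_def F'_def diag_const[OF xc, symmetric]
  by (simp add: diag_mult per_U_neg A.A.per_def)
 show ?thesis
  unfolding \<Delta>_def prim using 1 2 by (simp add: T3.AB.Q.l_distr T3.AB.Q.r_distr A.A.m_assoc)
qed

text \<open>e commutes with u and has weight 1, so \<Delta> e = e \<otimes> u + 1 \<otimes> e. Then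
  1 - et \<otimes> u - 1 \<otimes> et factors as u \<otimes> u.\<close>

lemma D_u: "\<Delta> C.u = T C.u C.u"
proof -
 have "diag (\<lambda>z. C.U z \<otimes> (e \<otimes> C.U (- z))) = diag (\<lambda>_. e)"
 proof (rule diag_cong)
  fix z
  have "C.U z \<otimes> (e \<otimes> C.U (- z)) = (C.U z \<otimes> e) \<otimes> C.U (- z)" by (simp add: A.A.m_assoc)
  then show "C.U z \<otimes> (e \<otimes> C.U (- z)) = e" by (simp add: C.U_e A.A.m_assoc C.U_inverse)
 qed simp
 then have De: "\<Delta> e = T e C.u \<oplus>\<^bsub>AA\<^esub> T \<one> e"
  using D_primitive[OF C.weight_e] primitive(1)[of e] by (simp add: diag_const)
 \<comment> \<open>Tensors are taken over R, so t may be moved to the second factor.\<close>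
 have "T (unit_map A t0) e = T \<one> C.et"
  using T3.AB.tens_balanced[of t0 "\<one>" e] C.t_central[of e] by (simp add: C.et_def)
 then have Det: "\<Delta> C.et = T C.et C.u \<oplus>\<^bsub>AA\<^esub> T \<one> C.et"
  using De by (simp add: C.et_def ring_hom_mult[OF D_hom] D_unit unit_AA T3.AB.Q.l_distr T3.AB.tens_mult)
 interpret D: ring_hom_ring A AA \<Delta> by unfold_locales (rule D_hom)
 have "\<Delta> C.u = \<one>\<^bsub>AA\<^esub> \<ominus>\<^bsub>AA\<^esub> (T C.et C.u \<oplus>\<^bsub>AA\<^esub> T \<one> C.et)"
  unfolding C.u_def a_minus_def using Det by (simp add: C.u_def a_minus_def)
 also have "\<dots> = (T \<one> \<one> \<ominus>\<^bsub>AA\<^esub> T \<one> C.et) \<ominus>\<^bsub>AA\<^esub> T C.et C.u"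
  by (simp add: T3.AB.tens_one a_minus_def T3.AB.Q.minus_add T3.AB.Q.a_ac)
 also have "T \<one> \<one> \<ominus>\<^bsub>AA\<^esub> T \<one> C.et = T \<one> C.u"
  unfolding C.u_def a_minus_def by (simp add: T3.AB.tens_add_right T3.AB.tens_minus_right)
 also have "T \<one> C.u \<ominus>\<^bsub>AA\<^esub> T C.et C.u = T C.u C.u"
  unfolding C.u_def[unfolded a_minus_def] a_minus_def
  by (simp add: T3.AB.tens_add_left T3.AB.tens_minus_left)
 finally show ?thesis .
qed

lemma T_pow: "\<lbrakk>a \<in> carrier A; b \<in> carrier A\<rbrakk> \<Longrightarrow> T a b [^]\<^bsub>AA\<^esub> (m::nat) = T (a [^] m) (b [^] m)"
 by (induction m) (simp_all add: T3.AB.tens_one T3.AB.tens_mult)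

lemma D_U: "\<Delta> (C.U z) = T (C.U z) (C.U z)"
proof -
 interpret D: ring_hom_ring A AA \<Delta> by unfold_locales (rule D_hom)
 show ?thesis unfolding C.U_def by (simp add: D.hom_nat_pow D_u T_pow)
qed

lemma D_h: "\<Delta>0 h = T h \<one> \<oplus>\<^bsub>AA\<^esub> T \<one> h"
 by (rule primitive) simp

lemma charp_AA: "charp_algebra AA (\<lambda>s. unit_map AA (\<kappa>0 s)) p"
proof (unfold_locales)
 show "(\<lambda>s. unit_map AA (\<kappa>0 s)) \<in> ring_hom ring_of_type_algebra AA"
 proof (rule ring_hom_memI)
  fix x y :: 'k
  show "unit_map AA (\<kappa>0 (x \<otimes>\<^bsub>ring_of_type_algebra\<^esub> y)) = unit_map AA (\<kappa>0 x) \<bullet> unit_map AA (\<kappa>0 y)"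
   by (simp add: unit_AA kappa_unit[symmetric] C.kappa_mult T3.AB.tens_mult)
  show "unit_map AA (\<kappa>0 (x \<oplus>\<^bsub>ring_of_type_algebra\<^esub> y)) = unit_map AA (\<kappa>0 x) \<oplus>\<^bsub>AA\<^esub> unit_map AA (\<kappa>0 y)"
   by (simp add: unit_AA kappa_unit[symmetric] C.kappa_add T3.AB.tens_add_left)
 next
  show "unit_map AA (\<kappa>0 \<one>\<^bsub>ring_of_type_algebra\<^esub>) = \<one>\<^bsub>AA\<^esub>"
   by (simp add: unit_AA kappa_unit[symmetric] T3.AB.tens_one)
 qed simp
next
 show "x \<in> carrier AA \<Longrightarrow> unit_map AA (\<kappa>0 s) \<bullet> x = x \<bullet> unit_map AA (\<kappa>0 s)" for x s
  using unital_algebra.unit_map_central[OF T3.AB.unital_algebra_AB kappa0_closed] by simp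
qed (rule C.char_p C.p_pos)+

text \<open>h \<otimes> 1 + 1 \<otimes> h has eigenvalue a + b on \<pi>_a \<otimes> \<pi>_b. Before
  twisting, \<pi>_z therefore becomes the sum of the \<pi>_a \<otimes> \<pi>_(z-a), a diagonal
  element that the twist conjugates componentwise.\<close>

lemma D_pj: "\<Delta> (C.pj z) = diag (\<lambda>a. C.U a \<otimes> (C.pj (z - a) \<otimes> C.U (- a)))"
proof -
 interpret K: charp_algebra AA "\<lambda>s. unit_map AA (\<kappa>0 s)" p by (rule charp_AA)
 let ?k = "\<lambda>s. unit_map AA (\<kappa>0 s)"
 define H where "H = T h \<one> \<oplus>\<^bsub>AA\<^esub> T \<one> h"
 have Hc [simp]: "H \<in> carrier AA" by (simp add: H_def)
 interpret EH: poly_evaluation AA ?k H by (rule K.poly_evaluation) simp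
 have k: "?k s = T (\<kappa> s) \<one>" for s by (simp add: unit_AA kappa_unit)
 have k': "T \<one> (\<kappa> s \<otimes> x) = T (\<kappa> s) x" if "x \<in> carrier A" for s x
  using T3.AB.tens_balanced[of "\<kappa>0 s" "\<one>" x] that by (simp add: kappa_unit)
 have Hv: "H \<bullet> T (C.pj a) (C.pj b) = ?k (of_int (a + b)) \<bullet> T (C.pj a) (C.pj b)" for a b
 proof -
  have "T (C.pj a) (\<kappa> s \<otimes> C.pj b) = T (\<kappa> s \<otimes> C.pj a) (C.pj b)" for s
   using T3.AB.tens_balanced[of "\<kappa>0 s" "C.pj a" "C.pj b"] by (simp add: kappa_unit)
  then show ?thesis
   by (simp add: H_def k T3.AB.Q.l_distr T3.AB.tens_mult C.h_pj C.kappa_add A.A.l_distr T3.AB.tens_add_left)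
 qed
 have "\<Delta>0 (C.pj z) = EH.ev (lagr p z)"
  unfolding C.pj_def
  by (rule poly_ev_hom[OF C.E.poly_evaluation_axioms EH.poly_evaluation_axioms D0_hom])
    (simp_all add: kappa_unit D0_unit D_h H_def)
 also have "\<dots> = diag (\<lambda>a. C.pj (z - a))"
 proof -
  have ev: "EH.ev (lagr p z) \<bullet> T (C.pj a) (C.pj b) = (if [b = z - a] (mod int p) then T (C.pj a) (C.pj b) else \<zero>\<^bsub>AA\<^esub>)" for a b
  proof -
   have "[z = a + b] (mod int p) \<longleftrightarrow> [b = z - a] (mod int p)"
    by (auto simp: cong_iff_dvd_diff algebra_simps dvd_diff_commute)
   then show ?thesis
    unfolding EH.ev_eigenvector[OF T3.AB.tens_closed[OF C.pj_closed C.pj_closed] Hv] poly_lagr[OF C.char_p C.p_pos]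
    by simp
  qed
  have "EH.ev (lagr p z) = EH.ev (lagr p z) \<bullet> diag (\<lambda>_. \<one>)"
   by (simp add: diag_const T3.AB.tens_one[symmetric])
  also have "\<dots> = (\<Oplus>\<^bsub>AA\<^esub>a\<in>C.Zp. EH.ev (lagr p z) \<bullet> T (C.pj a) \<one>)"
   unfolding diag_def by (intro T3.AB.Q.finsum_rdistr) auto
  also have "\<dots> = (\<Oplus>\<^bsub>AA\<^esub>a\<in>C.Zp. T (C.pj a) (C.pj (z - a)))"
  proof (intro T3.AB.Q.finsum_cong' refl)
   fix a
   have "EH.ev (lagr p z) \<bullet> T (C.pj a) \<one> = EH.ev (lagr p z) \<bullet> (\<Oplus>\<^bsub>AA\<^esub>b\<in>C.Zp. T (C.pj a) (C.pj b))"
    by (subst T_sum_right[symmetric]) (simp_all add: C.pj_sum Pi_def)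
   also have "\<dots> = (\<Oplus>\<^bsub>AA\<^esub>b\<in>C.Zp. EH.ev (lagr p z) \<bullet> T (C.pj a) (C.pj b))"
    by (intro T3.AB.Q.finsum_rdistr) auto
   also have "\<dots> = T (C.pj a) (C.pj (z - a))"
    unfolding ev by (rule T3.AB.Q.finsum_per_single) (use C.p_pos in \<open>auto intro!: AA_perI\<close>)
   finally show "EH.ev (lagr p z) \<bullet> T (C.pj a) \<one> = T (C.pj a) (C.pj (z - a))" .
  qed auto
  finally show ?thesis unfolding diag_def .
 qed
 finally have D0: "\<Delta>0 (C.pj z) = diag (\<lambda>a. C.pj (z - a))" .
 have per: "per (\<lambda>a. C.pj (z - a))"
 proof -
  have "C.pj (z - (a + int p)) = C.pj (z - a)" for a by (rule C.pj_cong) (simp add: cong_iff_dvd_diff)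
  then show ?thesis unfolding A.A.per_def by blast
 qed
 show ?thesis
  unfolding \<Delta>_def D0 F_def F'_def by (simp add: diag_mult per per_U_neg A.A.m_assoc)
qed

lemma hom_eqI:
 assumes f: "f \<in> ring_hom A B" and g: "g \<in> ring_hom A B" and "\<And>r. r \<in> carrier R \<Longrightarrow> f (unit_map A r) = g (unit_map A r)"
  and "\<And>x. x \<in> G \<Longrightarrow> f x = g x" and a: "a \<in> carrier A"
 shows "f a = g a"
 using a
 by (rule gen_induct)
   (simp_all add: assms ring_hom_add[OF f] ring_hom_add[OF g] ring_hom_mult[OF f] ring_hom_mult[OF g])

end

section \<open>Coassociativity of the twisted coproduct\<close>

context hopf_twist
begin

lemma alg_linear_D: "alg_linear R A AA \<Delta>"
 by (rule alg_linear_hom[OF A.unital_algebra_axioms D_hom D_unit])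

lemmas two = T3.AB.two_algebras_axioms T3.X.two_algebras_axioms T3.Y.two_algebras_axioms

abbreviation "XT \<equiv> tens R A AA"
abbreviation "YT \<equiv> tens R AA A"
abbreviation "AAA \<equiv> tensor_alg R A AA"
abbreviation "D1 \<equiv> tensor_map R AA A \<Delta> id"
abbreviation "D2 \<equiv> tensor_map R A AA id \<Delta>"
abbreviation "assoc \<equiv> tensor_assoc R A A A"

lemma D1_tens: "\<lbrakk>a \<in> carrier A; b \<in> carrier A\<rbrakk> \<Longrightarrow> D1 (T a b) = YT (\<Delta> a) b"
 using tensor_map_tens[OF two(1,3) alg_linear_D alg_linear_id] by simp

lemma D2_tens: "\<lbrakk>a \<in> carrier A; b \<in> carrier A\<rbrakk> \<Longrightarrow> D2 (T a b) = XT a (\<Delta> b)"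
 using tensor_map_tens[OF two(1,2) alg_linear_id alg_linear_D] by simp

lemma id_hom: "id \<in> ring_hom A A"
 by (rule ring_hom_memI) simp_all

lemma D1_hom: "D1 \<in> ring_hom AA (tensor_alg R AA A)"
 by (rule tensor_map_hom[OF two(1,3) alg_linear_D alg_linear_id D_hom id_hom])

lemma D2_hom: "D2 \<in> ring_hom AA AAA"
 by (rule tensor_map_hom[OF two(1,2) alg_linear_id alg_linear_D id_hom D_hom])

lemma XT_closed [simp]: "\<lbrakk>a \<in> carrier A; b \<in> carrier AA\<rbrakk> \<Longrightarrow> XT a b \<in> carrier AAA"
 by (rule T3.X.tens_closed)

lemma YT_closed [simp]: "\<lbrakk>a \<in> carrier AA; b \<in> carrier A\<rbrakk> \<Longrightarrow> YT a b \<in> carrier (tensor_alg R AA A)"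
 by (rule T3.Y.tens_closed)

lemma AAA_group: "abelian_group AAA" and AA_group: "abelian_group AA"
 and YY_group: "abelian_group (tensor_alg R AA A)" and A_group: "abelian_group A"
 by (rule T3.X.Q.is_abelian_group T3.AB.Q.is_abelian_group T3.Y.Q.is_abelian_group A.A.is_abelian_group)+

lemma hom_finsum':
 assumes "f \<in> ring_hom B B'" "ring B" "ring B'" "g \<in> I \<rightarrow> carrier B"
 shows "f (\<Oplus>\<^bsub>B\<^esub>i\<in>I. g i) = (\<Oplus>\<^bsub>B'\<^esub>i\<in>I. f (g i))"
 by (rule additive_finsum)
   (use assms ring_hom_closed[OF assms(1)] ring_hom_add[OF assms(1)] in \<open>auto simp: ring_def\<close>)

lemma XT_sum: "\<lbrakk>a \<in> carrier A; g \<in> I \<rightarrow> carrier AA\<rbrakk> \<Longrightarrow>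
  XT a (\<Oplus>\<^bsub>AA\<^esub>i\<in>I. g i) = (\<Oplus>\<^bsub>AAA\<^esub>i\<in>I. XT a (g i))"
 by (rule additive_finsum[OF AA_group AAA_group]) (auto simp: T3.X.tens_add_right)

lemma D1_diag: "(\<And>z. b z \<in> carrier A) \<Longrightarrow> D1 (diag b) = (\<Oplus>\<^bsub>tensor_alg R AA A\<^esub>z\<in>C.Zp. YT (\<Delta> (C.pj z)) (b z))"
 unfolding diag_def
 by (subst hom_finsum'[OF D1_hom T3.AB.Q.ring_axioms T3.Y.Q.ring_axioms]) (auto simp: D1_tens)

lemma D2_diag: "(\<And>z. b z \<in> carrier A) \<Longrightarrow> D2 (diag b) = (\<Oplus>\<^bsub>AAA\<^esub>z\<in>C.Zp. XT (C.pj z) (\<Delta> (b z)))"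
 unfolding diag_def
 by (subst hom_finsum'[OF D2_hom T3.AB.Q.ring_axioms T3.X.Q.ring_axioms]) (auto simp: D2_tens)

lemma assoc_hom: "assoc \<in> ring_hom (tensor_alg R AA A) AAA"
 by (rule T3.tensor_assoc_hom)

lemma assoc_diag:
 assumes "\<And>z. b z \<in> carrier A" "c \<in> carrier A"
 shows "assoc (YT (diag b) c) = (\<Oplus>\<^bsub>AAA\<^esub>z\<in>C.Zp. XT (C.pj z) (T (b z) c))"
proof -
 have "YT (diag b) c = (\<Oplus>\<^bsub>tensor_alg R AA A\<^esub>z\<in>C.Zp. YT (T (C.pj z) (b z)) c)"
  unfolding diag_def
  by (rule additive_finsum[OF AA_group YY_group, where \<phi> = "\<lambda>x. YT x c"])
    (use assms in \<open>auto simp: T3.Y.tens_add_left\<close>)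
 then show ?thesis
  using assms by (simp add: hom_finsum'[OF assoc_hom T3.Y.Q.ring_axioms T3.X.Q.ring_axioms] T3.tensor_assoc_tens)
qed

definition cj :: "'a \<Rightarrow> int \<Rightarrow> 'a" where "cj g z = C.U z \<otimes> (g \<otimes> C.U (- z))"

lemma cj_closed [simp]: "g \<in> carrier A \<Longrightarrow> cj g z \<in> carrier A"
 by (simp add: cj_def)

lemma cj_shift: "cj g (z + int p) = cj g z"
proof -
 have "C.U (- (z + int p)) = C.U (- z)" by (rule C.U_cong) (simp add: cong_iff_dvd_diff)
 then show ?thesis by (simp only: cj_def C.pj_shift)
qed

lemma D_G: assumes "C.weight w g" "g \<in> G \<union> {h, e}"
 shows "\<Delta> g = T g (C.U w) \<oplus>\<^bsub>AA\<^esub> diag (cj g)"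
 unfolding cj_def using assms by (intro D_primitive primitive) auto

lemma D_pj': "\<Delta> (C.pj z) = diag (\<lambda>a. cj (C.pj (z - a)) a)"
 unfolding cj_def by (rule D_pj)

lemma U_conj: "x \<in> carrier A \<Longrightarrow> C.U a \<otimes> (C.U b \<otimes> x) = C.U (a + b) \<otimes> x"
 by (rule C.U_add')

lemma D_cj:
 assumes w: "C.weight w g" and g: "g \<in> G"
 shows "\<Delta> (cj g z) = T (cj g z) (C.U w) \<oplus>\<^bsub>AA\<^esub> (\<Oplus>\<^bsub>AA\<^esub>a\<in>C.Zp. T (cj (C.pj a) z) (cj g (a + z)))"
proof -
 have gc [simp]: "g \<in> carrier A" using g by simp
 have "\<Delta> (cj g z) = T (C.U z) (C.U z) \<bullet> ((T g (C.U w) \<oplus>\<^bsub>AA\<^esub> diag (cj g)) \<bullet> T (C.U (- z)) (C.U (- z)))"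
  using g unfolding cj_def[of g z] by (simp add: ring_hom_mult[OF D_hom] D_U D_G[OF w])
 also have "\<dots> = T (C.U z) (C.U z) \<bullet> (T g (C.U w) \<bullet> T (C.U (- z)) (C.U (- z)))
   \<oplus>\<^bsub>AA\<^esub> T (C.U z) (C.U z) \<bullet> (diag (cj g) \<bullet> T (C.U (- z)) (C.U (- z)))"
  by (simp add: T3.AB.Q.l_distr T3.AB.Q.r_distr)
 also have "T (C.U z) (C.U z) \<bullet> (T g (C.U w) \<bullet> T (C.U (- z)) (C.U (- z))) = T (cj g z) (C.U w)"
  by (simp add: T3.AB.tens_mult cj_def C.U_add)
 also have "T (C.U z) (C.U z) \<bullet> (diag (cj g) \<bullet> T (C.U (- z)) (C.U (- z)))
   = (\<Oplus>\<^bsub>AA\<^esub>a\<in>C.Zp. T (C.U z) (C.U z) \<bullet> (T (C.pj a) (cj g a) \<bullet> T (C.U (- z)) (C.U (- z))))"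
 proof -
  have "diag (cj g) \<bullet> T (C.U (- z)) (C.U (- z)) = (\<Oplus>\<^bsub>AA\<^esub>a\<in>C.Zp. T (C.pj a) (cj g a) \<bullet> T (C.U (- z)) (C.U (- z)))"
   unfolding diag_def by (rule T3.AB.Q.finsum_ldistr) auto
  moreover have "T (C.U z) (C.U z) \<bullet> \<dots> = (\<Oplus>\<^bsub>AA\<^esub>a\<in>C.Zp. T (C.U z) (C.U z) \<bullet> (T (C.pj a) (cj g a) \<bullet> T (C.U (- z)) (C.U (- z))))"
   by (rule T3.AB.Q.finsum_rdistr) auto
  ultimately show ?thesis by (simp only:)
 qed
 also have "\<dots> = (\<Oplus>\<^bsub>AA\<^esub>a\<in>C.Zp. T (cj (C.pj a) z) (cj g (a + z)))"
 proof (intro T3.AB.Q.finsum_cong' refl)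
  fix a
  have "C.U z \<otimes> (cj g a \<otimes> C.U (- z)) = cj g (a + z)"
   by (simp add: cj_def A.A.m_assoc C.U_add U_conj add.commute)
  then show "T (C.U z) (C.U z) \<bullet> (T (C.pj a) (cj g a) \<bullet> T (C.U (- z)) (C.U (- z))) = T (cj (C.pj a) z) (cj g (a + z))"
   by (simp add: T3.AB.tens_mult cj_def[of "C.pj a"])
 qed auto
 finally show ?thesis .
qed

text \<open>Both sides are ring homomorphisms, so generators suffice. With g^(z) for the conjugate
  of g by u^z, each side consists of g \<otimes> u^w \<otimes> u^w, the terms \<pi>_z \<otimes>
  g^(z) \<otimes> u^w, and a double sum. The two double sums agree up to a shift of the index
  carried by the last factor.\<close>

lemma coassociativity:
 assumes "a \<in> carrier A" shows "assoc (D1 (\<Delta> a)) = D2 (\<Delta> a)"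
proof -
 have f: "(\<lambda>a. assoc (D1 (\<Delta> a))) \<in> ring_hom A AAA"
  using ring_hom_trans[OF ring_hom_trans[OF D_hom D1_hom] assoc_hom] by (simp add: comp_def)
 have g: "(\<lambda>a. D2 (\<Delta> a)) \<in> ring_hom A AAA"
  using ring_hom_trans[OF D_hom D2_hom] by (simp add: comp_def)
 show ?thesis
 proof (rule hom_eqI[OF f g _ _ assms])
  fix r assume r: "r \<in> carrier R"
  have "\<Delta> \<one> = T \<one> \<one>" using ring_hom_one[OF D_hom] by (simp add: T3.AB.tens_one)
  then show "assoc (D1 (\<Delta> (unit_map A r))) = D2 (\<Delta> (unit_map A r))"
   using r by (simp add: D_unit unit_AA D1_tens D2_tens T3.tensor_assoc_tens)
 next
  fix g assume g: "g \<in> G"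
  then obtain w where w: "C.weight w g" using G_weight by blast
  have gc [simp]: "g \<in> carrier A" using g by simp
  let ?t = "\<lambda>z a. XT (C.pj z) (T (cj (C.pj a) z) (cj g (a + z)))"
  have tc: "?t z a \<in> carrier AAA" for z a by simp
  have Dg: "\<Delta> g = T g (C.U w) \<oplus>\<^bsub>AA\<^esub> diag (cj g)" using D_G[OF w] g by simp
  have dc: "diag (cj g) \<in> carrier AA" by simp
  have "D2 (\<Delta> g) = XT g (T (C.U w) (C.U w)) \<oplus>\<^bsub>AAA\<^esub> (\<Oplus>\<^bsub>AAA\<^esub>z\<in>C.Zp. XT (C.pj z) (\<Delta> (cj g z)))"
   unfolding Dg using dc by (subst ring_hom_add[OF D2_hom]) (simp_all add: D2_tens D2_diag D_U)
  also have "(\<Oplus>\<^bsub>AAA\<^esub>z\<in>C.Zp. XT (C.pj z) (\<Delta> (cj g z))) =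
   (\<Oplus>\<^bsub>AAA\<^esub>z\<in>C.Zp. XT (C.pj z) (T (cj g z) (C.U w)) \<oplus>\<^bsub>AAA\<^esub> (\<Oplus>\<^bsub>AAA\<^esub>a\<in>C.Zp. ?t z a))"
  proof (intro T3.X.Q.finsum_cong' refl)
   fix z
   have "(\<Oplus>\<^bsub>AA\<^esub>a\<in>C.Zp. T (cj (C.pj a) z) (cj g (a + z))) \<in> carrier AA"
    by (intro T3.AB.Q.finsum_closed) auto
   then show "XT (C.pj z) (\<Delta> (cj g z)) = XT (C.pj z) (T (cj g z) (C.U w)) \<oplus>\<^bsub>AAA\<^esub> (\<Oplus>\<^bsub>AAA\<^esub>a\<in>C.Zp. ?t z a)"
    unfolding D_cj[OF w g] by (simp add: T3.X.tens_add_right XT_sum Pi_def)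
  qed (use tc in \<open>auto intro!: T3.X.Q.a_closed T3.X.Q.finsum_closed\<close>)
  also have "\<dots> = (\<Oplus>\<^bsub>AAA\<^esub>z\<in>C.Zp. XT (C.pj z) (T (cj g z) (C.U w))) \<oplus>\<^bsub>AAA\<^esub> (\<Oplus>\<^bsub>AAA\<^esub>z\<in>C.Zp. \<Oplus>\<^bsub>AAA\<^esub>a\<in>C.Zp. ?t z a)"
   by (intro T3.X.Q.finsum_addf) (use tc in \<open>auto intro!: T3.X.Q.finsum_closed\<close>)
  finally have R: "D2 (\<Delta> g) = XT g (T (C.U w) (C.U w)) \<oplus>\<^bsub>AAA\<^esub>
   ((\<Oplus>\<^bsub>AAA\<^esub>z\<in>C.Zp. XT (C.pj z) (T (cj g z) (C.U w))) \<oplus>\<^bsub>AAA\<^esub> (\<Oplus>\<^bsub>AAA\<^esub>z\<in>C.Zp. \<Oplus>\<^bsub>AAA\<^esub>a\<in>C.Zp. ?t z a))" .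
  have D1c: "D1 x \<in> carrier (tensor_alg R AA A)" if "x \<in> carrier AA" for x
   using ring_hom_closed[OF D1_hom that] .
  have "D1 (\<Delta> g) = YT (\<Delta> g) (C.U w) \<oplus>\<^bsub>tensor_alg R AA A\<^esub> D1 (diag (cj g))"
   by (subst Dg, subst ring_hom_add[OF D1_hom]) (simp_all add: D1_tens dc)
  then have "assoc (D1 (\<Delta> g)) = assoc (YT (\<Delta> g) (C.U w)) \<oplus>\<^bsub>AAA\<^esub> assoc (D1 (diag (cj g)))"
   using D1c dc by (simp add: ring_hom_add[OF assoc_hom])
  also have "assoc (YT (\<Delta> g) (C.U w)) = XT g (T (C.U w) (C.U w)) \<oplus>\<^bsub>AAA\<^esub> (\<Oplus>\<^bsub>AAA\<^esub>z\<in>C.Zp. XT (C.pj z) (T (cj g z) (C.U w)))"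
   unfolding Dg using dc by (simp add: T3.Y.tens_add_left ring_hom_add[OF assoc_hom] T3.tensor_assoc_tens assoc_diag)
  also have "assoc (D1 (diag (cj g))) = (\<Oplus>\<^bsub>AAA\<^esub>z\<in>C.Zp. assoc (YT (\<Delta> (C.pj z)) (cj g z)))"
   unfolding D1_diag[OF cj_closed[OF gc]]
   by (rule hom_finsum'[OF assoc_hom T3.Y.Q.ring_axioms T3.X.Q.ring_axioms]) auto
  also have "\<dots> = (\<Oplus>\<^bsub>AAA\<^esub>z\<in>C.Zp. \<Oplus>\<^bsub>AAA\<^esub>a\<in>C.Zp. XT (C.pj a) (T (cj (C.pj (z - a)) a) (cj g z)))"
   unfolding D_pj' by (simp add: assoc_diag)
  also have "\<dots> = (\<Oplus>\<^bsub>AAA\<^esub>a\<in>C.Zp. \<Oplus>\<^bsub>AAA\<^esub>z\<in>C.Zp. XT (C.pj a) (T (cj (C.pj (z - a)) a) (cj g z)))"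
   by (rule T3.X.Q.finsum_swap) auto
  also have "\<dots> = (\<Oplus>\<^bsub>AAA\<^esub>a\<in>C.Zp. \<Oplus>\<^bsub>AAA\<^esub>z\<in>C.Zp. ?t a z)"
  \<comment> \<open>For fixed a the inner sum is reindexed by z + a, which is legitimate because its
    terms are periodic in z.\<close>
  proof (rule T3.X.Q.finsum_cong'[OF refl])
   fix a
   have "(\<Oplus>\<^bsub>AAA\<^esub>z\<in>C.Zp. (\<lambda>z. XT (C.pj a) (T (cj (C.pj (z - a)) a) (cj g z))) (z + a)) =
     (\<Oplus>\<^bsub>AAA\<^esub>z\<in>C.Zp. XT (C.pj a) (T (cj (C.pj (z - a)) a) (cj g z)))"
    by (rule T3.X.Q.finsum_per_shift) (use C.p_pos in \<open>auto simp: T3.X.Q.per_def cj_shift\<close>)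
   then show "(\<Oplus>\<^bsub>AAA\<^esub>z\<in>C.Zp. XT (C.pj a) (T (cj (C.pj (z - a)) a) (cj g z))) = (\<Oplus>\<^bsub>AAA\<^esub>z\<in>C.Zp. ?t a z)"
    by simp
  qed (use tc in \<open>auto intro!: T3.X.Q.finsum_closed\<close>)
  finally have Lg: "assoc (D1 (\<Delta> g)) = (XT g (T (C.U w) (C.U w)) \<oplus>\<^bsub>AAA\<^esub> (\<Oplus>\<^bsub>AAA\<^esub>z\<in>C.Zp. XT (C.pj z) (T (cj g z) (C.U w))))
    \<oplus>\<^bsub>AAA\<^esub> (\<Oplus>\<^bsub>AAA\<^esub>a\<in>C.Zp. \<Oplus>\<^bsub>AAA\<^esub>z\<in>C.Zp. ?t a z)" .
  show "assoc (D1 (\<Delta> g)) = D2 (\<Delta> g)"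
   unfolding Lg R by (intro T3.X.Q.a_assoc) (use tc in \<open>auto intro!: T3.X.Q.finsum_closed\<close>)
 qed
qed

subsection \<open>Counit\<close>

lemma eps_closed [simp]: "a \<in> carrier A \<Longrightarrow> \<epsilon> a \<in> carrier R"
 using eps_hom by (rule ring_hom_closed)

lemma balanced_counit:
 "balanced_map R A A A (\<lambda>x y. unit_map A (\<epsilon> x) \<otimes> y)"
 "balanced_map R A A A (\<lambda>x y. x \<otimes> unit_map A (\<epsilon> y))"
proof -
 note eps = ring_hom_add[OF eps_hom] ring_hom_mult[OF eps_hom] eps_unit
 have 1: "unit_map A r \<otimes> unit_map A s \<otimes> y = unit_map A s \<otimes> (unit_map A r \<otimes> y)"
  if "r \<in> carrier R" "s \<in> carrier R" "y \<in> carrier A" for r s y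
  using that A.unit_left_commute[of r "unit_map A s" y] by (simp add: A.A.m_assoc)
 show "balanced_map R A A A (\<lambda>x y. unit_map A (\<epsilon> x) \<otimes> y)"
  by unfold_locales (simp_all add: eps A.unit_add A.unit_mult A.A.l_distr A.A.r_distr 1)
 show "balanced_map R A A A (\<lambda>x y. x \<otimes> unit_map A (\<epsilon> y))"
  by unfold_locales
   (simp_all add: eps A.unit_add A.unit_mult A.A.l_distr A.A.r_distr A.A.m_assoc A.unit_left_commute)
qed

lemma eps_kappa: "\<epsilon> (\<kappa> s) = \<kappa>0 s"
 by (simp add: kappa_unit eps_unit)

lemma kappa0_hom: "\<kappa>0 \<in> ring_hom ring_of_type_algebra R"
proof -
 have "(\<lambda>s. \<epsilon> (\<kappa> s)) \<in> ring_hom ring_of_type_algebra R"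
  using ring_hom_trans[OF C.kappa_hom eps_hom] by (simp add: comp_def)
 then show ?thesis by (simp add: eps_kappa)
qed

text \<open>The counit sends h to 0, so it evaluates the interpolation polynomial of z at 0.\<close>

lemma eps_pj: "\<epsilon> (C.pj z) = (if [z = 0] (mod int p) then \<one>\<^bsub>R\<^esub> else \<zero>\<^bsub>R\<^esub>)"
proof -
 interpret E0: poly_evaluation R \<kappa>0 "\<zero>\<^bsub>R\<^esub>"
  by unfold_locales (simp_all add: kappa0_hom)
 have "\<epsilon> (C.pj z) = E0.ev (lagr p z)"
  unfolding C.pj_def
  by (rule poly_ev_hom[OF C.E.poly_evaluation_axioms E0.poly_evaluation_axioms eps_hom])
    (simp_all add: eps_kappa primitive)
 also have "\<dots> = E0.ev (lagr p z) \<otimes>\<^bsub>R\<^esub> \<one>\<^bsub>R\<^esub>" by simp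
 also have "\<dots> = \<kappa>0 (poly (lagr p z) (of_int 0)) \<otimes>\<^bsub>R\<^esub> \<one>\<^bsub>R\<^esub>"
  by (rule E0.ev_eigenvector) simp_all
 finally show ?thesis by (simp add: poly_lagr[OF C.char_p C.p_pos, of z 0, simplified])
qed

lemma eps_u: "\<epsilon> C.u = \<one>\<^bsub>R\<^esub>"
proof -
 interpret e: ring_hom_ring A R \<epsilon> by unfold_locales (rule eps_hom)
 have "\<epsilon> C.et = \<zero>\<^bsub>R\<^esub>" by (simp add: C.et_def primitive eps_unit)
 then show ?thesis by (simp add: C.u_def a_minus_def)
qed

lemma eps_U: "\<epsilon> (C.U z) = \<one>\<^bsub>R\<^esub>"
proof -
 interpret e: ring_hom_ring A R \<epsilon> by unfold_locales (rule eps_hom)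
 show ?thesis by (simp add: C.U_def e.hom_nat_pow eps_u)
qed

lemma counit_l:
 assumes "a \<in> carrier A" shows "tensor_lift A (\<lambda>x y. unit_map A (\<epsilon> x) \<otimes> y) (\<Delta> a) = a"
proof -
 interpret B: balanced_map R A A A "\<lambda>x y. unit_map A (\<epsilon> x) \<otimes> y" by (rule balanced_counit)
 have hom: "B.lft \<in> ring_hom AA A"
 proof (rule B.lift_ring_hom)
  fix a b a' b' assume "a \<in> carrier A" "b \<in> carrier A" "a' \<in> carrier A" "b' \<in> carrier A"
  then show "unit_map A (\<epsilon> (a \<otimes> a')) \<otimes> (b \<otimes> b') = unit_map A (\<epsilon> a) \<otimes> b \<otimes> (unit_map A (\<epsilon> a') \<otimes> b')"
   by (simp add: ring_hom_mult[OF eps_hom] A.unit_mult A.A.m_assoc A.unit_left_commute[of "\<epsilon> a'"])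
 qed (simp_all add: ring_hom_one[OF eps_hom] A.A.ring_axioms)
 have f: "(\<lambda>a. B.lft (\<Delta> a)) \<in> ring_hom A A"
  using ring_hom_trans[OF D_hom hom] by (simp add: comp_def)
 have "(\<lambda>a. B.lft (\<Delta> a)) a = id a"
 proof (rule hom_eqI[OF f id_hom _ _ assms])
  fix r assume "r \<in> carrier R"
  then show "B.lft (\<Delta> (unit_map A r)) = id (unit_map A r)"
   by (simp add: D_unit unit_AA B.lift_tens eps_unit)
 next
  fix g assume g: "g \<in> G"
  then obtain w where w: "C.weight w g" using G_weight by blast
  have "B.lft (diag (cj g)) = (\<Oplus>z\<in>C.Zp. B.lft (T (C.pj z) (cj g z)))"
   unfolding diag_def by (rule hom_finsum'[OF hom T3.AB.Q.ring_axioms A.A.ring_axioms]) (use g in auto)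
  \<comment> \<open>Only the component z = 0 survives, and there the conjugation is trivial.\<close>
  also have "\<dots> = (\<Oplus>z\<in>C.Zp. if [z = 0] (mod int p) then cj g z else \<zero>)"
   using g by (intro A.A.finsum_cong') (auto simp: B.lift_tens eps_pj)
  also have "\<dots> = cj g 0"
   by (rule A.A.finsum_per_single) (use g C.p_pos in \<open>auto simp: A.A.per_def cj_shift\<close>)
  also have "\<dots> = g" using g by (simp add: cj_def)
  finally show "B.lft (\<Delta> g) = id g"
   using g D_G[OF w] by (simp add: ring_hom_add[OF hom] B.lift_tens primitive)
 qed
 then show ?thesis by simp
qed

lemma counit_r:
 assumes "a \<in> carrier A" shows "tensor_lift A (\<lambda>x y. x \<otimes> unit_map A (\<epsilon> y)) (\<Delta> a) = a"
proof -
 interpret B: balanced_map R A A A "\<lambda>x y. x \<otimes> unit_map A (\<epsilon> y)" by (rule balanced_counit)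
 have hom: "B.lft \<in> ring_hom AA A"
 proof (rule B.lift_ring_hom)
  fix a b a' b' assume "a \<in> carrier A" "b \<in> carrier A" "a' \<in> carrier A" "b' \<in> carrier A"
  then show "a \<otimes> a' \<otimes> unit_map A (\<epsilon> (b \<otimes> b')) = a \<otimes> unit_map A (\<epsilon> b) \<otimes> (a' \<otimes> unit_map A (\<epsilon> b'))"
   by (simp add: ring_hom_mult[OF eps_hom] A.unit_mult A.A.m_assoc A.unit_left_commute[of "\<epsilon> b"])
 qed (simp_all add: ring_hom_one[OF eps_hom] A.A.ring_axioms)
 have f: "(\<lambda>a. B.lft (\<Delta> a)) \<in> ring_hom A A"
  using ring_hom_trans[OF D_hom hom] by (simp add: comp_def)
 have "(\<lambda>a. B.lft (\<Delta> a)) a = id a"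
 proof (rule hom_eqI[OF f id_hom _ _ assms])
  fix r assume "r \<in> carrier R"
  then show "B.lft (\<Delta> (unit_map A r)) = id (unit_map A r)"
   by (simp add: D_unit unit_AA B.lift_tens ring_hom_one[OF eps_hom])
 next
  fix g assume g: "g \<in> G"
  then obtain w where w: "C.weight w g" using G_weight by blast
  have ec: "\<epsilon> (cj g z) = \<zero>\<^bsub>R\<^esub>" for z
   using g by (simp add: cj_def ring_hom_mult[OF eps_hom] primitive)
  have "B.lft (diag (cj g)) = (\<Oplus>z\<in>C.Zp. B.lft (T (C.pj z) (cj g z)))"
   unfolding diag_def by (rule hom_finsum'[OF hom T3.AB.Q.ring_axioms A.A.ring_axioms]) (use g in auto)
  also have "\<dots> = (\<Oplus>z\<in>C.Zp. \<zero>)"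
   using g by (intro A.A.finsum_cong') (auto simp: B.lift_tens ec)
  finally show "B.lft (\<Delta> g) = id g"
   using g D_G[OF w] by (simp add: ring_hom_add[OF hom] B.lift_tens eps_U ring_hom_one[OF eps_hom])
 qed
 then show ?thesis by simp
qed

end

context hopf_twist
begin

subsection \<open>Antipode\<close>

definition S where "S a = C.y' \<otimes> S0 a \<otimes> C.y"

lemma S_closed [simp]: "a \<in> carrier A \<Longrightarrow> S a \<in> carrier A"
 by (simp add: S_def)

lemma S_add: "\<lbrakk>a \<in> carrier A; b \<in> carrier A\<rbrakk> \<Longrightarrow> S (a \<oplus> b) = S a \<oplus> S b"
 by (simp add: S_def S0_add A.A.l_distr A.A.r_distr)

lemma y_cancel: "x \<in> carrier A \<Longrightarrow> C.y \<otimes> (C.y' \<otimes> x) = x" "x \<in> carrier A \<Longrightarrow> C.y' \<otimes> (C.y \<otimes> x) = x"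
 by (simp_all add: A.A.m_assoc[symmetric] C.y_y' C.y'_y)

lemma S_mult: "\<lbrakk>a \<in> carrier A; b \<in> carrier A\<rbrakk> \<Longrightarrow> S (a \<otimes> b) = S b \<otimes> S a"
 by (simp add: S_def S0_mult A.A.m_assoc y_cancel)

lemma S_unit: "r \<in> carrier R \<Longrightarrow> S (unit_map A r) = unit_map A r"
proof -
 assume r: "r \<in> carrier R"
 have "C.y' \<otimes> unit_map A r \<otimes> C.y = unit_map A r \<otimes> (C.y' \<otimes> C.y)"
  using r by (simp add: A.A.m_assoc A.unit_left_commute)
 then show ?thesis using r by (simp add: S_def S0_unit C.y'_y)
qed

lemma S_smult: "\<lbrakk>r \<in> carrier R; a \<in> carrier A\<rbrakk> \<Longrightarrow> S (unit_map A r \<otimes> a) = unit_map A r \<otimes> S a"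
 by (simp add: S_mult S_unit A.unit_map_central)

lemma alg_linear_S: "alg_linear R A A S"
 by (simp add: alg_linear_def S_add S_smult)

lemma balanced_mult: "balanced_map R A A A (monoid.mult A)"
 by unfold_locales
  (simp_all add: A.A.l_distr A.A.r_distr A.A.m_assoc A.unit_left_commute)

definition mSl where "mSl z = tensor_lift A (monoid.mult A) (tensor_map R A A S id z)"
definition mSr where "mSr z = tensor_lift A (monoid.mult A) (tensor_map R A A id S z)"

lemma mSl_tens: "\<lbrakk>a \<in> carrier A; b \<in> carrier A\<rbrakk> \<Longrightarrow> mSl (T a b) = S a \<otimes> b"
 and mSr_tens: "\<lbrakk>a \<in> carrier A; b \<in> carrier A\<rbrakk> \<Longrightarrow> mSr (T a b) = a \<otimes> S b"
 by (simp_all add: mSl_def mSr_def tensor_map_tens[OF two(1,1) alg_linear_S alg_linear_id]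
   tensor_map_tens[OF two(1,1) alg_linear_id alg_linear_S] balanced_map.lift_tens[OF balanced_mult])

lemma mSl_add: "\<lbrakk>a \<in> carrier AA; b \<in> carrier AA\<rbrakk> \<Longrightarrow> mSl (a \<oplus>\<^bsub>AA\<^esub> b) = mSl a \<oplus> mSl b"
 and mSr_add: "\<lbrakk>a \<in> carrier AA; b \<in> carrier AA\<rbrakk> \<Longrightarrow> mSr (a \<oplus>\<^bsub>AA\<^esub> b) = mSr a \<oplus> mSr b"
 by (simp_all add: mSl_def mSr_def tensor_map_add[OF two(1,1) alg_linear_S alg_linear_id]
   tensor_map_add[OF two(1,1) alg_linear_id alg_linear_S] balanced_map.lift_add[OF balanced_mult]
   tensor_map_closed[OF two(1,1) alg_linear_S alg_linear_id] tensor_map_closed[OF two(1,1) alg_linear_id alg_linear_S])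

lemma mSl_closed [simp]: "a \<in> carrier AA \<Longrightarrow> mSl a \<in> carrier A"
 and mSr_closed [simp]: "a \<in> carrier AA \<Longrightarrow> mSr a \<in> carrier A"
 by (simp_all add: mSl_def mSr_def balanced_map.lift_closed[OF balanced_mult]
   tensor_map_closed[OF two(1,1) alg_linear_S alg_linear_id] tensor_map_closed[OF two(1,1) alg_linear_id alg_linear_S])

lemma mSl_mult_tens:
 assumes "z \<in> carrier AA" "a \<in> carrier A" "b \<in> carrier A"
 shows "mSl (z \<bullet> T a b) = S a \<otimes> (mSl z \<otimes> b)"
 using assms(1)
proof (induction z rule: T3.AB.tens_induct)
 case (tens x y)
 then show ?case using assms by (simp add: T3.AB.tens_mult mSl_tens S_mult A.A.m_assoc)
next
 case (add x y)
 then show ?case using assms by (simp add: T3.AB.Q.l_distr mSl_add A.A.l_distr A.A.r_distr)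
qed

lemma mSr_mult_tens:
 assumes "z \<in> carrier AA" "a \<in> carrier A" "b \<in> carrier A"
 shows "mSr (T a b \<bullet> z) = a \<otimes> (mSr z \<otimes> S b)"
 using assms(1)
proof (induction z rule: T3.AB.tens_induct)
 case (tens x y)
 then show ?case using assms by (simp add: T3.AB.tens_mult mSr_tens S_mult A.A.m_assoc)
next
 case (add x y)
 then show ?case using assms by (simp add: T3.AB.Q.r_distr mSr_add A.A.l_distr A.A.r_distr)
qed

text \<open>m(S \<otimes> id) is not multiplicative, but S reverses products, so the value at z ends
  up in the middle of the value at z'. When it is a scalar it can be pulled out; this makes the
  antipode law stable under products.\<close>

lemma mSl_mult_unit:
 assumes z: "z \<in> carrier AA" "mSl z = unit_map A c" "c \<in> carrier R" and z': "z' \<in> carrier AA"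
 shows "mSl (z \<bullet> z') = unit_map A c \<otimes> mSl z'"
 using z'
proof (induction z' rule: T3.AB.tens_induct)
 case (tens x y)
 then show ?case using z by (simp add: mSl_mult_tens mSl_tens A.unit_left_commute)
next
 case (add x y)
 then show ?case using z by (simp add: T3.AB.Q.r_distr mSl_add A.A.r_distr)
qed

lemma mSr_mult_unit:
 assumes z: "z \<in> carrier AA" "mSr z = unit_map A c" "c \<in> carrier R" and z': "z' \<in> carrier AA"
 shows "mSr (z' \<bullet> z) = unit_map A c \<otimes> mSr z'"
 using z'
proof (induction z' rule: T3.AB.tens_induct)
 case (tens x y)
 then show ?case using z by (simp add: mSr_mult_tens mSr_tens A.unit_left_commute)
next
 case (add x y)
 then show ?case using z by (simp add: T3.AB.Q.l_distr mSr_add A.A.r_distr)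
qed

lemma mSl_sum: "g \<in> I \<rightarrow> carrier AA \<Longrightarrow> mSl (\<Oplus>\<^bsub>AA\<^esub>i\<in>I. g i) = (\<Oplus>i\<in>I. mSl (g i))"
 by (rule additive_finsum[OF AA_group A_group]) (auto simp: mSl_add)

lemma mSr_sum: "g \<in> I \<rightarrow> carrier AA \<Longrightarrow> mSr (\<Oplus>\<^bsub>AA\<^esub>i\<in>I. g i) = (\<Oplus>i\<in>I. mSr (g i))"
 by (rule additive_finsum[OF AA_group A_group]) (auto simp: mSr_add)

lemma S0_zero: "S0 \<zero> = \<zero>"
 using S0_unit[of "\<zero>\<^bsub>R\<^esub>"] by simp

lemma S0_kappa: "S0 (\<kappa> s) = \<kappa> s"
 by (simp add: kappa_unit S0_unit)

text \<open>S0 maps h to -h, whose eigenvalues are the negatives. That S0 reverses products is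
  harmless for polynomials in a single element.\<close>

lemma S0_pj: "S0 (C.pj z) = C.pj (- z)"
proof -
 interpret N: poly_evaluation A \<kappa> "\<ominus> h" by (rule C.poly_evaluation) simp
 have ev: "S0 (C.E.ev f) = N.ev f" for f
 proof (induction f)
  case 0
  then show ?case by (simp add: S0_zero)
 next
  case (pCons a f)
  have "N.ev f \<otimes> (\<ominus> h) = (\<ominus> h) \<otimes> N.ev f"
   by (rule N.ev_commute[symmetric]) (simp_all add: C.kappa_central)
  then show ?case
   using pCons by (simp add: S0_add S0_mult S0_kappa primitive)
 qed
 have hv: "(\<ominus> h) \<otimes> C.pj w = \<kappa> (of_int (- w)) \<otimes> C.pj w" for w
  by (simp add: A.A.l_minus C.h_pj C.kappa_uminus)
 have "N.ev (lagr p z) \<otimes> C.pj w = (if [w = - z] (mod int p) then C.pj w else \<zero>)" for w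
 proof -
  have "[z = - w] (mod int p) \<longleftrightarrow> [w = - z] (mod int p)"
   by (simp add: cong_iff_dvd_diff add.commute)
  then show ?thesis
   unfolding N.ev_eigenvector[OF C.pj_closed hv] poly_lagr[OF C.char_p C.p_pos] by simp
 qed
 then have "(\<Oplus>w\<in>C.Zp. N.ev (lagr p z) \<otimes> C.pj w) = (\<Oplus>w\<in>C.Zp. if [w = - z] (mod int p) then C.pj w else \<zero>)"
  by simp
 also have "\<dots> = C.pj (- z)"
  by (rule A.A.finsum_per_single) (use C.pj_per C.p_pos in auto)
 finally show ?thesis
  unfolding C.insert_pj(1)[OF N.ev_closed, symmetric] by (simp add: C.pj_def ev)
qed

lemma S_pj: "S (C.pj z) = C.y' \<otimes> (C.pj (- z) \<otimes> C.y)"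
 by (simp add: S_def S0_pj A.A.m_assoc)

lemma S0_u: "S0 C.u = C.ub"
proof -
 have 0: "S0 (\<ominus> x) = \<ominus> S0 x" if "x \<in> carrier A" for x
  using S0_add[of "\<ominus> x" x] that by (metis A.A.a_inv_closed A.A.l_neg A.A.minus_equality S0_closed S0_zero)
 have "S0 C.et = \<ominus> C.et"
  using C.t_central[of e] by (simp add: C.et_def S0_mult S0_unit primitive A.A.r_minus)
 then show ?thesis
  using S0_unit[of "\<one>\<^bsub>R\<^esub>"] by (simp add: C.u_def C.ub_def a_minus_def S0_add 0)
qed

text \<open>S0 sends u to 1 + et, and (1 + et)^m y = y u^-m by \<open>ub_y\<close>.\<close>

lemma S_U: "S (C.U z) = C.U (- z)"
proof -
 have S0_pow: "S0 (C.u [^] (m::nat)) = C.ub [^] m" for m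
 proof (induction m)
  case (Suc m)
  then show ?case
   by (simp add: S0_mult S0_u A.A.nat_pow_Suc2[symmetric] del: A.A.nat_pow_Suc)
 qed (use S0_unit[of "\<one>\<^bsub>R\<^esub>"] in simp)
 let ?m = "nat (z mod int p)"
 have "S (C.U z) = C.y' \<otimes> (C.ub [^] ?m \<otimes> C.y)"
  by (simp add: S_def C.U_def S0_pow A.A.m_assoc)
 also have "\<dots> = C.U (- int ?m)"
  unfolding C.ub_y by (simp add: y_cancel)
 also have "\<dots> = C.U (- z)"
 proof (rule C.U_cong)
  have "[int ?m = z] (mod int p)" using C.p_pos by (simp add: cong_def)
  then show "[- int ?m = - z] (mod int p)" by (simp add: cong_minus_minus_iff)
 qed
 finally show ?thesis .
qed

lemma S_G: "g \<in> G \<Longrightarrow> S g = \<ominus> (C.y' \<otimes> (g \<otimes> C.y))"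
 by (simp add: S_def primitive A.A.l_minus A.A.r_minus A.A.m_assoc)

lemma weight_pj_left:
 assumes "C.weight w g" "x \<in> carrier A"
 shows "C.pj z \<otimes> (g \<otimes> x) = g \<otimes> (C.pj (z - w) \<otimes> x)"
 using C.weight_pj[OF assms(1), of z] C.weight_closed[OF assms(1)] assms(2)
 by (simp add: A.A.m_assoc[symmetric])

lemma pj_U_shift_sum:
 assumes g: "g \<in> carrier A"
 shows "(\<Oplus>z\<in>C.Zp. g \<otimes> (C.pj (z - w) \<otimes> C.U z)) = g \<otimes> (C.y \<otimes> C.U w)"
proof -
 have "(\<Oplus>z\<in>C.Zp. (\<lambda>z. g \<otimes> (C.pj (z - w) \<otimes> C.U z)) (z + w)) = (\<Oplus>z\<in>C.Zp. g \<otimes> (C.pj (z - w) \<otimes> C.U z))"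
  by (rule A.A.finsum_per_shift) (use g C.p_pos in \<open>auto simp: A.A.per_def\<close>)
 moreover have "(\<lambda>z. g \<otimes> (C.pj (z - w) \<otimes> C.U z)) (z + w) = g \<otimes> (C.pj z \<otimes> C.U z \<otimes> C.U w)" for z
  using g by (simp add: A.A.m_assoc C.U_add)
 moreover have "(\<Oplus>z\<in>C.Zp. g \<otimes> (C.pj z \<otimes> C.U z \<otimes> C.U w)) = g \<otimes> (C.y \<otimes> C.U w)"
  unfolding C.y_def using g
  by (subst A.A.finsum_ldistr) (auto intro!: A.A.finsum_rdistr[symmetric])
 ultimately show ?thesis by simp
qed

lemma mSl_unit: "r \<in> carrier R \<Longrightarrow> mSl (\<Delta> (unit_map A r)) = unit_map A (\<epsilon> (unit_map A r))"
 and mSr_unit: "r \<in> carrier R \<Longrightarrow> mSr (\<Delta> (unit_map A r)) = unit_map A (\<epsilon> (unit_map A r))"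
proof -
 have "S \<one> = \<one>" using S_unit[of "\<one>\<^bsub>R\<^esub>"] by simp
 then show "r \<in> carrier R \<Longrightarrow> mSl (\<Delta> (unit_map A r)) = unit_map A (\<epsilon> (unit_map A r))"
  "r \<in> carrier R \<Longrightarrow> mSr (\<Delta> (unit_map A r)) = unit_map A (\<epsilon> (unit_map A r))"
  by (simp_all add: D_unit unit_AA mSl_tens mSr_tens S_unit eps_unit)
qed

text \<open>Since \<pi>_(-z) y = \<pi>_(-z) u^-z, the factor y cancels the left half of the
  conjugation by u^z. The sum then reassembles to y' g y u^w, which is cancelled by S(g)
  u^w.\<close>

lemma mSl_G: assumes g: "g \<in> G" shows "mSl (\<Delta> g) = \<zero>"
proof -
 obtain w where w: "C.weight w g" using g G_weight by blast
 have gc [simp]: "g \<in> carrier A" using g by simp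
 have t: "mSl (T (C.pj z) (cj g z)) = C.y' \<otimes> (\<lambda>z. g \<otimes> (C.pj (z - w) \<otimes> C.U z)) (- z)" for z
 proof -
  have "C.pj (- z) \<otimes> (C.y \<otimes> cj g z) = (C.pj (- z) \<otimes> C.y) \<otimes> cj g z"
   by (simp add: A.A.m_assoc)
  also have "\<dots> = C.pj (- z) \<otimes> (g \<otimes> C.U (- z))"
   unfolding C.pj_y cj_def by (simp add: A.A.m_assoc U_conj)
  finally have "C.pj (- z) \<otimes> (C.y \<otimes> cj g z) = g \<otimes> (C.pj (- z - w) \<otimes> C.U (- z))"
   by (simp add: weight_pj_left[OF w])
  then show ?thesis by (simp add: mSl_tens S_pj A.A.m_assoc)
 qed
 have "mSl (diag (cj g)) = (\<Oplus>z\<in>C.Zp. mSl (T (C.pj z) (cj g z)))"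
  unfolding diag_def by (rule mSl_sum) auto
 also have "\<dots> = C.y' \<otimes> (\<Oplus>z\<in>C.Zp. (\<lambda>z. g \<otimes> (C.pj (z - w) \<otimes> C.U z)) (- z))"
  unfolding t by (rule A.A.finsum_rdistr[symmetric]) auto
 also have "(\<Oplus>z\<in>C.Zp. (\<lambda>z. g \<otimes> (C.pj (z - w) \<otimes> C.U z)) (- z)) = (\<Oplus>z\<in>C.Zp. g \<otimes> (C.pj (z - w) \<otimes> C.U z))"
  by (rule A.A.finsum_per_neg) (use C.p_pos in \<open>auto simp: A.A.per_def\<close>)
 also have "\<dots> = g \<otimes> (C.y \<otimes> C.U w)" by (rule pj_U_shift_sum) simp
 finally have "mSl (diag (cj g)) = C.y' \<otimes> (g \<otimes> (C.y \<otimes> C.U w))" .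
 then show ?thesis
  using g D_G[OF w] by (simp add: mSl_add mSl_tens S_G A.A.l_minus A.A.m_assoc A.A.l_neg)
qed

text \<open>Here \<pi>_z u^z y' = \<pi>_z absorbs the left factor y' of S, and the sum collapses to
  -g u^-w by the resolution of 1.\<close>

lemma mSr_G: assumes g: "g \<in> G" shows "mSr (\<Delta> g) = \<zero>"
proof -
 obtain w where w: "C.weight w g" using g G_weight by blast
 have gc [simp]: "g \<in> carrier A" using g by simp
 have t: "mSr (T (C.pj z) (cj g z)) = \<ominus> (\<lambda>z. g \<otimes> (C.pj (z + - w) \<otimes> C.U (- w))) z" for z
 proof -
  have 1: "C.pj z \<otimes> (C.U z \<otimes> C.y') = C.pj z"
  proof -
   have "C.pj z \<otimes> (C.U z \<otimes> C.y') = (C.pj z \<otimes> C.y) \<otimes> C.y'"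
    unfolding C.pj_y by (simp add: A.A.m_assoc)
   then show ?thesis by (simp add: A.A.m_assoc C.y_y')
  qed
  have "C.pj z \<otimes> (C.U z \<otimes> (C.y' \<otimes> (g \<otimes> (C.y \<otimes> C.U (- z)))))
   = (C.pj z \<otimes> (C.U z \<otimes> C.y')) \<otimes> (g \<otimes> (C.y \<otimes> C.U (- z)))"
   by (simp add: A.A.m_assoc)
  also have "\<dots> = g \<otimes> (C.pj (z - w) \<otimes> (C.y \<otimes> C.U (- z)))"
   unfolding 1 by (simp add: weight_pj_left[OF w])
  also have "C.pj (z - w) \<otimes> (C.y \<otimes> C.U (- z)) = C.pj (z - w) \<otimes> C.U (- w)"
   using C.pj_y[of "z - w"] by (simp add: A.A.m_assoc[symmetric]) (simp add: A.A.m_assoc C.U_add)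
  finally have "C.pj z \<otimes> (C.U z \<otimes> (C.y' \<otimes> (g \<otimes> (C.y \<otimes> C.U (- z))))) = g \<otimes> (C.pj (z - w) \<otimes> C.U (- w))" .
  then show ?thesis
   using g by (simp add: mSr_tens cj_def S_mult S_U S_G A.A.m_assoc A.A.l_minus A.A.r_minus)
 qed
 have "mSr (diag (cj g)) = (\<Oplus>z\<in>C.Zp. mSr (T (C.pj z) (cj g z)))"
  unfolding diag_def by (rule mSr_sum) auto
 also have "\<dots> = \<ominus> (\<Oplus>z\<in>C.Zp. g \<otimes> (C.pj (z + - w) \<otimes> C.U (- w)))"
  unfolding t by (rule additive_finsum[OF A_group A_group, symmetric]) (auto simp: A.A.minus_add)
 also have "(\<Oplus>z\<in>C.Zp. g \<otimes> (C.pj (z + - w) \<otimes> C.U (- w))) = (\<Oplus>z\<in>C.Zp. g \<otimes> (C.pj z \<otimes> C.U (- w)))"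
  by (rule A.A.finsum_per_shift[where f = "\<lambda>z. g \<otimes> (C.pj z \<otimes> C.U (- w))"]) (use C.p_pos in \<open>auto simp: A.A.per_def\<close>)
 also have "\<dots> = g \<otimes> (\<Oplus>z\<in>C.Zp. C.pj z \<otimes> C.U (- w))"
  by (rule A.A.finsum_rdistr[symmetric]) auto
 also have "\<dots> = g \<otimes> C.U (- w)" unfolding C.insert_pj(2)[OF C.U_closed, symmetric] ..
 finally have "mSr (diag (cj g)) = \<ominus> (g \<otimes> C.U (- w))" .
 then show ?thesis
  using g D_G[OF w] by (simp add: mSr_add mSr_tens S_U A.A.r_neg)
qed

lemma antipode_l: assumes "a \<in> carrier A" shows "mSl (\<Delta> a) = unit_map A (\<epsilon> a)"
 using assms
proof (rule gen_induct)
 fix g assume "g \<in> G"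
 then show "mSl (\<Delta> g) = unit_map A (\<epsilon> g)" by (simp add: mSl_G primitive)
next
 fix a b assume "a \<in> carrier A" "b \<in> carrier A" "mSl (\<Delta> a) = unit_map A (\<epsilon> a)" "mSl (\<Delta> b) = unit_map A (\<epsilon> b)"
 then show "mSl (\<Delta> (a \<oplus> b)) = unit_map A (\<epsilon> (a \<oplus> b))"
  "mSl (\<Delta> (a \<otimes> b)) = unit_map A (\<epsilon> (a \<otimes> b))"
  by (simp_all add: ring_hom_add[OF D_hom] ring_hom_mult[OF D_hom] ring_hom_add[OF eps_hom] ring_hom_mult[OF eps_hom]
    mSl_add mSl_mult_unit A.unit_add A.unit_mult)
qed (rule mSl_unit)

lemma antipode_r: assumes "a \<in> carrier A" shows "mSr (\<Delta> a) = unit_map A (\<epsilon> a)"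
 using assms
proof (rule gen_induct)
 fix g assume "g \<in> G"
 then show "mSr (\<Delta> g) = unit_map A (\<epsilon> g)" by (simp add: mSr_G primitive)
next
 fix a b assume "a \<in> carrier A" "b \<in> carrier A" "mSr (\<Delta> a) = unit_map A (\<epsilon> a)" "mSr (\<Delta> b) = unit_map A (\<epsilon> b)"
 then show "mSr (\<Delta> (a \<oplus> b)) = unit_map A (\<epsilon> (a \<oplus> b))"
  "mSr (\<Delta> (a \<otimes> b)) = unit_map A (\<epsilon> (a \<otimes> b))"
  using A.unit_map_central[of "\<epsilon> b" "unit_map A (\<epsilon> a)"]
  by (simp_all add: ring_hom_add[OF D_hom] ring_hom_mult[OF D_hom] ring_hom_add[OF eps_hom] ring_hom_mult[OF eps_hom]
    mSr_add mSr_mult_unit A.unit_add A.unit_mult)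
qed (rule mSr_unit)

theorem hopf: "hopf_algebra R A \<Delta> S \<epsilon>"
 by unfold_locales
  (simp_all add: D_hom D_unit eps_hom eps_unit coassociativity counit_l counit_r S_add S_smult
   antipode_l[unfolded mSl_def] antipode_r[unfolded mSr_def])

subsection \<open>Closed formulas\<close>

lemma neg_one_pow: "(\<ominus> \<one>) [^] (l::nat) = \<kappa> ((- 1) ^ l)"
proof (induction l)
 case (Suc l)
 have "\<kappa> ((- 1) ^ Suc l) = \<kappa> ((- 1) ^ l) \<otimes> \<kappa> (- 1)" by (simp add: C.kappa_mult[symmetric])
 then show ?case using Suc by (simp add: C.kappa_uminus)
qed simp

text \<open>The claimed sum is multiplied by the resolution of the unit into the \<pi>_z \<otimes>
  1. On \<pi>_z the rising factorial of h is a scalar, which moves to the second factor; there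
  \<open>conj_left\<close> recognises the conjugate of g by u^z.\<close>

lemma D_formula:
 assumes g: "g \<in> G" and w: "C.weight w g" and xs: "C.ladder xs" "xs 0 = g"
 shows "\<Delta> g = T g (C.U w) \<oplus>\<^bsub>AA\<^esub> (\<Oplus>\<^bsub>AA\<^esub>l\<in>{..<p}.
  T ((\<ominus> \<one>) [^] l \<otimes> rising A 0 h l) (C.U (- int l) \<otimes> xs l \<otimes> unit_map A t0 [^] l))"
proof -
 note x [simp] = C.ladderD(1)[OF xs(1)]
 define Y where "Y l = (\<ominus> \<one>) [^] l \<otimes> rising A 0 h l" for l :: nat
 define Z where "Z l = C.U (- int l) \<otimes> (xs l \<otimes> unit_map A t0 [^] l)" for l :: nat
 have Yc [simp]: "Y l \<in> carrier A" and Zc [simp]: "Z l \<in> carrier A" for l by (simp_all add: Y_def Z_def)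
 let ?S = "\<Oplus>\<^bsub>AA\<^esub>l\<in>{..<p}. T (Y l) (Z l)"
 have Sc: "?S \<in> carrier AA" by (auto intro!: T3.AB.Q.finsum_closed)
 have "?S = ?S \<bullet> diag (\<lambda>_. \<one>)" using Sc by (simp add: diag_const T3.AB.tens_one[symmetric])
 also have "\<dots> = (\<Oplus>\<^bsub>AA\<^esub>z\<in>C.Zp. ?S \<bullet> T (C.pj z) \<one>)"
  unfolding diag_def by (rule T3.AB.Q.finsum_rdistr) (use Sc in auto)
 also have "\<dots> = (\<Oplus>\<^bsub>AA\<^esub>z\<in>C.Zp. T (C.pj z) (cj g z))"
 proof (rule T3.AB.Q.finsum_cong'[OF refl])
  fix z assume z: "z \<in> C.Zp"
  have "?S \<bullet> T (C.pj z) \<one> = (\<Oplus>\<^bsub>AA\<^esub>l\<in>{..<p}. T (Y l) (Z l) \<bullet> T (C.pj z) \<one>)"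
   by (rule T3.AB.Q.finsum_ldistr) auto
  also have "\<dots> = (\<Oplus>\<^bsub>AA\<^esub>l\<in>{..<p}. T (C.pj z) (\<kappa> ((- 1) ^ l * rs 0 z l) \<otimes> Z l))"
  proof (intro T3.AB.Q.finsum_cong' refl)
   fix l
   have "Y l \<otimes> C.pj z = \<kappa> ((- 1) ^ l * rs 0 z l) \<otimes> C.pj z"
    unfolding Y_def neg_one_pow by (simp add: A.A.m_assoc C.rising_pj C.kappa_mult)
   then show "T (Y l) (Z l) \<bullet> T (C.pj z) \<one> = T (C.pj z) (\<kappa> ((- 1) ^ l * rs 0 z l) \<otimes> Z l)"
    using T3.AB.tens_balanced[of "\<kappa>0 ((- 1) ^ l * rs 0 z l)" "C.pj z" "Z l"]
    by (simp add: T3.AB.tens_mult kappa_unit)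
  qed auto
  also have "\<dots> = T (C.pj z) (\<Oplus>l\<in>{..<p}. \<kappa> ((- 1) ^ l * rs 0 z l) \<otimes> Z l)"
   by (rule T_sum_right[symmetric]) auto
  also have "(\<Oplus>l\<in>{..<p}. \<kappa> ((- 1) ^ l * rs 0 z l) \<otimes> Z l) = cj g z"
  proof -
   \<comment> \<open>\<open>conj_left\<close> speaks of natural exponents, and the chosen
     representatives of Z/p are natural.\<close>
   obtain m where m: "z = int m" using z by (metis atLeastLessThan_iff nonneg_int_cases)
   have E: "(\<Oplus>l\<in>{..<p}. \<kappa> ((- 1) ^ l * rs 0 z l) \<otimes> Z l) \<in> carrier A" by (auto intro!: A.A.finsum_closed)
   have "cj g z = (C.U z \<otimes> xs 0) \<otimes> C.U (- z)"
    by (simp add: cj_def A.A.m_assoc xs(2)[symmetric])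
   also have "C.U z \<otimes> xs 0 = (\<Oplus>l\<in>{..<p}. \<kappa> ((- 1) ^ l * rs 0 z l) \<otimes> Z l) \<otimes> C.U z"
    unfolding m Z_def by (rule C.conj_left[OF xs(1)])
   finally show ?thesis using E by (simp add: A.A.m_assoc C.U_inverse)
  qed
  finally show "?S \<bullet> T (C.pj z) \<one> = T (C.pj z) (cj g z)" .
 qed (use g in auto)
 also have "\<dots> = diag (cj g)" by (simp add: diag_def)
 finally show ?thesis
  using D_G[OF w] g by (simp add: Y_def Z_def A.A.m_assoc)
qed

text \<open>y' g y is expanded along the idempotents and g is moved to the left of u^(-z-1). What
  remains for each l is the sum over z that \<open>rising_resolution\<close> collapses.\<close>

lemma S_formula:
 assumes g: "g \<in> G" and w: "C.weight w g" and xs: "C.ladder xs" "xs 0 = g"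
 shows "S g = \<ominus> (C.U (- w) \<otimes> (\<Oplus>l\<in>{..<p}. xs l \<otimes> rising A 1 h l \<otimes> unit_map A t0 [^] l))"
proof -
 note x [simp] = C.ladderD(1)[OF xs(1)]
 have gc [simp]: "g \<in> carrier A" using g by simp
 let ?t = "unit_map A t0"
 define B where "B z l = \<kappa> (rs 1 z l) \<otimes> (C.U (- z - 1 - int l) \<otimes> (C.pj z \<otimes> C.U z))" for z l
 have Bc [simp]: "B z l \<in> carrier A" for z l by (simp add: B_def)
 have Bs: "(\<Oplus>z\<in>C.Zp. B z l) = rising A 1 h l" for l
  unfolding B_def by (rule C.rising_resolution)
 define f where "f z = C.U (- z - 1) \<otimes> (g \<otimes> (C.pj (z - w) \<otimes> C.U (z - w)))" for z
 have fc: "f z \<in> carrier A" for z by (simp add: f_def)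
 have U1: "C.U (- (z + int p) - 1) = C.U (- z - 1)" for z
  by (rule C.U_cong) (simp add: cong_iff_dvd_diff)
 have fper: "per f" unfolding A.A.per_def f_def U1 by simp
 have "C.y' \<otimes> (g \<otimes> C.y) = (\<Oplus>z\<in>C.Zp. C.U (- z - 1) \<otimes> C.pj z \<otimes> (g \<otimes> C.y))"
  unfolding C.y'_def by (rule A.A.finsum_ldistr) auto
 also have "\<dots> = (\<Oplus>z\<in>C.Zp. f z)"
  by (simp add: f_def A.A.m_assoc weight_pj_left[OF w] C.pj_y)
 also have "\<dots> = (\<Oplus>z\<in>C.Zp. f (z + w))"
  by (rule A.A.finsum_per_shift[symmetric, OF fper fc C.p_pos])
 also have "\<dots> = (\<Oplus>z\<in>C.Zp. C.U (- w) \<otimes> (\<Oplus>l\<in>{..<p}. (xs l \<otimes> ?t [^] l) \<otimes> B z l))"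
 proof (rule A.A.finsum_cong'[OF refl])
  fix z assume z: "z \<in> C.Zp"
  \<comment> \<open>The exponent -z - 1 comes from y', so the conjugation formula is used at z + 1.
    This is the origin of the shift by 1 in the rising factorial of the antipode.\<close>
  define m where "m = nat (z + 1)"
  have m: "int m = z + 1" using z by (simp add: m_def)
  let ?E = "\<Oplus>l\<in>{..<p}. \<kappa> (rs 0 (z + 1) l) \<otimes> (xs l \<otimes> (C.U (- int l) \<otimes> ?t [^] l))"
  have Ec: "?E \<in> carrier A" by (auto intro!: A.A.finsum_closed)
  have "g \<otimes> C.U (z + 1) = C.U (z + 1) \<otimes> ?E"
   using C.conj_right[OF xs(1), of m] unfolding m xs(2) .
  then have "C.U (- (z + 1)) \<otimes> (g \<otimes> C.U (z + 1)) = ?E"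
   using Ec by (simp add: U_conj)
  then have "C.U (- (z + 1)) \<otimes> (g \<otimes> C.U (z + 1)) \<otimes> C.U (- (z + 1)) = ?E \<otimes> C.U (- (z + 1))" by simp
  then have Eg: "C.U (- z - 1) \<otimes> g = ?E \<otimes> C.U (- z - 1)"
   using C.U_inverse(1)[of "z + 1"] by (simp add: A.A.m_assoc)
  have i: "- (z + w) - 1 = - w + (- z - 1)" "z + w - w = z" by simp_all
  have "f (z + w) = C.U (- w) \<otimes> ((C.U (- z - 1) \<otimes> g) \<otimes> (C.pj z \<otimes> C.U z))"
   unfolding f_def i C.U_add[symmetric] by (simp add: A.A.m_assoc)
  also have "(C.U (- z - 1) \<otimes> g) \<otimes> (C.pj z \<otimes> C.U z) = ?E \<otimes> (C.U (- z - 1) \<otimes> (C.pj z \<otimes> C.U z))"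
   unfolding Eg using Ec by (simp add: A.A.m_assoc)
  also have "\<dots> = (\<Oplus>l\<in>{..<p}. \<kappa> (rs 0 (z + 1) l) \<otimes> (xs l \<otimes> (C.U (- int l) \<otimes> ?t [^] l)) \<otimes> (C.U (- z - 1) \<otimes> (C.pj z \<otimes> C.U z)))"
   by (rule A.A.finsum_ldistr) auto
  also have "\<dots> = (\<Oplus>l\<in>{..<p}. (xs l \<otimes> ?t [^] l) \<otimes> B z l)"
  proof (intro A.A.finsum_cong' refl)
   fix l
   have r: "rs 0 (z + 1) l = (rs 1 z l :: 'k)" using rs_shift[of 0 1 z l, where 'a='k] by simp
   have u: "C.U (- int l) \<otimes> (C.U (- z - 1) \<otimes> (C.pj z \<otimes> C.U z)) = C.U (- z - 1 - int l) \<otimes> (C.pj z \<otimes> C.U z)"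
    by (simp add: U_conj algebra_simps)
   have c1: "C.U (- int l) \<otimes> ?t [^] l = ?t [^] l \<otimes> C.U (- int l)"
    by (rule C.t_pow_central[symmetric]) simp
   have c2: "\<kappa> s \<otimes> (xs l \<otimes> (?t [^] l \<otimes> v)) = xs l \<otimes> (?t [^] l \<otimes> (\<kappa> s \<otimes> v))" if "v \<in> carrier A" for s v
    using that by (simp add: C.kappa_lcomm[of "xs l"] C.kappa_lcomm[of "?t [^] l"])
   show "\<kappa> (rs 0 (z + 1) l) \<otimes> (xs l \<otimes> (C.U (- int l) \<otimes> ?t [^] l)) \<otimes> (C.U (- z - 1) \<otimes> (C.pj z \<otimes> C.U z)) = (xs l \<otimes> ?t [^] l) \<otimes> B z l"
    unfolding r c1 B_def by (simp add: A.A.m_assoc u c2)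
  qed auto
  finally show "f (z + w) = C.U (- w) \<otimes> (\<Oplus>l\<in>{..<p}. (xs l \<otimes> ?t [^] l) \<otimes> B z l)" .
 qed (auto intro!: A.A.m_closed A.A.finsum_closed)
 also have "\<dots> = C.U (- w) \<otimes> (\<Oplus>z\<in>C.Zp. \<Oplus>l\<in>{..<p}. (xs l \<otimes> ?t [^] l) \<otimes> B z l)"
  by (rule A.A.finsum_rdistr[symmetric]) (auto intro!: A.A.finsum_closed)
 also have "(\<Oplus>z\<in>C.Zp. \<Oplus>l\<in>{..<p}. (xs l \<otimes> ?t [^] l) \<otimes> B z l) = (\<Oplus>l\<in>{..<p}. \<Oplus>z\<in>C.Zp. (xs l \<otimes> ?t [^] l) \<otimes> B z l)"
  by (rule A.A.finsum_swap) auto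
 also have "\<dots> = (\<Oplus>l\<in>{..<p}. xs l \<otimes> rising A 1 h l \<otimes> ?t [^] l)"
 proof (rule A.A.finsum_cong'[OF refl])
  fix l
  have "(\<Oplus>z\<in>C.Zp. (xs l \<otimes> ?t [^] l) \<otimes> B z l) = (xs l \<otimes> ?t [^] l) \<otimes> rising A 1 h l"
   unfolding Bs[symmetric] by (rule A.A.finsum_rdistr[symmetric]) auto
  then show "(\<Oplus>z\<in>C.Zp. (xs l \<otimes> ?t [^] l) \<otimes> B z l) = xs l \<otimes> rising A 1 h l \<otimes> ?t [^] l"
   by (simp add: A.A.m_assoc C.t_pow_central)
 qed auto
 finally show ?thesis by (simp add: S_G[OF g])
qed

text \<open>h has weight 0 and u^z h u^-z = h - z + z u^-1, so \<Delta> h = 1 \<otimes> h + h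
  \<otimes> u^-1. Comparing with the flip and multiplying by u \<otimes> u clears the inverse and
  leaves a relation that functionals can test.\<close>

lemma cocommutative_imp:
 assumes "cocommutative R A \<Delta>"
 shows "T (h \<otimes> C.u) C.et = T C.et (h \<otimes> C.u)"
proof -
 have w: "C.weight 0 h" by (simp add: C.weight_def)
 have U: "C.U z \<otimes> (h \<otimes> C.U (- z)) = (h \<ominus> \<kappa> (of_int z)) \<oplus> \<kappa> (of_int z) \<otimes> C.U (- 1)" for z
 proof -
  have "C.U z \<otimes> (h \<otimes> C.U (- z)) = (C.U z \<otimes> h) \<otimes> C.U (- z)" by (simp add: A.A.m_assoc)
  then show ?thesis unfolding C.U_h by (simp add: A.A.l_distr A.A.m_assoc C.U_add)
 qed
 have bal: "T (C.pj z) (\<kappa> s \<otimes> v) = T (\<kappa> s \<otimes> C.pj z) v" if "v \<in> carrier A" for z s v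
  using T3.AB.tens_balanced[of "\<kappa>0 s" "C.pj z" v] that by (simp add: kappa_unit)
 have cj: "T (C.pj z) (cj h z) = T (C.pj z) h \<oplus>\<^bsub>AA\<^esub> T (h \<otimes> C.pj z) (C.U (- 1) \<ominus> \<one>)" for z
 proof -
  have "cj h z = h \<oplus> \<kappa> (of_int z) \<otimes> (C.U (- 1) \<ominus> \<one>)"
   unfolding cj_def U by (simp add: a_minus_def A.A.r_distr A.A.r_minus A.A.a_ac)
  then show ?thesis by (simp add: T3.AB.tens_add_right bal C.h_pj)
 qed
 have "diag (cj h) = (\<Oplus>\<^bsub>AA\<^esub>z\<in>C.Zp. T (C.pj z) h) \<oplus>\<^bsub>AA\<^esub> (\<Oplus>\<^bsub>AA\<^esub>z\<in>C.Zp. T (h \<otimes> C.pj z) (C.U (- 1) \<ominus> \<one>))"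
  unfolding diag_def cj by (rule T3.AB.Q.finsum_addf) auto
 also have "(\<Oplus>\<^bsub>AA\<^esub>z\<in>C.Zp. T (C.pj z) h) = T \<one> h"
  using diag_const[of h] by (simp add: diag_def)
 also have "(\<Oplus>\<^bsub>AA\<^esub>z\<in>C.Zp. T (h \<otimes> C.pj z) (C.U (- 1) \<ominus> \<one>)) = T h (C.U (- 1) \<ominus> \<one>)"
  by (subst T_sum_left[symmetric]) (auto simp: C.insert_pj(1)[symmetric])
 finally have "\<Delta> h = T h \<one> \<oplus>\<^bsub>AA\<^esub> (T \<one> h \<oplus>\<^bsub>AA\<^esub> T h (C.U (- 1) \<ominus> \<one>))"
  using D_G[OF w] by simp
 then have Dh: "\<Delta> h = T \<one> h \<oplus>\<^bsub>AA\<^esub> T h (C.U (- 1))"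
  by (simp add: a_minus_def T3.AB.tens_add_right T3.AB.tens_minus_right T3.AB.Q.a_ac T3.AB.Q.add_cancels)
 have "tensor_flip R A A (\<Delta> h) = T h \<one> \<oplus>\<^bsub>AA\<^esub> T (C.U (- 1)) h"
  unfolding Dh by (simp add: T3.AB.tensor_flip_add T3.AB.tensor_flip_tens)
 then have "T h \<one> \<oplus>\<^bsub>AA\<^esub> T (C.U (- 1)) h = T \<one> h \<oplus>\<^bsub>AA\<^esub> T h (C.U (- 1))"
  using assms unfolding cocommutative_def Dh[symmetric] by simp
 then have "(T h \<one> \<oplus>\<^bsub>AA\<^esub> T (C.U (- 1)) h) \<bullet> T C.u C.u = (T \<one> h \<oplus>\<^bsub>AA\<^esub> T h (C.U (- 1))) \<bullet> T C.u C.u"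
  by simp
 moreover have "C.U (- 1) \<otimes> C.u = \<one>" using C.U_inverse(2)[of 1] by simp
 ultimately have eq: "T (h \<otimes> C.u) C.u \<oplus>\<^bsub>AA\<^esub> T \<one> (h \<otimes> C.u) = T C.u (h \<otimes> C.u) \<oplus>\<^bsub>AA\<^esub> T (h \<otimes> C.u) \<one>"
  by (simp add: T3.AB.Q.l_distr T3.AB.tens_mult)
 have et: "C.et = \<one> \<ominus> C.u"
  by (simp add: C.u_def a_minus_def A.A.minus_add A.A.a_ac A.A.add_cancels)
 have "T (h \<otimes> C.u) C.et = T (h \<otimes> C.u) \<one> \<ominus>\<^bsub>AA\<^esub> T (h \<otimes> C.u) C.u"
  unfolding et a_minus_def by (simp add: T3.AB.tens_add_right T3.AB.tens_minus_right)
 also have "\<dots> = T \<one> (h \<otimes> C.u) \<ominus>\<^bsub>AA\<^esub> T C.u (h \<otimes> C.u)"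
 proof -
  have aux: "a \<ominus>\<^bsub>AA\<^esub> b = c \<ominus>\<^bsub>AA\<^esub> d" if "b \<oplus>\<^bsub>AA\<^esub> c = d \<oplus>\<^bsub>AA\<^esub> a" "a \<in> carrier AA" "b \<in> carrier AA" "c \<in> carrier AA" "d \<in> carrier AA" for a b c d
  proof -
   have "a = (b \<oplus>\<^bsub>AA\<^esub> c) \<ominus>\<^bsub>AA\<^esub> d"
    unfolding that(1) a_minus_def using that(2-5) by (simp add: T3.AB.Q.a_ac T3.AB.Q.add_cancels)
   then show ?thesis using that(2-5) by (simp add: a_minus_def T3.AB.Q.a_ac T3.AB.Q.add_cancels)
  qed
  show ?thesis by (rule aux[OF eq]) auto
 qed
 also have "\<dots> = T C.et (h \<otimes> C.u)"
  unfolding et a_minus_def by (simp add: T3.AB.tens_add_left T3.AB.tens_minus_left)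
 finally show ?thesis .
qed

end

section \<open>Presentations by generators and relations\<close>

lemma free_monoid_simps [simp]:
 "carrier (free_monoid Y) = lists Y" "monoid.mult (free_monoid Y) = append" "one (free_monoid Y) = []"
 by (simp_all add: free_monoid_def)

lemma monoid_free_monoid: "Group.monoid (free_monoid Y)"
 by unfold_locales auto

lemma free_alg_simps [simp]:
 "carrier (free_alg Y) = {f. pkeys f \<subseteq> lists Y}" "one (free_alg Y) = psingle [] 1"
 "ring.zero (free_alg Y) = 0" "monoid.mult (free_alg Y) f g = mr_mult (free_monoid Y) f g"
 "add (free_alg Y) f g = f + g" "unit_map (free_alg Y) = psingle []"
 by (simp_all add: free_alg_def)

lemma unital_algebra_free_alg:
 "unital_algebra (ring_of_type_algebra :: 'k::field ring) (free_alg Y :: ('x list \<Rightarrow>\<^sub>0 'k, 'k) ralg)"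
proof -
 let ?A = "free_alg Y :: ('x list \<Rightarrow>\<^sub>0 'k, 'k) ralg"
 interpret M: Group.monoid "free_monoid Y" by (rule monoid_free_monoid)
 interpret A: ring ?A
  by (rule ring_same_structure[OF M.ring_monoid_ring]) (simp_all add: free_alg_def)
 interpret cring "ring_of_type_algebra :: 'k ring" by (rule cring_from_type_algebra)
 show ?thesis
 proof unfold_locales
  show "unit_map ?A \<in> ring_hom ring_of_type_algebra ?A"
   by (rule ring_hom_memI) (simp_all add: single_add)
 next
  fix c f assume "f \<in> carrier ?A"
  then have "pkeys f \<subseteq> lists Y" by simp
  then show "unit_map ?A c \<otimes>\<^bsub>?A\<^esub> f = f \<otimes>\<^bsub>?A\<^esub> unit_map ?A c"
   by (induction f rule: pm_induct) (simp_all add: mr_mult_add_left mr_mult_add_right mult.commute)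
 qed
qed

lemma free_alg_minus:
 "pkeys f \<subseteq> lists Y \<Longrightarrow> \<ominus>\<^bsub>free_alg Y\<^esub> (f :: 'x list \<Rightarrow>\<^sub>0 'k::field) = - f"
proof -
 interpret unital_algebra "ring_of_type_algebra :: 'k ring" "free_alg Y :: ('x list \<Rightarrow>\<^sub>0 'k, 'k) ralg"
  by (rule unital_algebra_free_alg)
 assume "pkeys f \<subseteq> lists Y"
 then show ?thesis by (intro A.minus_equality) simp_all
qed

lemma free_alg_lift:
 fixes \<beta> :: "'k::field \<Rightarrow> 'b"
 assumes B: "ring B" and hom: "\<beta> \<in> ring_hom ring_of_type_algebra B"
  and central: "\<And>c b. b \<in> carrier B \<Longrightarrow> \<beta> c \<otimes>\<^bsub>B\<^esub> b = b \<otimes>\<^bsub>B\<^esub> \<beta> c"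
  and g: "\<And>x. x \<in> Y \<Longrightarrow> g x \<in> carrier B"
 obtains \<phi> where "\<phi> \<in> ring_hom (free_alg Y) B" "\<And>c. \<phi> (psingle [] c) = \<beta> c"
  "\<And>x c. x \<in> Y \<Longrightarrow> \<phi> (psingle [x] c) = \<beta> c \<otimes>\<^bsub>B\<^esub> g x"
proof -
 interpret B: ring B by fact
 have bc [simp]: "\<beta> c \<in> carrier B" for c using ring_hom_closed[OF hom] by simp
 define W where "W w = foldr (\<lambda>x b. g x \<otimes>\<^bsub>B\<^esub> b) w \<one>\<^bsub>B\<^esub>" for w
 have W_closed [simp]: "W w \<in> carrier B" if "w \<in> lists Y" for w
  using that by (induction w) (simp_all add: W_def g)
 have W_append: "W (u @ v) = W u \<otimes>\<^bsub>B\<^esub> W v" if "u \<in> lists Y" "v \<in> lists Y" for u v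
  using that(1)
 proof (induction u)
  case (Cons x u)
  then show ?case using that(2) W_closed[of u] W_closed[of v] g[of x] by (simp add: W_def B.m_assoc)
 qed (use that(2) in \<open>simp add: W_def W_closed[unfolded W_def]\<close>)
 interpret F: additive_family B "lists Y" "\<lambda>w c. \<beta> c \<otimes>\<^bsub>B\<^esub> W w"
  by unfold_locales (use ring_hom_add[OF hom] in \<open>simp_all add: B.l_distr\<close>)
 have "pm_hom B (\<lambda>w c. \<beta> c \<otimes>\<^bsub>B\<^esub> W w) \<in> ring_hom (monoid_ring (free_monoid Y)) B"
 proof (rule pm_hom_ring_hom[OF monoid_free_monoid B])
  show "additive_family B (carrier (free_monoid Y)) (\<lambda>w c. \<beta> c \<otimes>\<^bsub>B\<^esub> W w)"
   using F.additive_family_axioms by simp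
  show "\<beta> 1 \<otimes>\<^bsub>B\<^esub> W \<one>\<^bsub>free_monoid Y\<^esub> = \<one>\<^bsub>B\<^esub>" using ring_hom_one[OF hom] by (simp add: W_def)
  fix u v a b assume "u \<in> carrier (free_monoid Y)" "v \<in> carrier (free_monoid Y)"
  then have u: "W u \<in> carrier B" "W v \<in> carrier B" and a: "W (u @ v) = W u \<otimes>\<^bsub>B\<^esub> W v"
   by (simp_all add: W_append)
  have "\<beta> (a * b) = \<beta> a \<otimes>\<^bsub>B\<^esub> \<beta> b" using ring_hom_mult[OF hom] by simp
  moreover have "\<beta> b \<otimes>\<^bsub>B\<^esub> (W u \<otimes>\<^bsub>B\<^esub> W v) = W u \<otimes>\<^bsub>B\<^esub> (\<beta> b \<otimes>\<^bsub>B\<^esub> W v)"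
   using u central[of "W u" b] by (metis B.m_assoc bc)
  ultimately show "\<beta> (a * b) \<otimes>\<^bsub>B\<^esub> W (u \<otimes>\<^bsub>free_monoid Y\<^esub> v) = \<beta> a \<otimes>\<^bsub>B\<^esub> W u \<otimes>\<^bsub>B\<^esub> (\<beta> b \<otimes>\<^bsub>B\<^esub> W v)"
   using u by (simp add: a B.m_assoc)
 qed
 then have h: "pm_hom B (\<lambda>w c. \<beta> c \<otimes>\<^bsub>B\<^esub> W w) \<in> ring_hom (free_alg Y) B"
  by (subst ring_hom_same_structure[of "free_alg Y" "monoid_ring (free_monoid Y)" B B]) (simp_all add: free_alg_def)
 show thesis
  by (rule that[OF h]) (simp_all add: F.pm_single, simp_all add: W_def g)
qed

lemma (in ring) genideal_coset_zero:
 assumes "S \<subseteq> carrier R" "s \<in> S" shows "(Idl S) +> s = \<zero>\<^bsub>R Quot (Idl S)\<^esub>"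
proof -
 interpret I: ideal "Idl S" R by (rule genideal_ideal[OF assms(1)])
 show ?thesis using assms genideal_self[OF assms(1)] by (auto simp: FactRing_simps I.a_rcos_const)
qed

lemma ring_hom_diff:
 assumes "ring A" "ring B" "f \<in> ring_hom A B" "x \<in> carrier A" "y \<in> carrier A"
 shows "f (x \<ominus>\<^bsub>A\<^esub> y) = f x \<ominus>\<^bsub>B\<^esub> f y"
proof -
 interpret ring_hom_ring A B f by (rule ring_hom_ringI2) fact+
 show ?thesis using assms by (simp add: a_minus_def)
qed

lemma ring_hom_nat_pow:
 assumes "ring A" "ring B" "f \<in> ring_hom A B" "x \<in> carrier A"
 shows "f (x [^]\<^bsub>A\<^esub> (m::nat)) = f x [^]\<^bsub>B\<^esub> m"
proof -
 interpret ring_hom_ring A B f by (rule ring_hom_ringI2) fact+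
 show ?thesis using assms by (simp add: hom_nat_pow)
qed

lemma (in ring) eq_add_of_minus_eq:
 "\<lbrakk>x \<ominus> y = z; x \<in> carrier R; y \<in> carrier R\<rbrakk> \<Longrightarrow> x = y \<oplus> z"
 using a_lcomm[of y x "\<ominus> y"] by (auto simp: a_minus_def r_neg)

context divided_powers
begin

abbreviation "KK \<equiv> ring_of_type_algebra :: 'k ring"
abbreviation "FA \<equiv> free_alg L :: ('k vfield list \<Rightarrow>\<^sub>0 'k, 'k) ralg"
abbreviation "UU \<equiv> US p n :: ('k env, 'k) ralg"
abbreviation "uu \<equiv> uS p n :: ('k env set, 'k) ralg"
abbreviation mult_uu (infixl "\<odot>" 70) where "a \<odot> b \<equiv> a \<otimes>\<^bsub>uu\<^esub> b"
abbreviation "cu \<equiv> unit_map uu"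
abbreviation "gu \<equiv> uS_gen p n :: 'k vfield \<Rightarrow> 'k env set"
abbreviation "env \<equiv> env_rels L vf_scale br"
abbreviation "lg x \<equiv> psingle [x] 1 :: 'k vfield list \<Rightarrow>\<^sub>0 'k"

sublocale FA: unital_algebra KK FA by (rule unital_algebra_free_alg)

lemma FA_diff: "\<lbrakk>f \<in> carrier FA; g \<in> carrier FA\<rbrakk> \<Longrightarrow> f - g \<in> carrier FA"
 using keys_diff[of f g] by auto

lemma L_add: "x \<in> L \<Longrightarrow> y \<in> L \<Longrightarrow> x + y \<in> L" and L_scale: "x \<in> L \<Longrightarrow> vf_scale c x \<in> L"
 using subspace_L by (auto simp: V.subspace_def)

lemma env_closed: "env \<subseteq> carrier FA"
proof
 fix r assume "r \<in> env"
 then consider (a) x y where "x \<in> L" "y \<in> L" "r = lg (x + y) - lg x - lg y"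
  | (s) c x where "x \<in> L" "r = lg (vf_scale c x) - psingle [x] c"
  | (b) x y where "x \<in> L" "y \<in> L" "r = psingle [x, y] 1 - psingle [y, x] 1 - lg (br x y)"
  unfolding env_rels_def by blast
 then show "r \<in> carrier FA"
  by cases (auto intro!: FA_diff simp: L_add L_scale br_in_L simp del: free_alg_simps(1), auto simp: L_add L_scale br_in_L)
qed

sublocale UI: ideal "env_ideal L vf_scale br :: ('k vfield list \<Rightarrow>\<^sub>0 'k) set" FA
 unfolding env_ideal_def by (rule FA.A.genideal_ideal[OF env_closed])

sublocale UU: unital_algebra KK UU
 unfolding US_def env_alg_def by (rule unital_algebra_quot_alg) unfold_locales

lemma US_hom: "(\<lambda>f. env_ideal L vf_scale br +>\<^bsub>FA\<^esub> f) \<in> ring_hom FA UU"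
 unfolding US_def env_alg_def ring_hom_quot_alg by (rule UI.rcos_ring_hom)

lemma US_gen_closed [simp]: "x \<in> L \<Longrightarrow> US_gen p n x \<in> carrier UU"
 unfolding US_gen_def env_gen_def by (rule ring_hom_closed[OF US_hom]) simp

abbreviation "prels \<equiv> {US_gen p n (D i j (eps i + eps j)) [^]\<^bsub>UU\<^esub> p \<ominus>\<^bsub>UU\<^esub> US_gen p n (D i j (eps i + eps j)) | i j.
     1 \<le> j \<and> j < i \<and> i \<le> n} \<union>
   {US_gen p n (D i j \<alpha>) [^]\<^bsub>UU\<^esub> p | i j \<alpha>. 1 \<le> j \<and> j < i \<and> i \<le> n \<and> \<alpha> \<in> MI \<and> \<alpha> \<noteq> eps i + eps j}"

lemma uS_ideal_def': "uS_ideal p n = Idl\<^bsub>UU\<^esub> prels" by (simp add: uS_ideal_def)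

lemma prels_closed: "prels \<subseteq> carrier UU"
 by (auto intro!: UU.A.minus_closed UU.A.nat_pow_closed US_gen_closed D_in_L)

sublocale uI: ideal "uS_ideal p n :: 'k env set" UU
 unfolding uS_ideal_def' by (rule UU.A.genideal_ideal[OF prels_closed])

sublocale uu: unital_algebra KK uu
 unfolding uS_def by (rule unital_algebra_quot_alg) unfold_locales

lemma uS_hom: "(\<lambda>f. uS_ideal p n +>\<^bsub>UU\<^esub> f) \<in> ring_hom UU uu"
 unfolding uS_def ring_hom_quot_alg by (rule uI.rcos_ring_hom)

definition qu :: "('k vfield list \<Rightarrow>\<^sub>0 'k) \<Rightarrow> 'k env set" where
 "qu f = uS_ideal p n +>\<^bsub>UU\<^esub> (env_ideal L vf_scale br +>\<^bsub>FA\<^esub> f)"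

lemma qu_hom: "qu \<in> ring_hom FA uu"
 using ring_hom_trans[OF US_hom uS_hom] by (simp add: comp_def qu_def[abs_def])

lemma qu_single: "qu (lg x) = gu x" "qu (psingle [] c) = cu c"
 by (simp_all add: qu_def uS_gen_def US_gen_def env_gen_def uS_def US_def env_alg_def)

lemma gu_closed [simp]: "x \<in> L \<Longrightarrow> gu x \<in> carrier uu"
 unfolding qu_single[symmetric] by (rule ring_hom_closed[OF qu_hom]) simp

lemma qu_env: "r \<in> env \<Longrightarrow> qu r = \<zero>\<^bsub>uu\<^esub>"
proof -
 assume "r \<in> env"
 then have "env_ideal L vf_scale br +>\<^bsub>FA\<^esub> r = \<zero>\<^bsub>UU\<^esub>"
  using FA.A.genideal_coset_zero[OF env_closed, of r] by (simp add: env_ideal_def US_def env_alg_def)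
 then show ?thesis
  using ring_hom_zero[OF uS_hom UU.A.ring_axioms uu.A.ring_axioms] by (simp add: qu_def)
qed

lemma qu_diff: "\<lbrakk>f \<in> carrier FA; g \<in> carrier FA\<rbrakk> \<Longrightarrow> qu (f - g) = qu f \<ominus>\<^bsub>uu\<^esub> qu g"
proof -
 assume fg: "f \<in> carrier FA" "g \<in> carrier FA"
 then have "f \<ominus>\<^bsub>FA\<^esub> g = f - g" by (simp add: a_minus_def free_alg_minus)
 then show ?thesis using ring_hom_diff[OF FA.A.ring_axioms uu.A.ring_axioms qu_hom, of f g] fg by simp
qed

lemma gu_add: assumes "x \<in> L" "y \<in> L" shows "gu (x + y) = gu x \<oplus>\<^bsub>uu\<^esub> gu y"
proof -
 have "qu (lg (x + y) - lg x - lg y) = \<zero>\<^bsub>uu\<^esub>"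
  by (rule qu_env) (use assms in \<open>auto simp: env_rels_def\<close>)
 moreover have "qu (lg (x + y) - lg x - lg y) = (gu (x + y) \<ominus>\<^bsub>uu\<^esub> gu x) \<ominus>\<^bsub>uu\<^esub> gu y"
  using assms L_add[OF assms] FA_diff[of "lg (x + y)" "lg x"]
  unfolding qu_single(1)[symmetric] by (subst qu_diff; simp add: qu_diff)
 ultimately have "(gu (x + y) \<ominus>\<^bsub>uu\<^esub> gu x) = gu y"
  using assms L_add[OF assms] by simp
 then show ?thesis using assms L_add[OF assms] by (intro uu.A.eq_add_of_minus_eq) simp_all
qed

lemma gu_scale: assumes "x \<in> L" shows "gu (vf_scale c x) = cu c \<odot> gu x"
proof -
 have "qu (lg (vf_scale c x) - psingle [x] c) = \<zero>\<^bsub>uu\<^esub>"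
  by (rule qu_env) (use assms in \<open>auto simp: env_rels_def\<close>)
 moreover have "psingle [x] c = psingle [] c \<otimes>\<^bsub>FA\<^esub> lg x" by simp
 then have "qu (psingle [x] c) = cu c \<odot> gu x"
  using assms ring_hom_mult[OF qu_hom, of "psingle [] c" "lg x"] by (simp only: qu_single) simp
 moreover have "qu (lg (vf_scale c x) - psingle [x] c) = gu (vf_scale c x) \<ominus>\<^bsub>uu\<^esub> qu (psingle [x] c)"
  using assms L_scale[OF assms, of c] by (subst qu_diff) (simp_all add: qu_single)
 ultimately show ?thesis using assms L_scale[OF assms, of c] by simp
qed

lemma gu_br: assumes "x \<in> L" "y \<in> L"
 shows "gu x \<odot> gu y = gu y \<odot> gu x \<oplus>\<^bsub>uu\<^esub> gu (br x y)"
proof -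
 note b = br_in_L[OF assms]
 have pr: "qu (psingle [u, v] 1) = gu u \<odot> gu v" if "u \<in> L" "v \<in> L" for u v
  using that ring_hom_mult[OF qu_hom, of "lg u" "lg v"] by (simp add: qu_single)
 have "qu (psingle [x, y] 1 - psingle [y, x] 1 - lg (br x y)) = \<zero>\<^bsub>uu\<^esub>"
  by (rule qu_env) (use assms in \<open>auto simp: env_rels_def\<close>)
 moreover have "qu (psingle [x, y] 1 - psingle [y, x] 1 - lg (br x y))
   = (qu (psingle [x, y] 1) \<ominus>\<^bsub>uu\<^esub> qu (psingle [y, x] 1)) \<ominus>\<^bsub>uu\<^esub> gu (br x y)"
  unfolding qu_single(1)[symmetric]
  using assms b FA_diff[of "psingle [x, y] 1" "psingle [y, x] 1"] by (subst qu_diff; simp add: qu_diff)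
 ultimately have "gu x \<odot> gu y \<ominus>\<^bsub>uu\<^esub> gu y \<odot> gu x = gu (br x y)"
  using assms b by (simp add: pr)
 then show ?thesis using assms b by (intro uu.A.eq_add_of_minus_eq) simp_all
qed

lemma gu_prel:
 assumes "1 \<le> j" "j < i" "i \<le> n"
 shows "gu (D i j (eps i + eps j)) [^]\<^bsub>uu\<^esub> p = gu (D i j (eps i + eps j))"
  and "\<lbrakk>\<alpha> \<in> MI; \<alpha> \<noteq> eps i + eps j\<rbrakk> \<Longrightarrow> gu (D i j \<alpha>) [^]\<^bsub>uu\<^esub> p = \<zero>\<^bsub>uu\<^esub>"
proof -
 have DL: "D i j \<alpha> \<in> L" for \<alpha> using assms by (intro D_in_L) auto
 note pw = ring_hom_nat_pow[OF UU.A.ring_axioms uu.A.ring_axioms uS_hom US_gen_closed[OF DL]]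
 have z: "r \<in> prels \<Longrightarrow> uS_ideal p n +>\<^bsub>UU\<^esub> r = \<zero>\<^bsub>uu\<^esub>" for r
  using UU.A.genideal_coset_zero[OF prels_closed, of r] unfolding uS_ideal_def'[symmetric] by (simp add: uS_def)
 show "\<lbrakk>\<alpha> \<in> MI; \<alpha> \<noteq> eps i + eps j\<rbrakk> \<Longrightarrow> gu (D i j \<alpha>) [^]\<^bsub>uu\<^esub> p = \<zero>\<^bsub>uu\<^esub>"
  unfolding uS_gen_def pw[symmetric] by (rule z) (use assms in blast)
 let ?x = "US_gen p n (D i j (eps i + eps j))"
 have "uS_ideal p n +>\<^bsub>UU\<^esub> (?x [^]\<^bsub>UU\<^esub> p \<ominus>\<^bsub>UU\<^esub> ?x) = \<zero>\<^bsub>uu\<^esub>"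
  by (rule z) (use assms in blast)
 then have "(uS_ideal p n +>\<^bsub>UU\<^esub> ?x) [^]\<^bsub>uu\<^esub> p \<ominus>\<^bsub>uu\<^esub> (uS_ideal p n +>\<^bsub>UU\<^esub> ?x) = \<zero>\<^bsub>uu\<^esub>"
  using ring_hom_diff[OF UU.A.ring_axioms uu.A.ring_axioms uS_hom, of "?x [^]\<^bsub>UU\<^esub> p" ?x] DL pw by simp
 then show "gu (D i j (eps i + eps j)) [^]\<^bsub>uu\<^esub> p = gu (D i j (eps i + eps j))"
  using gu_closed[OF DL[of "eps i + eps j"]] unfolding uS_gen_def by simp
qed

text \<open>The data that extend to a homomorphism out of the restricted enveloping algebra. Action,
  coproduct, antipode and counit are all produced by exhibiting such data.\<close>

definition u_rep :: "('b, 'm) ring_scheme \<Rightarrow> ('k \<Rightarrow> 'b) \<Rightarrow> ('k vfield \<Rightarrow> 'b) \<Rightarrow> bool" where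
 "u_rep B \<beta> g \<longleftrightarrow> charp_algebra B \<beta> p \<and> (\<forall>x\<in>L. g x \<in> carrier B) \<and>
  (\<forall>x\<in>L. \<forall>y\<in>L. g (x + y) = g x \<oplus>\<^bsub>B\<^esub> g y) \<and>
  (\<forall>c. \<forall>x\<in>L. g (vf_scale c x) = \<beta> c \<otimes>\<^bsub>B\<^esub> g x) \<and>
  (\<forall>x\<in>L. \<forall>y\<in>L. g x \<otimes>\<^bsub>B\<^esub> g y = g y \<otimes>\<^bsub>B\<^esub> g x \<oplus>\<^bsub>B\<^esub> g (br x y)) \<and>
  (\<forall>i j. 1 \<le> j \<and> j < i \<and> i \<le> n \<longrightarrow> g (D i j (eps i + eps j)) [^]\<^bsub>B\<^esub> p = g (D i j (eps i + eps j))) \<and>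
  (\<forall>i j. \<forall>\<alpha>\<in>MI. 1 \<le> j \<and> j < i \<and> i \<le> n \<and> \<alpha> \<noteq> eps i + eps j \<longrightarrow> g (D i j \<alpha>) [^]\<^bsub>B\<^esub> p = \<zero>\<^bsub>B\<^esub>)"

lemma charp_uu: "charp_algebra uu cu p"
 using uu.unit_map_hom char_p p_pos by unfold_locales (simp_all add: uu.unit_map_central)

lemma u_rep_gu: "u_rep uu cu gu"
 unfolding u_rep_def
proof (intro conjI ballI allI impI)
 fix x y c assume xy: "x \<in> L" "y \<in> L"
 show "gu (x + y) = gu x \<oplus>\<^bsub>uu\<^esub> gu y" by (rule gu_add[OF xy])
 show "gu (vf_scale c x) = cu c \<odot> gu x" by (rule gu_scale[OF xy(1)])
 show "gu x \<odot> gu y = gu y \<odot> gu x \<oplus>\<^bsub>uu\<^esub> gu (br x y)" by (rule gu_br[OF xy])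
next
 fix i j assume "1 \<le> j \<and> j < i \<and> i \<le> n"
 then show "gu (D i j (eps i + eps j)) [^]\<^bsub>uu\<^esub> p = gu (D i j (eps i + eps j))" by (elim conjE) (rule gu_prel(1))
next
 fix i j \<alpha> assume "\<alpha> \<in> MI" "1 \<le> j \<and> j < i \<and> i \<le> n \<and> \<alpha> \<noteq> eps i + eps j"
 then show "gu (D i j \<alpha>) [^]\<^bsub>uu\<^esub> p = \<zero>\<^bsub>uu\<^esub>" by (elim conjE) (rule gu_prel(2))
qed (simp_all add: charp_uu)

text \<open>The algebra is a quotient of a quotient of the free algebra, so the map is factored
  twice, and each time only the defining relations have to be sent to 0.\<close>

lemma u_lift:
 assumes "u_rep B \<beta> g"
 obtains \<Phi> where "\<Phi> \<in> ring_hom uu B" "\<And>c. \<Phi> (cu c) = \<beta> c" "\<And>x. x \<in> L \<Longrightarrow> \<Phi> (gu x) = g x"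
proof -
 note u = assms[unfolded u_rep_def]
 note u1 = u[THEN conjunct2] note u2 = u1[THEN conjunct2] note u3 = u2[THEN conjunct2]
 note u4 = u3[THEN conjunct2] note u5 = u4[THEN conjunct2]
 note g = u1[THEN conjunct1, rule_format] and ga = u2[THEN conjunct1, rule_format]
  and gs = u3[THEN conjunct1, rule_format] and gb = u4[THEN conjunct1, rule_format]
  and g1 = u5[THEN conjunct1, rule_format] and g2 = u5[THEN conjunct2, rule_format]
 interpret B: charp_algebra B \<beta> p by (rule u[THEN conjunct1])
 obtain \<phi> where \<phi>: "\<phi> \<in> ring_hom FA B" "\<And>c. \<phi> (psingle [] c) = \<beta> c"
  "\<And>x c. x \<in> L \<Longrightarrow> \<phi> (psingle [x] c) = \<beta> c \<otimes>\<^bsub>B\<^esub> g x"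
  by (rule free_alg_lift[OF B.C.ring_axioms B.kappa_hom, of L g])
   ((erule B.kappa_central)[1], (erule g)[1], (rule that; (assumption | simp))[1])
 have l: "\<phi> (lg x) = g x" if "x \<in> L" for x using that g \<phi>(3) by simp
 have df: "\<phi> (f - f') = \<phi> f \<ominus>\<^bsub>B\<^esub> \<phi> f'" if "f \<in> carrier FA" "f' \<in> carrier FA" for f f'
 proof -
  have "f \<ominus>\<^bsub>FA\<^esub> f' = f - f'" using that by (simp add: a_minus_def free_alg_minus)
  then show ?thesis using ring_hom_diff[OF FA.A.ring_axioms B.C.ring_axioms \<phi>(1), of f f'] that by simp
 qed
 have pr: "\<phi> (psingle [u, v] 1) = g u \<otimes>\<^bsub>B\<^esub> g v" if "u \<in> L" "v \<in> L" for u v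
  using that ring_hom_mult[OF \<phi>(1), of "lg u" "lg v"] by (simp add: l)
 have z1: "\<phi> r = \<zero>\<^bsub>B\<^esub>" if r: "r \<in> env" for r
 proof -
  have s: "psingle [x] c \<in> carrier FA" "psingle [x, y] c \<in> carrier FA" if "x \<in> L" "y \<in> L" for x y c using that by auto
  consider (a) x y where "x \<in> L" "y \<in> L" "r = lg (x + y) - lg x - lg y"
   | (s) c x where "x \<in> L" "r = lg (vf_scale c x) - psingle [x] c"
   | (b) x y where "x \<in> L" "y \<in> L" "r = psingle [x, y] 1 - psingle [y, x] 1 - lg (br x y)"
   using r unfolding env_rels_def by blast
  then show ?thesis
  proof cases
   case a
   then have "\<phi> r = (\<phi> (lg (x + y)) \<ominus>\<^bsub>B\<^esub> \<phi> (lg x)) \<ominus>\<^bsub>B\<^esub> \<phi> (lg y)"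
    using L_add[of x y] s FA_diff[OF s(1) s(1)] by (subst a; subst df; simp add: df del: free_alg_simps)
   then show ?thesis using a L_add[of x y] by (simp add: l ga g a_minus_def B.C.minus_add B.C.a_ac B.C.add_cancels)
  next
   case s
   then show ?thesis using L_scale[of x c] \<phi>(3) by (simp add: df l gs g)
  next
   case b
   then have "\<phi> r = (g x \<otimes>\<^bsub>B\<^esub> g y \<ominus>\<^bsub>B\<^esub> g y \<otimes>\<^bsub>B\<^esub> g x) \<ominus>\<^bsub>B\<^esub> g (br x y)"
    using br_in_L[of x y] s FA_diff[OF s(2) s(2)] by (subst b; subst df; simp add: df l pr del: free_alg_simps)
   also have "\<dots> = \<zero>\<^bsub>B\<^esub>" unfolding gb[OF b(1,2)] using b(1,2) br_in_L[of x y]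
    by (simp add: g a_minus_def B.C.a_ac B.C.add_cancels)
   finally show ?thesis .
  qed
 qed
 obtain \<psi> where \<psi>: "\<psi> \<in> ring_hom (FA Quot (Idl\<^bsub>FA\<^esub> env)) B"
  "\<And>f. f \<in> carrier FA \<Longrightarrow> \<psi> ((Idl\<^bsub>FA\<^esub> env) +>\<^bsub>FA\<^esub> f) = \<phi> f"
  by (rule FA.A.genideal_quot_lift[OF env_closed B.C.ring_axioms \<phi>(1) z1]) ((assumption)[1], (rule that; (assumption | simp))[1])
 have \<psi>1: "\<psi> \<in> ring_hom UU B" using \<psi>(1) by (simp add: US_def env_alg_def ring_hom_quot_alg env_ideal_def)
 have \<psi>2: "\<psi> (env_ideal L vf_scale br +>\<^bsub>FA\<^esub> f) = \<phi> f" if "f \<in> carrier FA" for f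
  using \<psi>(2)[OF that] by (simp add: env_ideal_def)
 have \<psi>g: "\<psi> (US_gen p n x) = g x" if "x \<in> L" for x
  using that \<psi>2[of "lg x"] by (simp add: US_gen_def env_gen_def l)
 have DL: "D i j \<alpha> \<in> L" if "1 \<le> j" "j < i" "i \<le> n" for i j \<alpha> using that by (intro D_in_L) auto
 have pw: "\<psi> (US_gen p n x [^]\<^bsub>UU\<^esub> p) = g x [^]\<^bsub>B\<^esub> p" if "x \<in> L" for x
  using ring_hom_nat_pow[OF UU.A.ring_axioms B.C.ring_axioms \<psi>1, of "US_gen p n x" p] that by (simp add: \<psi>g)
 have z2: "\<psi> r = \<zero>\<^bsub>B\<^esub>" if "r \<in> prels" for r
  using that
 proof (elim UnE CollectE exE conjE)
  fix i j assume ij: "1 \<le> j" "j < i" "i \<le> n"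
   "r = US_gen p n (D i j (eps i + eps j)) [^]\<^bsub>UU\<^esub> p \<ominus>\<^bsub>UU\<^esub> US_gen p n (D i j (eps i + eps j))"
  then show "\<psi> r = \<zero>\<^bsub>B\<^esub>"
   using DL[OF ij(1-3)] by (simp add: ring_hom_diff[OF UU.A.ring_axioms B.C.ring_axioms \<psi>1] pw g1 g \<psi>g)
 qed (simp add: pw DL g2)
 obtain \<theta> where \<theta>: "\<theta> \<in> ring_hom (UU Quot (Idl\<^bsub>UU\<^esub> prels)) B"
  "\<And>f. f \<in> carrier UU \<Longrightarrow> \<theta> ((Idl\<^bsub>UU\<^esub> prels) +>\<^bsub>UU\<^esub> f) = \<psi> f"
  by (rule UU.A.genideal_quot_lift[OF prels_closed B.C.ring_axioms \<psi>1 z2]) ((assumption)[1], (rule that; (assumption | simp))[1])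
 show thesis
 proof
  show "\<theta> \<in> ring_hom uu B" using \<theta>(1) by (simp only: uS_def ring_hom_quot_alg uS_ideal_def')
  have \<theta>2: "\<theta> (uS_ideal p n +>\<^bsub>UU\<^esub> f) = \<psi> f" if "f \<in> carrier UU" for f
   using \<theta>(2)[OF that] by (simp only: uS_ideal_def')
  show "\<theta> (gu x) = g x" if "x \<in> L" for x
   unfolding uS_gen_def using \<theta>2[OF US_gen_closed[OF that]] \<psi>g[OF that] by simp
  show "\<theta> (cu c) = \<beta> c" for c
  proof -
   have "cu c = uS_ideal p n +>\<^bsub>UU\<^esub> (env_ideal L vf_scale br +>\<^bsub>FA\<^esub> psingle [] c)"
    by (simp add: qu_single(2)[symmetric] qu_def)
   moreover have "env_ideal L vf_scale br +>\<^bsub>FA\<^esub> psingle [] c \<in> carrier UU"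
    by (rule ring_hom_closed[OF US_hom]) simp
   ultimately show ?thesis by (simp add: \<theta>2 \<psi>2 \<phi>(2))
  qed
 qed
qed

text \<open>Any set spanning the Lie algebra generates. Left multiplication by an arbitrary Lie
  element is first resolved into the spanning set; then words are built up letter by letter from the
  right.\<close>

lemma u_induct [consumes 2, case_names unit add scale mult]:
 assumes a: "a \<in> carrier uu" and Y: "L = V.span Y"
  and unit: "\<And>c. P (cu c)"
  and add: "\<And>a b. \<lbrakk>a \<in> carrier uu; b \<in> carrier uu; P a; P b\<rbrakk> \<Longrightarrow> P (a \<oplus>\<^bsub>uu\<^esub> b)"
  and scale: "\<And>c a. \<lbrakk>a \<in> carrier uu; P a\<rbrakk> \<Longrightarrow> P (cu c \<odot> a)"
  and mult: "\<And>x a. \<lbrakk>x \<in> Y; a \<in> carrier uu; P a\<rbrakk> \<Longrightarrow> P (gu x \<odot> a)"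
 shows "P a"
proof -
 have P0: "P \<zero>\<^bsub>uu\<^esub>" using unit[of 0] uu.unit_zero by simp
 have g: "x \<in> L \<and> (\<forall>a\<in>carrier uu. P a \<longrightarrow> P (gu x \<odot> a))" if "x \<in> V.span Y" for x
  using that
 proof (induction rule: V.span_induct_alt)
  case base
  have 0: "(0 :: 'k vfield) \<in> L" using subspace_L by (auto simp: V.subspace_def)
  moreover have "cu 0 = \<zero>\<^bsub>uu\<^esub>" using uu.unit_zero by (simp only: rota_simps)
  ultimately have "gu 0 = \<zero>\<^bsub>uu\<^esub>" using gu_scale[of 0 0] gu_closed[of 0] by simp
  moreover have "(\<lambda>a b. 0) = (0 :: 'k vfield)" by (simp add: fun_eq_iff)
  ultimately show ?case using 0 P0 by simp
 next
  case (step c x y)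
  have x: "x \<in> L" unfolding Y by (rule V.span_base) fact
  have "P (gu (vf_scale c x + y) \<odot> b)" if b: "b \<in> carrier uu" "P b" for b
  proof -
   have "gu (vf_scale c x + y) \<odot> b = cu c \<odot> (gu x \<odot> b) \<oplus>\<^bsub>uu\<^esub> gu y \<odot> b"
    using step x b by (simp add: gu_add gu_scale L_scale uu.A.l_distr uu.A.m_assoc)
   moreover have "P (cu c \<odot> (gu x \<odot> b))" using step(1) x b by (intro scale mult) simp_all
   ultimately show ?thesis using step x b by (simp add: add)
  qed
  moreover have "(\<lambda>a b. vf_scale c x a b + y a b) = vf_scale c x + y" by (simp add: fun_eq_iff)
  ultimately show ?case using step x by (simp add: L_add L_scale)
 qed
 have q: "P (qu f) \<and> qu f \<in> carrier uu" if "pkeys f \<subseteq> lists L" for f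
  using that
 proof (induction f rule: pm_induct)
  case zero
  have "qu 0 = \<zero>\<^bsub>uu\<^esub>" using ring_hom_zero[OF qu_hom FA.A.ring_axioms uu.A.ring_axioms] by simp
  then show ?case using P0 by simp
 next
  case (single w c)
  then show ?case
  proof (induction w)
   case Nil
   then show ?case by (simp add: qu_single unit)
  next
   case (Cons x w)
   have "psingle (x # w) c = lg x \<otimes>\<^bsub>FA\<^esub> psingle w c" by simp
   then have "qu (psingle (x # w) c) = gu x \<odot> qu (psingle w c)"
    using Cons ring_hom_mult[OF qu_hom, of "lg x" "psingle w c"] by (simp only: qu_single) simp
   then show ?case using Cons g[of x] Y by auto
  qed
 next
  case (add f f')
  then show ?case using ring_hom_add[OF qu_hom, of f f'] assms(4) by simp
 qed
 obtain y where y: "y \<in> carrier UU" "a = uS_ideal p n +>\<^bsub>UU\<^esub> y"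
  using a uI.quot_rep[of a] by (auto simp: uS_def)
 obtain f where "f \<in> carrier FA" "y = env_ideal L vf_scale br +>\<^bsub>FA\<^esub> f"
  using y(1) UI.quot_rep[of y] by (auto simp: US_def env_alg_def)
 then show ?thesis using q[of f] y(2) by (simp add: qu_def)
qed

end

section \<open>Representations of the restricted enveloping algebra\<close>

context two_algebras
begin

lemma inl_hom: "(\<lambda>a. T a \<one>\<^bsub>B\<^esub>) \<in> ring_hom A AB"
 by (rule ring_hom_memI) (simp_all add: tens_add_left tens_mult tens_one)

lemma inr_hom: "(\<lambda>b. T \<one>\<^bsub>A\<^esub> b) \<in> ring_hom B AB"
 by (rule ring_hom_memI) (simp_all add: tens_add_right tens_mult tens_one)

lemma inr_unit: "r \<in> carrier R \<Longrightarrow> T \<one>\<^bsub>A\<^esub> (unit_map B r) = unit_map AB r"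
 using tens_balanced[of r "\<one>\<^bsub>A\<^esub>" "\<one>\<^bsub>B\<^esub>"] by (simp add: AB_simps(6))

lemma inl_inr_commute: "\<lbrakk>a \<in> carrier A; b \<in> carrier B\<rbrakk> \<Longrightarrow>
  T a \<one>\<^bsub>B\<^esub> \<otimes>\<^bsub>AB\<^esub> T \<one>\<^bsub>A\<^esub> b = T \<one>\<^bsub>A\<^esub> b \<otimes>\<^bsub>AB\<^esub> T a \<one>\<^bsub>B\<^esub>"
 by (simp add: tens_mult)

end

lemma charp_algebra_unital:
 assumes "unital_algebra R A" "\<beta> \<in> ring_hom (ring_of_type_algebra :: 'k::field ring) R" "CHAR('k) = p" "p > 0"
 shows "charp_algebra A (\<lambda>c. unit_map A (\<beta> c)) p"
proof -
 interpret unital_algebra R A by fact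
 show ?thesis
 proof unfold_locales
  show "(\<lambda>c. unit_map A (\<beta> c)) \<in> ring_hom ring_of_type_algebra A"
   using ring_hom_trans[OF assms(2) unit_map_hom] by (simp add: comp_def)
  show "\<And>x s. x \<in> carrier A \<Longrightarrow> unit_map A (\<beta> s) \<otimes>\<^bsub>A\<^esub> x = x \<otimes>\<^bsub>A\<^esub> unit_map A (\<beta> s)"
   using ring_hom_closed[OF assms(2)] by (intro unit_map_central) simp_all
 qed (use assms in auto)
qed

context divided_powers
begin

lemma u_repD:
 assumes "u_rep B \<beta> g"
 shows "charp_algebra B \<beta> p" "x \<in> L \<Longrightarrow> g x \<in> carrier B"
  "\<lbrakk>x \<in> L; y \<in> L\<rbrakk> \<Longrightarrow> g (x + y) = g x \<oplus>\<^bsub>B\<^esub> g y"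
  "x \<in> L \<Longrightarrow> g (vf_scale c x) = \<beta> c \<otimes>\<^bsub>B\<^esub> g x"
  "\<lbrakk>x \<in> L; y \<in> L\<rbrakk> \<Longrightarrow> g x \<otimes>\<^bsub>B\<^esub> g y = g y \<otimes>\<^bsub>B\<^esub> g x \<oplus>\<^bsub>B\<^esub> g (br x y)"
  "1 \<le> j \<and> j < i \<and> i \<le> n \<Longrightarrow> g (D i j (eps i + eps j)) [^]\<^bsub>B\<^esub> p = g (D i j (eps i + eps j))"
  "\<lbrakk>\<alpha> \<in> MI; 1 \<le> j \<and> j < i \<and> i \<le> n \<and> \<alpha> \<noteq> eps i + eps j\<rbrakk> \<Longrightarrow> g (D i j \<alpha>) [^]\<^bsub>B\<^esub> p = \<zero>\<^bsub>B\<^esub>"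
proof -
 note u = assms[unfolded u_rep_def]
 note u1 = u[THEN conjunct2] note u2 = u1[THEN conjunct2] note u3 = u2[THEN conjunct2]
 note u4 = u3[THEN conjunct2] note u5 = u4[THEN conjunct2]
 show "charp_algebra B \<beta> p" by (rule u[THEN conjunct1])
 show "x \<in> L \<Longrightarrow> g x \<in> carrier B" by (rule u1[THEN conjunct1, rule_format])
 show "\<lbrakk>x \<in> L; y \<in> L\<rbrakk> \<Longrightarrow> g (x + y) = g x \<oplus>\<^bsub>B\<^esub> g y" by (rule u2[THEN conjunct1, rule_format])
 show "x \<in> L \<Longrightarrow> g (vf_scale c x) = \<beta> c \<otimes>\<^bsub>B\<^esub> g x" by (rule u3[THEN conjunct1, rule_format])
 show "\<lbrakk>x \<in> L; y \<in> L\<rbrakk> \<Longrightarrow> g x \<otimes>\<^bsub>B\<^esub> g y = g y \<otimes>\<^bsub>B\<^esub> g x \<oplus>\<^bsub>B\<^esub> g (br x y)" by (rule u4[THEN conjunct1, rule_format])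
 show "1 \<le> j \<and> j < i \<and> i \<le> n \<Longrightarrow> g (D i j (eps i + eps j)) [^]\<^bsub>B\<^esub> p = g (D i j (eps i + eps j))"
  by (rule u5[THEN conjunct1, rule_format])
 show "\<lbrakk>\<alpha> \<in> MI; 1 \<le> j \<and> j < i \<and> i \<le> n \<and> \<alpha> \<noteq> eps i + eps j\<rbrakk> \<Longrightarrow> g (D i j \<alpha>) [^]\<^bsub>B\<^esub> p = \<zero>\<^bsub>B\<^esub>"
  by (rule u5[THEN conjunct2, rule_format])
qed

lemma u_repI:
 assumes "charp_algebra B \<beta> p" "\<And>x. x \<in> L \<Longrightarrow> g x \<in> carrier B"
  "\<And>x y. \<lbrakk>x \<in> L; y \<in> L\<rbrakk> \<Longrightarrow> g (x + y) = g x \<oplus>\<^bsub>B\<^esub> g y"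
  "\<And>x c. x \<in> L \<Longrightarrow> g (vf_scale c x) = \<beta> c \<otimes>\<^bsub>B\<^esub> g x"
  "\<And>x y. \<lbrakk>x \<in> L; y \<in> L\<rbrakk> \<Longrightarrow> g x \<otimes>\<^bsub>B\<^esub> g y = g y \<otimes>\<^bsub>B\<^esub> g x \<oplus>\<^bsub>B\<^esub> g (br x y)"
  "\<And>i j. 1 \<le> j \<and> j < i \<and> i \<le> n \<Longrightarrow> g (D i j (eps i + eps j)) [^]\<^bsub>B\<^esub> p = g (D i j (eps i + eps j))"
  "\<And>i j \<alpha>. \<lbrakk>\<alpha> \<in> MI; 1 \<le> j \<and> j < i \<and> i \<le> n \<and> \<alpha> \<noteq> eps i + eps j\<rbrakk> \<Longrightarrow> g (D i j \<alpha>) [^]\<^bsub>B\<^esub> p = \<zero>\<^bsub>B\<^esub>"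
 shows "u_rep B \<beta> g"
 unfolding u_rep_def
 by (intro conjI assms(1) ballI allI impI; (rule assms(2) | rule assms(3) | rule assms(4) | rule assms(5)
   | rule assms(6) | rule assms(7)); assumption)

lemma D_in_L': "1 \<le> j \<and> j < i \<and> i \<le> n \<Longrightarrow> D i j \<alpha> \<in> L"
 by (intro D_in_L) auto

lemma u_rep_hom:
 assumes g: "u_rep B \<beta> g" and \<phi>: "\<phi> \<in> ring_hom B C" and C: "charp_algebra C \<gamma> p" and c: "\<And>c. \<phi> (\<beta> c) = \<gamma> c"
 shows "u_rep C \<gamma> (\<lambda>x. \<phi> (g x))"
proof -
 note gD = u_repD[OF g]
 interpret B: charp_algebra B \<beta> p by (rule gD)
 interpret C: charp_algebra C \<gamma> p by (rule C)
 interpret h: ring_hom_ring B C \<phi> by (rule ring_hom_ringI2) (use \<phi> B.C.ring_axioms C.C.ring_axioms in auto)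
 have cl: "x \<in> L \<Longrightarrow> g x \<in> carrier B" for x by (rule gD)
 show ?thesis
 proof (rule u_repI[OF C])
  show "\<phi> (g x) \<otimes>\<^bsub>C\<^esub> \<phi> (g y) = \<phi> (g y) \<otimes>\<^bsub>C\<^esub> \<phi> (g x) \<oplus>\<^bsub>C\<^esub> \<phi> (g (br x y))" if "x \<in> L" "y \<in> L" for x y
   using arg_cong[OF gD(5)[OF that], of \<phi>] that br_in_L[OF that] by (simp add: cl)
  show "\<phi> (g (D i j (eps i + eps j))) [^]\<^bsub>C\<^esub> p = \<phi> (g (D i j (eps i + eps j)))" if "1 \<le> j \<and> j < i \<and> i \<le> n" for i j
   using arg_cong[OF gD(6)[OF that], of \<phi>] cl[OF D_in_L'[OF that]] by (simp add: h.hom_nat_pow)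
  show "\<phi> (g (D i j \<alpha>)) [^]\<^bsub>C\<^esub> p = \<zero>\<^bsub>C\<^esub>" if "\<alpha> \<in> MI" "1 \<le> j \<and> j < i \<and> i \<le> n \<and> \<alpha> \<noteq> eps i + eps j" for i j \<alpha>
   using arg_cong[OF gD(7)[OF that], of \<phi>] cl[OF D_in_L'[of j i]] that by (simp add: h.hom_nat_pow)
 qed (use cl c in \<open>simp_all add: gD(3,4)\<close>)
qed

text \<open>Mixed terms cancel from the bracket, and the p-th power relations survive because
  Frobenius is additive on commuting elements. Applied to x \<otimes> 1 and 1 \<otimes> x this gives
  the primitive coproduct.\<close>

lemma u_rep_sum:
 assumes g: "u_rep B \<beta> g" and g': "u_rep B \<beta> g'"
  and comm: "\<And>x y. \<lbrakk>x \<in> L; y \<in> L\<rbrakk> \<Longrightarrow> g x \<otimes>\<^bsub>B\<^esub> g' y = g' y \<otimes>\<^bsub>B\<^esub> g x"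
 shows "u_rep B \<beta> (\<lambda>x. g x \<oplus>\<^bsub>B\<^esub> g' x)"
proof -
 note gD = u_repD[OF g] note gD' = u_repD[OF g']
 interpret B: charp_algebra B \<beta> p by (rule gD)
 have cl: "x \<in> L \<Longrightarrow> g x \<in> carrier B" "x \<in> L \<Longrightarrow> g' x \<in> carrier B" for x by (rule gD gD', assumption)+
 have fr: "(g x \<oplus>\<^bsub>B\<^esub> g' x) [^]\<^bsub>B\<^esub> p = g x [^]\<^bsub>B\<^esub> p \<oplus>\<^bsub>B\<^esub> g' x [^]\<^bsub>B\<^esub> p" if "x \<in> L" for x
  using that by (intro B.frobenius_add cl comm)
 show ?thesis
 proof (rule u_repI[OF gD(1)])
  fix x y assume xy: "x \<in> L" "y \<in> L"
  note b = br_in_L[OF xy]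
  show "(g x \<oplus>\<^bsub>B\<^esub> g' x) \<otimes>\<^bsub>B\<^esub> (g y \<oplus>\<^bsub>B\<^esub> g' y) =
   (g y \<oplus>\<^bsub>B\<^esub> g' y) \<otimes>\<^bsub>B\<^esub> (g x \<oplus>\<^bsub>B\<^esub> g' x) \<oplus>\<^bsub>B\<^esub> (g (br x y) \<oplus>\<^bsub>B\<^esub> g' (br x y))"
   using xy b cl[of x] cl[of y] cl[of "br x y"]
   by (simp add: B.C.l_distr B.C.r_distr gD(5)[of x y] gD'(5)[of x y] comm[of x y] comm[of y x, symmetric] B.C.a_ac)
 qed (use D_in_L' in \<open>simp_all add: cl gD(3,4) gD'(3,4) fr gD(6,7) gD'(6,7) B.C.a_ac B.C.r_distr\<close>)
qed

sublocale uC: charp_algebra uu cu p by (rule charp_uu)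

lemma gu_uminus: "x \<in> L \<Longrightarrow> gu (- x) = \<ominus>\<^bsub>uu\<^esub> gu x"
proof -
 assume x: "x \<in> L"
 have "- x = vf_scale (- 1) x" by (simp add: vf_scale_def fun_eq_iff)
 then have "gu (- x) = cu (- 1) \<odot> gu x" using gu_scale[OF x, of "- 1"] by (simp only:)
 then show ?thesis using x by (simp add: uC.kappa_uminus uu.A.l_minus)
qed

text \<open>The defining relations list only j < i. For i < j the sign in D_ij = -D_ji passes
  through the p-th power.\<close>

lemma gu_pow_p:
 assumes i: "i \<in> {1..n}" and j: "j \<in> {1..n}" and ij: "i \<noteq> j"
 shows "gu (D i j (eps i + eps j)) [^]\<^bsub>uu\<^esub> p = gu (D i j (eps i + eps j))"
  and "\<lbrakk>\<alpha> \<in> MI; \<alpha> \<noteq> eps i + eps j\<rbrakk> \<Longrightarrow> gu (D i j \<alpha>) [^]\<^bsub>uu\<^esub> p = \<zero>\<^bsub>uu\<^esub>"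
proof -
 have DL: "D i j \<alpha> \<in> L" "D j i \<alpha> \<in> L" for \<alpha> using assms D_in_L by auto
 have sw: "gu (D i j \<alpha>) = \<ominus>\<^bsub>uu\<^esub> gu (D j i \<alpha>)" for \<alpha> using DL by (subst dij_swap) (rule gu_uminus)
 note fr = uC.frobenius_uminus[OF gu_closed[OF DL(2)]]
 show "gu (D i j (eps i + eps j)) [^]\<^bsub>uu\<^esub> p = gu (D i j (eps i + eps j))"
 proof (cases "j < i")
  case False
  then show ?thesis using assms gu_prel(1)[of i j] unfolding sw fr by (simp add: add.commute)
 qed (use assms gu_prel(1) in auto)
 show "gu (D i j \<alpha>) [^]\<^bsub>uu\<^esub> p = \<zero>\<^bsub>uu\<^esub>" if "\<alpha> \<in> MI" "\<alpha> \<noteq> eps i + eps j"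
 proof (cases "j < i")
  case False
  then show ?thesis using assms that gu_prel(2)[of i j \<alpha>] unfolding sw fr by (simp add: add.commute)
 qed (use assms that gu_prel(2) in auto)
qed

subsection \<open>The action on divided powers\<close>

definition lin_ops :: "('k dpoly \<Rightarrow> 'k dpoly) ring" where
 "lin_ops = \<lparr>carrier = {F. (\<forall>f g. F (f + g) = F f + F g) \<and> (\<forall>c f. F (\<lambda>\<gamma>. c * f \<gamma>) = (\<lambda>\<gamma>. c * F f \<gamma>))},
   monoid.mult = (\<circ>), one = id, ring.zero = 0, add = (+)\<rparr>"

lemma lin_ops_simps [simp]:
 "F \<in> carrier lin_ops \<longleftrightarrow> (\<forall>f g. F (f + g) = F f + F g) \<and> (\<forall>c f. F (\<lambda>\<gamma>. c * f \<gamma>) = (\<lambda>\<gamma>. c * F f \<gamma>))"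
 "monoid.mult lin_ops = (\<circ>)" "one lin_ops = id" "ring.zero lin_ops = 0" "add lin_ops = (+)"
 by (simp_all add: lin_ops_def)

lemma ring_lin_ops: "ring lin_ops"
proof (rule ringI)
 show "abelian_group lin_ops"
 proof (rule abelian_groupI)
  fix F :: "'k dpoly \<Rightarrow> 'k dpoly" assume "F \<in> carrier lin_ops"
  then have "- F \<in> carrier lin_ops" "- F \<oplus>\<^bsub>lin_ops\<^esub> F = \<zero>\<^bsub>lin_ops\<^esub>" by (auto simp: fun_eq_iff)
  then show "\<exists>G\<in>carrier lin_ops. G \<oplus>\<^bsub>lin_ops\<^esub> F = \<zero>\<^bsub>lin_ops\<^esub>" by blast
 qed (auto simp: fun_eq_iff algebra_simps)
 show "Group.monoid lin_ops" by (rule monoidI) (auto simp: comp_assoc)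
qed (auto simp: fun_eq_iff)

lemma charp_lin_ops: "charp_algebra lin_ops (\<lambda>c f \<gamma>. c * f \<gamma>) p"
proof -
 interpret ring lin_ops by (rule ring_lin_ops)
 show ?thesis
  by unfold_locales (auto intro!: ring_hom_memI simp: fun_eq_iff algebra_simps char_p p_pos)
qed

text \<open>Operators are taken on all coefficient functions, whereas the commutator and p-th power
  identities are proved on the divided power algebra. Truncating first makes them hold
  everywhere.\<close>

definition tr :: "'k dpoly \<Rightarrow> 'k dpoly" where "tr f = (\<lambda>\<alpha>. if \<alpha> \<in> MI then f \<alpha> else 0)"

lemma tr_in_O [simp]: "tr f \<in> Od" by (simp add: tr_def dpoly_carrier_def)

lemma tr_O: "f \<in> Od \<Longrightarrow> tr f = f" by (auto simp: tr_def fun_eq_iff O_outside)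

lemma tr_lin: "tr (f + g) = tr f + tr g" "tr (\<lambda>\<gamma>. c * f \<gamma>) = (\<lambda>\<gamma>. c * tr f \<gamma>)"
 by (auto simp: tr_def fun_eq_iff)

lemma u_rep_act: "u_rep lin_ops (\<lambda>c f \<gamma>. c * f \<gamma>) (\<lambda>x f. act x (tr f))"
proof (rule u_repI[OF charp_lin_ops])
 \<comment> \<open>Only positive powers are of this form: the power 0 is the identity and not the
   truncation.\<close>
 have pw: "(\<lambda>f. act x (tr f)) [^]\<^bsub>lin_ops\<^esub> Suc m = (\<lambda>f. (act x ^^ Suc m) (tr f))" for x m
 proof (induction m)
  case (Suc m)
  then show ?case
   unfolding nat_pow_def by (simp add: comp_def tr_O funpow_swap1 del: funpow.simps) (simp add: funpow_swap1)
 qed (simp add: nat_pow_def)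
 have pp: "(\<lambda>f. act x (tr f)) [^]\<^bsub>lin_ops\<^esub> p = (\<lambda>f. (act x ^^ p) (tr f))" for x
  using pw[of x "p - 1"] p_pos by simp
 show "(\<lambda>f. act (D i j (eps i + eps j)) (tr f)) [^]\<^bsub>lin_ops\<^esub> p = (\<lambda>f. act (D i j (eps i + eps j)) (tr f))"
  if "1 \<le> j \<and> j < i \<and> i \<le> n" for i j
  unfolding pp using that by (simp add: act_cartan_pow_p)
 show "(\<lambda>f. act (D i j \<alpha>) (tr f)) [^]\<^bsub>lin_ops\<^esub> p = \<zero>\<^bsub>lin_ops\<^esub>"
  if "\<alpha> \<in> MI" "1 \<le> j \<and> j < i \<and> i \<le> n \<and> \<alpha> \<noteq> eps i + eps j" for i j \<alpha>
  unfolding pp using that by (simp add: act_D_pow_p_zero fun_eq_iff)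
 fix x y c assume x: "x \<in> L" and y: "y \<in> L"
 show "(\<lambda>f. act x (tr f)) \<otimes>\<^bsub>lin_ops\<^esub> (\<lambda>f. act y (tr f)) =
   (\<lambda>f. act y (tr f)) \<otimes>\<^bsub>lin_ops\<^esub> (\<lambda>f. act x (tr f)) \<oplus>\<^bsub>lin_ops\<^esub> (\<lambda>f. act (br x y) (tr f))"
  using x y by (simp add: fun_eq_iff tr_O act_br L_subset_W)
qed (auto simp: tr_lin act_add_right act_scale_right act_add_left act_scale_left fun_eq_iff)

definition rho :: "'k env set \<Rightarrow> 'k dpoly \<Rightarrow> 'k dpoly" where
 "rho = (SOME \<Phi>. \<Phi> \<in> ring_hom uu lin_ops \<and> (\<forall>c. \<Phi> (cu c) = (\<lambda>f \<gamma>. c * f \<gamma>)) \<and> (\<forall>x\<in>L. \<Phi> (gu x) = (\<lambda>f. act x (tr f))))"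

lemma rho: "rho \<in> ring_hom uu lin_ops" "rho (cu c) = (\<lambda>f \<gamma>. c * f \<gamma>)" "x \<in> L \<Longrightarrow> rho (gu x) = (\<lambda>f. act x (tr f))"
proof -
 have "\<exists>\<Phi>. \<Phi> \<in> ring_hom uu lin_ops \<and> (\<forall>c. \<Phi> (cu c) = (\<lambda>f \<gamma>. c * f \<gamma>)) \<and> (\<forall>x\<in>L. \<Phi> (gu x) = (\<lambda>f. act x (tr f)))"
  by (rule u_lift[OF u_rep_act]) (intro exI conjI allI ballI; assumption | simp)
 from someI_ex[OF this, folded rho_def]
 show "rho \<in> ring_hom uu lin_ops" "rho (cu c) = (\<lambda>f \<gamma>. c * f \<gamma>)" "x \<in> L \<Longrightarrow> rho (gu x) = (\<lambda>f. act x (tr f))"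
  by (simp_all only:)
qed

lemma rho_simps:
 "a \<in> carrier uu \<Longrightarrow> b \<in> carrier uu \<Longrightarrow> rho (a \<oplus>\<^bsub>uu\<^esub> b) f = rho a f + rho b f"
 "a \<in> carrier uu \<Longrightarrow> b \<in> carrier uu \<Longrightarrow> rho (a \<odot> b) f = rho a (rho b f)"
 "rho \<one>\<^bsub>uu\<^esub> f = f"
 using ring_hom_add[OF rho(1), of a b] ring_hom_mult[OF rho(1), of a b] ring_hom_one[OF rho(1)] by simp_all

definition ulin :: "('k env set \<Rightarrow> 'k) \<Rightarrow> bool" where
 "ulin f \<longleftrightarrow> (\<forall>a\<in>carrier uu. \<forall>b\<in>carrier uu. f (a \<oplus>\<^bsub>uu\<^esub> b) = f a + f b) \<and> (\<forall>c. \<forall>a\<in>carrier uu. f (cu c \<odot> a) = c * f a)"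

lemma ulinD: "\<lbrakk>ulin f; a \<in> carrier uu; b \<in> carrier uu\<rbrakk> \<Longrightarrow> f (a \<oplus>\<^bsub>uu\<^esub> b) = f a + f b"
 "\<lbrakk>ulin f; a \<in> carrier uu\<rbrakk> \<Longrightarrow> f (cu c \<odot> a) = c * f a"
 by (simp_all add: ulin_def)

lemma ulin_rho: "ulin (\<lambda>a. rho a f \<gamma>)"
 by (simp add: ulin_def rho_simps rho)

text \<open>The coefficient of \<open>x\<^sup>(\<^sup>\<beta>\<^sup>)D\<^sub>m\<close>, read off from the action on \<open>x\<^sub>m\<close> and corrected so as to vanish at 1.\<close>

definition fn :: "nat \<times> (nat \<Rightarrow> nat) \<Rightarrow> 'k env set \<Rightarrow> 'k" where
 "fn x a = rho a (mono (eps (fst x))) (snd x) - of_bool (snd x = eps (fst x)) * rho a (mono 0) 0"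

lemma ulin_fn: "ulin (fn x)"
 using ulin_rho[of "mono (eps (fst x))" "snd x"] ulin_rho[of "mono 0" 0]
 by (simp add: ulin_def fn_def algebra_simps)

lemma fn_one: "fst x \<in> {1..n} \<Longrightarrow> fn x \<one>\<^bsub>uu\<^esub> = 0"
 using eps_midx[of "fst x"] by (simp add: fn_def rho_simps mono_apply)

lemma fn_gu: "\<lbrakk>y \<in> L; m \<in> {1..n}\<rbrakk> \<Longrightarrow> fn (m, \<beta>) (gu y) = y m \<beta>"
 by (simp add: fn_def rho tr_O act_mono_eps act_mono_0 L_subset_W)

end

section \<open>A basis of the restricted enveloping algebra\<close>

text \<open>\<open>shuffle_sum f g w\<close> is the sum of \<open>f a * g b\<close> over all ways of distributing the letters of \<open>w\<close> into two
 subwords \<open>a\<close> and \<open>b\<close>; it evaluates the convolution of two functionals on a product of primitive elements.\<close>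

primrec shuffle_sum :: "('b list \<Rightarrow> 'c::comm_semiring_1) \<Rightarrow> ('b list \<Rightarrow> 'c) \<Rightarrow> 'b list \<Rightarrow> 'c" where
 "shuffle_sum f g [] = f [] * g []"
| "shuffle_sum f g (x # w) = shuffle_sum (\<lambda>a. f (x # a)) g w + shuffle_sum f (\<lambda>b. g (x # b)) w"

text \<open>g takes at least r letters to be nonzero and w has at most r, so the only distribution
  that counts gives all letters to g.\<close>

lemma shuffle_sum_low:
 assumes "\<And>b. b \<in> lists B \<Longrightarrow> length b < r \<Longrightarrow> g b = 0" "w \<in> lists B" "length w \<le> r"
 shows "shuffle_sum f g w = (if length w = r then f [] * g w else 0)"
 using assms
proof (induction w arbitrary: f g r)
 case (Cons x w)
 have 1: "shuffle_sum (\<lambda>a. f (x # a)) g w = 0"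
  using Cons.prems by (subst Cons.IH[of r]) auto
 have "shuffle_sum f (\<lambda>b. g (x # b)) w = (if length w = r - 1 then f [] * g (x # w) else 0)"
  using Cons.prems by (intro Cons.IH) auto
 then show ?case using 1 Cons.prems(3) by auto
qed auto

text \<open>f vanishes on the empty word, so of the r + 1 letters g receives exactly r, and f
  detects whether the remaining one is i. There are as many choices as w has letters i; the order of
  the others is immaterial to g.\<close>

lemma shuffle_sum_top:
 fixes i :: 'b and G :: "'b multiset \<Rightarrow> 'c::comm_ring_1"
 assumes "\<And>b. b \<in> lists B \<Longrightarrow> length b < r \<Longrightarrow> g b = 0" "\<And>b. b \<in> lists B \<Longrightarrow> length b = r \<Longrightarrow> g b = G (mset b)"
  and f: "f [] = 0" "\<And>j. j \<in> B \<Longrightarrow> f [j] = of_bool (j = i)" and "w \<in> lists B" "length w = Suc r"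
 shows "shuffle_sum f g w = of_nat (count (mset w) i) * G (mset w - {#i#})"
 using assms(1,2,5,6)
proof (induction w arbitrary: g G r)
 case (Cons x w)
 have x: "x \<in> B" "w \<in> lists B" "length w = r" using Cons.prems by auto
 have 1: "shuffle_sum (\<lambda>a. f (x # a)) g w = of_bool (x = i) * G (mset w)"
  using x Cons.prems(1,2) f(2) by (subst shuffle_sum_low[of B r]) auto
 have 2: "shuffle_sum f (\<lambda>b. g (x # b)) w = of_nat (count (mset w) i) * G (add_mset x (mset w - {#i#}))"
 proof (cases w)
  case Nil then show ?thesis using f(1) by simp
 next
  case (Cons y v)
  show ?thesis
   by (rule Cons.IH[of "r - 1" _ "\<lambda>M. G (add_mset x M)"]) (use x Cons.prems Cons in auto)
 qed
 show ?case
 proof (cases "i \<in># mset w")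
  case True
  then have e: "add_mset x (mset w - {#i#}) = add_mset x (mset w) - {#i#}" by simp
  show ?thesis unfolding shuffle_sum.simps 1 2 e by (cases "x = i") (simp_all add: distrib_right)
 next
  case False
  then have c0: "count (mset w) i = 0" by (simp add: not_in_iff)
  show ?thesis unfolding shuffle_sum.simps 1 2 by (cases "x = i") (simp_all add: c0)
 qed
qed simp

context divided_powers
begin

sublocale uu2: two_algebras KK uu uu
 by (rule two_algebrasI) unfold_locales

abbreviation "uu2 \<equiv> tensor_alg KK uu uu"
abbreviation "t2 \<equiv> tens KK uu uu"
abbreviation "c2 \<equiv> unit_map uu2"

lemma u_rep_primitive: "u_rep uu2 c2 (\<lambda>x. t2 (gu x) \<one>\<^bsub>uu\<^esub> \<oplus>\<^bsub>uu2\<^esub> t2 \<one>\<^bsub>uu\<^esub> (gu x))"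
proof -
 have ch: "charp_algebra uu2 c2 p"
  using charp_algebra_unital[OF uu2.unital_algebra_AB, of id p] char_p p_pos by (auto simp: ring_hom_def)
 show ?thesis
 proof (rule u_rep_sum)
  show "u_rep uu2 c2 (\<lambda>x. t2 (gu x) \<one>\<^bsub>uu\<^esub>)"
   by (rule u_rep_hom[OF u_rep_gu uu2.inl_hom ch]) (simp only: uu2.AB_simps(6))
  show "u_rep uu2 c2 (\<lambda>x. t2 \<one>\<^bsub>uu\<^esub> (gu x))"
   by (rule u_rep_hom[OF u_rep_gu uu2.inr_hom ch]) (rule uu2.inr_unit, simp)
 qed (simp add: uu2.inl_inr_commute)
qed

definition Du :: "'k env set \<Rightarrow> ('k env set \<times> 'k env set \<Rightarrow>\<^sub>0 int) set" where
 "Du = (SOME \<Phi>. \<Phi> \<in> ring_hom uu uu2 \<and> (\<forall>c. \<Phi> (cu c) = c2 c) \<and>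
   (\<forall>x\<in>L. \<Phi> (gu x) = t2 (gu x) \<one>\<^bsub>uu\<^esub> \<oplus>\<^bsub>uu2\<^esub> t2 \<one>\<^bsub>uu\<^esub> (gu x)))"

lemma Du: "Du \<in> ring_hom uu uu2" "Du (cu c) = c2 c"
 "x \<in> L \<Longrightarrow> Du (gu x) = t2 (gu x) \<one>\<^bsub>uu\<^esub> \<oplus>\<^bsub>uu2\<^esub> t2 \<one>\<^bsub>uu\<^esub> (gu x)"
proof -
 have "\<exists>\<Phi>. \<Phi> \<in> ring_hom uu uu2 \<and> (\<forall>c. \<Phi> (cu c) = c2 c) \<and>
   (\<forall>x\<in>L. \<Phi> (gu x) = t2 (gu x) \<one>\<^bsub>uu\<^esub> \<oplus>\<^bsub>uu2\<^esub> t2 \<one>\<^bsub>uu\<^esub> (gu x))"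
  by (rule u_lift[OF u_rep_primitive]) (intro exI conjI allI ballI; assumption | simp)
 from someI_ex[OF this, folded Du_def]
 show "Du \<in> ring_hom uu uu2" "Du (cu c) = c2 c"
  "x \<in> L \<Longrightarrow> Du (gu x) = t2 (gu x) \<one>\<^bsub>uu\<^esub> \<oplus>\<^bsub>uu2\<^esub> t2 \<one>\<^bsub>uu\<^esub> (gu x)"
  by (simp_all only:)
qed

lemma Du_closed [simp]: "a \<in> carrier uu \<Longrightarrow> Du a \<in> carrier uu2"
 by (rule ring_hom_closed[OF Du(1)])

definition conv_fn :: "('k env set \<Rightarrow> 'k) \<Rightarrow> ('k env set \<Rightarrow> 'k) \<Rightarrow> 'k env set \<Rightarrow> 'k" where
 "conv_fn f g a = tensor_lift KK (\<lambda>x y. f x * g y) (Du a)"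

lemma balanced_conv: "ulin f \<Longrightarrow> ulin g \<Longrightarrow> balanced_map KK uu uu KK (\<lambda>x y. f x * g y)"
proof -
 assume f: "ulin f" and g: "ulin g"
 interpret K: ring KK by (rule ring_from_type_algebra)
 show ?thesis by unfold_locales (simp_all add: ulinD[OF f] ulinD[OF g] algebra_simps)
qed

lemma ulin_conv:
 assumes f: "ulin f" and g: "ulin g" shows "ulin (conv_fn f g)"
proof -
 interpret b: balanced_map KK uu uu KK "\<lambda>x y. f x * g y" by (rule balanced_conv[OF f g])
 have s: "b.lft (c2 c \<otimes>\<^bsub>uu2\<^esub> z) = c * b.lft z" if "z \<in> carrier uu2" for c z
  using that
 proof (induction z rule: uu2.tens_induct)
  case (tens a b)
  then show ?case using b.lift_tens by (simp add: uu2.AB_simps(6) uu2.tens_mult ulinD[OF f])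
 next
  case (add x y)
  have "c2 c \<in> carrier uu2" unfolding uu2.AB_simps(6) by simp
  then show ?case using add b.lift_add by (simp add: uu2.Q.r_distr algebra_simps)
 qed
 show ?thesis
  using b.lift_add s
  by (simp add: ulin_def conv_fn_def ring_hom_add[OF Du(1)] ring_hom_mult[OF Du(1)] Du(2))
qed

lemma ulin_shift: "\<lbrakk>ulin f; x \<in> carrier uu\<rbrakk> \<Longrightarrow> ulin (\<lambda>a. f (x \<odot> a))"
 by (simp add: ulin_def uu.A.r_distr uu.unit_left_commute)

text \<open>The coproduct of a Lie element is primitive, so a new letter acts on one of the two
  tensor factors. This is the recursion of \<open>shuffle_sum\<close>.\<close>

lemma conv_step:
 assumes f: "ulin f" and g: "ulin g" and x: "x \<in> L" and a: "a \<in> carrier uu"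
 shows "conv_fn f g (gu x \<odot> a) = conv_fn (\<lambda>a. f (gu x \<odot> a)) g a + conv_fn f (\<lambda>a. g (gu x \<odot> a)) a"
proof -
 note gx = gu_closed[OF x]
 interpret b: balanced_map KK uu uu KK "\<lambda>x y. f x * g y" by (rule balanced_conv[OF f g])
 interpret b1: balanced_map KK uu uu KK "\<lambda>y z. f (gu x \<odot> y) * g z" by (rule balanced_conv[OF ulin_shift[OF f gx] g])
 interpret b2: balanced_map KK uu uu KK "\<lambda>y z. f y * g (gu x \<odot> z)" by (rule balanced_conv[OF f ulin_shift[OF g gx]])
 have "b.lft ((t2 (gu x) \<one>\<^bsub>uu\<^esub> \<oplus>\<^bsub>uu2\<^esub> t2 \<one>\<^bsub>uu\<^esub> (gu x)) \<otimes>\<^bsub>uu2\<^esub> z) = b1.lft z + b2.lft z" if "z \<in> carrier uu2" for z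
  using that
 proof (induction z rule: uu2.tens_induct)
  case (tens a b)
  then show ?case
   using gx b.lift_tens b1.lift_tens b2.lift_tens b.lift_add by (simp add: uu2.Q.l_distr uu2.tens_mult)
 next
  case (add z z')
  have "t2 (gu x) \<one>\<^bsub>uu\<^esub> \<oplus>\<^bsub>uu2\<^esub> t2 \<one>\<^bsub>uu\<^esub> (gu x) \<in> carrier uu2" using gx by simp
  then show ?case using add b.lift_add b1.lift_add b2.lift_add by (simp add: uu2.Q.r_distr)
 qed
 from this[OF Du_closed[OF a]] show ?thesis
  using gx a by (simp add: conv_fn_def ring_hom_mult[OF Du(1)] Du(3)[OF x])
qed

subsection \<open>Words in the basis\<close>

lemma bvec_L [simp]: "x \<in> bidx \<Longrightarrow> bvec x \<in> L"
 using D_in_L by (metis bvec_mem)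

definition word :: "(nat \<times> (nat \<Rightarrow> nat)) list \<Rightarrow> 'k env set" where
 "word w = foldr (\<lambda>x a. gu (bvec x) \<odot> a) w \<one>\<^bsub>uu\<^esub>"

lemma word_simps [simp]: "word [] = \<one>\<^bsub>uu\<^esub>" "word (x # w) = gu (bvec x) \<odot> word w"
 by (simp_all add: word_def)

lemma word_closed [simp]: "w \<in> lists bidx \<Longrightarrow> word w \<in> carrier uu"
 by (induction w) auto

lemma conv_word:
 assumes "ulin f" "ulin g" "w \<in> lists bidx"
 shows "conv_fn f g (word w) = shuffle_sum (\<lambda>a. f (word a)) (\<lambda>b. g (word b)) w"
 using assms
proof (induction w arbitrary: f g)
 case Nil
 interpret b: balanced_map KK uu uu KK "\<lambda>x y. f x * g y" by (rule balanced_conv[OF Nil(1,2)])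
 show ?case using b.lift_tens[of "\<one>\<^bsub>uu\<^esub>" "\<one>\<^bsub>uu\<^esub>"] by (simp add: conv_fn_def ring_hom_one[OF Du(1)] uu2.tens_one)
next
 case (Cons x w)
 then show ?case by (simp add: conv_step ulin_shift)
qed

text \<open>Derivations kill 1, so the starting functional, the constant term of a applied to 1, is
  the counit.\<close>

primrec dual :: "(nat \<times> (nat \<Rightarrow> nat)) list \<Rightarrow> 'k env set \<Rightarrow> 'k" where
 "dual [] = (\<lambda>a. rho a (mono 0) 0)"
| "dual (i # I) = conv_fn (fn i) (dual I)"

lemma ulin_dual: "ulin (dual I)"
 by (induction I) (simp_all add: ulin_rho ulin_conv ulin_fn)

text \<open>The product of the factorials of the multiplicities. It is invertible in K as long as
  these stay below p, which is how the bound on the exponents enters.\<close>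

primrec mult_fact :: "'b list \<Rightarrow> nat" where
 "mult_fact [] = 1"
| "mult_fact (i # I) = Suc (count (mset I) i) * mult_fact I"

lemma mult_fact_nonzero: "(\<forall>i. count (mset I) i < p) \<Longrightarrow> (of_nat (mult_fact I) :: 'k) \<noteq> 0"
proof (induction I)
 case (Cons i I)
 have "Suc (count (mset I) i) < p" using Cons.prems[rule_format, of i] by simp
 then have "(of_nat (Suc (count (mset I) i)) :: 'k) \<noteq> 0"
  unfolding of_nat_eq_0_iff_char_dvd char_p by (auto dest: dvd_imp_le)
 moreover have "\<forall>j. count (mset I) j < p" using Cons.prems by (metis Suc_lessD count_add_mset mset.simps(2))
 ultimately show ?case using Cons.IH by (simp del: of_nat_Suc mult_Suc)
qed simp

text \<open>Every \<open>fn\<close> vanishes at 1, so a convolution product with r factors vanishes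
  on words shorter than r. On words of length r it counts the ways of matching the letters with the
  factors.\<close>

lemma dual_word:
 assumes "I \<in> lists bidx" "w \<in> lists bidx" "length w \<le> length I"
 shows "dual I (word w) = of_bool (mset w = mset I) * of_nat (mult_fact I)"
 using assms
proof (induction I arbitrary: w rule: list.induct)
 case Nil
 then show ?case by (simp add: rho_simps mono_apply)
next
 case (Cons i I)
 obtain m \<beta> where i: "i = (m, \<beta>)" by force
 have ib: "(m, \<beta>) \<in> bidx" using Cons.prems(1) unfolding i by simp
 then have m: "m \<in> {1..n}" by (auto simp: bidx_def)
 have f0: "fn i (word []) = 0" using fn_one[of i] m i by simp
 have f1: "fn i (word [j]) = of_bool (j = i)" if "j \<in> bidx" for j
 proof -
  obtain m' \<beta>' where j: "j = (m', \<beta>')" by force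
  have "fn i (word [j]) = bvec j m \<beta>" using that m by (simp add: i fn_gu)
  then show ?thesis using bvec_dual[of m \<beta> m' \<beta>'] that ib by (simp add: i j)
 qed
 have low: "dual I (word b) = 0" if "b \<in> lists bidx" "length b < length I" for b
  using Cons.IH[of b] Cons.prems(1) that by (auto dest: mset_eq_length)
 have eq: "dual (i # I) (word w) = shuffle_sum (\<lambda>a. fn i (word a)) (\<lambda>b. dual I (word b)) w"
  using Cons.prems by (simp add: conv_word ulin_fn ulin_dual)
 show ?case
 proof (cases "length w = Suc (length I)")
  case False
  then have "dual (i # I) (word w) = 0"
   unfolding eq using Cons.prems low f0 by (subst shuffle_sum_low[of bidx "length I"]) auto
  moreover have "mset w \<noteq> mset (i # I)" using False mset_eq_length[of w "i # I"] by auto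
  ultimately show ?thesis by simp
 next
  case True
  have "dual (i # I) (word w) = of_nat (count (mset w) i) * (of_bool (mset w - {#i#} = mset I) * of_nat (mult_fact I))"
   unfolding eq
   by (rule shuffle_sum_top[where B = bidx and r = "length I" and G = "\<lambda>M. of_bool (M = mset I) * of_nat (mult_fact I)"])
    (use Cons low f0 f1 True in auto)
  also have "\<dots> = of_bool (mset w = mset (i # I)) * of_nat (mult_fact (i # I))"
  proof (cases "i \<in># mset w")
   case True
   then have "mset w - {#i#} = mset I \<longleftrightarrow> mset w = mset (i # I)"
    by (metis add_mset_remove_trivial insert_DiffM mset.simps(2))
   then show ?thesis by (auto simp del: of_nat_Suc mult_Suc)
  next
   case False
   then have c0: "count (mset w) i = 0" by (simp add: not_in_iff)
   then have ne: "mset w \<noteq> mset (i # I)" by (metis count_add_mset mset.simps(2) nat.distinct(1))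
   show ?thesis by (simp only: c0 ne) simp
  qed
  finally show ?thesis .
 qed
qed

section \<open>Straightening: words with exponents below p span\<close>

inductive_set lspan :: "(nat \<times> (nat \<Rightarrow> nat)) list set \<Rightarrow> 'k env set set" for S where
 zero: "\<zero>\<^bsub>uu\<^esub> \<in> lspan S"
| word: "w \<in> S \<Longrightarrow> word w \<in> lspan S"
| add: "a \<in> lspan S \<Longrightarrow> b \<in> lspan S \<Longrightarrow> a \<oplus>\<^bsub>uu\<^esub> b \<in> lspan S"
| scale: "a \<in> lspan S \<Longrightarrow> cu c \<odot> a \<in> lspan S"

lemma lspan_closed: "a \<in> lspan S \<Longrightarrow> S \<subseteq> lists bidx \<Longrightarrow> a \<in> carrier uu"
proof (induction rule: lspan.induct)
 case (word w)
 then show ?case using word_closed[of w] by blast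
qed auto

lemma lspan_mono: "a \<in> lspan S \<Longrightarrow> (\<And>w. w \<in> S \<Longrightarrow> word w \<in> lspan Sb) \<Longrightarrow> a \<in> lspan Sb"
 by (induction rule: lspan.induct) (auto intro: lspan.intros)

lemma gu_lspan:
 assumes "a \<in> lspan S" "S \<subseteq> lists bidx" "x \<in> L" and w: "\<And>w. w \<in> S \<Longrightarrow> gu x \<odot> word w \<in> lspan Sb"
 shows "gu x \<odot> a \<in> lspan Sb"
 using assms(1)
proof (induction rule: lspan.induct)
 case zero
 then show ?case using assms(3) lspan.zero by simp
next
 case (add a b)
 then show ?case using lspan_closed[OF _ assms(2)] assms(3) by (simp add: uu.A.r_distr lspan.add)
next
 case (scale a c)
 then show ?case using lspan_closed[OF _ assms(2)] assms(3) by (simp add: uu.unit_left_commute lspan.scale)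
qed (rule w)

abbreviation "short m \<equiv> {w \<in> lists bidx. length w < m}"

lemma gu_word_span:
 assumes x: "x \<in> L" and w: "w \<in> lists bidx" "Suc (length w) < m"
 shows "gu x \<odot> word w \<in> lspan (short m)"
proof -
 have "x \<in> L \<and> gu x \<odot> word w \<in> lspan (short m)" if "x \<in> V.span (bvec ` bidx)" for x
  using that
 proof (induction rule: V.span_induct_alt)
  case base
  have 0: "(0 :: 'k vfield) \<in> L" using subspace_L by (auto simp: V.subspace_def)
  moreover have "cu 0 = \<zero>\<^bsub>uu\<^esub>" using uu.unit_zero by (simp only: rota_simps)
  ultimately have "gu 0 = \<zero>\<^bsub>uu\<^esub>" using gu_scale[of 0 0] gu_closed[of 0] by simp
  moreover have "(\<lambda>a b. 0) = (0 :: 'k vfield)" by (simp add: fun_eq_iff)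
  ultimately show ?case using 0 w by (simp add: lspan.zero)
 next
  case (step c x y)
  then obtain j where j: "j \<in> bidx" "x = bvec j" by auto
  have "gu (vf_scale c x + y) \<odot> word w = cu c \<odot> word (j # w) \<oplus>\<^bsub>uu\<^esub> gu y \<odot> word w"
   using step j w by (simp add: gu_add gu_scale L_scale uu.A.l_distr uu.A.m_assoc)
  moreover have "word (j # w) \<in> lspan (short m)" using w j by (intro lspan.word) auto
  moreover have "(\<lambda>a b. vf_scale c x a b + y a b) = vf_scale c x + y" by (simp add: fun_eq_iff)
  ultimately show ?case using step j by (simp add: L_add L_scale lspan.add lspan.scale del: word_simps)
 qed
 then show ?thesis using x L_eq_span_bvec by auto
qed

text \<open>Each exchange of neighbours costs a bracket. This is a single Lie element replacing two
  letters, hence a combination of shorter words.\<close>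

lemma word_move:
 assumes "x \<in> bidx" "u \<in> lists bidx" "v \<in> lists bidx"
 shows "\<exists>z\<in>lspan (short (Suc (length u + length v))). word (x # u @ v) = word (u @ x # v) \<oplus>\<^bsub>uu\<^esub> z"
 using assms(2)
proof (induction u rule: list.induct)
 case Nil
 then show ?case using assms by (intro bexI[OF _ lspan.zero]) simp
next
 case (Cons a u)
 let ?m = "Suc (length u + length v)" and ?W = "word (u @ v)"
 have ab: "a \<in> bidx" "u \<in> lists bidx" using Cons.prems by auto
 obtain z where z: "z \<in> lspan (short ?m)" "word (x # u @ v) = word (u @ x # v) \<oplus>\<^bsub>uu\<^esub> z" using Cons by auto
 have zc: "z \<in> carrier uu" by (rule lspan_closed[OF z(1)]) auto
 have Wc: "?W \<in> carrier uu" "word (u @ x # v) \<in> carrier uu" using ab assms by (auto intro!: word_closed)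
 note L = bvec_L[OF assms(1)] bvec_L[OF ab(1)]
 note B = br_in_L[OF L]
 let ?z = "gu (bvec a) \<odot> z \<oplus>\<^bsub>uu\<^esub> gu (br (bvec x) (bvec a)) \<odot> ?W"
 have 1: "gu (bvec a) \<odot> z \<in> lspan (short (Suc ?m))"
  by (rule gu_lspan[OF z(1)]) (use L gu_word_span in auto)
 have 2: "gu (br (bvec x) (bvec a)) \<odot> ?W \<in> lspan (short (Suc ?m))"
  by (rule gu_word_span) (use B ab assms in auto)
 have "word (x # (a # u) @ v) = (gu (bvec x) \<odot> gu (bvec a)) \<odot> ?W"
  using L Wc by (simp add: uu.A.m_assoc)
 also have "\<dots> = gu (bvec a) \<odot> word (x # u @ v) \<oplus>\<^bsub>uu\<^esub> gu (br (bvec x) (bvec a)) \<odot> ?W"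
  unfolding gu_br[OF L] using L B Wc by (simp add: uu.A.l_distr uu.A.m_assoc)
 also have "\<dots> = word ((a # u) @ x # v) \<oplus>\<^bsub>uu\<^esub> ?z"
  unfolding z(2) using L B Wc zc by (simp add: uu.A.r_distr uu.A.a_assoc)
 finally show ?case using lspan.add[OF 1 2] by auto
qed

lemma word_perm:
 assumes "w \<in> lists bidx" "mset w = mset w'"
 shows "\<exists>z\<in>lspan (short (length w)). word w = word w' \<oplus>\<^bsub>uu\<^esub> z"
 using assms
proof (induction w arbitrary: w' rule: list.induct)
 case Nil
 then show ?case by (intro bexI[OF _ lspan.zero]) simp
next
 case (Cons x w)
 have "x \<in> set w'" using Cons.prems(2) by (metis list.set_intros(1) set_mset_mset)
 then obtain u v where w': "w' = u @ x # v" by (auto dest: split_list)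
 have m: "mset w = mset (u @ v)" using Cons.prems(2) unfolding w' by simp
 then have ln: "length w = length u + length v" using mset_eq_length[OF m] by simp
 have uv: "u \<in> lists bidx" "v \<in> lists bidx" "x \<in> bidx" "w \<in> lists bidx"
  using Cons.prems(1) mset_eq_setD[OF m] by auto
 obtain z where z: "z \<in> lspan (short (length w))" "word w = word (u @ v) \<oplus>\<^bsub>uu\<^esub> z"
  using Cons.IH[OF uv(4) m] by auto
 obtain y where y: "y \<in> lspan (short (Suc (length u + length v)))" "word (x # u @ v) = word w' \<oplus>\<^bsub>uu\<^esub> y"
  using word_move[OF uv(3,1,2)] w' by auto
 have zc: "z \<in> carrier uu" "y \<in> carrier uu" using lspan_closed[OF z(1)] lspan_closed[OF y(1)] by auto
 have wc: "word (u @ v) \<in> carrier uu" "word w' \<in> carrier uu" using uv w' by (auto intro!: word_closed)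
 have 1: "gu (bvec x) \<odot> z \<in> lspan (short (Suc (length w)))"
  by (rule gu_lspan[OF z(1)]) (use uv gu_word_span in auto)
 have "word (x # w) = word (x # u @ v) \<oplus>\<^bsub>uu\<^esub> gu (bvec x) \<odot> z"
  using z(2) zc wc uv by (simp add: uu.A.r_distr)
 also have "\<dots> = word w' \<oplus>\<^bsub>uu\<^esub> (y \<oplus>\<^bsub>uu\<^esub> gu (bvec x) \<odot> z)"
  unfolding y(2) using zc wc uv by (simp add: uu.A.a_assoc)
 finally show ?case using lspan.add[OF y(1)[folded ln] 1] by auto
qed

abbreviation "expo \<equiv> bidx \<rightarrow>\<^sub>E {..<p}"

text \<open>No order of the basis is fixed: any arrangement of the prescribed multiset will do,
  because rearranging a word changes it only by shorter ones.\<close>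

definition pbw :: "(nat \<times> (nat \<Rightarrow> nat) \<Rightarrow> nat) \<Rightarrow> (nat \<times> (nat \<Rightarrow> nat)) list" where
 "pbw c = (SOME w. mset w = (\<Sum>x\<in>bidx. replicate_mset (c x) x))"

lemma mset_pbw: "mset (pbw c) = (\<Sum>x\<in>bidx. replicate_mset (c x) x)"
 unfolding pbw_def by (rule someI_ex) (rule ex_mset)

lemma count_pbw: "count (mset (pbw c)) x = (if x \<in> bidx then c x else 0)"
 by (simp add: mset_pbw count_sum)

lemma pbw_lists [simp]: "pbw c \<in> lists bidx"
 using count_pbw[of c] by (metis in_lists_conv_set count_eq_zero_iff set_mset_mset)

lemma pbw_inj: "\<lbrakk>c \<in> expo; c' \<in> expo; mset (pbw c) = mset (pbw c')\<rbrakk> \<Longrightarrow> c = c'"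
 by (rule PiE_ext) (auto simp: count_pbw dest: arg_cong[of _ _ "\<lambda>M. count M _"] , metis count_pbw)

lemma card_expo: "card expo = p ^ card bidx" "finite expo"
 by (simp_all add: card_PiE finite_PiE)

text \<open>Induction on the length. If a letter occurs p times, p copies are moved to the front;
  their product is the letter itself or 0, so the word gets shorter or vanishes.\<close>

lemma word_in_pbw: "w \<in> lists bidx \<Longrightarrow> word w \<in> lspan (pbw ` expo)"
proof (induction "length w" arbitrary: w rule: less_induct)
 case less
 have sh: "z \<in> lspan (pbw ` expo)" if "z \<in> lspan (short (length w))" for z
  by (rule lspan_mono[OF that]) (use less.hyps in auto)
 have red: "word w \<in> lspan (pbw ` expo)" if m: "mset w = mset w'" and l: "word w' \<in> lspan (pbw ` expo)" for w'
 proof -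
  obtain z where z: "z \<in> lspan (short (length w))" "word w = word w' \<oplus>\<^bsub>uu\<^esub> z"
   using word_perm[OF less.prems m] by blast
  show ?thesis unfolding z(2) by (rule lspan.add[OF l sh[OF z(1)]])
 qed
 show ?case
 proof (cases "\<forall>x. count (mset w) x < p")
  case True
  let ?c = "restrict (count (mset w)) bidx"
  have c: "?c \<in> expo" using True by auto
  have "mset w = mset (pbw ?c)"
  proof (rule multiset_eqI)
   show "count (mset w) x = count (mset (pbw ?c)) x" for x
    using less.prems by (auto simp: count_pbw count_eq_zero_iff)
  qed
  then show ?thesis by (rule red[OF _ lspan.word]) (rule imageI[OF c])
 next
  case False
  then obtain x where x: "count (mset w) x \<ge> p" by (auto simp: not_less)
  then have xb: "x \<in> bidx" using less.prems p_pos by (metis in_listsD count_eq_zero_iff not_gr_zero not_less set_mset_mset)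
  obtain r where r: "mset r = mset w - replicate_mset p x" using ex_mset by blast
  have sub: "replicate_mset p x \<subseteq># mset w" using x by (simp add: count_le_replicate_mset_subset_eq[symmetric])
  have mw: "mset w = mset (replicate p x @ r)" using r sub by simp
  have rl: "r \<in> lists bidx" using less.prems mset_eq_setD[OF mw] by auto
  have len: "length w = p + length r" using mset_eq_length[OF mw] by simp
  obtain i j \<alpha> where D: "bvec x = D i j \<alpha>" "i \<in> {1..n}" "j \<in> {1..n}" "i \<noteq> j" "\<alpha> \<in> MI" using bvec_mem[OF xb] by metis
  have rep: "word (replicate m x @ r) = gu (bvec x) [^]\<^bsub>uu\<^esub> m \<odot> word r" for m
  proof (induction m)
   case (Suc m)
   then show ?case
    unfolding uu.A.nat_pow_Suc2[OF gu_closed[OF bvec_L[OF xb]]] using xb rl by (simp add: uu.A.m_assoc)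
  qed (use rl in simp)
  have "word (replicate p x @ r) \<in> lspan (pbw ` expo)"
  proof (cases "\<alpha> = eps i + eps j")
   case True
   then have "word (replicate p x @ r) = word (x # r)" using gu_pow_p(1)[OF D(2-4)] by (simp add: rep D(1))
   then show ?thesis using less.hyps[of "x # r"] xb rl len p_gt_1 by simp
  next
   case False
   then have "word (replicate p x @ r) = \<zero>\<^bsub>uu\<^esub>" using gu_pow_p(2)[OF D(2-5)] rl by (simp add: rep D(1))
   then show ?thesis by (simp add: lspan.zero)
  qed
  then show ?thesis by (rule red[OF mw])
 qed
qed

lemma uu_span: "a \<in> carrier uu \<Longrightarrow> a \<in> lspan (pbw ` expo)"
proof -
 assume a: "a \<in> carrier uu"
 have "a \<in> lspan (lists bidx)"
  using a L_eq_span_bvec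
 proof (induction rule: u_induct)
  case (unit c)
  have "cu c \<odot> word [] \<in> lspan (lists bidx)" by (intro lspan.intros) simp
  then show ?case by simp
 next
  case (mult x a)
  then obtain j where j: "j \<in> bidx" "x = bvec j" by auto
  show ?case
  proof (rule gu_lspan[OF mult(3)])
   fix w assume "w \<in> lists bidx"
   then show "gu x \<odot> word w \<in> lspan (lists bidx)" using j lspan.word[of "j # w" "lists bidx"] by simp
  qed (use j in auto)
 qed (auto intro: lspan.intros)
 then show ?thesis by (rule lspan_mono) (rule word_in_pbw)
qed

lemma dual_pbw:
 assumes c: "c \<in> expo" and c': "c' \<in> expo" and le: "length (pbw c') \<le> length (pbw c)"
 shows "dual (pbw c) (word (pbw c')) \<noteq> 0 \<longleftrightarrow> c = c'"
proof -
 have "\<forall>x. count (mset (pbw c)) x < p" using c p_pos by (auto simp: count_pbw PiE_mem)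
 then show ?thesis
  using dual_word[of "pbw c" "pbw c'"] le pbw_inj[OF c' c] mult_fact_nonzero[of "pbw c"] by auto
qed

end

section \<open>The base ring and the extended algebra\<close>

lemma unital_algebra_poly_alg: "unital_algebra (ring_of_type_algebra :: 'k::field ring) poly_alg"
proof -
 interpret K: cring "ring_of_type_algebra :: 'k ring" by (rule cring_from_type_algebra)
 interpret P: ring "poly_alg :: ('k poly, 'k) ralg"
  by (rule ring_same_structure[OF ring_from_type_algebra[where 'a = "'k poly"]]) (simp_all add: poly_alg_def)
 show ?thesis
  by unfold_locales (auto intro!: ring_hom_memI simp: poly_alg_def mult.commute)
qed

lemma poly_alg_simps [simp]:
 "carrier (poly_alg :: ('k::field poly, 'k) ralg) = UNIV"
 "f \<otimes>\<^bsub>poly_alg\<^esub> g = f * g" "f \<oplus>\<^bsub>poly_alg\<^esub> g = f + g" "\<one>\<^bsub>poly_alg\<^esub> = 1"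
 "\<zero>\<^bsub>poly_alg\<^esub> = 0" "unit_map poly_alg c = [:c:]"
 by (simp_all add: poly_alg_def)

lemma cring_poly_alg: "cring (poly_alg :: ('k::field poly, 'k) ralg)"
 by (rule cring_same_structure[OF cring_from_type_algebra[where 'a = "'k poly"]]) (simp_all add: poly_alg_def)

locale special_twist = divided_powers p n K for p n :: nat and K :: "'k::field itself" +
 fixes q :: 'k and k k' :: nat
 assumes kk: "1 \<le> k" "k \<le> n" "1 \<le> k'" "k' \<le> n" "k \<noteq> k'"
begin

abbreviation "PA \<equiv> poly_alg :: ('k poly, 'k) ralg"
abbreviation "R \<equiv> Ktpq p q"
abbreviation "md \<equiv> monom 1 p - monom q 1 :: 'k poly"

sublocale PA: unital_algebra KK PA by (rule unital_algebra_poly_alg)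

sublocale KI: ideal "Ktpq_ideal p q" PA
 unfolding Ktpq_ideal_def by (rule PA.A.genideal_ideal) simp

sublocale R: unital_algebra KK R
 unfolding Ktpq_def by (rule unital_algebra_quot_alg) unfold_locales

definition cl :: "'k poly \<Rightarrow> 'k poly set" where "cl f = Ktpq_ideal p q +>\<^bsub>PA\<^esub> f"

lemma cl_hom: "cl \<in> ring_hom PA R"
 unfolding Ktpq_def ring_hom_quot_alg cl_def[abs_def] by (rule KI.rcos_ring_hom)

lemma cl_simps [simp]: "cl f \<in> carrier R" "cl f \<oplus>\<^bsub>R\<^esub> cl g = cl (f + g)" "cl f \<otimes>\<^bsub>R\<^esub> cl g = cl (f * g)"
 using ring_hom_closed[OF cl_hom, of f] ring_hom_add[OF cl_hom, of f g] ring_hom_mult[OF cl_hom, of f g] by simp_all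

lemma R_const: "\<one>\<^bsub>R\<^esub> = cl 1" "\<zero>\<^bsub>R\<^esub> = cl 0" "unit_map R c = cl [:c:]" "Ktpq_t p q = cl (monom 1 1)"
 using ring_hom_one[OF cl_hom] ring_hom_zero[OF cl_hom PA.A.ring_axioms R.A.ring_axioms]
 by (simp_all add: cl_def Ktpq_t_def) (simp add: Ktpq_def)

lemma R_rep: assumes "z \<in> carrier R" obtains f where "z = cl f"
 using assms KI.quot_rep[of z] by (auto simp: cl_def Ktpq_def)

lemma cring_R: "cring R"
proof -
 have "cring (PA Quot Ktpq_ideal p q)" by (rule KI.quotient_is_cring[OF cring_poly_alg])
 then show ?thesis by (rule cring_same_structure) (simp_all add: Ktpq_def)
qed

sublocale RC: cring R by (rule cring_R)

lemma ideal_iff: "f \<in> Ktpq_ideal p q \<longleftrightarrow> md dvd f"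
proof -
 have "Ktpq_ideal p q = PIdl\<^bsub>PA\<^esub> md"
  unfolding Ktpq_ideal_def by (rule cring.cgenideal_eq_genideal[OF cring_poly_alg, symmetric]) simp
 then show ?thesis by (auto simp: cgenideal_def dvd_def mult.commute)
qed

lemma cl_eq: "cl f = cl g \<longleftrightarrow> f mod md = g mod md"
proof
 assume "cl f = cl g"
 moreover have "f \<in> cl f" unfolding cl_def by (rule KI.a_rcos_self) simp
 ultimately have "f \<in> cl g" by simp
 then obtain i where "i \<in> Ktpq_ideal p q" "f = i + g" by (auto simp: cl_def a_r_coset_def r_coset_def)
 then show "f mod md = g mod md" by (auto simp: ideal_iff mod_eq_dvd_iff)
next
 assume "f mod md = g mod md"
 then have "md dvd f - g" by (simp add: mod_eq_dvd_iff)
 then have m: "f - g \<in> Ktpq_ideal p q" unfolding ideal_iff .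
 have 0: "cl (f - g) = \<zero>\<^bsub>R\<^esub>"
  unfolding cl_def using m by (simp add: KI.a_rcos_const Ktpq_def FactRing_simps)
 have "cl f = cl (f - g) \<oplus>\<^bsub>R\<^esub> cl g" by simp
 then show "cl f = cl g" unfolding 0 by (simp add: R_const(2))
qed

text \<open>Coefficient of t^i in the representative of degree below p. The choice of a preimage is
  harmless, since classes agree exactly when the remainders do.\<close>

definition coef :: "nat \<Rightarrow> 'k poly set \<Rightarrow> 'k" where
 "coef i z = coeff ((SOME f. cl f = z) mod md) i"

lemma coef_cl: "coef i (cl f) = coeff (f mod md) i"
proof -
 have "cl (SOME g. cl g = cl f) = cl f" by (rule someI[of _ f]) simp
 then show ?thesis by (simp add: coef_def cl_eq)
qed

lemma coef_add: "\<lbrakk>z \<in> carrier R; w \<in> carrier R\<rbrakk> \<Longrightarrow> coef i (z \<oplus>\<^bsub>R\<^esub> w) = coef i z + coef i w"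
 by (elim R_rep) (simp add: coef_cl poly_mod_add_left)

lemma coef_scale: "z \<in> carrier R \<Longrightarrow> coef i (unit_map R c \<otimes>\<^bsub>R\<^esub> z) = c * coef i z"
 by (elim R_rep) (simp add: coef_cl R_const mod_smult_left)

lemma degree_md: "degree md = p"
proof -
 have "degree (monom 1 p + (- monom q 1) :: 'k poly) = degree (monom 1 p :: 'k poly)"
  using p_gt_1 degree_monom_le[of q 1] by (intro degree_add_eq_left) (simp add: degree_monom_eq)
 then show ?thesis by (simp add: degree_monom_eq)
qed

definition ti :: "nat \<Rightarrow> 'k poly set" where "ti i = cl (monom 1 i)"

lemma ti_closed [simp]: "ti i \<in> carrier R" by (simp add: ti_def)

lemma coef_ti: "j < p \<Longrightarrow> coef i (ti j) = of_bool (i = j)"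
proof -
 assume "j < p"
 then have "(monom 1 j :: 'k poly) mod md = monom 1 j"
  by (intro mod_poly_less) (simp only: degree_md degree_monom_eq one_neq_zero not_False_eq_True)
 then show ?thesis unfolding ti_def coef_cl by simp
qed

lemma R_induct [consumes 1, case_names scale add]:
 assumes z: "z \<in> carrier R" and s: "\<And>c i. i < p \<Longrightarrow> P (unit_map R c \<otimes>\<^bsub>R\<^esub> ti i)"
  and add: "\<And>z w. \<lbrakk>z \<in> carrier R; w \<in> carrier R; P z; P w\<rbrakk> \<Longrightarrow> P (z \<oplus>\<^bsub>R\<^esub> w)"
 shows "P z"
proof -
 obtain f where f: "z = cl f" using z by (rule R_rep)
 let ?g = "f mod md"
 have m: "cl (monom c i) = unit_map R c \<otimes>\<^bsub>R\<^esub> ti i" for c i by (simp add: R_const ti_def smult_monom)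
 have "P (cl (\<Sum>i\<in>S. monom (coeff ?g i) i))" if "finite S" "S \<subseteq> {..<p}" for S
  using that
 proof (induction S rule: finite_induct)
  case empty
  have "cl 0 = unit_map R 0 \<otimes>\<^bsub>R\<^esub> ti 0" unfolding m[symmetric] by simp
  then show ?case using s[of 0 0] p_pos by simp
 next
  case (insert i S)
  have "P (cl (monom (coeff ?g i) i) \<oplus>\<^bsub>R\<^esub> cl (\<Sum>i\<in>S. monom (coeff ?g i) i))"
   using insert s[of i] by (intro add) (simp_all only: m, simp_all)
  then show ?case using insert by simp
 qed
 moreover have "md \<noteq> 0" using degree_md p_pos by auto
 then have "degree ?g \<le> p - 1" using degree_mod_less[of md f] degree_md p_gt_1 by auto
 then have "(\<Sum>i\<le>p - 1. monom (coeff ?g i) i) = ?g" by (rule poly_as_sum_of_monoms')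
 moreover have "{..p - 1} \<subseteq> {..<p}" using p_pos by auto
 ultimately have "P (cl ?g)" by (metis finite_atMost)
 moreover have "cl ?g = cl f" by (simp add: cl_eq)
 ultimately show ?thesis by (simp add: f)
qed

sublocale ar: two_algebras KK uu R
 by (rule two_algebrasI) unfold_locales

abbreviation "AK \<equiv> tensor_alg KK uu R"
abbreviation "TK \<equiv> tens KK uu R"
abbreviation "A \<equiv> utqS p n q"
abbreviation mult_A (infixl "\<cdot>" 70) where "a \<cdot> b \<equiv> a \<otimes>\<^bsub>A\<^esub> b"
abbreviation "io a \<equiv> TK a \<one>\<^bsub>R\<^esub>"
abbreviation "ga \<equiv> utqS_gen p n q"
abbreviation "ka c \<equiv> unit_map A (unit_map R c)"

lemma A_struct: "carrier A = carrier AK" "monoid.mult A = monoid.mult AK" "one A = one AK" "ring.zero A = ring.zero AK"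
 "add A = add AK" "unit_map A r = TK \<one>\<^bsub>uu\<^esub> r"
 by (simp_all add: utqS_def)

lemma ring_A: "ring A" by (rule ring_same_structure[OF ar.Q.ring_axioms]) (simp_all add: A_struct)

lemma hom_A: "ring_hom A B = ring_hom AK B" "ring_hom B A = ring_hom B AK"
 by (rule ring_hom_same_structure; simp add: A_struct)+

sublocale A: unital_algebra R A
proof -
 interpret A: ring A by (rule ring_A)
 show "unital_algebra R A"
 proof unfold_locales
  have "unit_map A = TK \<one>\<^bsub>uu\<^esub>" by (simp add: A_struct fun_eq_iff)
  then show "unit_map A \<in> ring_hom R A" unfolding hom_A by (simp add: ar.inr_hom)
  fix r a assume r: "r \<in> carrier R" and "a \<in> carrier A"
  then have "a \<in> carrier AK" by (simp add: A_struct)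
  then have "TK \<one>\<^bsub>uu\<^esub> r \<otimes>\<^bsub>AK\<^esub> a = a \<otimes>\<^bsub>AK\<^esub> TK \<one>\<^bsub>uu\<^esub> r"
   by (induction a rule: ar.tens_induct) (use r in \<open>simp_all add: ar.tens_mult RC.m_comm ar.Q.l_distr ar.Q.r_distr\<close>)
  then show "unit_map A r \<cdot> a = a \<cdot> unit_map A r" by (simp add: A_struct)
 qed
qed

lemma tens_A: "\<lbrakk>a \<in> carrier uu; r \<in> carrier R\<rbrakk> \<Longrightarrow> TK a r = unit_map A r \<cdot> io a"
 by (simp add: A_struct ar.tens_mult)

lemma io_hom: "io \<in> ring_hom uu A"
 unfolding hom_A by (rule ar.inl_hom)

lemma io_unit: "io (cu c) = ka c"
 using ar.inr_unit[of c] by (simp add: A_struct ar.AB_simps(6))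

lemma io_closed [simp]: "a \<in> carrier uu \<Longrightarrow> io a \<in> carrier A"
 by (rule ring_hom_closed[OF io_hom])

lemma io_simps: "\<lbrakk>a \<in> carrier uu; b \<in> carrier uu\<rbrakk> \<Longrightarrow> io (a \<oplus>\<^bsub>uu\<^esub> b) = io a \<oplus>\<^bsub>A\<^esub> io b"
 "\<lbrakk>a \<in> carrier uu; b \<in> carrier uu\<rbrakk> \<Longrightarrow> io (a \<odot> b) = io a \<cdot> io b" "io \<one>\<^bsub>uu\<^esub> = \<one>\<^bsub>A\<^esub>"
 "io \<zero>\<^bsub>uu\<^esub> = \<zero>\<^bsub>A\<^esub>" "a \<in> carrier uu \<Longrightarrow> io (a [^]\<^bsub>uu\<^esub> (m::nat)) = io a [^]\<^bsub>A\<^esub> m"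
 by (rule ring_hom_add[OF io_hom] ring_hom_mult[OF io_hom] ring_hom_one[OF io_hom]
   ring_hom_zero[OF io_hom uu.A.ring_axioms A.A.ring_axioms] ring_hom_nat_pow[OF uu.A.ring_axioms A.A.ring_axioms io_hom];
   assumption?)+

lemma ga_def': "ga x = io (gu x)" by (simp add: utqS_gen_def)

lemma ga_closed [simp]: "x \<in> L \<Longrightarrow> ga x \<in> carrier A" by (simp add: ga_def')

sublocale AC: charp_algebra A ka p
 by (rule charp_algebra_unital[OF A.unital_algebra_axioms R.unit_map_hom char_p p_pos])

lemma u_rep_ga: "u_rep A ka ga"
proof -
 have "ga = (\<lambda>x. io (gu x))" by (rule ext) (rule ga_def')
 then show ?thesis using u_rep_hom[OF u_rep_gu io_hom AC.charp_algebra_axioms io_unit] by (simp only:)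
qed

lemma A_induct [consumes 1, case_names tens add]:
 assumes "a \<in> carrier A" "\<And>b r. \<lbrakk>b \<in> carrier uu; r \<in> carrier R\<rbrakk> \<Longrightarrow> P (TK b r)"
  "\<And>x y. \<lbrakk>x \<in> carrier A; y \<in> carrier A; P x; P y\<rbrakk> \<Longrightarrow> P (x \<oplus>\<^bsub>A\<^esub> y)"
 shows "P a"
 using assms ar.tens_induct[of a P] by (simp add: A_struct)

lemma A_gen_induct:
 assumes a: "a \<in> carrier A" and unit: "\<And>r. r \<in> carrier R \<Longrightarrow> P (unit_map A r)" and gen: "\<And>g. g \<in> ga ` gens \<Longrightarrow> P g"
  and add: "\<And>a b. \<lbrakk>a \<in> carrier A; b \<in> carrier A; P a; P b\<rbrakk> \<Longrightarrow> P (a \<oplus>\<^bsub>A\<^esub> b)"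
  and mult: "\<And>a b. \<lbrakk>a \<in> carrier A; b \<in> carrier A; P a; P b\<rbrakk> \<Longrightarrow> P (a \<cdot> b)"
 shows "P a"
proof -
 have gL: "x \<in> L" if "x \<in> gens" for x using that V.span_base L_eq_span by blast
 have io: "P (io b)" if "b \<in> carrier uu" for b
  using that L_eq_span
 proof (induction rule: u_induct)
  case (unit c)
  then show ?case unfolding io_unit by (intro assms(2)) simp
 next
  case (add a b)
  then show ?case by (simp add: io_simps assms(4))
 next
  case (scale c a)
  have c: "cu c \<in> carrier uu" by simp
  have "P (ka c)" by (rule assms(2)) simp
  then show ?case unfolding io_simps(2)[OF c scale(1)] io_unit using scale by (intro assms(5)) simp_all
 next
  case (mult x a)
  then show ?case using gL[of x] gen[of "ga x"] by (simp add: io_simps assms(5) ga_def')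
 qed
 show ?thesis
  using a
 proof (induction rule: A_induct)
  case (tens b r)
  then show ?case unfolding tens_A[OF tens] by (intro mult unit io) simp_all
 qed (rule add)
qed

text \<open>Extension of scalars: a homomorphism out of the restricted enveloping algebra is
  multiplied with the unit map of B, whose values are central.\<close>

lemma A_lift:
 assumes B: "unital_algebra R B" and g: "u_rep B (\<lambda>c. unit_map B (unit_map R c)) g"
 shows "\<exists>\<Psi>. \<Psi> \<in> ring_hom A B \<and> (\<forall>r\<in>carrier R. \<Psi> (unit_map A r) = unit_map B r) \<and> (\<forall>x\<in>L. \<Psi> (ga x) = g x)"
proof -
 interpret B: unital_algebra R B by fact
 obtain \<Phi> where \<Phi>: "\<Phi> \<in> ring_hom uu B" "\<And>c. \<Phi> (cu c) = unit_map B (unit_map R c)" "\<And>x. x \<in> L \<Longrightarrow> \<Phi> (gu x) = g x"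
  by (rule u_lift[OF g]) (rule that; (assumption | simp))
 have c [simp]: "a \<in> carrier uu \<Longrightarrow> \<Phi> a \<in> carrier B" for a by (rule ring_hom_closed[OF \<Phi>(1)])
 have Ru: "unit_map R c \<in> carrier R" for c by simp
 interpret b: balanced_map KK uu R B "\<lambda>a r. \<Phi> a \<otimes>\<^bsub>B\<^esub> unit_map B r"
  by unfold_locales
   (use Ru in \<open>simp_all add: ring_hom_add[OF \<Phi>(1)] ring_hom_mult[OF \<Phi>(1)] \<Phi>(2) B.A.l_distr B.A.r_distr
    B.unit_add B.unit_mult B.unit_left_commute B.A.m_assoc\<close>)
 have "b.lft \<in> ring_hom AK B"
 proof (rule b.lift_ring_hom[OF B.A.ring_axioms])
  fix a b a' b' assume ab: "a \<in> carrier uu" "b \<in> carrier R" "a' \<in> carrier uu" "b' \<in> carrier R"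
  then show "\<Phi> (a \<odot> a') \<otimes>\<^bsub>B\<^esub> unit_map B (b \<otimes>\<^bsub>R\<^esub> b') = \<Phi> a \<otimes>\<^bsub>B\<^esub> unit_map B b \<otimes>\<^bsub>B\<^esub> (\<Phi> a' \<otimes>\<^bsub>B\<^esub> unit_map B b')"
   by (simp add: ring_hom_mult[OF \<Phi>(1)] B.unit_mult B.A.m_assoc B.unit_left_commute)
 qed (simp add: ring_hom_one[OF \<Phi>(1)])
 moreover have "b.lft (unit_map A r) = unit_map B r" if "r \<in> carrier R" for r
  using that b.lift_tens[of "\<one>\<^bsub>uu\<^esub>" r] by (simp add: A_struct ring_hom_one[OF \<Phi>(1)])
 moreover have "b.lft (ga x) = g x" if "x \<in> L" for x
  using that b.lift_tens[of "gu x" "\<one>\<^bsub>R\<^esub>"] u_repD(2)[OF g that] \<Phi>(3)[OF that] by (simp add: ga_def')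
 ultimately show ?thesis unfolding hom_A by blast
qed

end

section \<open>Dimension\<close>

text \<open>The functional of each vector vanishes on all later vectors, hence on their span, but
  not on the vector itself.\<close>

lemma (in ring) independent_functionals:
 fixes \<kappa> :: "'k::field \<Rightarrow> 'a" and \<phi> :: "'i \<Rightarrow> 'a \<Rightarrow> 'k"
 assumes v: "\<And>x. x \<in> set xs \<Longrightarrow> v x \<in> carrier R" and K: "\<And>s. \<kappa> s \<in> carrier R"
  and add: "\<And>x a b. \<lbrakk>a \<in> carrier R; b \<in> carrier R\<rbrakk> \<Longrightarrow> \<phi> x (a \<oplus> b) = \<phi> x a + \<phi> x b"
  and scale: "\<And>x s a. a \<in> carrier R \<Longrightarrow> \<phi> x (\<kappa> s \<otimes> a) = s * \<phi> x a"
  and tri: "sorted_wrt (\<lambda>x y. \<phi> x (v y) = 0) xs" "\<And>x. x \<in> set xs \<Longrightarrow> \<phi> x (v x) \<noteq> 0"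
 shows "independent (range \<kappa>) (map v xs)"
 using v tri
proof (induction xs)
 case (Cons x xs)
 have sp: "a \<in> carrier R \<and> \<phi> x a = 0"
  if "a \<in> Span (range \<kappa>) (map v ys)" "\<forall>y\<in>set ys. v y \<in> carrier R \<and> \<phi> x (v y) = 0" for a ys
  using that
 proof (induction ys arbitrary: a)
  case Nil
  have "\<phi> x \<zero> = \<phi> x \<zero> + \<phi> x \<zero>" using add[of \<zero> \<zero> x] by (simp only: zero_closed l_zero)
  then have "\<phi> x \<zero> = 0" by (metis add_cancel_right_right)
  then show ?case using Nil by simp
 next
  case (Cons y ys)
  obtain s b where b: "b \<in> Span (range \<kappa>) (map v ys)" "a = \<kappa> s \<otimes> v y \<oplus> b"
   using Cons.prems(1) by (auto simp: line_extension_mem_iff)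
  then show ?case using Cons.IH[OF b(1)] Cons.prems(2) K by (simp add: add scale)
 qed
 have "v x \<notin> Span (range \<kappa>) (map v xs)"
  using sp[of "v x" xs] Cons.prems by fastforce
 then show ?case using Cons by (auto intro!: li_Cons)
qed simp

text \<open>Two pairs are told apart by the second component when their first components agree, and
  by the order of the first components otherwise.\<close>

lemma sorted_wrt_product:
 assumes "sorted_wrt Q cs" "distinct cs"
 shows "sorted_wrt (\<lambda>x y. (fst x = fst y \<and> snd x \<noteq> snd y) \<or> (fst x \<noteq> fst y \<and> Q (fst x) (fst y))) (List.product cs [0..<m])"
 using assms
proof (induction cs)
 case (Cons c cs)
 have "sorted_wrt (\<lambda>i j. i \<noteq> j) [0..<m]"
  by (rule sorted_wrt_mono_rel[OF _ sorted_wrt_upt]) simp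
 then show ?case using Cons by (auto simp: sorted_wrt_append sorted_wrt_map)
qed simp

context special_twist
begin

definition fA :: "('k env set \<Rightarrow> 'k) \<Rightarrow> nat \<Rightarrow> 'k utq \<Rightarrow> 'k" where
 "fA f i = tensor_lift KK (\<lambda>a r. f a * coef i r)"

lemma balanced_fA: "ulin f \<Longrightarrow> balanced_map KK uu R KK (\<lambda>a r. f a * coef i r)"
proof -
 assume f: "ulin f"
 interpret K: ring KK by (rule ring_from_type_algebra)
 show ?thesis by unfold_locales (simp_all add: ulinD[OF f] coef_add coef_scale algebra_simps)
qed

lemma fA_tens: "\<lbrakk>ulin f; a \<in> carrier uu; r \<in> carrier R\<rbrakk> \<Longrightarrow> fA f i (TK a r) = f a * coef i r"
 using balanced_map.lift_tens[OF balanced_fA] by (simp add: fA_def)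

lemma fA_add: "\<lbrakk>ulin f; x \<in> carrier A; y \<in> carrier A\<rbrakk> \<Longrightarrow> fA f i (x \<oplus>\<^bsub>A\<^esub> y) = fA f i x + fA f i y"
 using balanced_map.lift_add[OF balanced_fA] by (simp add: fA_def A_struct)

lemma ka_tens: "\<lbrakk>a \<in> carrier uu; r \<in> carrier R\<rbrakk> \<Longrightarrow> ka c \<cdot> TK a r = TK a (unit_map R c \<otimes>\<^bsub>R\<^esub> r)"
 by (simp add: A_struct ar.tens_mult)

lemma TK_closed [simp]: "\<lbrakk>a \<in> carrier uu; r \<in> carrier R\<rbrakk> \<Longrightarrow> TK a r \<in> carrier A"
 by (simp add: A_struct)

lemma fA_scale: "\<lbrakk>ulin f; z \<in> carrier A\<rbrakk> \<Longrightarrow> fA f i (ka c \<cdot> z) = c * fA f i z"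
proof -
 assume f: "ulin f" and z: "z \<in> carrier A"
 show ?thesis
  using z
 proof (induction z rule: A_induct)
  case (tens b r)
  have "unit_map R c \<otimes>\<^bsub>R\<^esub> r \<in> carrier R" using tens(2) by simp
  then show ?case unfolding ka_tens[OF tens] using tens f by (simp add: fA_tens coef_scale)
 next
  case (add x y)
  have "ka c \<cdot> x \<in> carrier A" "ka c \<cdot> y \<in> carrier A" using add by simp_all
  then show ?case using add f by (simp add: A.A.r_distr fA_add algebra_simps)
 qed
qed

lemma A_nontrivial: "\<one>\<^bsub>A\<^esub> \<noteq> \<zero>\<^bsub>A\<^esub>"
proof
 assume "\<one>\<^bsub>A\<^esub> = \<zero>\<^bsub>A\<^esub>"
 moreover have "fA (dual []) 0 \<one>\<^bsub>A\<^esub> = 1"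
  unfolding io_simps(3)[symmetric] using coef_ti[of 0 0] p_pos
  by (subst fA_tens[OF ulin_dual]) (simp_all add: rho_simps mono_apply R_const ti_def del: dual.simps(2))
 moreover have "fA (dual []) 0 \<zero>\<^bsub>A\<^esub> = 0"
  using fA_add[OF ulin_dual, of "\<zero>\<^bsub>A\<^esub>" "\<zero>\<^bsub>A\<^esub>" "[]" 0]
  by (metis A.A.l_zero A.A.zero_closed add_cancel_right_right)
 ultimately show False by simp
qed

text \<open>The basis consists of the tensors of a word \<open>pbw c\<close> with t^i for i < p.
  Independence is tested by the dual functional of the word combined with the coefficient of
  t^i.\<close>

lemma dimension_A:
 "ring.dimension A (p ^ (1 + (n - 1) * (p ^ n - 1))) (unit_map A ` unit_map R ` UNIV) (carrier A)"
proof -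
 let ?K = "range ka"
 obtain cs0 where cs0: "set cs0 = expo" "distinct cs0" using finite_distinct_list[OF card_expo(2)] by blast
 \<comment> \<open>Decreasing length: a dual functional is controlled only on words that are not
   longer than its own.\<close>
 define cs where "cs = sort_key (\<lambda>c. - int (length (pbw c))) cs0"
 have cs: "set cs = expo" "distinct cs" by (simp_all add: cs_def cs0)
 have "sorted (map (\<lambda>c. - int (length (pbw c))) cs)" by (simp add: cs_def)
 then have srt: "sorted_wrt (\<lambda>c d. length (pbw d) \<le> length (pbw c)) cs" by (simp add: sorted_map)
 define xs where "xs = List.product cs [0..<p]"
 have xs: "set xs = expo \<times> {..<p}" by (auto simp: xs_def cs)
 define v where "v x = TK (word (pbw (fst x))) (ti (snd x))" for x
 have vc: "v x \<in> carrier A" for x by (simp add: v_def)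
 have val: "fA (dual (pbw (fst x))) (snd x) (v y) =
   dual (pbw (fst x)) (word (pbw (fst y))) * of_bool (snd x = snd y)" if "y \<in> set xs" for x y
  using that by (auto simp: v_def fA_tens ulin_dual xs coef_ti)
 have "sorted_wrt (\<lambda>x y. fA (dual (pbw (fst x))) (snd x) (v y) = 0) xs"
 proof (rule sorted_wrt_mono_rel[OF _ sorted_wrt_product[OF srt cs(2), of p, folded xs_def]])
  fix x y assume xy: "x \<in> set xs" "y \<in> set xs"
   "fst x = fst y \<and> snd x \<noteq> snd y \<or> fst x \<noteq> fst y \<and> length (pbw (fst y)) \<le> length (pbw (fst x))"
  then have "fst x \<in> expo" "fst y \<in> expo" by (auto simp: xs)
  then show "fA (dual (pbw (fst x))) (snd x) (v y) = 0"
   unfolding val[OF xy(2)] using xy(3) dual_pbw[of "fst x" "fst y"] by auto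
 qed
 moreover have "fA (dual (pbw (fst x))) (snd x) (v x) \<noteq> 0" if "x \<in> set xs" for x
 proof -
  have "fst x \<in> expo" using that by (auto simp: xs)
  then show ?thesis unfolding val[OF that] using dual_pbw[of "fst x" "fst x"] by simp
 qed
 ultimately have ind: "A.A.independent ?K (map v xs)"
  by (intro A.A.independent_functionals[where \<phi> = "\<lambda>x. fA (dual (pbw (fst x))) (snd x)"])
   (simp_all add: vc fA_add fA_scale ulin_dual)
 have len: "length (map v xs) = p ^ (1 + (n - 1) * (p ^ n - 1))"
  using distinct_card[OF cs(2)] by (simp add: xs_def length_product cs(1) card_expo card_bidx)
 interpret h: ring_hom_ring KK A ka
  by (rule ring_hom_ringI2[OF ring_from_type_algebra A.A.ring_axioms AC.kappa_hom])
 have sf: "subfield ?K A"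
  using h.img_is_subfield(2)[OF field.carrier_is_subfield[OF field_from_type_algebra] A_nontrivial] by simp
 have sub: "set (map v xs) \<subseteq> carrier A" by (auto simp: vc)
 define S where "S = A.A.Span ?K (map v xs)"
 note S = A.A.Span_subgroup_props[OF sf sub, folded S_def]
 note Ssm = A.A.Span_smult_closed[OF sf sub, folded S_def]
 note Sb = A.A.Span_base_incl[OF sf sub, folded S_def]
 have z1: "TK (word (pbw c)) r \<in> S" if c: "c \<in> expo" and r: "r \<in> carrier R" for c r
  using r
 proof (induction r rule: R_induct)
  case (scale s i)
  have "v (c, i) \<in> S" using Sb c scale by (auto simp: xs)
  then have m: "ka s \<cdot> v (c, i) \<in> S" by (intro Ssm) auto
  have e: "ka s \<cdot> v (c, i) = TK (word (pbw c)) (unit_map R s \<otimes>\<^bsub>R\<^esub> ti i)" by (simp add: v_def ka_tens)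
  show ?case using m unfolding e .
 next
  case (add z w)
  then show ?case using S(3)[OF add(3,4)] by (simp add: ar.tens_add_right A_struct)
 qed
 have z2: "a \<in> carrier uu \<and> TK a r \<in> S" if "a \<in> lspan (pbw ` expo)" "r \<in> carrier R" for a r
  using that(1)
 proof (induction rule: lspan.induct)
  case zero
  then show ?case using S(2) that(2) by (simp add: A_struct)
 next
  case (word w)
  then show ?case using z1 that(2) by auto
 next
  case (add a b)
  then have "TK a r \<oplus>\<^bsub>A\<^esub> TK b r \<in> S" by (intro S(3)) auto
  then show ?case using add that(2) by (simp add: ar.tens_add_left A_struct)
 next
  case (scale a c)
  have "ka c \<cdot> TK a r \<in> S" using scale by (intro Ssm) auto
  moreover have "ka c \<cdot> TK a r = TK (cu c \<odot> a) r"
   using scale that(2) ar.tens_balanced[of c a r] by (simp add: ka_tens)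
  ultimately show ?case using scale by simp
 qed
 have "carrier A \<subseteq> S"
 proof
  fix z assume "z \<in> carrier A"
  then show "z \<in> S"
  proof (induction z rule: A_induct)
   case (tens b r)
   then show ?case using z2[OF uu_span[OF tens(1)]] by simp
  qed (rule S(3))
 qed
 then have eq: "S = carrier A" using S(1) by blast
 show ?thesis
  using A.A.dimension_independent[OF ind] unfolding len S_def[symmetric] eq image_image .
qed

section \<open>The distinguished elements\<close>

abbreviation "h' \<equiv> D k k' (eps k + eps k')"
abbreviation "y2 \<equiv> D k k' (eps k + eps k + eps k')"
abbreviation "e' \<equiv> vf_scale 2 y2"
abbreviation "hu \<equiv> gu h'"
abbreviation "eu \<equiv> gu e'"

lemma kk': "k \<in> {1..n}" "k' \<in> {1..n}" using kk by auto

lemma h'_L [simp]: "h' \<in> L" and y2_L [simp]: "y2 \<in> L" and e'_L [simp]: "e' \<in> L"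
 using D_in_L[OF kk' kk(5)] L_scale by auto

text \<open>If 2\<epsilon>_k + \<epsilon>_k' is in range, it is not the toral index, and the p-th
  power relation gives 0. If it is out of range, as for p = 2, the element is itself 0.\<close>

lemma y2_cases: "eps k + eps k + eps k' \<in> MI \<and> eps k + eps k + eps k' \<noteq> eps k + eps k' \<or> y2 = 0"
proof (cases "eps k + eps k + eps k' \<in> MI")
 case True
 have "(eps k + eps k + eps k') k \<noteq> (eps k + eps k') k" by (simp add: eps_def)
 then show ?thesis using True by metis
next
 case False
 then have "mono (eps k + eps k + eps k') = 0" by (simp add: mono_apply fun_eq_iff)
 then show ?thesis using dij_zero[of k k'] by simp
qed

lemma gu_zero: "gu 0 = \<zero>\<^bsub>uu\<^esub>"
proof -
 have 0: "(0 :: 'k vfield) \<in> L" using subspace_L by (auto simp: V.subspace_def)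
 then have "gu 0 \<oplus>\<^bsub>uu\<^esub> gu 0 = gu 0" using gu_add[of 0 0] by simp
 then show ?thesis using 0 gu_closed[of 0] uu.A.add.l_cancel_one' by metis
qed

lemma eu_eq: "eu = cu 2 \<odot> gu y2" by (rule gu_scale) simp

lemma eu_pow: "eu [^]\<^bsub>uu\<^esub> p = \<zero>\<^bsub>uu\<^esub>"
proof -
 have "gu y2 [^]\<^bsub>uu\<^esub> p = \<zero>\<^bsub>uu\<^esub>"
  using y2_cases gu_pow_p(2)[OF kk' kk(5)] p_pos by (auto simp: gu_zero uu.A.nat_pow_zero)
 then show ?thesis unfolding eu_eq
  using uu.A.pow_mult_distrib[of "cu 2" "gu y2" p] uC.kappa_central[of "gu y2" 2] by simp
qed

lemma hu_gu:
 assumes "i \<in> {1..n}" "j \<in> {1..n}" "i \<noteq> j"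
 shows "hu \<odot> gu (D i j \<alpha>) = gu (D i j \<alpha>) \<odot> hu \<oplus>\<^bsub>uu\<^esub> cu (of_int (int (\<alpha> k) - of_bool (i = k) - of_bool (j = k)
   - int (\<alpha> k') + of_bool (i = k') + of_bool (j = k'))) \<odot> gu (D i j \<alpha>)"
 using gu_br[OF h'_L D_in_L[OF assms], of \<alpha>] D_in_L[OF assms, of \<alpha>]
 unfolding br_cartan[OF kk' kk(5) assms] by (simp only: gu_scale)

lemma hu_eu: "hu \<odot> eu = eu \<odot> hu \<oplus>\<^bsub>uu\<^esub> eu"
proof -
 have y: "hu \<odot> gu y2 = gu y2 \<odot> hu \<oplus>\<^bsub>uu\<^esub> gu y2"
 proof -
  have w: "int ((eps k + eps k + eps k') k) - of_bool (k = k) - of_bool (k' = k) - int ((eps k + eps k + eps k') k')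
   + of_bool (k = k') + of_bool (k' = k') = 1" using kk(5) by (simp add: eps_def)
  show ?thesis
   using hu_gu[OF kk' kk(5), of "eps k + eps k + eps k'"] gu_closed[OF y2_L]
   unfolding w by (simp only: of_int_1 uC.kappa_one uu.A.l_one)
 qed
 have "hu \<odot> eu = cu 2 \<odot> (hu \<odot> gu y2)" unfolding eu_eq by (simp add: uu.unit_left_commute)
 then show ?thesis unfolding y unfolding eu_eq by (simp add: uu.A.r_distr uu.A.m_assoc)
qed

section \<open>Powers of ad e and their vanishing at p\<close>

lemma binomial_shift:
 "(\<Sum>l\<le>m. of_nat (m choose l) * a l) + (\<Sum>l\<le>m. of_nat (m choose l) * a (Suc l)) = (\<Sum>l\<le>Suc m. of_nat (Suc m choose l) * (a l :: 'k))"
proof -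
 have "(\<Sum>l\<le>m. of_nat (m choose l) * a l) = (\<Sum>l\<le>Suc m. of_nat (m choose l) * a l)" by (simp add: binomial_eq_0)
 also have "\<dots> = a 0 + (\<Sum>l\<le>m. of_nat (m choose Suc l) * a (Suc l))" by (subst sum.atMost_Suc_shift) simp
 finally show ?thesis by (subst sum.atMost_Suc_shift) (simp add: sum.distrib algebra_simps)
qed

lemma act_pow_add: "(act E ^^ m) (f + g) = (act E ^^ m) f + (act E ^^ m) g"
 by (induction m) (simp_all only: funpow.simps comp_apply id_apply act_add_right)

text \<open>In operator form E^m x is the sum of the (m choose l) (ad E)^l(x) E^(m-l). For m = p
  only the extreme terms survive.\<close>

lemma act_pow_ad:
 assumes "E \<in> L"
 shows "\<lbrakk>x \<in> L; f \<in> Od\<rbrakk> \<Longrightarrow> (act E ^^ m) (act x f) \<gamma> =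
  (\<Sum>l\<le>m. of_nat (m choose l) * act ((br E ^^ l) x) ((act E ^^ (m - l)) f) \<gamma>)"
proof (induction m arbitrary: x f)
 case (Suc m)
 have "act (br E x) f = act E (act x f) - act x (act E f)" using assms Suc.prems by (intro act_br L_subset_W)
 then have "act E (act x f) = act x (act E f) + act (br E x) f" by simp
 then have "(act E ^^ Suc m) (act x f) \<gamma> = (act E ^^ m) (act x (act E f)) \<gamma> + (act E ^^ m) (act (br E x) f) \<gamma>"
  by (simp only: funpow_Suc_right comp_apply act_pow_add plus_fun_apply)
 also have "\<dots> = (\<Sum>l\<le>m. of_nat (m choose l) * act ((br E ^^ l) x) ((act E ^^ (Suc m - l)) f) \<gamma>) +
   (\<Sum>l\<le>m. of_nat (m choose l) * act ((br E ^^ Suc l) x) ((act E ^^ (Suc m - Suc l)) f) \<gamma>)"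
  using Suc.prems br_in_L[OF assms Suc.prems(1)]
  by (simp add: Suc.IH Suc_diff_le funpow_Suc_right del: funpow.simps)
 finally show ?case unfolding binomial_shift[of m "\<lambda>l. act ((br E ^^ l) x) ((act E ^^ (Suc m - l)) f) \<gamma>"] .
qed simp

lemma ad_in_L: "E \<in> L \<Longrightarrow> x \<in> L \<Longrightarrow> (br E ^^ m) x \<in> L"
 by (induction m) (simp_all add: br_in_L)

lemma act_e'_pow: "f \<in> Od \<Longrightarrow> (act e' ^^ p) f = 0"
proof -
 assume f: "f \<in> Od"
 have "(act e' ^^ m) f = (\<lambda>\<gamma>. 2 ^ m * (act y2 ^^ m) f \<gamma>)" for m
  by (induction m) (simp_all add: act_scale_left act_scale_right mult_ac)
 moreover have "(act y2 ^^ p) f = 0"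
 proof (cases "y2 = 0")
  case True
  have "(act 0 ^^ Suc m) f = 0" for m by simp
  from this[of "p - 1"] show ?thesis unfolding True using p_pos by simp
 next
  case False
  then show ?thesis using y2_cases act_D_pow_p_zero[OF kk(5) _ _ f] by metis
 qed
 ultimately show ?thesis by (simp add: fun_eq_iff)
qed

text \<open>Modulo p the expansion reduces to (ad e)^p(x) = e^p x - x e^p, and e^p acts as 0. This
  is tested on the x_i, which determine a derivation. Since p! is not invertible, the end of the
  ladder of divided powers rests on this fact.\<close>

lemma ad_e'_pow: assumes x: "x \<in> L" shows "(br e' ^^ p) x = 0"
proof
 fix i
 let ?z = "(br e' ^^ p) x"
 have z: "?z \<in> W" using ad_in_L[OF e'_L x] by (rule L_subset_W)
 show "?z i = 0 i"
 proof (cases "i \<in> {1..n}")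
  case False
  then show ?thesis using z by (simp add: witt_def)
 next
  case True
  have "act ?z (mono (eps i)) \<gamma> = 0" for \<gamma>
  proof -
   let ?t = "\<lambda>l. of_nat (p choose l) * act ((br e' ^^ l) x) ((act e' ^^ (p - l)) (mono (eps i))) \<gamma>"
   have "0 = (\<Sum>l\<le>p. ?t l)"
    using act_pow_ad[OF e'_L x mono_in_O, of p "eps i" \<gamma>] by (simp add: act_e'_pow)
   also have "\<dots> = ?t p + (\<Sum>l\<in>{..p} - {p}. ?t l)" by (rule sum.remove) auto
   also have "(\<Sum>l\<in>{..p} - {p}. ?t l) = 0"
   proof (rule sum.neutral, rule ballI)
    fix l assume l: "l \<in> {..p} - {p}"
    show "?t l = 0"
    proof (cases "l = 0")
     case False
     then have "p dvd (p choose l)" using l prime_p by (intro dvd_choose_prime) auto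
     then have "(of_nat (p choose l) :: 'k) = 0" unfolding of_nat_eq_0_iff_char_dvd char_p .
     then show ?thesis by simp
    qed (simp add: act_e'_pow)
   qed
   finally have "?t p = 0" by (metis add.right_neutral)
   then show ?thesis by (simp only: binomial_n_n diff_self_eq_0 funpow_0 id_apply of_nat_1 mult_1_left)
  qed
  then show ?thesis using act_mono_eps[OF z True] by (simp add: fun_eq_iff)
 qed
qed

lemma br_scale_right: "br a (vf_scale c b) = vf_scale c (br a b)"
proof (intro ext)
 fix j \<gamma>
 have 1: "act a ((vf_scale c b) j) \<gamma> = c * act a (b j) \<gamma>" unfolding vf_scale_def act_scale_right ..
 have 2: "act (vf_scale c b) (a j) \<gamma> = c * act b (a j) \<gamma>" unfolding act_scale_left ..
 have "br a (vf_scale c b) j \<gamma> = act a ((vf_scale c b) j) \<gamma> - act (vf_scale c b) (a j) \<gamma>"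
  by (simp only: vf_bracket_def fun_diff_def)
 also have "\<dots> = vf_scale c (br a b) j \<gamma>"
  unfolding 1 2 by (simp only: vf_scale_def vf_bracket_def fun_diff_def right_diff_distrib)
 finally show "br a (vf_scale c b) j \<gamma> = vf_scale c (br a b) j \<gamma>" .
qed

end

section \<open>The twisted Hopf algebra\<close>

text \<open>An antihomomorphism is a homomorphism into the opposite algebra, so the antipode also
  comes from the universal property.\<close>

definition opp :: "('a, 'r) ralg \<Rightarrow> ('a, 'r) ralg" where
 "opp A = A\<lparr>monoid.mult := (\<lambda>a b. b \<otimes>\<^bsub>A\<^esub> a)\<rparr>"

lemma opp_simps [simp]:
 "carrier (opp A) = carrier A" "a \<otimes>\<^bsub>opp A\<^esub> b = b \<otimes>\<^bsub>A\<^esub> a" "one (opp A) = one A" "ring.zero (opp A) = ring.zero A"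
 "add (opp A) = add A" "unit_map (opp A) = unit_map A"
 by (simp_all add: opp_def)

lemma unital_algebra_opp:
 assumes "unital_algebra R A" shows "unital_algebra R (opp A)"
proof -
 interpret unital_algebra R A by fact
 interpret O: ring "opp A"
 proof (rule ringI)
  show "abelian_group (opp A)"
   using A.is_abelian_group by (simp add: abelian_group_def abelian_monoid_def abelian_group_axioms_def)
  show "Group.monoid (opp A)" by (rule monoidI) (auto simp: A.m_assoc)
 qed (auto simp: A.l_distr A.r_distr)
 show ?thesis
 proof unfold_locales
  show "unit_map (opp A) \<in> ring_hom R (opp A)"
  proof (rule ring_hom_memI)
   fix x y assume "x \<in> carrier R" "y \<in> carrier R"
   then show "unit_map (opp A) (x \<otimes>\<^bsub>R\<^esub> y) = unit_map (opp A) x \<otimes>\<^bsub>opp A\<^esub> unit_map (opp A) y"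
    using unit_map_central[of x "unit_map A y"] by (simp add: unit_mult)
  qed (simp_all add: unit_add)
 qed (simp add: unit_map_central)
qed

lemma nat_pow_opp:
 assumes "ring A" "x \<in> carrier A" shows "x [^]\<^bsub>opp A\<^esub> (m::nat) = x [^]\<^bsub>A\<^esub> m"
proof -
 interpret ring A by fact
 show ?thesis
 proof (induction m)
  case (Suc m)
  then show ?case using nat_pow_Suc2[OF assms(2), of m] by (simp add: nat_pow_def)
 qed (simp add: nat_pow_def)
qed

section \<open>The primitive Hopf structure on the extended algebra\<close>

context special_twist
begin

text \<open>In the opposite algebra commutators change sign, and so does the image of the bracket
  under negation. In the p-th power relations the sign passes through Frobenius.\<close>

lemma u_rep_antipode: "u_rep (opp A) ka (\<lambda>x. \<ominus>\<^bsub>A\<^esub> ga x)"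
proof -
 note gD = u_repD[OF u_rep_ga]
 have ch: "charp_algebra (opp A) ka p"
  using charp_algebra_unital[OF unital_algebra_opp[OF A.unital_algebra_axioms] R.unit_map_hom char_p p_pos] by simp
 have pw: "(\<ominus>\<^bsub>A\<^esub> ga x) [^]\<^bsub>opp A\<^esub> p = \<ominus>\<^bsub>A\<^esub> (ga x [^]\<^bsub>A\<^esub> p)" if "x \<in> L" for x
  using that by (simp add: nat_pow_opp[OF A.A.ring_axioms] AC.frobenius_uminus)
 show ?thesis
 proof (rule u_repI[OF ch])
  fix x y c assume x: "x \<in> L" and y: "y \<in> L"
  note b = br_in_L[OF x y]
  show "\<ominus>\<^bsub>A\<^esub> ga x \<in> carrier (opp A)" using x by simp
  show "\<ominus>\<^bsub>A\<^esub> ga (x + y) = \<ominus>\<^bsub>A\<^esub> ga x \<oplus>\<^bsub>opp A\<^esub> \<ominus>\<^bsub>A\<^esub> ga y"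
   using x y gD(3)[OF x y] by (simp add: A.A.minus_add)
  show "\<ominus>\<^bsub>A\<^esub> ga (vf_scale c x) = ka c \<otimes>\<^bsub>opp A\<^esub> \<ominus>\<^bsub>A\<^esub> ga x"
   using x gD(4)[OF x, of c] by (simp add: A.A.l_minus AC.kappa_central[of "ga x" c, symmetric])
  show "\<ominus>\<^bsub>A\<^esub> ga x \<otimes>\<^bsub>opp A\<^esub> \<ominus>\<^bsub>A\<^esub> ga y =
    \<ominus>\<^bsub>A\<^esub> ga y \<otimes>\<^bsub>opp A\<^esub> \<ominus>\<^bsub>A\<^esub> ga x \<oplus>\<^bsub>opp A\<^esub> \<ominus>\<^bsub>A\<^esub> ga (br x y)"
   using x y b gD(5)[OF x y]
   by (simp add: A.A.l_minus A.A.r_minus A.A.a_assoc A.A.r_neg)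
 next
  fix i j assume "1 \<le> j \<and> j < i \<and> i \<le> n"
  then show "(\<ominus>\<^bsub>A\<^esub> ga (D i j (eps i + eps j))) [^]\<^bsub>opp A\<^esub> p = \<ominus>\<^bsub>A\<^esub> ga (D i j (eps i + eps j))"
   by (simp only: pw[OF D_in_L'] gD(6))
 next
  fix i j \<alpha> assume a: "\<alpha> \<in> MI" "1 \<le> j \<and> j < i \<and> i \<le> n \<and> \<alpha> \<noteq> eps i + eps j"
  then have "1 \<le> j \<and> j < i \<and> i \<le> n" by blast
  then show "(\<ominus>\<^bsub>A\<^esub> ga (D i j \<alpha>)) [^]\<^bsub>opp A\<^esub> p = \<zero>\<^bsub>opp A\<^esub>"
   using gD(7)[OF a] by (simp only: pw[OF D_in_L']) simp
 qed
qed

sublocale aa: two_algebras R A A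
 by (rule two_algebrasI) unfold_locales

lemma u_rep_primitive_A:
 "u_rep aa.AB (\<lambda>c. unit_map aa.AB (unit_map R c)) (\<lambda>x. aa.T (ga x) \<one>\<^bsub>A\<^esub> \<oplus>\<^bsub>aa.AB\<^esub> aa.T \<one>\<^bsub>A\<^esub> (ga x))"
proof -
 have ch: "charp_algebra aa.AB (\<lambda>c. unit_map aa.AB (unit_map R c)) p"
  by (rule charp_algebra_unital[OF aa.unital_algebra_AB R.unit_map_hom char_p p_pos])
 show ?thesis
 proof (rule u_rep_sum)
  show "u_rep aa.AB (\<lambda>c. unit_map aa.AB (unit_map R c)) (\<lambda>x. aa.T (ga x) \<one>\<^bsub>A\<^esub>)"
   by (rule u_rep_hom[OF u_rep_ga aa.inl_hom ch]) (simp only: aa.AB_simps(6))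
  show "u_rep aa.AB (\<lambda>c. unit_map aa.AB (unit_map R c)) (\<lambda>x. aa.T \<one>\<^bsub>A\<^esub> (ga x))"
   by (rule u_rep_hom[OF u_rep_ga aa.inr_hom ch]) (rule aa.inr_unit, simp)
 qed (simp add: aa.inl_inr_commute)
qed

text \<open>The base ring as an algebra over itself, the target of the counit.\<close>

definition RR :: "('k poly set, 'k poly set) ralg" where
 "RR = ring.extend (ring.truncate R) (ralg.fields id)"

lemma RR_simps [simp]: "carrier RR = carrier R" "monoid.mult RR = monoid.mult R" "one RR = one R" "ring.zero RR = ring.zero R"
 "add RR = add R" "unit_map RR r = r"
 by (simp_all add: RR_def)

lemma unital_algebra_RR: "unital_algebra R RR"
proof -
 interpret r: ring RR by (rule ring_same_structure[OF R.A.ring_axioms]) simp_all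
 show ?thesis by unfold_locales (auto intro!: ring_hom_memI simp: RC.m_comm)
qed

lemma u_rep_counit: "u_rep RR (\<lambda>c. unit_map RR (unit_map R c)) (\<lambda>_. \<zero>\<^bsub>R\<^esub>)"
proof -
 have ch: "charp_algebra RR (\<lambda>c. unit_map RR (unit_map R c)) p"
  by (rule charp_algebra_unital[OF unital_algebra_RR R.unit_map_hom char_p p_pos])
 interpret c: charp_algebra RR "\<lambda>c. unit_map RR (unit_map R c)" p by (rule ch)
 have "\<zero>\<^bsub>R\<^esub> [^]\<^bsub>RR\<^esub> p = \<zero>\<^bsub>R\<^esub>" using c.C.nat_pow_zero[of p] p_pos by simp
 then show ?thesis by (intro u_repI[OF ch]) simp_all
qed

lemma ga_zero: "ga 0 = \<zero>\<^bsub>A\<^esub>" by (simp add: ga_def' gu_zero io_simps)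

lemma gens_L: "x \<in> gens \<Longrightarrow> x \<in> L"
 using V.span_base L_eq_span by blast

lemma cartan: "cartan_nilpotent A ka p (ga h') (ga e') (unit_map A (Ktpq_t p q))"
proof unfold_locales
 show "ga h' [^]\<^bsub>A\<^esub> p = ga h'"
  using gu_pow_p(1)[OF kk' kk(5)] by (simp add: ga_def' io_simps(5)[symmetric])
 show "ga e' [^]\<^bsub>A\<^esub> p = \<zero>\<^bsub>A\<^esub>" using eu_pow by (simp add: ga_def' io_simps(5)[symmetric] io_simps(4))
 show "ga h' \<cdot> ga e' = ga e' \<cdot> ga h' \<oplus>\<^bsub>A\<^esub> ga e'"
  using hu_eu by (simp add: ga_def' io_simps(1,2)[symmetric])
 show "unit_map A (Ktpq_t p q) \<cdot> x = x \<cdot> unit_map A (Ktpq_t p q)" if "x \<in> carrier A" for x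
  using that by (intro A.unit_map_central) (simp_all add: R_const)
qed (simp_all add: R_const)

sublocale CN: cartan_nilpotent A ka p "ga h'" "ga e'" "unit_map A (Ktpq_t p q)" by (rule cartan)

lemma weight_ga:
 assumes "i \<in> {1..n}" "j \<in> {1..n}" "i \<noteq> j"
 shows "CN.weight (int (\<alpha> k) - of_bool (i = k) - of_bool (j = k) - int (\<alpha> k') + of_bool (i = k') + of_bool (j = k')) (ga (D i j \<alpha>))"
proof -
 let ?w = "int (\<alpha> k) - of_bool (i = k) - of_bool (j = k) - int (\<alpha> k') + of_bool (i = k') + of_bool (j = k') :: int"
 let ?x = "D i j \<alpha>"
 have x: "?x \<in> L" by (rule D_in_L[OF assms])
 have c: "cu (of_int ?w) \<in> carrier uu" by simp
 have "io (hu \<odot> gu ?x) = io (gu ?x \<odot> hu \<oplus>\<^bsub>uu\<^esub> cu (of_int ?w) \<odot> gu ?x)"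
  unfolding hu_gu[OF assms, of \<alpha>] ..
 then have "io hu \<cdot> io (gu ?x) = io (gu ?x) \<cdot> io hu \<oplus>\<^bsub>A\<^esub> io (cu (of_int ?w)) \<cdot> io (gu ?x)"
  using x c by (simp only: io_simps(1,2) gu_closed h'_L uu.A.m_closed)
 then show ?thesis unfolding CN.weight_def io_unit using x by (simp only: ga_def') simp
qed

text \<open>From l = p on the factorial of l is 0 in K, so the divided powers are cut off there
  explicitly.\<close>

definition xs :: "'k vfield \<Rightarrow> nat \<Rightarrow> 'k utq" where
 "xs x l = (if l < p then ga (div_ad p n e' l x) else \<zero>\<^bsub>A\<^esub>)"

lemma ladder_xs: assumes x: "x \<in> L" shows "CN.ladder (xs x)"
 unfolding CN.ladder_def
proof (intro conjI allI)
 have dL: "div_ad p n e' l x \<in> L" for l by (simp add: div_ad_def L_scale ad_in_L x)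
 then show c: "xs x l \<in> carrier A" for l by (simp add: xs_def)
 show "xs x p = \<zero>\<^bsub>A\<^esub>" by (simp add: xs_def)
 fix l
 show "ga e' \<cdot> xs x l = xs x l \<cdot> ga e' \<oplus>\<^bsub>A\<^esub> ka (of_nat (Suc l)) \<cdot> xs x (Suc l)"
 proof (cases "l < p")
  case False
  then show ?thesis by (simp add: xs_def)
 next
  case True
  have b: "br e' (div_ad p n e' l x) = vf_scale (inverse (of_nat (fact l))) ((br e' ^^ Suc l) x)"
   by (simp only: div_ad_def br_scale_right funpow.simps comp_apply)
  have "ga (br e' (div_ad p n e' l x)) = ka (of_nat (Suc l)) \<cdot> xs x (Suc l)"
  proof (cases "Suc l < p")
   case True
   then have nz: "(of_nat (Suc l) :: 'k) \<noteq> 0" unfolding of_nat_eq_0_iff_char_dvd char_p by (auto dest: dvd_imp_le)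
   have i: "inverse (of_nat (fact l)) = (of_nat (Suc l) * inverse (of_nat (fact (Suc l))) :: 'k)"
    by (simp only: fact_Suc of_nat_mult inverse_mult_distrib of_nat_id mult.assoc[symmetric] right_inverse[OF nz] mult_1_left)
   have "br e' (div_ad p n e' l x) = vf_scale (of_nat (Suc l)) (div_ad p n e' (Suc l) x)"
    unfolding b by (simp only: i div_ad_def V.scale_scale)
   then show ?thesis using True u_repD(4)[OF u_rep_ga dL[of "Suc l"]] by (simp only: xs_def if_True)
  next
   case False
   \<comment> \<open>At the end of the ladder (p-1)! is still invertible, and the next bracket is a
     multiple of (ad e)^p(x), which is 0.\<close>
   then have "Suc l = p" using \<open>l < p\<close> by simp
   then have "br e' (div_ad p n e' l x) = 0" unfolding b using ad_e'_pow[OF x] by (simp only: V.scale_zero_right)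
   then have "ga (br e' (div_ad p n e' l x)) = \<zero>\<^bsub>A\<^esub>" by (simp only: ga_zero)
   then show ?thesis using False by (simp add: xs_def)
  qed
  then show ?thesis using True u_repD(5)[OF u_rep_ga e'_L dL[of l]] by (simp only: xs_def[of x l] if_True)
 qed
qed

lemma coproduct_exists:
 "\<exists>\<Delta>0 S0 \<epsilon>. hopf_twist R A ka p (ga h') (ga e') (Ktpq_t p q) (unit_map R) (ga ` gens) \<Delta>0 S0 \<epsilon>"
proof -
 obtain \<Delta>0 where \<Delta>0: "\<Delta>0 \<in> ring_hom A aa.AB" "\<forall>r\<in>carrier R. \<Delta>0 (unit_map A r) = unit_map aa.AB r"
  "\<forall>x\<in>L. \<Delta>0 (ga x) = aa.T (ga x) \<one>\<^bsub>A\<^esub> \<oplus>\<^bsub>aa.AB\<^esub> aa.T \<one>\<^bsub>A\<^esub> (ga x)"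
  using A_lift[OF aa.unital_algebra_AB u_rep_primitive_A] by (elim exE conjE)
 have "u_rep (opp A) (\<lambda>c. unit_map (opp A) (unit_map R c)) (\<lambda>x. \<ominus>\<^bsub>A\<^esub> ga x)" using u_rep_antipode by (simp only: opp_simps)
 note lift = A_lift[OF unital_algebra_opp[OF A.unital_algebra_axioms] this]
 obtain S0 where S0: "S0 \<in> ring_hom A (opp A)" "\<forall>r\<in>carrier R. S0 (unit_map A r) = unit_map (opp A) r"
  "\<forall>x\<in>L. S0 (ga x) = \<ominus>\<^bsub>A\<^esub> ga x"
  using lift by (elim exE conjE)
 obtain \<epsilon> where \<epsilon>: "\<epsilon> \<in> ring_hom A RR" "\<forall>r\<in>carrier R. \<epsilon> (unit_map A r) = unit_map RR r" "\<forall>x\<in>L. \<epsilon> (ga x) = \<zero>\<^bsub>R\<^esub>"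
  using A_lift[OF unital_algebra_RR u_rep_counit] by (elim exE conjE)
 have G: "\<exists>x\<in>L. g = ga x" if "g \<in> ga ` gens \<union> {ga h', ga e'}" for g
  using that gens_L h'_L e'_L by blast
 have "hopf_twist R A ka p (ga h') (ga e') (Ktpq_t p q) (unit_map R) (ga ` gens) \<Delta>0 S0 \<epsilon>"
 proof unfold_locales
  show "Ktpq_t p q \<in> carrier R" by (simp add: R_const)
  show "\<And>s. unit_map R s \<in> carrier R" by simp
  show "\<And>P a. \<lbrakk>a \<in> carrier A; \<And>r. r \<in> carrier R \<Longrightarrow> P (unit_map A r); \<And>g. g \<in> ga ` gens \<Longrightarrow> P g;
   \<And>a b. \<lbrakk>a \<in> carrier A; b \<in> carrier A; P a; P b\<rbrakk> \<Longrightarrow> P (a \<oplus>\<^bsub>A\<^esub> b);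
   \<And>a b. \<lbrakk>a \<in> carrier A; b \<in> carrier A; P a; P b\<rbrakk> \<Longrightarrow> P (a \<cdot> b)\<rbrakk> \<Longrightarrow> P a"
   by (rule A_gen_induct)
  show "\<exists>w. CN.weight w g" if g: "g \<in> ga ` gens" for g
  proof -
   obtain i j \<alpha> where "g = ga (D i j \<alpha>)" "1 \<le> j" "j < i" "i \<le> n" using g unfolding gens_def by blast
   then show ?thesis using weight_ga[of i j \<alpha>] by auto
  qed
  show "\<Delta>0 \<in> ring_hom A aa.AB" by (rule \<Delta>0)
  show "\<And>r. r \<in> carrier R \<Longrightarrow> \<Delta>0 (unit_map A r) = unit_map aa.AB r" using \<Delta>0(2) by blast
  show "\<And>a. a \<in> carrier A \<Longrightarrow> S0 a \<in> carrier A" using ring_hom_closed[OF S0(1)] by simp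
  show "\<And>a b. \<lbrakk>a \<in> carrier A; b \<in> carrier A\<rbrakk> \<Longrightarrow> S0 (a \<oplus>\<^bsub>A\<^esub> b) = S0 a \<oplus>\<^bsub>A\<^esub> S0 b" using ring_hom_add[OF S0(1)] by simp
  show "\<And>a b. \<lbrakk>a \<in> carrier A; b \<in> carrier A\<rbrakk> \<Longrightarrow> S0 (a \<cdot> b) = S0 b \<cdot> S0 a" using ring_hom_mult[OF S0(1)] by simp
  show "\<And>r. r \<in> carrier R \<Longrightarrow> S0 (unit_map A r) = unit_map A r" using S0(2) by simp
  have "ring_hom A RR = ring_hom A R" by (rule ring_hom_same_structure) simp_all
  then show "\<epsilon> \<in> ring_hom A R" using \<epsilon>(1) by simp
  show "\<And>r. r \<in> carrier R \<Longrightarrow> \<epsilon> (unit_map A r) = r" using \<epsilon>(2) by simp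
  show "\<And>x. x \<in> ga ` gens \<union> {ga h', ga e'} \<Longrightarrow> \<Delta>0 x = aa.T x \<one>\<^bsub>A\<^esub> \<oplus>\<^bsub>aa.AB\<^esub> aa.T \<one>\<^bsub>A\<^esub> x"
   using G \<Delta>0(3) by metis
  show "\<And>x. x \<in> ga ` gens \<union> {ga h', ga e'} \<Longrightarrow> S0 x = \<ominus>\<^bsub>A\<^esub> x" using G S0(3) by metis
  show "\<And>x. x \<in> ga ` gens \<union> {ga h', ga e'} \<Longrightarrow> \<epsilon> x = \<zero>\<^bsub>R\<^esub>" using G \<epsilon>(3) by metis
 qed simp
 then show ?thesis by blast
qed

text \<open>D_kk'(x_k) = -D_k' has weight 1, that is [h, D_k'] = D_k'. In a commutative algebra it
  would be 0, yet its coefficient at D_k' is -1.\<close>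

lemma not_commutative: "\<not> commutative_alg A"
proof
 assume c: "commutative_alg A"
 let ?x = "D k k' (eps k)"
 have x: "?x \<in> L" by (rule D_in_L[OF kk' kk(5)])
 have w: "int (eps k k) - of_bool (k = k) - of_bool (k' = k) - int (eps k k') + of_bool (k = k') + of_bool (k' = k') = 1"
  using kk(5) by (simp add: eps_def)
 have "CN.weight 1 (ga ?x)" using weight_ga[OF kk' kk(5), of "eps k"] unfolding w .
 then have "ga h' \<cdot> ga ?x = ga ?x \<cdot> ga h' \<oplus>\<^bsub>A\<^esub> ga ?x" using x by (simp add: CN.weight_def)
 moreover have "ga h' \<cdot> ga ?x = ga ?x \<cdot> ga h'" using c x by (simp add: commutative_alg_def)
 ultimately have "ga ?x = \<zero>\<^bsub>A\<^esub>" using x by (metis A.A.add.l_cancel_one' A.A.m_closed ga_closed h'_L)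
 moreover have "fA (fn (k', 0)) 0 (ga ?x) = - 1"
 proof -
  have "?x k' 0 = - 1" using kk(5) eps_midx[OF kk'(1)] by (simp add: dij_def pder_def mono_apply)
  then show ?thesis
   using x kk'(2) coef_ti[of 0 0] p_pos unfolding ga_def'
   by (subst fA_tens[OF ulin_fn]) (simp_all add: fn_gu R_const ti_def)
 qed
 moreover have "fA (fn (k', 0)) 0 \<zero>\<^bsub>A\<^esub> = 0"
  using fA_add[OF ulin_fn, of "\<zero>\<^bsub>A\<^esub>" "\<zero>\<^bsub>A\<^esub>" "(k', 0)" 0]
  by (metis A.A.l_zero A.A.zero_closed add_cancel_right_right)
 ultimately show False by simp
qed

section \<open>Functionals with values in the base ring that tell the coproduct from its
  flip\<close>

definition fR :: "('k env set \<Rightarrow> 'k) \<Rightarrow> 'k utq \<Rightarrow> 'k poly set" where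
 "fR f = tensor_lift R (\<lambda>a r. unit_map R (f a) \<otimes>\<^bsub>R\<^esub> r)"

lemma unit_R_simps: "unit_map R (a + b) = unit_map R a \<oplus>\<^bsub>R\<^esub> unit_map R b" "unit_map R (a * b) = unit_map R a \<otimes>\<^bsub>R\<^esub> unit_map R b"
 using R.unit_add[of a b] R.unit_mult[of a b] by simp_all

lemma unit_R_closed [simp]: "unit_map R c \<in> carrier R" by simp

lemma balanced_fR: assumes f: "ulin f" shows "balanced_map KK uu R R (\<lambda>a r. unit_map R (f a) \<otimes>\<^bsub>R\<^esub> r)"
 by unfold_locales (simp_all add: ulinD[OF f] unit_R_simps R.A.l_distr R.A.r_distr RC.m_ac del: cl_simps)

lemma fR_tens: "\<lbrakk>ulin f; a \<in> carrier uu; r \<in> carrier R\<rbrakk> \<Longrightarrow> fR f (TK a r) = unit_map R (f a) \<otimes>\<^bsub>R\<^esub> r"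
 using balanced_map.lift_tens[OF balanced_fR] by (simp add: fR_def)

lemma fR_add: "\<lbrakk>ulin f; x \<in> carrier A; y \<in> carrier A\<rbrakk> \<Longrightarrow> fR f (x \<oplus>\<^bsub>A\<^esub> y) = fR f x \<oplus>\<^bsub>R\<^esub> fR f y"
 using balanced_map.lift_add[OF balanced_fR] by (simp add: fR_def A_struct)

lemma fR_closed: "\<lbrakk>ulin f; x \<in> carrier A\<rbrakk> \<Longrightarrow> fR f x \<in> carrier R"
 using balanced_map.lift_closed[OF balanced_fR] by (simp add: fR_def A_struct)

lemma fR_scale: assumes f: "ulin f" and r: "r \<in> carrier R" and z: "z \<in> carrier A"
 shows "fR f (unit_map A r \<cdot> z) = r \<otimes>\<^bsub>R\<^esub> fR f z"
 using z
proof (induction z rule: A_induct)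
 case (tens b s)
 have "unit_map A r \<cdot> TK b s = TK b (r \<otimes>\<^bsub>R\<^esub> s)" using tens r by (simp add: A_struct ar.tens_mult)
 then show ?case using tens r f by (simp add: fR_tens RC.m_lcomm)
next
 case (add x y)
 then show ?case using f r by (simp add: A.A.r_distr fR_add fR_closed R.A.r_distr)
qed

text \<open>Tensors are over R, so a test functional on the tensor square must be built from
  R-linear functionals. This is why the values are kept in R instead of being reduced to one
  coefficient of t.\<close>

lemma fR_tens2:
 assumes f: "ulin f" and g: "ulin g" and a: "a \<in> carrier A" and b: "b \<in> carrier A"
 shows "tensor_lift R (\<lambda>x y. fR f x \<otimes>\<^bsub>R\<^esub> fR g y) (aa.T a b) = fR f a \<otimes>\<^bsub>R\<^esub> fR g b"
proof -
 interpret b: balanced_map R A A R "\<lambda>x y. fR f x \<otimes>\<^bsub>R\<^esub> fR g y"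
  by unfold_locales
   (simp_all add: fR_add fR_scale fR_closed f g R.A.l_distr R.A.r_distr RC.m_ac)
 show ?thesis by (rule b.lift_tens[OF a b])
qed

text \<open>Let f be the corrected coefficient of x_k D_k and g the coefficient of x^(2\<epsilon>_k)
  D_k. Then f is 1 on h and 0 on e and on he, while g is 2 on e, so f \<otimes> g takes the value 2t
  on the first tensor and 0 on the second. The condition p \<noteq> 2 gives 2 \<noteq> 0 and keeps
  x^(2\<epsilon>_k) in range.\<close>

lemma twist_not_symmetric:
 assumes "p \<noteq> 2"
 shows "aa.T (ga h' \<cdot> CN.u) CN.et \<noteq> aa.T CN.et (ga h' \<cdot> CN.u)"
proof
 assume eq: "aa.T (ga h' \<cdot> CN.u) CN.et = aa.T CN.et (ga h' \<cdot> CN.u)"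
 let ?f = "fn (k, eps k)" and ?g = "fn (k, eps k + eps k)" and ?t = "Ktpq_t p q"
 have two: "(2 :: 'k) \<noteq> 0"
  using of_nat_eq_0_iff_char_dvd[of 2, where 'a = 'k] char_p assms p_gt_1 by (auto dest: dvd_imp_le)
 have p3: "p > 2" using assms p_gt_1 by simp
 have t: "?t \<in> carrier R" by (simp add: R_const)
 have ek: "eps k \<in> MI" by (rule eps_midx[OF kk'(1)])
 have e2: "eps k + eps k \<in> MI" using p3 kk by (auto simp: midx_def eps_def)
 have e3: "eps k + eps k + eps k' \<in> MI" using p3 kk by (auto simp: midx_def eps_def)
 have y2k: "y2 k = mono (eps k + eps k)"
 proof -
  have "eps k + eps k + eps k' - eps k' = eps k + eps k" "(eps k + eps k + eps k') k' \<noteq> 0"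
   by (simp_all add: fun_eq_iff eps_def)
  then show ?thesis using kk(5) e3 by (simp only: dij_def pder_mono[OF e3]) simp
 qed
 have e'k: "e' k \<gamma> = 2 * mono (eps k + eps k) \<gamma>" for \<gamma> by (simp only: vf_scale_def y2k)
 have "(eps k :: nat \<Rightarrow> nat) k \<noteq> (eps k + eps k) k" by (simp add: eps_def)
 then have ne: "eps k \<noteq> eps k + eps k" by metis
 have e'1: "e' k (eps k) = 0" unfolding e'k using ne by (simp add: mono_apply)
 have f_e: "?f eu = 0" unfolding fn_gu[OF e'_L kk'(1)] by (rule e'1)
 have g_e: "?g eu = 2" unfolding fn_gu[OF e'_L kk'(1)] e'k using e2 by (simp add: mono_apply)
 have f_h: "?f hu = 1"
  unfolding fn_gu[OF h'_L kk'(1)] unfolding D_cartan[OF kk' kk(5)] using kk(5) ek by (simp add: unitv_def mono_apply)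
 \<comment> \<open>e maps x_k to 2 x^(2\<epsilon>_k), which h only rescales, so x_k does not occur
   in the result.\<close>
 have f_he: "?f (hu \<odot> eu) = 0"
 proof -
  have a: "act e' (mono (eps k)) = e' k" using act_mono_eps[OF L_subset_W[OF e'_L] kk'(1)] .
  have O: "e' k \<in> Od" using wittD[OF L_subset_W[OF e'_L]] .
  have "act h' (e' k) (eps k) = 0" unfolding act_cartan[OF kk' kk(5) O] e'1 by simp
  then show ?thesis
   unfolding fn_def by (simp add: rho_simps rho tr_O a O act_mono_0 del: One_nat_def)
 qed
 have huc: "ga h' \<cdot> CN.u \<in> carrier A" by simp
 have et: "CN.et = unit_map A ?t \<cdot> ga e'"
  unfolding CN.et_def by (rule A.unit_map_central[symmetric]) (use t in simp_all)
 have io2: "io (hu \<odot> eu) = ga h' \<cdot> ga e'"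
  by (simp only: ga_def' io_simps(2) gu_closed h'_L e'_L)
 have het: "ga h' \<cdot> CN.et = unit_map A ?t \<cdot> io (hu \<odot> eu)"
  unfolding et io2 by (rule A.unit_left_commute) (use t in simp_all)
 have hu: "ga h' \<cdot> CN.u \<oplus>\<^bsub>A\<^esub> ga h' \<cdot> CN.et = ga h'"
  unfolding CN.u_def by (simp add: a_minus_def A.A.r_distr A.A.r_minus A.A.a_assoc A.A.l_neg)
 have io_f: "fR f (io a) = unit_map R (f a)" if "ulin f" "a \<in> carrier uu" for f a
  using that by (simp add: fR_tens)
 have ga_f: "fR f (ga x) = unit_map R (f (gu x))" if "ulin f" "x \<in> L" for f x
  unfolding ga_def' by (rule io_f[OF that(1) gu_closed[OF that(2)]])
 have un: "unit_map R 0 = \<zero>\<^bsub>R\<^esub>" "unit_map R 1 = \<one>\<^bsub>R\<^esub>" by (simp_all add: R_const one_pCons)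
 have fet: "fR f CN.et = ?t \<otimes>\<^bsub>R\<^esub> unit_map R (f eu)" if "ulin f" for f
  unfolding et fR_scale[OF that t ga_closed[OF e'_L]] ga_f[OF that e'_L] ..
 have 1: "fR ?f CN.et = \<zero>\<^bsub>R\<^esub>" unfolding fet[OF ulin_fn] f_e un by (rule R.A.r_null[OF t])
 have heu: "hu \<odot> eu \<in> carrier uu" by simp
 have 2: "fR ?f (ga h' \<cdot> CN.et) = \<zero>\<^bsub>R\<^esub>"
  unfolding het fR_scale[OF ulin_fn t io_closed[OF heu]] io_f[OF ulin_fn heu] f_he un by (rule R.A.r_null[OF t])
 have "fR ?f (ga h' \<cdot> CN.u) \<oplus>\<^bsub>R\<^esub> fR ?f (ga h' \<cdot> CN.et) = fR ?f (ga h')"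
  using fR_add[OF ulin_fn huc, of "ga h' \<cdot> CN.et"] unfolding hu by simp
 then have 3: "fR ?f (ga h' \<cdot> CN.u) = \<one>\<^bsub>R\<^esub>"
  unfolding 2 ga_f[OF ulin_fn h'_L] f_h un R.A.r_zero[OF fR_closed[OF ulin_fn huc]] .
 have 4: "fR ?g CN.et = unit_map R 2 \<otimes>\<^bsub>R\<^esub> ?t"
  unfolding fet[OF ulin_fn] g_e by (rule RC.m_comm[OF t unit_R_closed])
 let ?l = "tensor_lift R (\<lambda>x y. fR ?f x \<otimes>\<^bsub>R\<^esub> fR ?g y)"
 have "?l (aa.T (ga h' \<cdot> CN.u) CN.et) = unit_map R 2 \<otimes>\<^bsub>R\<^esub> ?t"
  using t by (subst fR_tens2[OF ulin_fn ulin_fn]) (simp_all only: huc CN.et_closed 3 4 R.A.l_one R.A.m_closed unit_R_closed)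
 moreover have "?l (aa.T CN.et (ga h' \<cdot> CN.u)) = \<zero>\<^bsub>R\<^esub>"
  using fR_closed[OF ulin_fn huc] by (subst fR_tens2[OF ulin_fn ulin_fn]) (simp_all only: huc CN.et_closed 1 R.A.l_null)
 ultimately have z: "unit_map R 2 \<otimes>\<^bsub>R\<^esub> ?t = \<zero>\<^bsub>R\<^esub>" unfolding eq by simp
 have "coef 1 (unit_map R 2 \<otimes>\<^bsub>R\<^esub> ?t) = 2 * coef 1 (ti 1)" using t by (simp only: coef_scale R_const(4) ti_def cl_simps)
 then have "coef 1 (unit_map R 2 \<otimes>\<^bsub>R\<^esub> ?t) = 2" using coef_ti[OF p_gt_1, of 1] by simp
 moreover have "coef 1 \<zero>\<^bsub>R\<^esub> = 0" unfolding R_const(2) coef_cl by simp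
 ultimately show False using two unfolding z by simp
qed

end

theorem theorem3p5:
  fixes q :: "'k::field" and p n k k' :: nat
  assumes "CHAR('k) = p" and "p > 0"
    and "1 \<le> k" and "k \<le> n" and "1 \<le> k'" and "k' \<le> n" and "k \<noteq> k'"
  shows "let R = Ktpq p q;
             A = utqS p n q;
             AA = tensor_alg R A A;
             tensor = tens R A A;
             gen = utqS_gen p n q;
             t = unit_map A (Ktpq_t p q);
             h' = dij k k' (dpow p n (eps k + eps k')) :: 'k vfield;
             e' = vf_scale 2 (dij k k' (dpow p n (eps k + eps k + eps k'))) :: 'k vfield;
             h = gen h';
             e = gen e';
             u = \<one>\<^bsub>A\<^esub> \<ominus>\<^bsub>A\<^esub> e \<otimes>\<^bsub>A\<^esub> t;
             D = (\<lambda>i j \<alpha>. dij i j (dpow p n \<alpha>) :: 'k vfield);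
             w = (\<lambda>i j \<alpha>. int (\<alpha> k) - of_bool (i = k) - of_bool (j = k)
                   - int (\<alpha> k') + of_bool (i = k') + of_bool (j = k'))
         in (\<exists>\<Delta> S \<epsilon>. hopf_algebra R A \<Delta> S \<epsilon>
               \<and> \<not> commutative_alg A
               \<and> (p \<noteq> 2 \<longrightarrow> \<not> cocommutative R A \<Delta>)
               \<and> (\<forall>\<alpha>\<in>midx p n. \<forall>i j. 1 \<le> j \<and> j < i \<and> i \<le> n \<longrightarrow>
                    \<Delta> (gen (D i j \<alpha>)) =
                      tensor (gen (D i j \<alpha>)) (u [^]\<^bsub>A\<^esub> w i j \<alpha>) \<oplus>\<^bsub>AA\<^esub>
                      (\<Oplus>\<^bsub>AA\<^esub>l\<in>{0..p - 1}.
                         tensor ((\<ominus>\<^bsub>A\<^esub> \<one>\<^bsub>A\<^esub>) [^]\<^bsub>A\<^esub> l \<otimes>\<^bsub>A\<^esub> rising A 0 h l)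
                                (u [^]\<^bsub>A\<^esub> (- int l) \<otimes>\<^bsub>A\<^esub> gen (div_ad p n e' l (D i j \<alpha>))
                                   \<otimes>\<^bsub>A\<^esub> t [^]\<^bsub>A\<^esub> l))
                  \<and> S (gen (D i j \<alpha>)) =
                      \<ominus>\<^bsub>A\<^esub> (u [^]\<^bsub>A\<^esub> (- w i j \<alpha>) \<otimes>\<^bsub>A\<^esub>
                         (\<Oplus>\<^bsub>A\<^esub>l\<in>{0..p - 1}.
                            gen (div_ad p n e' l (D i j \<alpha>)) \<otimes>\<^bsub>A\<^esub> rising A 1 h l
                              \<otimes>\<^bsub>A\<^esub> t [^]\<^bsub>A\<^esub> l))
                  \<and> \<epsilon> (gen (D i j \<alpha>)) = \<zero>\<^bsub>R\<^esub>))
            \<and> ring.dimension A (p ^ (1 + (n - 1) * (p ^ n - 1)))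
                (unit_map A ` unit_map R ` UNIV) (carrier A)"
proof -
 interpret special_twist p n "TYPE('k)" q k k'
  by unfold_locales (use assms in auto)
 obtain \<Delta>0 S0 \<epsilon> where tw: "hopf_twist R A ka p (ga h') (ga e') (Ktpq_t p q) (unit_map R) (ga ` gens) \<Delta>0 S0 \<epsilon>"
  using coproduct_exists by (elim exE)
 interpret H: hopf_twist R A ka p "ga h'" "ga e'" "Ktpq_t p q" "unit_map R" "ga ` gens" \<Delta>0 S0 \<epsilon> by (rule tw)
 let ?t = "unit_map A (Ktpq_t p q)"
 have u: "\<one>\<^bsub>A\<^esub> \<ominus>\<^bsub>A\<^esub> ga e' \<otimes>\<^bsub>A\<^esub> ?t = CN.u" by (simp only: CN.u_def CN.et_def)
 have rg: "{0..p - 1} = {..<p}" using p_pos by auto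
 have coco: "\<not> cocommutative R A H.\<Delta>" if "p \<noteq> 2"
  using twist_not_symmetric[OF that] H.cocommutative_imp by blast
 have main: "H.\<Delta> (ga (D i j \<alpha>)) = aa.T (ga (D i j \<alpha>)) (CN.u [^]\<^bsub>A\<^esub> w) \<oplus>\<^bsub>aa.AB\<^esub>
    (\<Oplus>\<^bsub>aa.AB\<^esub>l\<in>{..<p}. aa.T ((\<ominus>\<^bsub>A\<^esub> \<one>\<^bsub>A\<^esub>) [^]\<^bsub>A\<^esub> l \<otimes>\<^bsub>A\<^esub> rising A 0 (ga h') l)
      (CN.u [^]\<^bsub>A\<^esub> (- int l) \<otimes>\<^bsub>A\<^esub> ga (div_ad p n e' l (D i j \<alpha>)) \<otimes>\<^bsub>A\<^esub> ?t [^]\<^bsub>A\<^esub> l))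
   \<and> H.S (ga (D i j \<alpha>)) = \<ominus>\<^bsub>A\<^esub> (CN.u [^]\<^bsub>A\<^esub> (- w) \<otimes>\<^bsub>A\<^esub>
    (\<Oplus>\<^bsub>A\<^esub>l\<in>{..<p}. ga (div_ad p n e' l (D i j \<alpha>)) \<otimes>\<^bsub>A\<^esub> rising A 1 (ga h') l \<otimes>\<^bsub>A\<^esub> ?t [^]\<^bsub>A\<^esub> l))
   \<and> \<epsilon> (ga (D i j \<alpha>)) = \<zero>\<^bsub>R\<^esub>"
  if a: "\<alpha> \<in> MI" and ij: "1 \<le> j \<and> j < i \<and> i \<le> n"
   and w: "w = int (\<alpha> k) - of_bool (i = k) - of_bool (j = k) - int (\<alpha> k') + of_bool (i = k') + of_bool (j = k')"
  for i j \<alpha> w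
 proof -
  let ?x = "D i j \<alpha>"
  have ij': "i \<in> {1..n}" "j \<in> {1..n}" "i \<noteq> j" using ij by auto
  have x: "?x \<in> L" by (rule D_in_L[OF ij'])
  have "?x \<in> gens" using a ij unfolding gens_def by blast
  then have G: "ga ?x \<in> ga ` gens" by (rule imageI)
  have wt: "CN.weight w (ga ?x)" unfolding w by (rule weight_ga[OF ij'])
  have "div_ad p n e' 0 ?x = ?x" by (simp add: div_ad_def)
  then have x0: "xs ?x 0 = ga ?x" using p_pos by (simp only: xs_def if_True)
  have xl: "xs ?x l = ga (div_ad p n e' l ?x)" if "l \<in> {..<p}" for l using that by (simp add: xs_def)
  have dL: "ga (div_ad p n e' l ?x) \<in> carrier A" for l by (simp add: div_ad_def L_scale ad_in_L x)
  note xc [simp] = CN.ladderD(1)[OF ladder_xs[OF x]]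
  have "H.\<Delta> (ga ?x) = aa.T (ga ?x) (CN.U w) \<oplus>\<^bsub>aa.AB\<^esub> (\<Oplus>\<^bsub>aa.AB\<^esub>l\<in>{..<p}.
    aa.T ((\<ominus>\<^bsub>A\<^esub> \<one>\<^bsub>A\<^esub>) [^]\<^bsub>A\<^esub> l \<otimes>\<^bsub>A\<^esub> rising A 0 (ga h') l) (CN.U (- int l) \<otimes>\<^bsub>A\<^esub> xs ?x l \<otimes>\<^bsub>A\<^esub> ?t [^]\<^bsub>A\<^esub> l))"
   by (rule H.D_formula[OF G wt ladder_xs[OF x] x0])
  also have "(\<Oplus>\<^bsub>aa.AB\<^esub>l\<in>{..<p}. aa.T ((\<ominus>\<^bsub>A\<^esub> \<one>\<^bsub>A\<^esub>) [^]\<^bsub>A\<^esub> l \<otimes>\<^bsub>A\<^esub> rising A 0 (ga h') l) (CN.U (- int l) \<otimes>\<^bsub>A\<^esub> xs ?x l \<otimes>\<^bsub>A\<^esub> ?t [^]\<^bsub>A\<^esub> l))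
   = (\<Oplus>\<^bsub>aa.AB\<^esub>l\<in>{..<p}. aa.T ((\<ominus>\<^bsub>A\<^esub> \<one>\<^bsub>A\<^esub>) [^]\<^bsub>A\<^esub> l \<otimes>\<^bsub>A\<^esub> rising A 0 (ga h') l)
     (CN.U (- int l) \<otimes>\<^bsub>A\<^esub> ga (div_ad p n e' l ?x) \<otimes>\<^bsub>A\<^esub> ?t [^]\<^bsub>A\<^esub> l))"
   by (rule aa.Q.finsum_cong'[OF refl]) (auto simp only: xl intro!: aa.tens_closed A.A.m_closed A.A.nat_pow_closed
     A.A.a_inv_closed A.A.one_closed CN.rising_closed CN.U_closed CN.t_closed CN.h_closed dL)
  finally have 1: "H.\<Delta> (ga ?x) = aa.T (ga ?x) (CN.U w) \<oplus>\<^bsub>aa.AB\<^esub> (\<Oplus>\<^bsub>aa.AB\<^esub>l\<in>{..<p}.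
    aa.T ((\<ominus>\<^bsub>A\<^esub> \<one>\<^bsub>A\<^esub>) [^]\<^bsub>A\<^esub> l \<otimes>\<^bsub>A\<^esub> rising A 0 (ga h') l)
     (CN.U (- int l) \<otimes>\<^bsub>A\<^esub> ga (div_ad p n e' l ?x) \<otimes>\<^bsub>A\<^esub> ?t [^]\<^bsub>A\<^esub> l))" .
  have "H.S (ga ?x) = \<ominus>\<^bsub>A\<^esub> (CN.U (- w) \<otimes>\<^bsub>A\<^esub> (\<Oplus>\<^bsub>A\<^esub>l\<in>{..<p}. xs ?x l \<otimes>\<^bsub>A\<^esub> rising A 1 (ga h') l \<otimes>\<^bsub>A\<^esub> ?t [^]\<^bsub>A\<^esub> l))"
   by (rule H.S_formula[OF G wt ladder_xs[OF x] x0])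
  also have "(\<Oplus>\<^bsub>A\<^esub>l\<in>{..<p}. xs ?x l \<otimes>\<^bsub>A\<^esub> rising A 1 (ga h') l \<otimes>\<^bsub>A\<^esub> ?t [^]\<^bsub>A\<^esub> l)
   = (\<Oplus>\<^bsub>A\<^esub>l\<in>{..<p}. ga (div_ad p n e' l ?x) \<otimes>\<^bsub>A\<^esub> rising A 1 (ga h') l \<otimes>\<^bsub>A\<^esub> ?t [^]\<^bsub>A\<^esub> l)"
   by (rule A.A.finsum_cong'[OF refl]) (auto simp only: xl intro!: A.A.m_closed A.A.nat_pow_closed
     CN.rising_closed CN.t_closed CN.h_closed dL)
  finally have 2: "H.S (ga ?x) = \<ominus>\<^bsub>A\<^esub> (CN.U (- w) \<otimes>\<^bsub>A\<^esub>
    (\<Oplus>\<^bsub>A\<^esub>l\<in>{..<p}. ga (div_ad p n e' l ?x) \<otimes>\<^bsub>A\<^esub> rising A 1 (ga h') l \<otimes>\<^bsub>A\<^esub> ?t [^]\<^bsub>A\<^esub> l))" .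
  have 3: "\<epsilon> (ga ?x) = \<zero>\<^bsub>R\<^esub>" using H.primitive(3) G by blast
  \<comment> \<open>The integer powers of u in the statement are powers of a unit; u^p = 1
    identifies them with the powers indexed by residues.\<close>
  show ?thesis unfolding CN.u_int_pow by (intro conjI 1 2 3)
 qed
 show ?thesis
  unfolding Let_def u rg
  by (rule conjI, rule exI[of _ H.\<Delta>], rule exI[of _ H.S], rule exI[of _ \<epsilon>], intro conjI ballI allI impI,
    rule H.hopf, rule not_commutative, rule coco, assumption,
    rule main[THEN conjunct1], assumption, assumption, rule refl,
    rule main[THEN conjunct2, THEN conjunct1], assumption, assumption, rule refl,
    rule main[THEN conjunct2, THEN conjunct2], assumption, assumption, rule refl, rule dimension_A)
qed

end
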